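(* Let $n,m\ge1$ be integers, $\tau>0$ and $Q=m+n(\tau+1)$. If $$\frac{2Q}{Q-2}=\frac{2m+2n(\tau+1)}{m-2+n(\tau+1)}$$ is a positive integer, then $S_\tau(n,m)=S_{\tau,z}(n,m)$.
   Context: For $x\in\mathbb{R}^n$, $z\in\mathbb{R}^m$ let $\|u\|=\big(\int_{\mathbb{R}^{n+m}}(|\nabla_zu|^2+(\tau+1)^2|z|^{2\tau}|\nabla_xu|^2)dx\,dz\big)^{1/2}$. $\mathcal{D}^1_\tau(\mathbb{R}^{n+m})$ is the completion of $C_0^\infty(\mathbb{R}^{n+m})$ under this norm, and $\mathcal{D}^1_{\tau,z}(\mathbb{R}^{n+m})$ is the completion of $\{u\in C_0^\infty(\mathbb{R}^{n+m}): u(x,z)\text{ radially symmetric in }z\}$ under the same norm. $S_\tau(n,m)$ (resp. $S_{\tau,z}(n,m)$) is the optimal (largest) positive constant $S$ such that $$\Big(\int_{\mathbb{R}^{n+m}}|u|^{\frac{2Q}{Q-2}}dx\,dz\Big)^{\frac{Q-2}Q}\le S^{-1}\int_{\mathbb{R}^{n+m}}\big(|\nabla_zu|^2+(\tau+1)^2|z|^{2\tau}|\nabla_xu|^2\big)dx\,dz$$ for all $u\in\mathcal{D}^1_\tau(\mathbb{R}^{n+m})$ (resp. all $u\in\mathcal{D}^1_{\tau,z}(\mathbb{R}^{n+m})$). *)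

theory Defs
  imports "HOL-Analysis.Analysis"
begin

text \<open>Points of \<open>R^(n+m)\<close> are pairs \<open>(x, z)\<close> with \<open>x \<in> R^n\<close> and \<open>z \<in> R^m\<close>, where \<open>n\<close> and \<open>m\<close> are
  the cardinalities of the index types; \<open>lborel\<close> on the product type is \<open>dx dz\<close>.\<close>

type_synonym ('n, 'm) point = "(real, 'n) vec \<times> (real, 'm) vec"

type_synonym ('n, 'm) energy_fields =
  "(('n, 'm) point \<Rightarrow> real) \<times> (('n, 'm) point \<Rightarrow> (real, 'm) vec) \<times> (('n, 'm) point \<Rightarrow> (real, 'n) vec)"

primrec C_k :: "nat \<Rightarrow> ('a::euclidean_space \<Rightarrow> real) \<Rightarrow> bool" where
  "C_k 0 f \<longleftrightarrow> continuous_on UNIV f"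
| "C_k (Suc k) f \<longleftrightarrow>
     f differentiable_on UNIV \<and> (\<forall>b\<in>Basis. C_k k (\<lambda>p. frechet_derivative f (at p) b))"

definition test_functions :: "('a::euclidean_space \<Rightarrow> real) set" where
  "test_functions = {u. (\<forall>k. C_k k u) \<and> compact (closure {p. u p \<noteq> 0})}"

definition radial_z :: "(('n::finite, 'm::finite) point \<Rightarrow> real) \<Rightarrow> bool" where
  "radial_z u \<longleftrightarrow> (\<forall>x z z'. norm z = norm z' \<longrightarrow> u (x, z) = u (x, z'))"

definition grad_x :: "(('n::finite, 'm::finite) point \<Rightarrow> real) \<Rightarrow> ('n, 'm) point \<Rightarrow> real^'n" where
  "grad_x u p = (THE D. GDERIV (\<lambda>x. u (x, snd p)) (fst p) :> D)"

definition grad_z :: "(('n::finite, 'm::finite) point \<Rightarrow> real) \<Rightarrow> ('n, 'm) point \<Rightarrow> real^'m" where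
  "grad_z u p = (THE D. GDERIV (\<lambda>z. u (fst p, z)) (snd p) :> D)"

definition energy_density ::
  "real \<Rightarrow> (('n::finite, 'm::finite) point \<Rightarrow> real^'m) \<Rightarrow> (('n, 'm) point \<Rightarrow> real^'n) \<Rightarrow>
   ('n, 'm) point \<Rightarrow> real"
where
  "energy_density \<tau> g h p =
     (norm (g p))\<^sup>2 + (\<tau> + 1)\<^sup>2 * norm (snd p) powr (2 * \<tau>) * (norm (h p))\<^sup>2"

definition L1_loc_tendsto :: "(nat \<Rightarrow> 'a::euclidean_space \<Rightarrow> real) \<Rightarrow> ('a \<Rightarrow> real) \<Rightarrow> bool" where
  "L1_loc_tendsto \<phi> u \<longleftrightarrow>
     (\<forall>K. compact K \<longrightarrow> (\<lambda>k. \<integral>\<^sup>+p\<in>K. ennreal \<bar>\<phi> k p - u p\<bar> \<partial>lborel) \<longlonglongrightarrow> 0)"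

text \<open>The completion of a space \<open>C\<close> of test functions under the energy norm, realised as a space
  of functions: its elements are the functions \<open>u\<close> that are limits of sequences in \<open>C\<close> which are
  Cauchy in the energy norm.  Such an element is recorded together with its gradients \<open>g\<close> in \<open>z\<close> and
  \<open>h\<close> in \<open>x\<close>, the limits of the gradients of the approximating sequence in the (complete) space of
  pairs of fields with finite energy.  The triple is determined by the element up to null sets; \<open>h\<close>
  need not be locally integrable near \<open>z = 0\<close>, hence need not be a distributional gradient there,
  because the weight vanishes on that null set.\<close>

definition energy_completion ::
  "real \<Rightarrow> (('n::finite, 'm::finite) point \<Rightarrow> real) set \<Rightarrow>
   ('n, 'm) energy_fields set"
where
  "energy_completion \<tau> C =
     {(u, g, h). u \<in> borel_measurable lborel \<and> g \<in> borel_measurable lborel \<and>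
        h \<in> borel_measurable lborel \<and>
        (\<exists>\<phi>. (\<forall>k. \<phi> k \<in> C) \<and> L1_loc_tendsto \<phi> u \<and>
          (\<lambda>k. \<integral>\<^sup>+p. ennreal (energy_density \<tau>
             (\<lambda>q. grad_z (\<phi> k) q - g q) (\<lambda>q. grad_x (\<phi> k) q - h q) p) \<partial>lborel) \<longlonglongrightarrow> 0)}"

definition D1 :: "real \<Rightarrow> ('n::finite, 'm::finite) energy_fields set" where
  "D1 \<tau> = energy_completion \<tau> test_functions"

definition D1_z :: "real \<Rightarrow> ('n::finite, 'm::finite) energy_fields set" where
  "D1_z \<tau> = energy_completion \<tau> {u \<in> test_functions. radial_z u}"

definition hom_dim :: "real \<Rightarrow> 'n::finite itself \<Rightarrow> 'm::finite itself \<Rightarrow> real" where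
  "hom_dim \<tau> _ _ = real CARD('m) + real CARD('n) * (\<tau> + 1)"

text \<open>Integrability of the power of \<open>u\<close> is part of the inequality, since the Bochner integral of a
  non-integrable function is \<open>0\<close>.\<close>

definition sobolev_inequality ::
  "real \<Rightarrow> ('n::finite, 'm::finite) energy_fields set \<Rightarrow> real \<Rightarrow> bool"
where
  "sobolev_inequality \<tau> D S \<longleftrightarrow>
     (let Q = hom_dim \<tau> TYPE('n) TYPE('m) in
      \<forall>(u, g, h)\<in>D.
        integrable lborel (\<lambda>p. \<bar>u p\<bar> powr (2 * Q / (Q - 2))) \<and>
        (LINT p|lborel. \<bar>u p\<bar> powr (2 * Q / (Q - 2))) powr ((Q - 2) / Q)
          \<le> inverse S * (LINT p|lborel. energy_density \<tau> g h p))"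

definition S_opt :: "real \<Rightarrow> 'n::finite itself \<Rightarrow> 'm::finite itself \<Rightarrow> real" where
  "S_opt \<tau> _ _ = (GREATEST S. 0 < S \<and>
     sobolev_inequality \<tau> (D1 \<tau> :: ('n, 'm) energy_fields set) S)"

definition S_opt_z :: "real \<Rightarrow> 'n::finite itself \<Rightarrow> 'm::finite itself \<Rightarrow> real" where
  "S_opt_z \<tau> _ _ = (GREATEST S. 0 < S \<and>
     sobolev_inequality \<tau> (D1_z \<tau> :: ('n, 'm) energy_fields set) S)"

end

theory Submission
  imports Defs "HOL-Complex_Analysis.Great_Picard"
begin

text \<open>It suffices to deduce the inequality for arbitrary test functions \<open>u\<close> from the inequality for
  radial ones.  Regard \<open>\<bar>u\<bar>\<close> as periodic in \<open>x\<close> with a large period \<open>L\<close> and expand it into a Fourier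
  series in \<open>x\<close> with coefficients depending on \<open>z\<close>.  Because the exponent \<open>2 Q / (Q - 2) = k\<close> is an
  integer, the integral of the \<open>k\<close>-th power over a period is a sum of products of \<open>k\<close> coefficients, so
  it does not decrease when the coefficients are replaced by their moduli and these are then
  rearranged in \<open>z\<close>; by Parseval both parts of the energy do not increase.  The rearrangement has to
  act on finitely many coefficients at once: in the compact class of families obtained by
  comparison with the given one, a family minimizing the second moment is fixed by all
  polarizations and hence is radial.  The \<open>z\<close>-energy is controlled through the integrals of
  \<open>(f z - f z')\<^sup>2\<close> over \<open>\<bar>z - z'\<bar> < h\<close>, which polarization does not increase.  The rearranged trigonometric sum,
  mollified in \<open>z\<close> and cut off in \<open>x\<close>, is a radial test function, and letting \<open>L\<close> tend to infinity
  removes the effect of the cutoff.\<close>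

section \<open>Polarization\<close>

text \<open>Rearranging the slices of u in z for fixed x controls the z-energy but not the x-energy:
  increments between slices carry the weight |z|^(2\<tau>), and polarizing two slices can move their
  difference to the outer point of a mirror pair, where the weight is larger. In Fourier variables a
  derivative in x is multiplication by the frequency, so the x-energy is a weighted sum of squares
  of single coefficients, and moving these inwards only helps. The price is that the left-hand side
  couples k coefficients: it is a sum over k-tuples of frequencies with zero sum. Once moduli are
  taken all its terms are nonnegative, and the product inequality for one common rearrangement
  applies to each tuple. Finitely many frequencies suffice because of Fejer type means, whose
  multipliers have modulus at most 1 and do not raise the energy. The powers of the period L cancel.
  The cutoff adds an error of order 1/L to the energy per cell: its gradient is of order 1/L, and
  the parameter in Young's inequality is taken to be 1/L.\<close>

lemma nn_integral_lborel_plus: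
  fixes f :: "'a::euclidean_space \<Rightarrow> ennreal"
  assumes [measurable]: "f \<in> borel_measurable borel"
  shows "(\<integral>\<^sup>+x. f (a + x) \<partial>lborel) = (\<integral>\<^sup>+x. f x \<partial>lborel)"
proof -
  have "(\<integral>\<^sup>+x. f x \<partial>lborel) = (\<integral>\<^sup>+x. f x \<partial>distr lborel borel ((+) a))"
    by (simp add: lborel_distr_plus)
  also have "\<dots> = (\<integral>\<^sup>+x. f (a + x) \<partial>lborel)"
    by (subst nn_integral_distr) auto
  finally show ?thesis by simp
qed

lemma nn_integral_lborel_minus:
  fixes f :: "'a::euclidean_space \<Rightarrow> ennreal"
  assumes [measurable]: "f \<in> borel_measurable borel"
  shows "(\<integral>\<^sup>+x. f (a - x) \<partial>lborel) = (\<integral>\<^sup>+x. f x \<partial>lborel)"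
proof -
  have e: "lborel = distr lborel borel (\<lambda>x::'a. a - x)"
    using lborel_affine[of "-1" a] by (simp add: density_1)
  have "(\<integral>\<^sup>+x. f x \<partial>lborel) = (\<integral>\<^sup>+x. f x \<partial>distr lborel borel (\<lambda>x. a - x))"
    using e by simp
  also have "\<dots> = (\<integral>\<^sup>+x. f (a - x) \<partial>lborel)"
    by (subst nn_integral_distr) auto
  finally show ?thesis by simp
qed

text \<open>Uniqueness of Haar measure by Fubini: evaluating the double integral of the indicators
  of \<open>x \<in> A\<close> and \<open>x + y \<in> B\<close> in both orders gives \<mu>(A) |B| =
  |A| \<mu>(B). For the unit ball \<open>B\<close> the common value \<mu>(B) = |B| is positive and
  finite, so it cancels.\<close>

lemma lborel_eqI_translation_invariant:
  fixes \<mu> :: "'a::euclidean_space measure"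
  assumes sets [measurable_cong]: "sets \<mu> = sets borel"
    and sf: "sigma_finite_measure \<mu>"
    and inv: "\<And>a. distr \<mu> borel ((+) a) = \<mu>"
    and ball: "emeasure \<mu> (ball 0 1) = emeasure lborel (ball (0::'a) 1)"
  shows "\<mu> = lborel"
proof (rule measure_eqI)
  show "sets \<mu> = sets lborel" using sets by simp
  fix A assume "A \<in> sets \<mu>"
  then have A[measurable]: "A \<in> sets borel" using sets by simp
  interpret M: sigma_finite_measure \<mu> by (rule sf)
  interpret P: pair_sigma_finite lborel \<mu> ..
  define B where "B = ball (0::'a) 1"
  have B[measurable]: "B \<in> sets borel" by (simp add: B_def)
  have invn: "(\<integral>\<^sup>+x. f (a + x) \<partial>\<mu>) = (\<integral>\<^sup>+x. f x \<partial>\<mu>)" if [measurable]: "f \<in> borel_measurable borel" for f :: "'a \<Rightarrow> ennreal" and a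
  proof -
    have "(\<integral>\<^sup>+x. f x \<partial>\<mu>) = (\<integral>\<^sup>+x. f x \<partial>distr \<mu> borel ((+) a))"
      by (simp add: inv)
    also have "\<dots> = (\<integral>\<^sup>+x. f (a + x) \<partial>\<mu>)"
      by (subst nn_integral_distr) (auto simp: measurable_cong_sets[OF sets refl])
    finally show ?thesis by simp
  qed
  have iA: "(\<integral>\<^sup>+x. indicator A x \<partial>\<mu>) = emeasure \<mu> A" "(\<integral>\<^sup>+x. indicator A x \<partial>lborel) = emeasure lborel A"
    and iB: "(\<integral>\<^sup>+x. indicator B x \<partial>\<mu>) = emeasure \<mu> B" "(\<integral>\<^sup>+x. indicator B x \<partial>lborel) = emeasure lborel B"
    using sets by auto
  have "emeasure \<mu> A * emeasure lborel B = (\<integral>\<^sup>+x. indicator A x * emeasure lborel B \<partial>\<mu>)"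
    by (subst nn_integral_multc) (auto simp: iA)
  also have "\<dots> = (\<integral>\<^sup>+x. (\<integral>\<^sup>+y. indicator A x * indicator B (x + y) \<partial>lborel) \<partial>\<mu>)"
    by (subst nn_integral_cmult) (auto simp: nn_integral_lborel_plus iB)
  also have "\<dots> = (\<integral>\<^sup>+y. (\<integral>\<^sup>+x. indicator A x * indicator B (x + y) \<partial>\<mu>) \<partial>lborel)"
    by (rule P.Fubini') measurable
  also have "\<dots> = (\<integral>\<^sup>+y. (\<integral>\<^sup>+x. indicator A (x - y) * indicator B x \<partial>\<mu>) \<partial>lborel)"
  proof (rule nn_integral_cong)
    fix y
    show "(\<integral>\<^sup>+x. indicator A x * indicator B (x + y) \<partial>\<mu>) = (\<integral>\<^sup>+x. indicator A (x - y) * indicator B x \<partial>\<mu>)"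
      using invn[of "\<lambda>x. indicator A (x - y) * indicator B x" y] by (simp add: add.commute)
  qed
  also have "\<dots> = (\<integral>\<^sup>+x. (\<integral>\<^sup>+y. indicator A (x - y) * indicator B x \<partial>lborel) \<partial>\<mu>)"
    by (rule P.Fubini'[symmetric]) measurable
  also have "\<dots> = (\<integral>\<^sup>+x. emeasure lborel A * indicator B x \<partial>\<mu>)"
    by (subst nn_integral_multc) (auto simp: nn_integral_lborel_minus iA)
  also have "\<dots> = emeasure lborel A * emeasure \<mu> B"
    by (subst nn_integral_cmult) (auto simp: iB)
  finally have eq: "emeasure \<mu> A * emeasure lborel B = emeasure lborel A * emeasure lborel B"
    using ball by (simp add: B_def)
  have "emeasure lborel B \<noteq> 0" "emeasure lborel B \<noteq> \<infinity>"
    using emeasure_bounded_finite[of B] emeasure_lborel_countable content_ball_pos[of 1 "0::'a"]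
    by (auto simp: B_def emeasure_eq_measure2 measure_def)
  then show "emeasure \<mu> A = emeasure lborel A"
    using eq by (simp add: ennreal_mult_cancel_left mult.commute[of _ "emeasure lborel B"])
qed

text \<open>A translation by \<open>T b\<close> after \<open>T\<close> is a translation by
  \<open>b\<close> before it, so the image measure is translation invariant; its normalization is
  read off from the unit ball, which \<open>T\<close> preserves. This avoids determinants.\<close>

lemma lborel_distr_orthogonal:
  fixes T :: "'a::euclidean_space \<Rightarrow> 'a"
  assumes T: "orthogonal_transformation T"
  shows "distr lborel borel T = lborel"
proof (rule lborel_eqI_translation_invariant)
  have lin: "linear T" and nrm: "\<And>x. norm (T x) = norm x"
    using T by (auto simp: orthogonal_transformation)
  have cont: "continuous_on UNIV T" using lin by (simp add: linear_continuous_on linear_linear)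
  have [measurable]: "T \<in> borel_measurable borel"
    using cont by (rule borel_measurable_continuous_onI)
  have vb: "T -` ball 0 r = ball 0 r" for r by (auto simp: nrm)
  have em: "emeasure (distr lborel borel T) (ball 0 r) = emeasure lborel (ball (0::'a) r)" for r
    by (simp add: emeasure_distr vb)
  show "sets (distr lborel borel T) = sets borel" by simp
  show "emeasure (distr lborel borel T) (ball 0 1) = emeasure lborel (ball (0::'a) 1)" by (rule em)
  show "sigma_finite_measure (distr lborel borel T)"
  proof
    show "\<exists>A. countable A \<and> A \<subseteq> sets (distr lborel borel T) \<and> \<Union>A = space (distr lborel borel T) \<and> (\<forall>a\<in>A. emeasure (distr lborel borel T) a \<noteq> \<infinity>)"
    proof (intro exI conjI ballI)
      show "countable (range (\<lambda>n::nat. ball (0::'a) (real n)))" by simp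
      show "range (\<lambda>n::nat. ball (0::'a) (real n)) \<subseteq> sets (distr lborel borel T)" by auto
      show "\<Union>(range (\<lambda>n::nat. ball (0::'a) (real n))) = space (distr lborel borel T)"
        using reals_Archimedean2 by auto
      fix a assume "a \<in> range (\<lambda>n::nat. ball (0::'a) (real n))"
      then show "emeasure (distr lborel borel T) a \<noteq> \<infinity>"
        using emeasure_bounded_finite[of "ball (0::'a) _"] by (auto simp: em less_top)
    qed
  qed
  fix a
  obtain b where b: "T b = a" using orthogonal_transformation_surj[OF T] by (metis surjD)
  have "distr (distr lborel borel T) borel ((+) a) = distr lborel borel (\<lambda>x. T (b + x))"
    by (subst distr_distr) (auto simp: comp_def b[symmetric] linear_add[OF lin])
  also have "\<dots> = distr (distr lborel borel ((+) b)) borel T"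
    by (subst distr_distr) (auto simp: comp_def)
  finally show "distr (distr lborel borel T) borel ((+) a) = distr lborel borel T"
    by (simp add: lborel_distr_plus)
qed

section \<open>Hyperplane reflections and two-point rearrangement\<close>

text \<open>For a unit vector \<open>e\<close> this is the reflection in the hyperplane
  \<open>z \<bullet> e = c\<close>. The offset \<open>c\<close> is kept nonnegative in the
  applications, so that the half space \<open>z \<bullet> e \<le> c\<close> contains the
  origin.\<close>

definition hreflect :: "'a::euclidean_space \<Rightarrow> real \<Rightarrow> 'a \<Rightarrow> 'a" where
  "hreflect e c z = z + (2 * (c - z \<bullet> e)) *\<^sub>R e"

lemma hreflect_inner: "norm e = 1 \<Longrightarrow> hreflect e c z \<bullet> e = 2 * c - z \<bullet> e"
  by (simp add: hreflect_def inner_add_left flip: power2_norm_eq_inner)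

lemma hreflect_hreflect [simp]: "norm e = 1 \<Longrightarrow> hreflect e c (hreflect e c z) = z"
  unfolding hreflect_def[of e c "hreflect e c z"] hreflect_inner
  by (simp add: hreflect_def scaleR_add_left[symmetric])

text \<open>The added term is nonnegative for two points on the same side, so replacing one of them
  by its mirror image never brings them closer. The identity at \<open>z = 0\<close> compares the
  norms of mirror points.\<close>

lemma dist_hreflect:
  assumes "norm e = 1"
  shows "(dist z (hreflect e c z'))\<^sup>2 = (dist z z')\<^sup>2 + 4 * (c - z \<bullet> e) * (c - z' \<bullet> e)"
proof -
  have "e \<bullet> e = 1" using assms by (simp flip: power2_norm_eq_inner)
  then show ?thesis
    unfolding dist_norm power2_norm_eq_inner hreflect_def
    by (simp add: inner_diff_left inner_diff_right inner_add_left inner_add_right inner_commute algebra_simps power2_eq_square)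
qed

lemma norm_hreflect:
  assumes "norm e = 1"
  shows "(norm (hreflect e c z))\<^sup>2 = (norm z)\<^sup>2 + 4 * c * (c - z \<bullet> e)"
  using dist_hreflect[OF assms, of 0 c z] by (simp add: mult.assoc)

lemma dist_hreflect_hreflect:
  assumes "norm e = 1"
  shows "dist (hreflect e c z) (hreflect e c z') = dist z z'"
proof -
  have "(dist (hreflect e c z) (hreflect e c z'))\<^sup>2 = (dist z z')\<^sup>2"
    using dist_hreflect[OF assms, of "hreflect e c z" c z'] dist_hreflect[OF assms, of z' c z]
    by (simp add: hreflect_inner[OF assms] dist_commute algebra_simps)
  then show ?thesis by simp
qed

lemma hreflect_measurable [measurable]: "hreflect e c \<in> borel_measurable borel"
  by (rule borel_measurable_continuous_onI) (auto simp: hreflect_def[abs_def] intro!: continuous_intros)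

lemma nn_integral_lborel_orthogonal:
  fixes f :: "'a::euclidean_space \<Rightarrow> ennreal" and T :: "'a \<Rightarrow> 'a"
  assumes T: "orthogonal_transformation T" and [measurable]: "f \<in> borel_measurable borel"
  shows "(\<integral>\<^sup>+x. f (T x) \<partial>lborel) = (\<integral>\<^sup>+x. f x \<partial>lborel)"
proof -
  have [measurable]: "T \<in> borel_measurable borel"
    using T by (intro borel_measurable_continuous_onI)
      (simp add: orthogonal_transformation_def linear_continuous_on linear_linear)
  show ?thesis
    by (subst (2) lborel_distr_orthogonal[OF T, symmetric]) (simp add: nn_integral_distr)
qed

lemma orthogonal_transformation_hreflect:
  assumes "norm e = 1"
  shows "orthogonal_transformation (hreflect e 0)"
proof -
  have "linear (hreflect e 0)"
    by (rule linearI) (simp_all add: hreflect_def inner_add_left algebra_simps)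
  then show ?thesis
    using norm_hreflect[OF assms, of 0] by (auto simp: orthogonal_transformation)
qed

lemma nn_integral_hreflect:
  fixes f :: "'a::euclidean_space \<Rightarrow> ennreal"
  assumes e: "norm e = 1" and [measurable]: "f \<in> borel_measurable borel"
  shows "(\<integral>\<^sup>+x. f (hreflect e c x) \<partial>lborel) = (\<integral>\<^sup>+x. f x \<partial>lborel)"
proof -
  have "hreflect e c x = (2 * c) *\<^sub>R e + hreflect e 0 x" for x
    by (simp add: hreflect_def algebra_simps)
  then have "(\<integral>\<^sup>+x. f (hreflect e c x) \<partial>lborel) = (\<integral>\<^sup>+x. f ((2 * c) *\<^sub>R e + hreflect e 0 x) \<partial>lborel)"
    by simp
  also have "\<dots> = (\<integral>\<^sup>+x. f ((2 * c) *\<^sub>R e + x) \<partial>lborel)"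
    by (rule nn_integral_lborel_orthogonal[OF orthogonal_transformation_hreflect[OF e]]) measurable
  finally show ?thesis by (simp add: nn_integral_lborel_plus)
qed

text \<open>Of the two values on a mirror pair the larger one goes to the side
  \<open>z \<bullet> e \<le> c\<close>, which is the side of the origin when
  \<open>0 \<le> c\<close>. On the hyperplane itself both values coincide.\<close>

definition polarize :: "'a::euclidean_space \<Rightarrow> real \<Rightarrow> ('a \<Rightarrow> real) \<Rightarrow> 'a \<Rightarrow> real" where
  "polarize e c f z = (if z \<bullet> e \<le> c then max (f z) (f (hreflect e c z)) else min (f z) (f (hreflect e c z)))"

lemma polarize_measurable [measurable]:
  assumes [measurable]: "f \<in> borel_measurable borel"
  shows "polarize e c f \<in> borel_measurable borel"
  unfolding polarize_def[abs_def] by measurable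

lemma polarize_pair:
  assumes "norm e = 1" "z \<bullet> e \<le> c"
  shows "polarize e c f z = max (f z) (f (hreflect e c z))"
    and "polarize e c f (hreflect e c z) = min (f z) (f (hreflect e c z))"
proof -
  show "polarize e c f z = max (f z) (f (hreflect e c z))"
    using assms by (simp add: polarize_def)
  show "polarize e c f (hreflect e c z) = min (f z) (f (hreflect e c z))"
  proof (cases "z \<bullet> e = c")
    case True
    then have "hreflect e c z = z" by (simp add: hreflect_def)
    then show ?thesis by (simp add: polarize_def)
  next
    case False
    then have "\<not> hreflect e c z \<bullet> e \<le> c" using assms by (simp add: hreflect_inner)
    then show ?thesis using assms by (simp add: polarize_def min.commute)
  qed
qed

lemma half_space_hreflect_cases:
  assumes "norm e = 1"
  obtains "z \<bullet> e \<le> c" | y where "z = hreflect e c y" "y \<bullet> e \<le> c"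
  using assms hreflect_hreflect[OF assms, of c z] hreflect_inner[OF assms, of c z]
  by (metis add_le_cancel_left diff_le_eq le_cases mult_2)

text \<open>On one side of the hyperplane the polarization is a maximum or a minimum of two
  functions with the same Lipschitz constant. Across it, the selected values may come from two
  points on the same side; by \<open>mono\<close> their distance is at most the distance
  across.\<close>

lemma polarize_lipschitz:
  assumes e: "norm e = 1" and f: "\<And>z z'. \<bar>f z - f z'\<bar> \<le> A * dist z z'" and A: "A \<ge> 0"
  shows "\<bar>polarize e c f z - polarize e c f z'\<bar> \<le> A * dist z z'"
proof -
  let ?r = "hreflect e c"
  have r: "\<bar>f (?r z) - f (?r z')\<bar> \<le> A * dist z z'" for z z'
    using f[of "?r z" "?r z'"] by (simp add: dist_hreflect_hreflect[OF e])
  have mono: "dist y z \<le> dist y (?r z)" if "y \<bullet> e \<le> c" "z \<bullet> e \<le> c" for y z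
  proof -
    have "(dist y z)\<^sup>2 \<le> (dist y (?r z))\<^sup>2"
      using that by (simp add: dist_hreflect[OF e])
    then show ?thesis using power2_le_imp_le by (meson zero_le_dist)
  qed
  have mix: "\<bar>polarize e c f y - polarize e c f (?r z)\<bar> \<le> A * dist y (?r z)"
    if "y \<bullet> e \<le> c" "z \<bullet> e \<le> c" for y z
  proof -
    have m: "A * dist y z \<le> A * dist y (?r z)" using mono[OF that] A by (rule mult_left_mono)
    have "dist (?r y) z = dist y (?r z)"
      using dist_hreflect_hreflect[OF e, of c "?r y" z] e by simp
    then have "\<bar>f (?r y) - f z\<bar> \<le> A * dist y (?r z)" using f[of "?r y" z] by simp
    then show ?thesis
      using m f[of y z] r[of y z] f[of y "?r z"]
      unfolding polarize_pair[OF e that(1)] polarize_pair[OF e that(2)]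
      by (auto simp: max_def min_def)
  qed
  show ?thesis
  proof (cases rule: half_space_hreflect_cases[OF e, of z c])
    case 1
    note z = 1
    show ?thesis
    proof (cases rule: half_space_hreflect_cases[OF e, of z' c])
      case 1
      then show ?thesis
        using f[of z z'] r[of z z'] unfolding polarize_pair[OF e z] polarize_pair[OF e 1]
        by (auto simp: max_def)
    next
      case (2 y)
      then show ?thesis using mix[OF z] by auto
    qed
  next
    case (2 y)
    note z = 2
    show ?thesis
    proof (cases rule: half_space_hreflect_cases[OF e, of z' c])
      case 1
      then show ?thesis using mix[OF 1 z(2)] z by (simp add: abs_minus_commute dist_commute)
    next
      case (2 y')
      then show ?thesis
        using f[of y y'] r[of y y'] z unfolding z(1) 2(1) polarize_pair[OF e z(2)] polarize_pair[OF e 2(2)]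
        by (auto simp: min_def dist_hreflect_hreflect[OF e])
    qed
  qed
qed

text \<open>Polarization arguments average an integral with its reflection and compare integrands
  pointwise; this avoids splitting the domain along the hyperplane.\<close>

lemma nn_integral_hreflect_mono:
  assumes e: "norm e = 1"
    and [measurable]: "f \<in> borel_measurable borel" "g \<in> borel_measurable borel"
    and le: "\<And>z. z \<bullet> e \<le> c \<Longrightarrow> f z + f (hreflect e c z) \<le> g z + g (hreflect e c z)"
  shows "(\<integral>\<^sup>+z. f z \<partial>lborel) \<le> (\<integral>\<^sup>+z. g z \<partial>lborel)"
proof -
  have dbl: "2 * (\<integral>\<^sup>+z. f z \<partial>lborel) = (\<integral>\<^sup>+z. f z + f (hreflect e c z) \<partial>lborel)"
    if [measurable]: "f \<in> borel_measurable borel" for f :: "'a \<Rightarrow> ennreal"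
    by (subst nn_integral_add) (auto simp: nn_integral_hreflect[OF e] mult_2)
  have "f z + f (hreflect e c z) \<le> g z + g (hreflect e c z)" for z
  proof (cases rule: half_space_hreflect_cases[OF e, of z c])
    case (2 y)
    then show ?thesis using le[of y] e by (simp add: add.commute)
  qed (rule le)
  then have "2 * (\<integral>\<^sup>+z. f z \<partial>lborel) \<le> 2 * (\<integral>\<^sup>+z. g z \<partial>lborel)"
    unfolding dbl[OF assms(2)] dbl[OF assms(3)] by (rule nn_integral_mono)
  then show ?thesis by (simp add: ennreal_mult_le_mult_iff)
qed

text \<open>The sum of the two squares on a mirror pair is preserved. Whatever is exchanged moves
  from the outer point to the inner one, where the weight is not larger.\<close>

lemma polarize_weight:
  assumes e: "norm e = 1" and c: "c \<ge> 0"
    and [measurable]: "f \<in> borel_measurable borel" "w \<in> borel_measurable borel"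
    and w: "\<And>z z'. norm z \<le> norm z' \<Longrightarrow> w z \<le> w z'" "\<And>z. 0 \<le> w z"
    and f: "\<And>z. 0 \<le> f z"
  shows "(\<integral>\<^sup>+z. ennreal (w z * (polarize e c f z)\<^sup>2) \<partial>lborel) \<le> (\<integral>\<^sup>+z. ennreal (w z * (f z)\<^sup>2) \<partial>lborel)"
proof (rule nn_integral_hreflect_mono[OF e, of _ _ c])
  fix z assume z: "z \<bullet> e \<le> c"
  let ?r = "hreflect e c z"
  have "(norm z)\<^sup>2 \<le> (norm ?r)\<^sup>2" using z c by (simp add: norm_hreflect[OF e])
  then have "w z \<le> w ?r" by (intro w) (meson norm_ge_zero power2_le_imp_le)
  moreover have "(min a b)\<^sup>2 + (max a b)\<^sup>2 = a\<^sup>2 + b\<^sup>2" for a b :: real by (auto simp: min_def max_def)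
  moreover have "(min (f z) (f ?r))\<^sup>2 \<le> (f ?r)\<^sup>2" using f by (intro power_mono) auto
  moreover have "(max (f z) (f ?r))\<^sup>2 - (f z)\<^sup>2 = (f ?r)\<^sup>2 - (min (f z) (f ?r))\<^sup>2"
    by (auto simp: max_def min_def)
  ultimately have "w z * ((max (f z) (f ?r))\<^sup>2 - (f z)\<^sup>2) \<le> w ?r * ((f ?r)\<^sup>2 - (min (f z) (f ?r))\<^sup>2)"
    by (simp add: mult_right_mono)
  then have "w z * (polarize e c f z)\<^sup>2 + w ?r * (polarize e c f ?r)\<^sup>2 \<le> w z * (f z)\<^sup>2 + w ?r * (f ?r)\<^sup>2"
    unfolding polarize_pair[OF e z] by (simp add: algebra_simps)
  then show "ennreal (w z * (polarize e c f z)\<^sup>2) + ennreal (w ?r * (polarize e c f ?r)\<^sup>2)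
      \<le> ennreal (w z * (f z)\<^sup>2) + ennreal (w ?r * (f ?r)\<^sup>2)"
    using w(2) by (simp flip: ennreal_plus add: ennreal_leI)
qed measurable

section \<open>The nonlocal difference energy\<close>

text \<open>A derivative-free stand-in for the Dirichlet integral: polarization can be compared on
  mirror pairs, without weak derivatives. For smooth functions of compact support the Dirichlet
  integral is recovered, after division by \<open>second_moment\<close>, as \<open>h\<close> tends
  to 0.\<close>

definition diff_energy :: "real \<Rightarrow> ('a::euclidean_space \<Rightarrow> real) \<Rightarrow> ennreal" where
  "diff_energy h f = (\<integral>\<^sup>+z. \<integral>\<^sup>+z'. indicator {..<h} (dist z z') * ennreal ((f z - f z')\<^sup>2) \<partial>lborel \<partial>lborel)"

text \<open>The squares of the single terms agree on both sides, so only the mixed products count,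
  and matching larger with larger and smaller with smaller maximizes their sum.\<close>

lemma max_min_square_diff_le:
  fixes a b c d :: real
  shows "(max a b - max c d)\<^sup>2 + (min a b - min c d)\<^sup>2 \<le> (a - c)\<^sup>2 + (b - d)\<^sup>2"
proof -
  have "0 \<le> (a - b) * (d - c)" if "a \<ge> b" "c \<le> d" using that by simp
  moreover have "0 \<le> (b - a) * (c - d)" if "a \<le> b" "c \<ge> d" using that by simp
  ultimately show ?thesis
    by (auto simp: max_def min_def power2_eq_square algebra_simps)
qed

text \<open>Each side contains all four differences between the pair \<open>a\<close>,
  \<open>b\<close> and the pair \<open>c\<close>, \<open>d\<close>, so sorting the pairs has no
  effect.\<close>

lemma max_min_square_diff_sum:
  fixes a b c d :: real
  shows "(max a b - max c d)\<^sup>2 + (min a b - min c d)\<^sup>2 + ((max a b - min c d)\<^sup>2 + (min a b - max c d)\<^sup>2)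
       = (a - c)\<^sup>2 + (b - d)\<^sup>2 + ((a - d)\<^sup>2 + (b - c)\<^sup>2)"
  by (auto simp: max_def min_def)

text \<open>Symmetrizing in both variables groups the integrand into the four differences between
  the mirror pairs of \<open>z\<close> and \<open>z'\<close>. The kernel takes one value for points
  on the same side and a value that is not larger across the hyperplane.\<close>

lemma diff_energy_polarize:
  assumes e: "norm e = 1" and [measurable]: "f \<in> borel_measurable borel"
  shows "diff_energy h (polarize e c f) \<le> diff_energy h f"
proof -
  let ?r = "hreflect e c"
  define k :: "'a \<Rightarrow> 'a \<Rightarrow> real" where "k z z' = indicator {..<h} (dist z z')" for z z'
  define G where "G g z z' = k z z' * (g z - g z')\<^sup>2 + k z (?r z') * (g z - g (?r z'))\<^sup>2" for g z z'
  have k0: "0 \<le> k z z'" for z z' by (simp add: k_def)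
  have G0: "0 \<le> G g z z'" for g z z' using k0 by (simp add: G_def)
  have [measurable]: "case_prod k \<in> borel_measurable (borel \<Otimes>\<^sub>M borel)"
    unfolding k_def[abs_def] by measurable
  have dbl: "2 * diff_energy h g = (\<integral>\<^sup>+z. \<integral>\<^sup>+z'. ennreal (G g z z') \<partial>lborel \<partial>lborel)"
    if [measurable]: "g \<in> borel_measurable borel" for g
  proof -
    have "(\<integral>\<^sup>+z'. ennreal (G g z z') \<partial>lborel) = 2 * (\<integral>\<^sup>+z'. indicator {..<h} (dist z z') * ennreal ((g z - g z')\<^sup>2) \<partial>lborel)" for z
    proof -
      have "(\<integral>\<^sup>+z'. ennreal (G g z z') \<partial>lborel) = (\<integral>\<^sup>+z'. ennreal (k z z' * (g z - g z')\<^sup>2) + ennreal (k z (?r z') * (g z - g (?r z'))\<^sup>2) \<partial>lborel)"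
        unfolding G_def using k0 by (intro nn_integral_cong) simp
      also have "\<dots> = (\<integral>\<^sup>+z'. ennreal (k z z' * (g z - g z')\<^sup>2) \<partial>lborel) + (\<integral>\<^sup>+z'. ennreal (k z (?r z') * (g z - g (?r z'))\<^sup>2) \<partial>lborel)"
        by (rule nn_integral_add) measurable
      also have "(\<integral>\<^sup>+z'. ennreal (k z (?r z') * (g z - g (?r z'))\<^sup>2) \<partial>lborel) = (\<integral>\<^sup>+z'. ennreal (k z z' * (g z - g z')\<^sup>2) \<partial>lborel)"
        by (rule nn_integral_hreflect[OF e]) measurable
      also have "(\<integral>\<^sup>+z'. ennreal (k z z' * (g z - g z')\<^sup>2) \<partial>lborel) = (\<integral>\<^sup>+z'. indicator {..<h} (dist z z') * ennreal ((g z - g z')\<^sup>2) \<partial>lborel)"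
        by (intro nn_integral_cong) (auto simp: k_def indicator_def)
      finally show ?thesis by (simp add: mult_2)
    qed
    then show ?thesis
      unfolding diff_energy_def by (simp add: nn_integral_cmult)
  qed
  let ?p = "polarize e c f"
  have [measurable]: "?p \<in> borel_measurable borel" by measurable
  have key: "G ?p z z' + G ?p (?r z) z' \<le> G f z z' + G f (?r z) z'" for z z'
  proof -
    have kr: "k (?r y) y' = k y (?r y')" "k (?r y) (?r y') = k y y'" for y y'
      using dist_hreflect_hreflect[OF e, of c "?r y" y'] dist_hreflect_hreflect[OF e, of c y y'] e
      by (simp_all add: k_def)
    have *: "G ?p z z' + G ?p (?r z) z' \<le> G f z z' + G f (?r z) z'"
      if z: "z \<bullet> e \<le> c" and z': "z' \<bullet> e \<le> c" for z z'
    proof -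
      have "(dist z z')\<^sup>2 \<le> (dist z (?r z'))\<^sup>2" using z z' by (simp add: dist_hreflect[OF e])
      then have "dist z z' \<le> dist z (?r z')" by (meson power2_le_imp_le zero_le_dist)
      then have kk: "k z (?r z') \<le> k z z'" by (auto simp: k_def indicator_def)
      let ?a = "f z" and ?b = "f (?r z)" and ?c = "f z'" and ?d = "f (?r z')"
      \<comment> \<open>The excess of the kernel on the same side multiplies a sum that polarization
        does not increase; the remaining common value multiplies the sum of all four squares, which
        is invariant.\<close>
      have E: "G g z z' + G g (?r z) z' = (k z z' - k z (?r z')) * ((g z - g z')\<^sup>2 + (g (?r z) - g (?r z'))\<^sup>2)
          + k z (?r z') * ((g z - g z')\<^sup>2 + (g (?r z) - g (?r z'))\<^sup>2 + ((g z - g (?r z'))\<^sup>2 + (g (?r z) - g z')\<^sup>2))" for g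
        by (simp add: G_def kr e algebra_simps)
      show ?thesis
        unfolding E polarize_pair[OF e z] polarize_pair[OF e z'] max_min_square_diff_sum
        using kk max_min_square_diff_le[of ?a ?b ?c ?d] by (intro add_right_mono mult_left_mono) auto
    qed
    have sym1: "G g (?r z) z' + G g (?r (?r z)) z' = G g z z' + G g (?r z) z'" for g z z'
      using e by simp
    have sym2: "G g z (?r z') = G g z z'" for g z z'
      using e by (simp add: G_def)
    show ?thesis
    proof (cases rule: half_space_hreflect_cases[OF e, of z c])
      case 1
      note z = 1
      show ?thesis
        by (cases rule: half_space_hreflect_cases[OF e, of z' c]) (use *[OF z] in \<open>auto simp: sym2\<close>)
    next
      case (2 y)
      show ?thesis
        by (cases rule: half_space_hreflect_cases[OF e, of z' c]) (use *[OF 2(2)] 2(1) in \<open>auto simp: sym2 sym1\<close>)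
    qed
  qed
  have Gm: "(\<lambda>z. \<integral>\<^sup>+z'. ennreal (G g z z') \<partial>lborel) \<in> borel_measurable borel"
    if [measurable]: "g \<in> borel_measurable borel" for g
    unfolding G_def by measurable
  have "2 * diff_energy h ?p \<le> 2 * diff_energy h f"
    unfolding dbl[OF \<open>?p \<in> _\<close>] dbl[OF assms(2)]
  proof (rule nn_integral_hreflect_mono[OF e, of _ _ c])
    fix z assume "z \<bullet> e \<le> c"
    have mG: "(\<lambda>z'. ennreal (G g y z')) \<in> borel_measurable lborel" if [measurable]: "g \<in> borel_measurable borel" for g y
      unfolding G_def by measurable
    have add: "(\<integral>\<^sup>+z'. ennreal (G g z z') \<partial>lborel) + (\<integral>\<^sup>+z'. ennreal (G g (?r z) z') \<partial>lborel)
        = (\<integral>\<^sup>+z'. ennreal (G g z z' + G g (?r z) z') \<partial>lborel)" if "g \<in> borel_measurable borel" for g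
      using G0 by (subst nn_integral_add[OF mG[OF that] mG[OF that], symmetric]) simp
    show "(\<integral>\<^sup>+z'. ennreal (G ?p z z') \<partial>lborel) + (\<integral>\<^sup>+z'. ennreal (G ?p (?r z) z') \<partial>lborel)
       \<le> (\<integral>\<^sup>+z'. ennreal (G f z z') \<partial>lborel) + (\<integral>\<^sup>+z'. ennreal (G f (?r z) z') \<partial>lborel)"
      unfolding add[OF \<open>?p \<in> _\<close>] add[OF assms(2)] by (intro nn_integral_mono ennreal_leI key)
  qed (simp_all add: Gm assms(2) \<open>?p \<in> _\<close>)
  then show ?thesis by (simp add: ennreal_mult_le_mult_iff)
qed

section \<open>Integrals of products of several factors\<close>

text \<open>In the induction the smaller of \<open>f i\<close> and \<open>g i\<close> multiplies the
  induction hypothesis, and the excess of the larger one multiplies a product that is dominated by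
  the product of the maxima.\<close>

lemma prod_max_min_ge:
  fixes f g :: "'i \<Rightarrow> real"
  assumes "finite I" "\<And>i. i \<in> I \<Longrightarrow> 0 \<le> f i" "\<And>i. i \<in> I \<Longrightarrow> 0 \<le> g i"
  shows "(\<Prod>i\<in>I. f i) + (\<Prod>i\<in>I. g i) \<le> (\<Prod>i\<in>I. max (f i) (g i)) + (\<Prod>i\<in>I. min (f i) (g i))"
  using assms
proof (induction I rule: finite_induct)
  case (insert i I)
  let ?F = "\<Prod>i\<in>I. f i" and ?G = "\<Prod>i\<in>I. g i" and ?M = "\<Prod>i\<in>I. max (f i) (g i)" and ?m = "\<Prod>i\<in>I. min (f i) (g i)"
  have IH: "?F + ?G \<le> ?M + ?m" using insert by simp
  have *: "0 \<le> f i" "0 \<le> g i" using insert by auto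
  have le: "?F \<le> ?M" "?G \<le> ?M" using insert by (auto intro!: prod_mono)
  have "f i * ?F + g i * ?G \<le> max (f i) (g i) * ?M + min (f i) (g i) * ?m"
  proof (cases "f i \<ge> g i")
    case True
    have "g i * (?F + ?G) \<le> g i * (?M + ?m)" using IH * by (intro mult_left_mono)
    moreover have "(f i - g i) * ?F \<le> (f i - g i) * ?M" using True le by (intro mult_left_mono) auto
    ultimately show ?thesis using True by (simp add: max_def min_def algebra_simps)
  next
    case False
    have "f i * (?F + ?G) \<le> f i * (?M + ?m)" using IH * by (intro mult_left_mono)
    moreover have "(g i - f i) * ?G \<le> (g i - f i) * ?M" using False le by (intro mult_left_mono) auto
    ultimately show ?thesis using False by (simp add: max_def min_def algebra_simps)
  qed
  then show ?case using insert by simp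
qed simp

text \<open>All factors are polarized in the same hyperplane, so on each mirror pair the inequality
  for maxima and minima of products applies to the whole family.\<close>

lemma nn_integral_prod_polarize:
  assumes e: "norm e = 1" and "finite I"
    and [measurable]: "\<And>i. i \<in> I \<Longrightarrow> f i \<in> borel_measurable borel" and f: "\<And>i z. i \<in> I \<Longrightarrow> 0 \<le> f i z"
  shows "(\<integral>\<^sup>+z. ennreal (\<Prod>i\<in>I. f i z) \<partial>lborel) \<le> (\<integral>\<^sup>+z. ennreal (\<Prod>i\<in>I. polarize e c (f i) z) \<partial>lborel)"
proof (rule nn_integral_hreflect_mono[OF e, of _ _ c])
  fix z assume z: "z \<bullet> e \<le> c"
  show "ennreal (\<Prod>i\<in>I. f i z) + ennreal (\<Prod>i\<in>I. f i (hreflect e c z))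
      \<le> ennreal (\<Prod>i\<in>I. polarize e c (f i) z) + ennreal (\<Prod>i\<in>I. polarize e c (f i) (hreflect e c z))"
    unfolding polarize_pair[OF e z]
    using prod_max_min_ge[OF \<open>finite I\<close>, of "\<lambda>i. f i z" "\<lambda>i. f i (hreflect e c z)"] f
    by (subst (1 2) ennreal_plus[symmetric]) (auto intro!: ennreal_leI prod_nonneg simp: le_max_iff_disj)
qed measurable

section \<open>Simultaneous radial rearrangement\<close>

text \<open>Arzela-Ascoli on the ball of radius \<open>R\<close>, one member after another along
  successive subsequences; outside the ball all functions vanish, and so does the limit.\<close>

lemma finite_family_lipschitz_subseq:
  fixes F :: "nat \<Rightarrow> 'k \<Rightarrow> 'a::euclidean_space \<Rightarrow> real"
  assumes "finite K" and A: "0 \<le> A"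
    and lip: "\<And>n k z z'. k \<in> K \<Longrightarrow> \<bar>F n k z - F n k z'\<bar> \<le> A * dist z z'"
    and bd: "\<And>n k z. k \<in> K \<Longrightarrow> \<bar>F n k z\<bar> \<le> B"
    and supp: "\<And>n k z. k \<in> K \<Longrightarrow> norm z > R \<Longrightarrow> F n k z = 0"
  shows "\<exists>r G. strict_mono (r :: nat \<Rightarrow> nat) \<and> (\<forall>k\<in>K. \<forall>z. (\<lambda>n. F (r n) k z) \<longlonglongrightarrow> G k z)"
  using assms(1) lip bd supp
proof (induction K rule: finite_induct)
  case empty
  then show ?case by (intro exI[of _ id]) (auto simp: strict_mono_def)
next
  case (insert j K)
  obtain r G where r: "strict_mono r" and G: "\<And>k z. k \<in> K \<Longrightarrow> (\<lambda>n. F (r n) k z) \<longlonglongrightarrow> G k z"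
    using insert.IH[OF insert.prems] by auto
  obtain g s where s: "strict_mono (s :: nat \<Rightarrow> nat)"
    and g: "\<And>e. 0 < e \<Longrightarrow> \<exists>N. \<forall>n x. n \<ge> N \<and> x \<in> cball 0 R \<longrightarrow> norm (F (r (s n)) j x - g x) < e"
  proof (rule Arzela_Ascoli[of "cball (0::'a) R" "\<lambda>n. F (r n) j" B])
    show "norm (F (r n) j x) \<le> B" for n x using insert.prems(2) by simp
    fix x :: 'a and e :: real assume "0 < e"
    show "\<exists>d. 0 < d \<and> (\<forall>n y. y \<in> cball 0 R \<and> norm (x - y) < d \<longrightarrow> norm (F (r n) j x - F (r n) j y) < e)"
    \<comment> \<open>Dividing by \<open>A + 1\<close> instead of \<open>A\<close> covers the case
      \<open>A = 0\<close>.\<close>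
    proof (intro exI[of _ "e / (A + 1)"] conjI allI impI)
      show "0 < e / (A + 1)" using A \<open>0 < e\<close> by simp
      fix n y assume y: "y \<in> cball 0 R \<and> norm (x - y) < e / (A + 1)"
      have "\<bar>F (r n) j x - F (r n) j y\<bar> \<le> A * dist x y" using insert.prems(1) by simp
      also have "\<dots> \<le> (A + 1) * norm (x - y)" by (simp add: dist_norm algebra_simps)
      also have "\<dots> < e" using y A by (simp add: field_simps)
      finally show "norm (F (r n) j x - F (r n) j y) < e" by simp
    qed
  qed auto
  have "(\<lambda>n. F (r (s n)) j z) \<longlonglongrightarrow> (if norm z \<le> R then g z else 0)" for z
  proof (cases "norm z \<le> R")
    case True
    then show ?thesis using g by (simp add: LIMSEQ_iff) meson
  next
    case False
    then show ?thesis using insert.prems(3) by simp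
  qed
  moreover have "(\<lambda>n. F (r (s n)) k z) \<longlonglongrightarrow> G k z" if "k \<in> K" for k z
    using LIMSEQ_subseq_LIMSEQ[OF G[OF that] s] by (simp add: comp_def)
  ultimately have "\<forall>k\<in>insert j K. \<forall>z. (\<lambda>n. F ((r \<circ> s) n) k z) \<longlonglongrightarrow> (G(j := \<lambda>z. if norm z \<le> R then g z else 0)) k z"
    using insert.hyps by auto
  then show ?case using strict_mono_o[OF r s] by blast
qed

lemma nn_integral_const_cball: "(\<integral>\<^sup>+z. ennreal (c * indicator (cball (0::'a::euclidean_space) R) z) \<partial>lborel) < \<infinity>"
proof -
  have "ennreal (c * indicator (cball (0::'a) R) z) = ennreal c * indicator (cball 0 R) z" for z
    by (auto simp: indicator_def)
  then show ?thesis
    using emeasure_bounded_finite[of "cball (0::'a) R"]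
    by (simp add: nn_integral_cmult_indicator ennreal_mult_less_top)
qed

text \<open>Monotonicity of \<open>w\<close> in the norm also makes it radial. The Lipschitz
  constant and the support radius are common to all members; they provide the compactness of the
  admissible class.\<close>

locale rearrangement_class =
  fixes K :: "'k set" and f :: "'k \<Rightarrow> 'a::euclidean_space \<Rightarrow> real" and w :: "'a \<Rightarrow> real" and A R :: real
  assumes K: "finite K" and A: "0 \<le> A" and R: "0 \<le> R"
    and nonneg: "\<And>k z. k \<in> K \<Longrightarrow> 0 \<le> f k z"
    and lip: "\<And>k z z'. k \<in> K \<Longrightarrow> \<bar>f k z - f k z'\<bar> \<le> A * dist z z'"
    and supp: "\<And>k z. k \<in> K \<Longrightarrow> norm z > R \<Longrightarrow> f k z = 0"
    and w_mono: "\<And>z z'. norm z \<le> norm z' \<Longrightarrow> w z \<le> w z'" and w0: "\<And>z. 0 \<le> w z"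
    and w_meas [measurable]: "w \<in> borel_measurable borel"
begin

text \<open>The clause on equal members keeps the symmetry \<open>f (- k) = f k\<close> of moduli of Fourier coefficients of a
  real function.\<close>

definition adm :: "('k \<Rightarrow> 'a \<Rightarrow> real) \<Rightarrow> bool" where
  "adm F \<longleftrightarrow>
     (\<forall>k\<in>K. (\<forall>z. 0 \<le> F k z) \<and> (\<forall>z z'. \<bar>F k z - F k z'\<bar> \<le> A * dist z z') \<and> (\<forall>z. norm z > R \<longrightarrow> F k z = 0) \<and>
        (\<integral>\<^sup>+z. ennreal (w z * (F k z)\<^sup>2) \<partial>lborel) \<le> (\<integral>\<^sup>+z. ennreal (w z * (f k z)\<^sup>2) \<partial>lborel) \<and>
        (\<forall>h. diff_energy h (F k) \<le> diff_energy h (f k)) \<and> (\<forall>k'\<in>K. f k = f k' \<longrightarrow> F k = F k')) \<and>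
     (\<forall>(I::nat set) \<phi>. finite I \<and> \<phi> \<in> I \<rightarrow> K \<longrightarrow>
        (\<integral>\<^sup>+z. ennreal (\<Prod>i\<in>I. f (\<phi> i) z) \<partial>lborel) \<le> (\<integral>\<^sup>+z. ennreal (\<Prod>i\<in>I. F (\<phi> i) z) \<partial>lborel))"

lemma admD:
  assumes "adm F" "k \<in> K"
  shows "0 \<le> F k z" "\<bar>F k z - F k z'\<bar> \<le> A * dist z z'" "norm z > R \<Longrightarrow> F k z = 0"
      "(\<integral>\<^sup>+z. ennreal (w z * (F k z)\<^sup>2) \<partial>lborel) \<le> (\<integral>\<^sup>+z. ennreal (w z * (f k z)\<^sup>2) \<partial>lborel)"
      "diff_energy h (F k) \<le> diff_energy h (f k)" "k' \<in> K \<Longrightarrow> f k = f k' \<Longrightarrow> F k = F k'"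
proof -
  note * = bspec[OF conjunct1[OF assms(1)[unfolded adm_def]] assms(2)]
  show "0 \<le> F k z" "\<bar>F k z - F k z'\<bar> \<le> A * dist z z'" "norm z > R \<Longrightarrow> F k z = 0"
      "(\<integral>\<^sup>+z. ennreal (w z * (F k z)\<^sup>2) \<partial>lborel) \<le> (\<integral>\<^sup>+z. ennreal (w z * (f k z)\<^sup>2) \<partial>lborel)"
      "diff_energy h (F k) \<le> diff_energy h (f k)"
    using * by simp_all
  show "k' \<in> K \<Longrightarrow> f k = f k' \<Longrightarrow> F k = F k'"
    using * by (elim conjE) (drule (1) bspec, erule (1) mp)
qed

lemma adm_prod:
  fixes I :: "nat set"
  assumes "adm F" "finite I" "\<phi> \<in> I \<rightarrow> K"
  shows "(\<integral>\<^sup>+z. ennreal (\<Prod>i\<in>I. f (\<phi> i) z) \<partial>lborel) \<le> (\<integral>\<^sup>+z. ennreal (\<Prod>i\<in>I. F (\<phi> i) z) \<partial>lborel)"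
  using conjunct2[OF assms(1)[unfolded adm_def]] assms(2,3) by simp

lemma lipschitz_continuous_on:
  assumes "\<And>z z'. \<bar>g z - g z'\<bar> \<le> A * dist z z'"
  shows "continuous_on UNIV (g :: 'a \<Rightarrow> real)"
  using assms A by (intro lipschitz_on_continuous_on[of A] lipschitz_onI) (auto simp: dist_real_def)

lemma adm_continuous: "adm F \<Longrightarrow> k \<in> K \<Longrightarrow> continuous_on UNIV (F k)"
  by (rule lipschitz_continuous_on) (rule admD)

lemma adm_measurable: "adm F \<Longrightarrow> k \<in> K \<Longrightarrow> F k \<in> borel_measurable borel"
  by (intro borel_measurable_continuous_onI adm_continuous)

text \<open>The factor \<open>2 * R + 1\<close> bounds the distance from a point of the ball of
  radius \<open>R\<close> to a point of norm \<open>R + 1\<close>, where every admissible member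
  vanishes.\<close>

definition bd :: real where "bd = A * (2 * R + 1)"

lemma adm_bound:
  assumes "adm F" "k \<in> K"
  shows "F k z \<le> bd * indicator (cball 0 R) z"
proof (cases "norm z \<le> R")
  case True
  obtain y :: 'a where y: "norm y = R + 1" using vector_choose_size[of "R + 1"] R by auto
  have "F k z - F k y \<le> A * dist z y" using admD(2)[OF assms, of z y] by linarith
  moreover have "F k y = 0" using admD(3)[OF assms] y by simp
  moreover have "dist z y \<le> 2 * R + 1"
    using True y norm_triangle_ineq4[of z y] by (simp add: dist_norm)
  then have "A * dist z y \<le> A * (2 * R + 1)"
    using A by (rule mult_left_mono)
  ultimately show ?thesis using True by (simp add: bd_def)
qed (use admD(3)[OF assms] in simp)

lemma adm_self: "adm f"
  unfolding adm_def by (simp add: nonneg lip supp)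

text \<open>The sign of \<open>c\<close> matters twice: since values are moved towards the side of
  the origin, the support stays in the ball of radius \<open>R\<close> and the weighted integral
  does not grow.\<close>

lemma adm_polarize:
  assumes F: "adm F" and e: "norm e = 1" and c: "0 \<le> c"
  shows "adm (\<lambda>k. polarize e c (F k))"
proof -
  note F' = admD[OF F]
  note m = adm_measurable[OF F]
  have nonneg: "0 \<le> polarize e c (F k) z" if "k \<in> K" for k z
    using F'(1)[OF that] by (auto simp: polarize_def max_def min_def)
  have supp: "polarize e c (F k) z = 0" if k: "k \<in> K" and z: "norm z > R" for k z
  proof (cases "z \<bullet> e \<le> c")
    case True
    then have "(norm z)\<^sup>2 \<le> (norm (hreflect e c z))\<^sup>2" using c by (simp add: norm_hreflect[OF e])
    then have "norm z \<le> norm (hreflect e c z)" by (meson norm_ge_zero power2_le_imp_le)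
    then show ?thesis using True z F'(3)[OF k] by (simp add: polarize_def)
  next
    case False
    then show ?thesis using z F'(1,3)[OF k] by (simp add: polarize_def)
  qed
  have wt: "(\<integral>\<^sup>+z. ennreal (w z * (polarize e c (F k) z)\<^sup>2) \<partial>lborel) \<le> (\<integral>\<^sup>+z. ennreal (w z * (f k z)\<^sup>2) \<partial>lborel)" if "k \<in> K" for k
    using polarize_weight[OF e c m[OF that] w_meas w_mono w0 F'(1)[OF that]] F'(4)[OF that] by (rule order.trans)
  have de: "diff_energy h (polarize e c (F k)) \<le> diff_energy h (f k)" if "k \<in> K" for h k
    using diff_energy_polarize[OF e m[OF that]] F'(5)[OF that] by (rule order.trans)
  have lip': "\<bar>polarize e c (F k) z - polarize e c (F k) z'\<bar> \<le> A * dist z z'" if "k \<in> K" for k z z'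
    by (rule polarize_lipschitz[OF e F'(2)[OF that] A])
  have eq': "polarize e c (F k) = polarize e c (F k')" if "k \<in> K" "k' \<in> K" "f k = f k'" for k k'
    using F'(6)[OF that] by simp
  have pr: "(\<integral>\<^sup>+z. ennreal (\<Prod>i\<in>I. f (\<phi> i) z) \<partial>lborel) \<le> (\<integral>\<^sup>+z. ennreal (\<Prod>i\<in>I. polarize e c (F (\<phi> i)) z) \<partial>lborel)"
    if I: "finite I" "\<phi> \<in> I \<rightarrow> K" for I :: "nat set" and \<phi>
  proof -
    have "(\<integral>\<^sup>+z. ennreal (\<Prod>i\<in>I. f (\<phi> i) z) \<partial>lborel) \<le> (\<integral>\<^sup>+z. ennreal (\<Prod>i\<in>I. F (\<phi> i) z) \<partial>lborel)"
      by (rule adm_prod[OF F I])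
    also have "\<dots> \<le> (\<integral>\<^sup>+z. ennreal (\<Prod>i\<in>I. polarize e c (F (\<phi> i)) z) \<partial>lborel)"
      by (rule nn_integral_prod_polarize[OF e I(1)]) (use I m F'(1) in auto)
    finally show ?thesis .
  qed
  show ?thesis
    unfolding adm_def by (intro conjI ballI allI impI; (elim conjE)?; (rule nonneg lip' supp wt de eq' pr; assumption))
qed

text \<open>The quantities bounded from above by those of \<open>f\<close> pass to the limit by
  Fatou's lemma. The product integrals are bounded from below, which needs convergence; it is
  dominated by a power of \<open>bd\<close> on the ball of radius \<open>R\<close>.\<close>

lemma adm_limit:
  assumes F: "\<And>n. adm (F n)" and lim: "\<And>k z. k \<in> K \<Longrightarrow> (\<lambda>n. F n k z) \<longlonglongrightarrow> G k z"
  shows "adm G"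
proof -
  note F' = admD[OF F]
  note m = adm_measurable[OF F]
  have n0: "0 \<le> G k z" if "k \<in> K" for k z
    by (rule LIMSEQ_le_const[OF lim[OF that]]) (use F'(1)[OF that] in auto)
  have lip: "\<bar>G k z - G k z'\<bar> \<le> A * dist z z'" if "k \<in> K" for k z z'
  proof (rule LIMSEQ_le_const2)
    show "(\<lambda>n. \<bar>F n k z - F n k z'\<bar>) \<longlonglongrightarrow> \<bar>G k z - G k z'\<bar>" by (intro tendsto_intros lim that)
    show "\<exists>N. \<forall>n\<ge>N. \<bar>F n k z - F n k z'\<bar> \<le> A * dist z z'" using F'(2)[OF that] by blast
  qed
  have Gm: "G k \<in> borel_measurable borel" if "k \<in> K" for k
    using lipschitz_continuous_on[OF lip[OF that]] by (rule borel_measurable_continuous_onI)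
  have supp: "G k z = 0" if "k \<in> K" "norm z > R" for k z
    using lim[OF that(1), of z] F'(3)[OF that] by (simp add: LIMSEQ_const_iff)
  have eq: "G k = G k'" if "k \<in> K" "k' \<in> K" "f k = f k'" for k k'
  proof
    fix z show "G k z = G k' z"
      using lim[OF that(1), of z] lim[OF that(2), of z] F'(6)[OF that]
      by (simp add: LIMSEQ_unique)
  qed
  have wt: "(\<integral>\<^sup>+z. ennreal (w z * (G k z)\<^sup>2) \<partial>lborel) \<le> (\<integral>\<^sup>+z. ennreal (w z * (f k z)\<^sup>2) \<partial>lborel)" if k: "k \<in> K" for k
  proof -
    note [measurable] = m[OF k]
    have "(\<integral>\<^sup>+z. ennreal (w z * (G k z)\<^sup>2) \<partial>lborel) = (\<integral>\<^sup>+z. liminf (\<lambda>n. ennreal (w z * (F n k z)\<^sup>2)) \<partial>lborel)"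
      by (intro nn_integral_cong lim_imp_Liminf[symmetric] tendsto_intros lim k) auto
    also have "\<dots> \<le> liminf (\<lambda>n. \<integral>\<^sup>+z. ennreal (w z * (F n k z)\<^sup>2) \<partial>lborel)"
      by (rule nn_integral_liminf) measurable
    also have "\<dots> \<le> (\<integral>\<^sup>+z. ennreal (w z * (f k z)\<^sup>2) \<partial>lborel)"
      by (rule Liminf_le) (use F'(4)[OF k] in auto)
    finally show ?thesis .
  qed
  have de: "diff_energy h (G k) \<le> diff_energy h (f k)" if k: "k \<in> K" for h k
  proof -
    note [measurable] = m[OF k]
    define u where "u g z z' = indicator {..<h} (dist z z') * ennreal ((g z - g z')\<^sup>2)" for g :: "'a \<Rightarrow> real" and z z'
    have [measurable]: "case_prod (u (F n k)) \<in> borel_measurable (borel \<Otimes>\<^sub>M borel)" for n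
      unfolding u_def[abs_def] by measurable
    have ul: "u (G k) z z' = liminf (\<lambda>n. u (F n k) z z')" for z z'
    proof -
      have "(\<lambda>n. ennreal (indicator {..<h} (dist z z') * (F n k z - F n k z')\<^sup>2)) \<longlonglongrightarrow> ennreal (indicator {..<h} (dist z z') * (G k z - G k z')\<^sup>2)"
        by (intro tendsto_intros lim k)
      then have "(\<lambda>n. u (F n k) z z') \<longlonglongrightarrow> u (G k) z z'"
        by (simp add: u_def ennreal_mult ennreal_indicator)
      then show ?thesis by (intro lim_imp_Liminf[symmetric]) auto
    qed
    have "diff_energy h (G k) = (\<integral>\<^sup>+z. \<integral>\<^sup>+z'. liminf (\<lambda>n. u (F n k) z z') \<partial>lborel \<partial>lborel)"
      unfolding ul[symmetric] by (simp add: diff_energy_def u_def)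
    also have "\<dots> \<le> (\<integral>\<^sup>+z. liminf (\<lambda>n. \<integral>\<^sup>+z'. u (F n k) z z' \<partial>lborel) \<partial>lborel)"
      by (intro nn_integral_mono nn_integral_liminf) measurable
    also have "\<dots> \<le> liminf (\<lambda>n. \<integral>\<^sup>+z. \<integral>\<^sup>+z'. u (F n k) z z' \<partial>lborel \<partial>lborel)"
      by (intro nn_integral_liminf) measurable
    also have "\<dots> \<le> diff_energy h (f k)"
      by (rule Liminf_le) (use F'(5)[OF k] in \<open>auto simp: diff_energy_def u_def\<close>)
    finally show ?thesis .
  qed
  have pr: "(\<integral>\<^sup>+z. ennreal (\<Prod>i\<in>I. f (\<phi> i) z) \<partial>lborel) \<le> (\<integral>\<^sup>+z. ennreal (\<Prod>i\<in>I. G (\<phi> i) z) \<partial>lborel)"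
    if I: "finite I" "\<phi> \<in> I \<rightarrow> K" for I :: "nat set" and \<phi>
  \<comment> \<open>For the empty index set both products are the constant 1, which has no
    integrable majorant; the claim is then an equality.\<close>
  proof (cases "I = {}")
    case False
    have bd0: "0 \<le> bd" using A R by (simp add: bd_def)
    have "(\<lambda>n. \<integral>\<^sup>+z. ennreal (\<Prod>i\<in>I. F n (\<phi> i) z) \<partial>lborel) \<longlonglongrightarrow> (\<integral>\<^sup>+z. ennreal (\<Prod>i\<in>I. G (\<phi> i) z) \<partial>lborel)"
    proof (rule nn_integral_dominated_convergence)
      have "F n (\<phi> i) \<in> borel_measurable borel" if "i \<in> I" for n i using m I that by auto
      then show "(\<lambda>z. ennreal (\<Prod>i\<in>I. F n (\<phi> i) z)) \<in> borel_measurable lborel" for n by measurable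
      have "G (\<phi> i) \<in> borel_measurable borel" if "i \<in> I" for i using Gm I that by auto
      then show "(\<lambda>z. ennreal (\<Prod>i\<in>I. G (\<phi> i) z)) \<in> borel_measurable lborel" by measurable
      have [measurable]: "cball (0::'a) R \<in> sets borel" by simp
      show "(\<lambda>z. ennreal (bd ^ card I * indicator (cball (0::'a) R) z)) \<in> borel_measurable lborel" by measurable
      show "(\<integral>\<^sup>+z. ennreal (bd ^ card I * indicator (cball (0::'a) R) z) \<partial>lborel) < \<infinity>"
        by (rule nn_integral_const_cball)
      show "AE z in lborel. ennreal (\<Prod>i\<in>I. F n (\<phi> i) z) \<le> ennreal (bd ^ card I * indicator (cball 0 R) z)" for n
      proof (intro AE_I2 ennreal_leI)
        fix z
        have "(\<Prod>i\<in>I. F n (\<phi> i) z) \<le> (\<Prod>i\<in>I. bd * indicator (cball 0 R) z)"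
          using adm_bound[OF F] F'(1) Pi_mem[OF I(2)] by (intro prod_mono) blast
        also have "\<dots> = bd ^ card I * indicator (cball 0 R) z"
          using I False by (auto simp: indicator_def power_0_left)
        finally show "(\<Prod>i\<in>I. F n (\<phi> i) z) \<le> bd ^ card I * indicator (cball 0 R) z" .
      qed
      show "AE z in lborel. (\<lambda>n. ennreal (\<Prod>i\<in>I. F n (\<phi> i) z)) \<longlonglongrightarrow> ennreal (\<Prod>i\<in>I. G (\<phi> i) z)"
        using I by (intro AE_I2 tendsto_intros lim) auto
    qed
    then show ?thesis
      by (rule LIMSEQ_le_const) (use adm_prod[OF F I] in auto)
  qed simp
  show ?thesis
    unfolding adm_def by (intro conjI ballI allI impI; (elim conjE)?; (rule n0 lip supp wt de eq pr; assumption))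
qed

section \<open>Minimization of the second moment\<close>

text \<open>For \<open>c > 0\<close> the outer point of a mirror pair has strictly larger norm, so
  every genuine exchange of values lowers this functional. The decreases of the members add up, so a
  single functional watches all of them.\<close>

definition moment :: "('k \<Rightarrow> 'a \<Rightarrow> real) \<Rightarrow> ennreal" where
  "moment F = (\<integral>\<^sup>+z. ennreal ((norm z)\<^sup>2 * (\<Sum>k\<in>K. F k z)) \<partial>lborel)"

text \<open>Direct method: the common bounds give a pointwise convergent subsequence of a minimizing
  sequence, its limit is admissible, and the moment is lower semicontinuous by Fatou's
  lemma.\<close>

lemma ex_minimal_moment: "\<exists>F. adm F \<and> (\<forall>G. adm G \<longrightarrow> moment F \<le> moment G)"
proof -
  obtain u where u: "\<And>n::nat. u n \<in> moment ` Collect adm" "u \<longlonglongrightarrow> Inf (moment ` Collect adm)"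
    using Inf_as_limit[of "moment ` Collect adm"] adm_self by auto
  have "\<forall>n. \<exists>F. adm F \<and> moment F = u n" using u(1) by (metis imageE mem_Collect_eq)
  then obtain F where F: "\<And>n. adm (F n)" "\<And>n. moment (F n) = u n" by metis
  note F' = admD[OF F(1)]
  have bd0: "0 \<le> bd" using A R by (simp add: bd_def)
  have "\<bar>F n k z\<bar> \<le> bd" if "k \<in> K" for n k z
    using adm_bound[OF F(1) that, of n z] F'(1)[OF that] bd0
    by (cases "norm z \<le> R") auto
  then obtain r G where r: "strict_mono r" and G: "\<And>k z. k \<in> K \<Longrightarrow> (\<lambda>n. F (r n) k z) \<longlonglongrightarrow> G k z"
    using finite_family_lipschitz_subseq[OF K A, of F bd R] F'(2,3) by blast
  have adm: "adm G" by (rule adm_limit[of "\<lambda>n. F (r n)"]) (auto simp: F G)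
  have "moment G = (\<integral>\<^sup>+z. liminf (\<lambda>n. ennreal ((norm z)\<^sup>2 * (\<Sum>k\<in>K. F (r n) k z))) \<partial>lborel)"
    unfolding moment_def
    by (intro nn_integral_cong lim_imp_Liminf[symmetric] tendsto_intros G) auto
  also have "\<dots> \<le> liminf (\<lambda>n. \<integral>\<^sup>+z. ennreal ((norm z)\<^sup>2 * (\<Sum>k\<in>K. F (r n) k z)) \<partial>lborel)"
  proof (rule nn_integral_liminf)
    fix n
    have "F (r n) k \<in> borel_measurable borel" if "k \<in> K" for k using adm_measurable[OF F(1) that] .
    then show "(\<lambda>z. ennreal ((norm z)\<^sup>2 * (\<Sum>k\<in>K. F (r n) k z))) \<in> borel_measurable lborel" by measurable
  qed
  also have "\<dots> = Inf (moment ` Collect adm)"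
    using LIMSEQ_subseq_LIMSEQ[OF u(2) r]
    by (intro lim_imp_Liminf) (auto simp: F(2)[symmetric] moment_def comp_def)
  finally have le: "moment G \<le> Inf (moment ` Collect adm)" .
  have "moment G \<le> moment H" if "adm H" for H
    by (rule order.trans[OF le Inf_lower]) (use that in simp)
  then show ?thesis using adm by auto
qed

text \<open>A minimizer is fixed by every polarization with \<open>c > 0\<close>. Two points of
  different norm are mirror images in such a hyperplane, with the one of smaller norm on the
  favoured side, so the members do not increase with the norm; continuity extends the comparison to
  equal norms.\<close>

lemma ex_radial_adm: "\<exists>F. adm F \<and> (\<forall>k\<in>K. \<forall>z z'. norm z = norm z' \<longrightarrow> F k z = F k z')"
proof -
  obtain F where F: "adm F" and min: "\<And>G. adm G \<Longrightarrow> moment F \<le> moment G"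
    using ex_minimal_moment by blast
  have fixed: "F k (hreflect e c z) \<le> F k z"
    if e: "norm e = 1" and c: "0 < c" and z: "z \<bullet> e < c" and k: "k \<in> K" for e c z k
  proof -
    let ?r = "hreflect e c" and ?P = "\<lambda>k. polarize e c (F k)"
    have P: "adm ?P" using F e c by (intro adm_polarize) auto
    define g where "g G z = (norm z)\<^sup>2 * (\<Sum>k\<in>K. G k z)" for G :: "'k \<Rightarrow> 'a \<Rightarrow> real" and z
    \<comment> \<open>Adding the mirror term turns the comparison of the two integrals into a
      pointwise one on mirror pairs.\<close>
    define v where "v G z = g G z + g G (?r z)" for G :: "'k \<Rightarrow> 'a \<Rightarrow> real" and z
    have g0: "0 \<le> g G z" if "adm G" for G z
      using admD(1)[OF that] by (auto simp: g_def intro!: mult_nonneg_nonneg sum_nonneg)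
    have gc: "continuous_on UNIV (g G)" if "adm G" for G
      unfolding g_def[abs_def] by (intro continuous_intros adm_continuous that)
    have rc: "continuous_on UNIV ?r"
      unfolding hreflect_def[abs_def] by (intro continuous_intros)
    have vc: "continuous_on UNIV (v G)" if "adm G" for G
      unfolding v_def[abs_def]
      by (intro continuous_intros gc that continuous_on_compose2[OF gc[OF that] rc]) auto
    have gm: "g G \<in> borel_measurable borel" if "adm G" for G
      using gc[OF that] by (rule borel_measurable_continuous_onI)
    have vm: "v G \<in> borel_measurable borel" if "adm G" for G
      using vc[OF that] by (rule borel_measurable_continuous_onI)
    have iv: "(\<integral>\<^sup>+z. ennreal (v G z) \<partial>lborel) = 2 * moment G" if G: "adm G" for G
    proof -
      note [measurable] = gm[OF G]
      have "(\<integral>\<^sup>+z. ennreal (v G z) \<partial>lborel) = (\<integral>\<^sup>+z. ennreal (g G z) + ennreal (g G (?r z)) \<partial>lborel)"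
        using g0[OF G] by (simp add: v_def)
      also have "\<dots> = (\<integral>\<^sup>+z. ennreal (g G z) \<partial>lborel) + (\<integral>\<^sup>+z. ennreal (g G (?r z)) \<partial>lborel)"
        by (rule nn_integral_add) measurable
      also have "(\<integral>\<^sup>+z. ennreal (g G (?r z)) \<partial>lborel) = (\<integral>\<^sup>+z. ennreal (g G z) \<partial>lborel)"
        by (rule nn_integral_hreflect[OF e]) measurable
      finally show ?thesis by (simp add: moment_def g_def mult_2)
    qed
    have bd0: "0 \<le> bd" using A R by (simp add: bd_def)
    have fin: "moment F < \<infinity>"
    proof -
      have "moment F \<le> (\<integral>\<^sup>+z. ennreal (R\<^sup>2 * (real (card K) * bd) * indicator (cball (0::'a) R) z) \<partial>lborel)"
        unfolding moment_def
      proof (intro nn_integral_mono ennreal_leI)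
        fix z
        show "(norm z)\<^sup>2 * (\<Sum>k\<in>K. F k z) \<le> R\<^sup>2 * (real (card K) * bd) * indicator (cball 0 R) z"
        proof (cases "norm z \<le> R")
          case True
          have "F k z \<le> bd" if "k \<in> K" for k using adm_bound[OF F that, of z] True by simp
          then have "(\<Sum>k\<in>K. F k z) \<le> real (card K) * bd" by (rule sum_bounded_above)
          then show ?thesis using True bd0 admD(1)[OF F]
            by (simp add: mult_mono power_mono sum_nonneg)
        next
          case False
          then show ?thesis using admD(3)[OF F] by simp
        qed
      qed
      also have "\<dots> < \<infinity>"
        by (rule nn_integral_const_cball)
      finally show ?thesis .
    qed
    \<comment> \<open>The amount by which polarizing the member \<open>k\<close> lowers the moment
      on the pair of \<open>z\<close>: the gap between the squared norms times the value that is
      moved inwards.\<close>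
    define d where "d k z = (if z \<bullet> e \<le> c then ((norm (?r z))\<^sup>2 - (norm z)\<^sup>2) * (F k (?r z) - min (F k z) (F k (?r z))) else 0)" for k z
    have vd: "v F z - v ?P z = (\<Sum>k\<in>K. d k z)" if "z \<bullet> e \<le> c" for z
    proof -
      have "v F z - v ?P z = (\<Sum>k\<in>K. (norm z)\<^sup>2 * F k z + (norm (?r z))\<^sup>2 * F k (?r z) - (norm z)\<^sup>2 * ?P k z - (norm (?r z))\<^sup>2 * ?P k (?r z))"
        by (simp add: v_def g_def sum_subtractf sum.distrib sum_distrib_left)
      also have "\<dots> = (\<Sum>k\<in>K. d k z)"
        using that unfolding polarize_pair[OF e that]
        by (intro sum.cong) (auto simp: d_def max_def min_def algebra_simps)
      finally show ?thesis .
    qed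
    have d0: "0 \<le> d k z" for k z
      using c by (auto simp: d_def norm_hreflect[OF e])
    have v_le: "v ?P z \<le> v F z" for z
    proof (cases rule: half_space_hreflect_cases[OF e, of z c])
      case 1
      then show ?thesis using vd[OF 1] sum_nonneg[of K "\<lambda>k. d k z"] d0 by simp
    next
      case (2 y)
      then show ?thesis using vd[OF 2(2)] sum_nonneg[of K "\<lambda>k. d k y"] d0 e by (simp add: v_def)
    qed
    have ae: "AE z in lborel. v F z \<le> v ?P z"
    proof (rule ccontr)
      assume "\<not> (AE z in lborel. v F z \<le> v ?P z)"
      moreover have "0 \<le> v ?P z" for z using g0[OF P] by (simp add: v_def)
      ultimately have "\<not> (AE z in lborel. ennreal (v F z) \<le> ennreal (v ?P z))"
        by (simp add: ennreal_le_iff)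
      then have "(\<integral>\<^sup>+z. ennreal (v ?P z) \<partial>lborel) < (\<integral>\<^sup>+z. ennreal (v F z) \<partial>lborel)"
      proof (rule nn_integral_less[rotated 4])
        show "(\<lambda>z. ennreal (v ?P z)) \<in> borel_measurable lborel" "(\<lambda>z. ennreal (v F z)) \<in> borel_measurable lborel"
          using vm[OF P] vm[OF F] by measurable
        have "moment ?P \<le> moment F"
          using iv[OF P] iv[OF F] nn_integral_mono[of lborel "\<lambda>z. ennreal (v ?P z)" "\<lambda>z. ennreal (v F z)"]
            v_le by (simp add: ennreal_leI ennreal_mult_le_mult_iff)
        then show "(\<integral>\<^sup>+z. ennreal (v ?P z) \<partial>lborel) \<noteq> \<infinity>"
          using fin unfolding iv[OF P] by (auto simp: ennreal_mult_eq_top_iff)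
        show "AE z in lborel. ennreal (v ?P z) \<le> ennreal (v F z)"
          using v_le by (simp add: ennreal_leI)
      qed
      then have "2 * moment ?P < 2 * moment F" unfolding iv[OF P] iv[OF F] .
      moreover have "2 * moment F \<le> 2 * moment ?P" using min[OF P] by (intro mult_left_mono) auto
      ultimately show False by simp
    qed
    \<comment> \<open>The exceptional set is open by continuity; being null, it is empty, and the
      comparison holds at every point.\<close>
    define U where "U = {z. v ?P z < v F z}"
    have "open U" unfolding U_def by (intro open_Collect_less vc P F)
    moreover have "negligible U"
    proof -
      have "U \<in> null_sets lborel"
        using ae \<open>open U\<close> unfolding U_def by (subst (asm) AE_iff_null) (auto simp: not_le vm)
      then show ?thesis by (simp add: negligible_iff_null_sets null_sets_completionI)
    qed
    ultimately have "U = {}" using open_not_negligible by blast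
    then have "v F z = v ?P z" using v_le[of z] by (auto simp: U_def not_less intro: antisym)
    then have "(\<Sum>k\<in>K. d k z) = 0" using vd[of z] z by simp
    then have "d k z = 0" using K k d0 by (simp add: sum_nonneg_eq_0_iff)
    moreover have "(norm (?r z))\<^sup>2 - (norm z)\<^sup>2 \<noteq> 0" using c z by (simp add: norm_hreflect[OF e])
    ultimately show ?thesis using z by (simp add: d_def min_def split: if_splits)
  qed
  have dec: "F k z' \<le> F k z" if lt: "norm z < norm z'" and k: "k \<in> K" for z z' k
  proof -
    \<comment> \<open>The hyperplane is the perpendicular bisector of \<open>z\<close> and
      \<open>z'\<close>. Its offset \<open>c\<close> is positive because \<open>z\<close> has the
      smaller norm.\<close>
    define L where "L = norm (z' - z)"
    define e where "e = (1 / L) *\<^sub>R (z' - z)"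
    define c where "c = ((z + z') \<bullet> e) / 2"
    have L: "L > 0" using lt by (auto simp: L_def)
    have e: "norm e = 1" using L by (simp add: e_def L_def)
    have d: "(z' - z) \<bullet> e = L"
      using L by (simp add: e_def flip: power2_norm_eq_inner) (simp add: L_def power2_eq_square)
    have "c = ((norm z')\<^sup>2 - (norm z)\<^sup>2) / (2 * L)"
      unfolding c_def e_def power2_norm_eq_inner using L
      by (simp add: inner_add_left inner_diff_right inner_commute[of z' z] diff_divide_distrib add_divide_distrib)
    moreover have "(norm z)\<^sup>2 < (norm z')\<^sup>2" using lt by (simp add: power_strict_mono)
    ultimately have c: "0 < c" using L by simp
    have cz: "c - z \<bullet> e = L / 2" using d by (simp add: c_def inner_add_left inner_diff_left)
    have "hreflect e c z = z + L *\<^sub>R e" using cz by (simp add: hreflect_def)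
    also have "\<dots> = z'" using L by (simp add: e_def)
    finally have "hreflect e c z = z'" .
    moreover have "z \<bullet> e < c" using cz L by simp
    ultimately show ?thesis using fixed[OF e c _ k, of z] by simp
  qed
  have le: "F k z' \<le> F k z" if eq: "norm z = norm z'" and k: "k \<in> K" for z z' k
  proof (cases "z = 0")
    case False
    \<comment> \<open>The bisector of two points of equal norm passes through the origin, so
      \<open>fixed\<close> does not apply to it. Shrinking \<open>z\<close> by a factor
      \<open>1 - s\<close> makes the norms differ, at a Lipschitz cost that vanishes with
      \<open>s\<close>.\<close>
    have s: "F k z' - F k z \<le> A * norm z * s" if "0 < s" "s \<le> 1" for s
    proof -
      have "norm ((1 - s) *\<^sub>R z) < norm z'" using that False by (simp add: eq[symmetric])
      then have "F k z' \<le> F k ((1 - s) *\<^sub>R z)" using dec k by blast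
      moreover have "F k ((1 - s) *\<^sub>R z) - F k z \<le> A * dist ((1 - s) *\<^sub>R z) z"
        using admD(2)[OF F k, of "(1 - s) *\<^sub>R z" z] by linarith
      moreover have "dist ((1 - s) *\<^sub>R z) z = s * norm z"
        using that by (simp add: dist_norm algebra_simps)
      ultimately show ?thesis by (simp add: mult_ac)
    qed
    have "((\<lambda>s. A * norm z * s) \<longlongrightarrow> A * norm z * 0) (at_right 0)"
      by (intro tendsto_intros)
    moreover have "\<forall>\<^sub>F s in at_right 0. F k z' - F k z \<le> A * norm z * s"
      using eventually_at_right_less[of 0] eventually_at_rightI[of 0 1 "\<lambda>s. s < (1::real)"]
      by (auto elim!: eventually_elim2 intro!: s)
    ultimately have "F k z' - F k z \<le> A * norm z * 0"
      by (intro tendsto_lowerbound) auto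
    then show ?thesis by simp
  qed (use eq in simp)
  show ?thesis using F le by (metis antisym)
qed

end

section \<open>Smooth functions\<close>

lemma C_k_SucI:
  fixes f :: "'a::euclidean_space \<Rightarrow> real"
  assumes "\<And>x. (f has_derivative f' x) (at x)" "\<And>b. b \<in> Basis \<Longrightarrow> C_k k (\<lambda>x. f' x b)"
  shows "C_k (Suc k) f"
proof -
  have "frechet_derivative f (at x) = f' x" for x
    using frechet_derivative_at[OF assms(1)] by simp
  then show ?thesis
    using assms by (auto simp: differentiable_on_def differentiable_def)
qed

lemma C_k_Suc_has_derivative:
  "C_k (Suc k) f \<Longrightarrow> (f has_derivative frechet_derivative f (at x)) (at x)"
  by (simp add: differentiable_on_def flip: frechet_derivative_works)

lemma C_k_SucD: "C_k (Suc k) f \<Longrightarrow> C_k k f"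
proof (induction k arbitrary: f)
  case 0
  then show ?case by (simp add: differentiable_imp_continuous_on)
qed auto

lemma C_k_continuous: "C_k k f \<Longrightarrow> continuous_on UNIV f"
  by (cases k) (auto simp: differentiable_imp_continuous_on)

lemma C_k_const [simp]: "C_k k (\<lambda>x. c)"
proof (induction k arbitrary: c)
  case (Suc k)
  show ?case by (rule C_k_SucI[of _ "\<lambda>_ _. 0"]) (auto simp: Suc)
qed simp

lemma C_k_inner_left [simp]: "C_k k (\<lambda>x::'a::euclidean_space. x \<bullet> a)"
proof (cases k)
  case (Suc j)
  show ?thesis unfolding Suc
    by (rule C_k_SucI[of _ "\<lambda>_ y. y \<bullet> a"]) (auto intro!: derivative_eq_intros)
qed (auto intro!: continuous_intros)

lemma C_k_add: "C_k k f \<Longrightarrow> C_k k g \<Longrightarrow> C_k k (\<lambda>x. f x + g x)"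
proof (induction k arbitrary: f g)
  case (Suc k)
  show ?case
    by (rule C_k_SucI[of _ "\<lambda>x y. frechet_derivative f (at x) y + frechet_derivative g (at x) y"])
      (use Suc in \<open>auto intro!: has_derivative_add C_k_Suc_has_derivative\<close>)
qed (auto intro!: continuous_intros)

lemma C_k_mult: "C_k k f \<Longrightarrow> C_k k g \<Longrightarrow> C_k k (\<lambda>x. f x * g x)"
proof (induction k arbitrary: f g)
  case (Suc k)
  show ?case
  proof (rule C_k_SucI)
    show "((\<lambda>x. f x * g x) has_derivative (\<lambda>y. f x * frechet_derivative g (at x) y + frechet_derivative f (at x) y * g x)) (at x)" for x
      by (intro has_derivative_mult C_k_Suc_has_derivative[OF Suc.prems(1)] C_k_Suc_has_derivative[OF Suc.prems(2)])
    show "C_k k (\<lambda>x. f x * frechet_derivative g (at x) b + frechet_derivative f (at x) b * g x)" if "b \<in> Basis" for b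
      using that Suc.prems C_k_SucD[OF Suc.prems(1)] C_k_SucD[OF Suc.prems(2)]
      by (intro C_k_add Suc.IH) auto
  qed
qed (auto intro!: continuous_intros)

lemma C_k_sum: "(\<And>i. i \<in> I \<Longrightarrow> C_k k (f i)) \<Longrightarrow> C_k k (\<lambda>x. \<Sum>i\<in>I. f i x)"
  by (induction I rule: infinite_finite_induct) (auto intro: C_k_add)

lemma C_k_prod: "(\<And>i. i \<in> I \<Longrightarrow> C_k k (f i)) \<Longrightarrow> C_k k (\<lambda>x. \<Prod>i\<in>I. f i x)"
  by (induction I rule: infinite_finite_induct) (auto intro: C_k_mult)

lemma C_k_power: "C_k k f \<Longrightarrow> C_k k (\<lambda>x. f x ^ n)"
  by (induction n) (auto intro: C_k_mult)

lemma C_k_minus: "C_k k f \<Longrightarrow> C_k k (\<lambda>x. - f x)"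
  using C_k_mult[OF C_k_const[of k "-1"], of f] by simp

lemma C_k_diff: "C_k k f \<Longrightarrow> C_k k g \<Longrightarrow> C_k k (\<lambda>x. f x - g x)"
  using C_k_add[of k f "\<lambda>x. - g x"] C_k_minus[of k g] by simp

lemma has_derivative_basis_sum:
  fixes f :: "'a::euclidean_space \<Rightarrow> real"
  assumes "(f has_derivative f') F"
  shows "f' y = (\<Sum>b\<in>Basis. (y \<bullet> b) * f' b)"
proof -
  interpret linear f' using assms by (rule has_derivative_linear)
  have "f' y = f' (\<Sum>b\<in>Basis. (y \<bullet> b) *\<^sub>R b)" by (simp add: euclidean_representation)
  also have "\<dots> = (\<Sum>b\<in>Basis. (y \<bullet> b) * f' b)" by (simp add: sum scale)
  finally show ?thesis .
qed

text \<open>The direction \<open>A b\<close> is in general not a basis vector of the target, so the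
  derivative along it is expanded in the basis before the induction hypothesis applies.\<close>

lemma C_k_compose_affine:
  fixes f :: "'b::euclidean_space \<Rightarrow> real" and A :: "'a::euclidean_space \<Rightarrow> 'b"
  assumes A: "bounded_linear A"
  shows "C_k k f \<Longrightarrow> C_k k (\<lambda>x. f (A x + c))"
proof (induction k arbitrary: f)
  case 0
  have "continuous_on UNIV (\<lambda>x. A x + c)"
    by (intro continuous_intros linear_continuous_on A)
  then show ?case using 0 by (auto intro: continuous_on_compose2)
next
  case (Suc k)
  let ?D = "\<lambda>p. frechet_derivative f (at p)"
  show ?case
  proof (rule C_k_SucI)
    show d: "((\<lambda>x. f (A x + c)) has_derivative (\<lambda>y. ?D (A x + c) (A y))) (at x)" for x
      by (rule has_derivative_compose[of "\<lambda>x. A x + c" A, OF _ C_k_Suc_has_derivative[OF Suc.prems]])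
        (auto intro!: derivative_eq_intros bounded_linear_imp_has_derivative A)
    fix b :: 'a assume "b \<in> Basis"
    have "?D (A x + c) (A b) = (\<Sum>i\<in>Basis. (A b \<bullet> i) * ?D (A x + c) i)" for x
      by (rule has_derivative_basis_sum[OF C_k_Suc_has_derivative[OF Suc.prems]])
    then show "C_k k (\<lambda>x. ?D (A x + c) (A b))"
      using Suc by (auto intro!: C_k_sum C_k_mult)
  qed
qed

text \<open>All orders of smoothness are asked of \<phi> because the induction replaces \<phi> by
  its derivative.\<close>

lemma C_k_compose_real:
  fixes \<phi> :: "real \<Rightarrow> real" and f :: "'a::euclidean_space \<Rightarrow> real"
  shows "(\<And>j. C_k j \<phi>) \<Longrightarrow> C_k k f \<Longrightarrow> C_k k (\<lambda>x. \<phi> (f x))"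
proof (induction k arbitrary: \<phi>)
  case 0
  then show ?case using C_k_continuous[of 0 \<phi>] by (auto intro: continuous_on_compose2)
next
  case (Suc k)
  let ?d = "\<lambda>t. frechet_derivative \<phi> (at t) 1"
  have d: "C_k j ?d" for j using Suc.prems(1)[of "Suc j"] by auto
  show ?case
  proof (rule C_k_SucI)
    fix x
    have e: "frechet_derivative \<phi> (at t) y = y * ?d t" for t y
      using has_derivative_basis_sum[OF C_k_Suc_has_derivative[OF Suc.prems(1)[of "Suc 0"]], of t y] by simp
    have "((\<lambda>x. \<phi> (f x)) has_derivative (\<lambda>y. frechet_derivative \<phi> (at (f x)) (frechet_derivative f (at x) y))) (at x)"
      by (rule has_derivative_compose[OF C_k_Suc_has_derivative[OF Suc.prems(2)] C_k_Suc_has_derivative[OF Suc.prems(1)[of "Suc 0"]]])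
    then show "((\<lambda>x. \<phi> (f x)) has_derivative (\<lambda>y. frechet_derivative f (at x) y * ?d (f x))) (at x)"
      by (subst (asm) e)
  next
    fix b :: 'a assume "b \<in> Basis"
    then show "C_k k (\<lambda>x. frechet_derivative f (at x) b * ?d (f x))"
      using Suc.IH[OF d] Suc.prems(2) C_k_SucD by (intro C_k_mult) auto
  qed
qed

lemma C_k_real_SucI:
  fixes f :: "real \<Rightarrow> real"
  assumes "\<And>x. (f has_real_derivative f' x) (at x)" "C_k k f'"
  shows "C_k (Suc k) f"
  by (rule C_k_SucI[of _ "\<lambda>x y. f' x * y"]) (use assms in \<open>auto simp: has_field_derivative_def\<close>)

lemma C_k_sin_cos: "C_k k (sin :: real \<Rightarrow> real) \<and> C_k k (cos :: real \<Rightarrow> real)"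
proof (induction k)
  case (Suc k)
  have "C_k (Suc k) (sin :: real \<Rightarrow> real)" "C_k (Suc k) (cos :: real \<Rightarrow> real)"
    by (rule C_k_real_SucI[of _ cos] C_k_real_SucI[of _ "\<lambda>x. - sin x"];
        use Suc in \<open>auto intro!: derivative_eq_intros C_k_minus\<close>)+
  then show ?case by simp
qed (auto intro!: continuous_intros)

text \<open>The flat functions \<open>p(1/t) exp(-1/t)\<close> are closed under differentiation, so
  \<open>exp(-1/t)\<close> extended by zero is smooth.\<close>

definition flat :: "real poly \<Rightarrow> real \<Rightarrow> real" where
  "flat p t = (if t > 0 then poly p (1 / t) * exp (- (1 / t)) else 0)"

lemma poly_exp_tendsto_0: "((\<lambda>s. poly p s * exp (- s)) \<longlongrightarrow> 0) (at_top :: real filter)"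
proof -
  have "((\<lambda>s. \<Sum>i\<le>degree p. coeff p i * (s ^ i / exp s)) \<longlongrightarrow> (\<Sum>i\<le>degree p. coeff p i * 0)) at_top"
    by (intro tendsto_intros tendsto_power_div_exp_0)
  then show ?thesis
    by (simp add: poly_altdef sum_divide_distrib exp_minus divide_inverse[symmetric])
qed

lemma flat_tendsto_0: "(flat p \<longlongrightarrow> 0) (at 0)"
proof -
  have "((\<lambda>t. poly p (1 / t) * exp (- (1 / t))) \<longlongrightarrow> 0) (at_right 0)"
    using filterlim_compose[OF poly_exp_tendsto_0[of p] filterlim_inverse_at_top_right]
    by (simp add: inverse_eq_divide)
  then have "(flat p \<longlongrightarrow> 0) (at_right 0)"
    by (rule Lim_transform_eventually) (auto simp: flat_def eventually_at_filter)
  moreover have "(flat p \<longlongrightarrow> 0) (at_left 0)"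
    by (rule Lim_transform_eventually[OF tendsto_const]) (auto simp: flat_def eventually_at_filter)
  ultimately show ?thesis by (simp add: filterlim_split_at)
qed

text \<open>The new polynomial comes from the derivative -1/t^2 of 1/t: it produces the factor of
  degree 2, with \<open>p\<close> from the exponential and \<open>- pderiv p\<close> from the
  polynomial.\<close>

lemma flat_has_derivative:
  "(flat p has_real_derivative flat (monom 1 2 * (p - pderiv p)) t) (at t)"
proof -
  consider "t < 0" | "t = 0" | "t > 0" by linarith
  then show ?thesis
  proof cases
    case 1
    have "((\<lambda>_. 0) has_real_derivative 0) (at t)" by simp
    then show ?thesis
      using 1 by (subst DERIV_cong_ev[OF refl, of _ "\<lambda>_. 0"]) (auto simp: flat_def eventually_nhds_top intro!: eventually_mono[OF eventually_gt_at_top] exI[of _ "{..<0}"] simp: eventually_nhds)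
  next
    case 2
    \<comment> \<open>Dividing by \<open>h\<close> multiplies the polynomial in 1/h by its variable,
      so the difference quotient at 0 is again a flat function and tends to 0.\<close>
    have "((\<lambda>h. flat p h / h) \<longlongrightarrow> 0) (at 0)"
    proof (rule Lim_transform_eventually[OF flat_tendsto_0[of "monom 1 1 * p"]])
      show "\<forall>\<^sub>F h in at 0. flat (monom 1 1 * p) h = flat p h / h"
        by (auto simp: eventually_at_filter flat_def poly_monom)
    qed
    then show ?thesis using 2 by (simp add: DERIV_def flat_def)
  next
    case 3
    have "((\<lambda>t. poly p (1 / t) * exp (- (1 / t))) has_real_derivative flat (monom 1 2 * (p - pderiv p)) t) (at t)"
      using 3 by (auto intro!: derivative_eq_intros simp: flat_def poly_monom power2_eq_square field_simps)
    then show ?thesis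
      using 3 by (subst DERIV_cong_ev[OF refl, of _ "\<lambda>t. poly p (1 / t) * exp (- (1 / t))"])
        (auto simp: flat_def eventually_nhds intro!: exI[of _ "{0<..}"])
  qed
qed

lemma C_k_flat: "C_k k (flat p)"
proof (induction k arbitrary: p)
  case 0
  have "isCont (flat p) t" for t using flat_has_derivative DERIV_isCont by blast
  then show ?case by (simp add: continuous_on_eq_continuous_at)
next
  case (Suc k)
  show ?case by (rule C_k_real_SucI[OF flat_has_derivative Suc])
qed

text \<open>Composing with the squared norm instead of the norm keeps the function smooth at the
  origin.\<close>

definition bump :: "real \<Rightarrow> 'a::euclidean_space \<Rightarrow> real" where
  "bump r z = flat 1 (r\<^sup>2 - (norm z)\<^sup>2)"

lemma bump_nonneg: "0 \<le> bump r z" and bump_le_1: "bump r z \<le> 1"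
  and bump_pos: "0 \<le> r \<Longrightarrow> norm z < r \<Longrightarrow> 0 < bump r z"
  and bump_eq_0: "0 \<le> r \<Longrightarrow> r \<le> norm z \<Longrightarrow> bump r z = 0"
  by (auto simp: bump_def flat_def power_mono power_strict_mono not_less)

lemma C_k_norm_square: "C_k k (\<lambda>z::'a::euclidean_space. (norm z)\<^sup>2)"
proof -
  have "(\<lambda>z::'a. (norm z)\<^sup>2) = (\<lambda>z. \<Sum>b\<in>Basis. (z \<bullet> b) * (z \<bullet> b))"
    by (simp add: power2_norm_eq_inner euclidean_inner[symmetric] fun_eq_iff)
  then show ?thesis by (auto intro!: C_k_sum C_k_mult)
qed

lemma C_k_bump: "C_k k (bump r)"
  unfolding bump_def[abs_def]
  by (rule C_k_compose_real[OF C_k_flat]) (intro C_k_diff C_k_const C_k_norm_square)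

section \<open>Mollification\<close>

lemma integral_lborel_minus:
  fixes f :: "'a::euclidean_space \<Rightarrow> real"
  shows "(LINT x|lborel. f (a - x)) = (LINT x|lborel. f x)"
proof (cases "f \<in> borel_measurable borel")
  case True
  note [measurable] = True
  have e: "lborel = distr lborel borel (\<lambda>x::'a. a - x)"
    using lborel_affine[of "-1" a] by (simp add: density_1)
  have "(LINT x|lborel. f x) = (LINT x|distr lborel borel (\<lambda>x. a - x). f x)"
    using e by simp
  also have "\<dots> = (LINT x|lborel. f (a - x))"
    by (subst integral_distr) auto
  finally show ?thesis by simp
next
  \<comment> \<open>Without measurability neither function is integrable, and both integrals are 0
    by convention.\<close>
  case False
  have "(\<lambda>x. f (a - x)) \<notin> borel_measurable borel"
  proof
    assume [measurable]: "(\<lambda>x. f (a - x)) \<in> borel_measurable borel"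
    have "(\<lambda>x. f (a - (a - x))) \<in> borel_measurable borel" by measurable
    then show False using False by simp
  qed
  then show ?thesis
    using False borel_measurable_integrable[of lborel f] borel_measurable_integrable[of lborel "\<lambda>x. f (a - x)"]
    by (subst (1 2) not_integrable_integral_eq) auto
qed

lemma integral_lborel_orthogonal:
  fixes f :: "'a::euclidean_space \<Rightarrow> real" and T :: "'a \<Rightarrow> 'a"
  assumes T: "orthogonal_transformation T" and [measurable]: "f \<in> borel_measurable borel"
  shows "(LINT x|lborel. f (T x)) = (LINT x|lborel. f x)"
proof -
  have [measurable]: "T \<in> borel_measurable borel"
    using T by (intro borel_measurable_continuous_onI)
      (simp add: orthogonal_transformation_def linear_continuous_on linear_linear)
  show ?thesis
    by (subst (2) lborel_distr_orthogonal[OF T, symmetric]) (simp add: integral_distr)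
qed

text \<open>For distinct points of equal norm the perpendicular bisector passes through the origin,
  so the reflection in it is linear and maps one point to the other.\<close>

lemma ex_orthogonal_norm_eq:
  fixes z z' :: "'a::euclidean_space"
  assumes "norm z = norm z'"
  shows "\<exists>T. orthogonal_transformation T \<and> T z = z'"
proof (cases "z = z'")
  case True
  then show ?thesis by (intro exI[of _ id]) (auto simp: orthogonal_transformation_def linear_id)
next
  case False
  define L where "L = norm (z' - z)"
  define e where "e = (1 / L) *\<^sub>R (z' - z)"
  have L: "L > 0" using False by (auto simp: L_def)
  have e: "norm e = 1" using L by (simp add: e_def L_def)
  have L2: "L\<^sup>2 = z' \<bullet> z' - 2 * (z \<bullet> z') + z \<bullet> z"
    by (simp add: L_def power2_norm_eq_inner inner_diff_left inner_diff_right inner_commute)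
  have "z' \<bullet> z' = z \<bullet> z" using assms by (simp flip: power2_norm_eq_inner)
  then have "- 2 * (z \<bullet> e) = L"
    using L L2 by (simp add: e_def inner_diff_right field_simps power2_eq_square)
  then have "hreflect e 0 z = z + L *\<^sub>R e" by (simp add: hreflect_def)
  also have "\<dots> = z'" using L by (simp add: e_def)
  finally show ?thesis using orthogonal_transformation_hreflect[OF e] by blast
qed

lemma integrable_continuous_compact_support:
  fixes f :: "'a::euclidean_space \<Rightarrow> real"
  assumes "continuous_on UNIV f" "\<And>z. norm z > R \<Longrightarrow> f z = 0"
  shows "integrable lborel f"
proof -
  have "integrable lborel (\<lambda>x. indicator (cball 0 R) x *\<^sub>R f x)"
    by (rule borel_integrable_compact) (auto intro: continuous_on_subset[OF assms(1)])
  moreover have "(\<lambda>x. indicator (cball 0 R) x *\<^sub>R f x) = f"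
    using assms(2) by (force simp: indicator_def)
  ultimately show ?thesis by simp
qed

definition conv :: "('a::euclidean_space \<Rightarrow> real) \<Rightarrow> ('a \<Rightarrow> real) \<Rightarrow> 'a \<Rightarrow> real" where
  "conv \<eta> F z = (LINT y|lborel. \<eta> (z - y) * F y)"

lemma conv_commute: "conv \<eta> F z = (LINT y|lborel. \<eta> y * F (z - y))"
  unfolding conv_def by (subst integral_lborel_minus[of _ z, symmetric]) simp

text \<open>The support of \<open>F\<close> alone confines the integral to a fixed box, on which
  differentiation under the integral sign is available whatever the support of the kernel.\<close>

lemma conv_eq_integral:
  fixes F :: "'a::euclidean_space \<Rightarrow> real"
  assumes "continuous_on UNIV \<eta>" "continuous_on UNIV F" "\<And>z. norm z > R \<Longrightarrow> F z = 0"
    and ab: "cball 0 R \<subseteq> cbox a b"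
  shows "conv \<eta> F z = integral (cbox a b) (\<lambda>t. \<eta> (z - t) * F t)"
proof -
  let ?f = "\<lambda>t. \<eta> (z - t) * F t"
  have c: "continuous_on UNIV ?f"
    by (intro continuous_intros assms(2) continuous_on_compose2[OF assms(1)]) auto
  then have "set_integrable lborel (cbox a b) ?f"
    unfolding set_integrable_def by (intro borel_integrable_compact) (auto intro: continuous_on_subset)
  then have "(LINT t:cbox a b|lborel. ?f t) = integral (cbox a b) ?f"
    by (rule set_borel_integral_eq_integral)
  moreover have "(\<lambda>t. indicator (cbox a b) t *\<^sub>R ?f t) = ?f"
  proof
    fix t show "indicator (cbox a b) t *\<^sub>R ?f t = ?f t"
      using ab assms(3)[of t] by (cases "norm t \<le> R") (auto simp: indicator_def subset_eq)
  qed
  ultimately show ?thesis by (simp add: conv_def set_lebesgue_integral_def)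
qed

text \<open>All derivatives fall on the kernel, so \<open>F\<close> only has to be continuous. The
  partial derivatives are convolutions with kernels of the same kind, which makes smoothness of
  every order an induction.\<close>

lemma conv_has_derivative:
  fixes F :: "'a::euclidean_space \<Rightarrow> real"
  assumes \<eta>: "\<And>k. C_k k \<eta>" and F: "continuous_on UNIV F" "\<And>z. norm z > R \<Longrightarrow> F z = 0"
  shows "(conv \<eta> F has_derivative (\<lambda>y. \<Sum>b\<in>Basis. (y \<bullet> b) * conv (\<lambda>p. frechet_derivative \<eta> (at p) b) F x)) (at x)"
proof -
  let ?D = "\<lambda>b p. frechet_derivative \<eta> (at p) b"
  obtain a b where ab: "cball (0::'a) R \<subseteq> cbox a b"
    using bounded_subset_cbox_symmetric[OF bounded_cball] by blast
  have D: "(\<eta> has_derivative frechet_derivative \<eta> (at p)) (at p)" for p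
    using C_k_Suc_has_derivative[OF \<eta>[of "Suc 0"]] .
  have Dc: "C_k k (?D i)" if "i \<in> Basis" for i k using \<eta>[of "Suc k"] that by simp
  have Dcont: "continuous_on UNIV (?D i)" if "i \<in> Basis" for i
    using C_k_continuous[OF Dc[OF that]] .
  \<comment> \<open>The rule for parameter integrals wants the derivative as a jointly continuous
    map into bounded linear functionals; building it from the basis reduces its continuity to that
    of the partial derivatives.\<close>
  define fx :: "'a \<Rightarrow> 'a \<Rightarrow> 'a \<Rightarrow>\<^sub>L real" where
    "fx x t = (\<Sum>i\<in>Basis. (?D i (x - t) * F t) *\<^sub>R blinfun_inner_left i)" for x t
  have fx: "blinfun_apply (fx x t) = (\<lambda>y. frechet_derivative \<eta> (at (x - t)) y * F t)" for x t
  proof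
    fix y
    show "blinfun_apply (fx x t) y = frechet_derivative \<eta> (at (x - t)) y * F t"
      using has_derivative_basis_sum[OF D[of "x - t"], of y]
      by (simp add: fx_def blinfun.bilinear_simps sum_distrib_left sum_distrib_right mult_ac)
  qed
  have cont: "continuous_on (UNIV \<times> cbox a b) (\<lambda>(x, t). fx x t)"
    unfolding fx_def split_beta
    by (intro continuous_intros continuous_on_compose2[OF Dcont] continuous_on_compose2[OF F(1)]) auto
  have "((\<lambda>x. integral (cbox a b) (\<lambda>t. \<eta> (x - t) * F t)) has_derivative integral (cbox a b) (fx x)) (at x within UNIV)"
  proof (rule leibniz_rule[OF _ _ cont])
    fix x t
    have "((\<lambda>x. \<eta> (x - t)) has_derivative frechet_derivative \<eta> (at (x - t))) (at x)"
      by (rule has_derivative_compose[of "\<lambda>x. x - t" "\<lambda>x. x", OF _ D]) (auto intro!: derivative_eq_intros)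
    then show "((\<lambda>x. \<eta> (x - t) * F t) has_derivative blinfun_apply (fx x t)) (at x within UNIV)"
      unfolding fx by (auto intro: has_derivative_mult_left)
    show "(\<lambda>t. \<eta> (x - t) * F t) integrable_on cbox a b"
      by (intro integrable_continuous continuous_intros continuous_on_compose2[OF C_k_continuous[OF \<eta>]] continuous_on_subset[OF F(1)]) auto
  qed auto
  moreover have "(\<lambda>x. integral (cbox a b) (\<lambda>t. \<eta> (x - t) * F t)) = conv \<eta> F"
    using conv_eq_integral[OF C_k_continuous[OF \<eta>] F ab] by auto
  moreover have "blinfun_apply (integral (cbox a b) (fx x)) = (\<lambda>y. \<Sum>i\<in>Basis. (y \<bullet> i) * conv (?D i) F x)"
  proof
    fix y
    show "blinfun_apply (integral (cbox a b) (fx x)) y = (\<Sum>i\<in>Basis. (y \<bullet> i) * conv (?D i) F x)"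
  proof -
    have p: "continuous_on (cbox a b) (\<lambda>t. (x, t))" by (intro continuous_intros)
    have i: "fx x integrable_on cbox a b"
      using continuous_on_compose2[OF cont p] by (intro integrable_continuous) auto
    have c: "(\<lambda>t. ?D i (x - t) * F t) integrable_on cbox a b" if "i \<in> Basis" for i
      by (intro integrable_continuous continuous_intros continuous_on_compose2[OF Dcont[OF that]] continuous_on_subset[OF F(1)]) auto
    have "blinfun_apply (integral (cbox a b) (fx x)) y = integral (cbox a b) (\<lambda>t. blinfun_apply (fx x t) y)"
      by (rule blinfun_apply_integral[OF i])
    also have "\<dots> = integral (cbox a b) (\<lambda>t. \<Sum>i\<in>Basis. (y \<bullet> i) * (?D i (x - t) * F t))"
    proof -
      have "blinfun_apply (fx x t) y = (\<Sum>i\<in>Basis. (y \<bullet> i) * (?D i (x - t) * F t))" for t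
        using has_derivative_basis_sum[OF D[of "x - t"], of y] by (simp add: fx sum_distrib_left sum_distrib_right mult_ac)
      then show ?thesis by simp
    qed
    also have "\<dots> = (\<Sum>i\<in>Basis. (y \<bullet> i) * integral (cbox a b) (\<lambda>t. ?D i (x - t) * F t))"
      by (subst integral_sum) (auto intro!: c integrable_on_mult_right)
    finally show ?thesis
      using conv_eq_integral[OF Dcont F ab] by simp
  qed
  qed
  ultimately show ?thesis by simp
qed

lemma C_k_conv:
  fixes F :: "'a::euclidean_space \<Rightarrow> real"
  assumes \<eta>: "\<And>k. C_k k \<eta>" and F: "continuous_on UNIV F" "\<And>z. norm z > R \<Longrightarrow> F z = 0"
  shows "C_k k (conv \<eta> F)"
  using \<eta>
proof (induction k arbitrary: \<eta>)
  case 0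
  show ?case
    using conv_has_derivative[OF 0 F]
    by (simp add: continuous_on_eq_continuous_at) (meson has_derivative_continuous)
next
  case (Suc k)
  show ?case
  proof (rule C_k_SucI[OF conv_has_derivative[OF Suc.prems F]])
    fix b :: 'a assume b: "b \<in> Basis"
    have "(\<Sum>i\<in>Basis. (b \<bullet> i) * g i) = g b" for g :: "'a \<Rightarrow> real"
    proof -
      have "(\<Sum>i\<in>Basis. (b \<bullet> i) * g i) = (\<Sum>i\<in>Basis. if i = b then g i else 0)"
        using b by (intro sum.cong) (auto simp: inner_Basis)
      then show ?thesis using b by simp
    qed
    moreover have "C_k j (\<lambda>p. frechet_derivative \<eta> (at p) b)" for j
      using Suc.prems[of "Suc j"] b by simp
    ultimately show "C_k k (\<lambda>x. \<Sum>i\<in>Basis. (b \<bullet> i) * conv (\<lambda>p. frechet_derivative \<eta> (at p) i) F x)"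
      using Suc.IH by simp
  qed
qed

text \<open>Substitute an orthogonal map that takes \<open>z\<close> to \<open>z'\<close>: the
  measure, the kernel and \<open>F\<close> are all invariant under it.\<close>

lemma conv_radial:
  assumes \<eta>: "\<And>z z'. norm z = norm z' \<Longrightarrow> \<eta> z = \<eta> z'" and F: "\<And>z z'. norm z = norm z' \<Longrightarrow> F z = F z'"
    and [measurable]: "\<eta> \<in> borel_measurable borel" "F \<in> borel_measurable borel"
    and eq: "norm z = norm z'"
  shows "conv \<eta> F z = conv \<eta> F z'"
proof -
  obtain T where T: "orthogonal_transformation T" "T z = z'"
    using ex_orthogonal_norm_eq[OF eq] by blast
  have n: "norm (T y) = norm y" for y using T(1) by (auto simp: orthogonal_transformation)
  have "norm (z' - T y) = norm (z - y)" for y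
    using n[of "z - y"] T by (simp add: orthogonal_transformation_def linear_diff)
  then have "\<eta> (z - y) * F y = \<eta> (z' - T y) * F (T y)" for y
    using \<eta> F n by metis
  then have "conv \<eta> F z = (LINT y|lborel. \<eta> (z' - T y) * F (T y))" by (simp add: conv_def)
  also have "\<dots> = conv \<eta> F z'"
    unfolding conv_def by (rule integral_lborel_orthogonal[OF T(1)]) measurable
  finally show ?thesis .
qed

definition mollifier :: "real \<Rightarrow> 'a::euclidean_space \<Rightarrow> real" where
  "mollifier \<delta> z = bump \<delta> z / (LINT y|lborel. bump \<delta> (y::'a))"

lemma open_null_empty:
  fixes U :: "'a::euclidean_space set"
  assumes "open U" "U \<in> null_sets lborel"
  shows "U = {}"
  using assms open_not_negligible[of U] by (auto simp: negligible_iff_null_sets null_sets_completionI)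

lemma
  fixes z z' :: "'a::euclidean_space"
  assumes \<delta>: "0 < \<delta>"
  shows integrable_mollifier: "integrable lborel (mollifier \<delta> :: 'a \<Rightarrow> real)"
    and integral_mollifier: "(LINT y|lborel. mollifier \<delta> (y::'a)) = 1"
    and mollifier_nonneg: "0 \<le> mollifier \<delta> z"
    and mollifier_eq_0: "\<delta> \<le> norm z \<Longrightarrow> mollifier \<delta> z = 0"
    and C_k_mollifier: "C_k k (mollifier \<delta> :: 'a \<Rightarrow> real)"
    and mollifier_radial: "norm z = norm z' \<Longrightarrow> mollifier \<delta> z = mollifier \<delta> z'"
proof -
  let ?b = "bump \<delta> :: 'a \<Rightarrow> real"
  have i: "integrable lborel ?b"
    by (rule integrable_continuous_compact_support[OF C_k_continuous[OF C_k_bump], of \<delta>])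
      (use \<delta> in \<open>auto intro: bump_eq_0\<close>)
  have "(LINT y|lborel. ?b y) \<noteq> 0"
  proof
    assume "(LINT y|lborel. ?b y) = 0"
    then have "AE y in lborel. ?b y = 0"
      using integral_nonneg_eq_0_iff_AE[OF i] bump_nonneg by blast
    then have "AE y in lborel. y \<notin> ball (0::'a) \<delta>"
      by eventually_elim (use \<delta> bump_pos[of \<delta>] in fastforce)
    then have "ball (0::'a) \<delta> \<in> null_sets lborel" by (subst (asm) AE_iff_null) (auto simp: ball_def)
    then show False using open_null_empty[OF open_ball] \<delta> by (metis ball_eq_empty not_le)
  qed
  then have pos: "0 < (LINT y|lborel. ?b y)"
    using Bochner_Integration.integral_nonneg[of lborel ?b, OF bump_nonneg] by (simp add: less_le)
  show "integrable lborel (mollifier \<delta> :: 'a \<Rightarrow> real)"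
    unfolding mollifier_def[abs_def] using i by simp
  show "(LINT y|lborel. mollifier \<delta> (y::'a)) = 1"
    unfolding mollifier_def[abs_def] using pos by simp
  show "0 \<le> mollifier \<delta> z" unfolding mollifier_def using pos bump_nonneg by (intro divide_nonneg_pos)
  show "\<delta> \<le> norm z \<Longrightarrow> mollifier \<delta> z = 0" using \<delta> by (simp add: mollifier_def bump_eq_0)
  show "C_k k (mollifier \<delta> :: 'a \<Rightarrow> real)"
    unfolding mollifier_def[abs_def] divide_inverse by (intro C_k_mult C_k_bump C_k_const)
  show "norm z = norm z' \<Longrightarrow> mollifier \<delta> z = mollifier \<delta> z'" by (simp add: mollifier_def bump_def)
qed

lemma conv_mollifier_close:
  fixes F :: "'a::euclidean_space \<Rightarrow> real"
  assumes \<delta>: "0 < \<delta>" and F: "\<And>z z'. \<bar>F z - F z'\<bar> \<le> A * dist z z'" and A: "0 \<le> A"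
  shows "\<bar>conv (mollifier \<delta>) F z - F z\<bar> \<le> A * \<delta>"
proof -
  let ?m = "mollifier \<delta> :: 'a \<Rightarrow> real"
  have c: "continuous_on UNIV F"
    using F A by (intro lipschitz_on_continuous_on[of A] lipschitz_onI) (auto simp: dist_real_def)
  have i1: "integrable lborel (\<lambda>y. ?m y * F (z - y))"
    by (rule integrable_continuous_compact_support[of _ \<delta>])
      (auto intro!: continuous_intros C_k_continuous[OF C_k_mollifier[OF \<delta>]] continuous_on_compose2[OF c] simp: mollifier_eq_0[OF \<delta>])
  have i2: "integrable lborel (\<lambda>y. ?m y * F z)" using integrable_mollifier[OF \<delta>, where 'a='a] by simp
  have "conv ?m F z - F z = (LINT y|lborel. ?m y * F (z - y)) - (LINT y|lborel. ?m y * F z)"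
    by (simp add: conv_commute integral_mollifier[OF \<delta>, where 'a='a])
  also have "\<dots> = (LINT y|lborel. ?m y * (F (z - y) - F z))"
    using i1 i2 by (simp add: right_diff_distrib)
  finally have e: "conv ?m F z - F z = (LINT y|lborel. ?m y * (F (z - y) - F z))" .
  have "\<bar>LINT y|lborel. ?m y * (F (z - y) - F z)\<bar> \<le> (LINT y|lborel. ?m y * (A * \<delta>))"
  proof (rule integral_abs_bound_integral)
    show "integrable lborel (\<lambda>y. ?m y * (F (z - y) - F z))"
      using i1 i2 by (simp add: right_diff_distrib)
    show "integrable lborel (\<lambda>y. ?m y * (A * \<delta>))" using integrable_mollifier[OF \<delta>, where 'a='a] by simp
    fix y :: 'a
    show "\<bar>?m y * (F (z - y) - F z)\<bar> \<le> ?m y * (A * \<delta>)"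
    proof (cases "norm y < \<delta>")
      case True
      have "\<bar>F (z - y) - F z\<bar> \<le> A * norm y" using F[of "z - y" z] by (simp add: dist_norm)
      also have "\<dots> \<le> A * \<delta>" using True A by (intro mult_left_mono) auto
      finally show ?thesis using mollifier_nonneg[OF \<delta>, of y] by (simp add: abs_mult mult_left_mono)
    qed (simp add: mollifier_eq_0[OF \<delta>])
  qed
  then show ?thesis using e by (simp add: integral_mollifier[OF \<delta>, where 'a='a])
qed

lemma conv_mollifier_support:
  assumes \<delta>: "0 < \<delta>" and F: "\<And>z. norm z > R \<Longrightarrow> F z = 0" and z: "norm z > R + \<delta>"
  shows "conv (mollifier \<delta>) F z = 0"
proof -
  have "mollifier \<delta> (z - y) * F y = 0" for y
  proof (cases "norm y > R")
    case False
    then have "\<delta> \<le> norm (z - y)" using z norm_triangle_ineq2[of z y] by linarith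
    then show ?thesis by (simp add: mollifier_eq_0[OF \<delta>])
  qed (simp add: F)
  then have "(\<lambda>y. mollifier \<delta> (z - y) * F y) = (\<lambda>_. 0)" by blast
  then show ?thesis by (simp only: conv_def) simp
qed

text \<open>The variance of \<open>g\<close> under the probability density \<eta> is
  nonnegative.\<close>

lemma weighted_jensen_square:
  fixes \<eta> g :: "'a::euclidean_space \<Rightarrow> real"
  assumes "\<And>y. 0 \<le> \<eta> y" "(LINT y|lborel. \<eta> y) = 1" "integrable lborel \<eta>"
    "integrable lborel (\<lambda>y. \<eta> y * g y)" "integrable lborel (\<lambda>y. \<eta> y * (g y)\<^sup>2)"
  shows "(LINT y|lborel. \<eta> y * g y)\<^sup>2 \<le> (LINT y|lborel. \<eta> y * (g y)\<^sup>2)"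
proof -
  define c where "c = (LINT y|lborel. \<eta> y * g y)"
  have "0 \<le> (LINT y|lborel. \<eta> y * (g y - c)\<^sup>2)" using assms(1) by (intro Bochner_Integration.integral_nonneg) auto
  also have "(\<lambda>y. \<eta> y * (g y - c)\<^sup>2) = (\<lambda>y. \<eta> y * (g y)\<^sup>2 - (2 * c) * (\<eta> y * g y) + c\<^sup>2 * \<eta> y)"
    by (simp add: fun_eq_iff power2_eq_square algebra_simps)
  also have "(LINT y|lborel. \<eta> y * (g y)\<^sup>2 - (2 * c) * (\<eta> y * g y) + c\<^sup>2 * \<eta> y) = (LINT y|lborel. \<eta> y * (g y)\<^sup>2) - 2 * c * c + c\<^sup>2 * 1"
    unfolding assms(2)[symmetric] c_def using assms(3-5) by simp
  finally show ?thesis by (simp add: c_def power2_eq_square)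
qed

text \<open>The convolution is an average of translates of \<open>F\<close> of total mass 1.
  Jensen's inequality moves the square inside the average, and every translate has the same
  difference energy.\<close>

lemma diff_energy_conv:
  fixes F :: "'a::euclidean_space \<Rightarrow> real"
  assumes \<delta>: "0 < \<delta>" and F: "continuous_on UNIV F"
  shows "diff_energy h (conv (mollifier \<delta>) F) \<le> diff_energy h F"
proof -
  let ?m = "mollifier \<delta> :: 'a \<Rightarrow> real" and ?k = "\<lambda>z z'. indicator {..<h} (dist z z') :: ennreal"
  have mc: "continuous_on UNIV ?m" using C_k_continuous[OF C_k_mollifier[OF \<delta>]] .
  have [measurable]: "?m \<in> borel_measurable borel" "F \<in> borel_measurable borel"
    using mc F by (auto intro: borel_measurable_continuous_onI)
  have J: "ennreal ((conv ?m F z - conv ?m F z')\<^sup>2) \<le> (\<integral>\<^sup>+y. ennreal (?m y) * ennreal ((F (z - y) - F (z' - y))\<^sup>2) \<partial>lborel)" for z z'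
  proof -
    have i: "integrable lborel (\<lambda>y. ?m y * g y)" if "continuous_on UNIV g" for g
      by (rule integrable_continuous_compact_support[of _ \<delta>])
        (auto intro!: continuous_intros mc that simp: mollifier_eq_0[OF \<delta>])
    have c: "continuous_on UNIV (\<lambda>y. F (z - y))" for z
      by (intro continuous_on_compose2[OF F] continuous_intros) auto
    have "conv ?m F z - conv ?m F z' = (LINT y|lborel. ?m y * (F (z - y) - F (z' - y)))"
      using i[OF c[of z]] i[OF c[of z']] by (simp add: conv_commute right_diff_distrib)
    then have "(conv ?m F z - conv ?m F z')\<^sup>2 \<le> (LINT y|lborel. ?m y * (F (z - y) - F (z' - y))\<^sup>2)"
      by (simp only:) (intro weighted_jensen_square i c continuous_intros mollifier_nonneg[OF \<delta>] integral_mollifier[OF \<delta>] integrable_mollifier[OF \<delta>])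
    also have "ennreal \<dots> = (\<integral>\<^sup>+y. ennreal (?m y * (F (z - y) - F (z' - y))\<^sup>2) \<partial>lborel)"
      by (intro nn_integral_eq_integral[symmetric] i continuous_intros c) (simp add: mollifier_nonneg[OF \<delta>])
    finally show ?thesis by (simp add: ennreal_mult mollifier_nonneg[OF \<delta>] ennreal_leI)
  qed
  have "diff_energy h (conv ?m F) \<le> (\<integral>\<^sup>+z. \<integral>\<^sup>+z'. ?k z z' * (\<integral>\<^sup>+y. ennreal (?m y) * ennreal ((F (z - y) - F (z' - y))\<^sup>2) \<partial>lborel) \<partial>lborel \<partial>lborel)"
    unfolding diff_energy_def by (intro nn_integral_mono mult_left_mono J) auto
  also have "\<dots> = (\<integral>\<^sup>+z. \<integral>\<^sup>+z'. \<integral>\<^sup>+y. ennreal (?m y) * (?k z z' * ennreal ((F (z - y) - F (z' - y))\<^sup>2)) \<partial>lborel \<partial>lborel \<partial>lborel)"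
    by (intro nn_integral_cong) (simp add: nn_integral_cmult[symmetric] mult_ac)
  also have "\<dots> = (\<integral>\<^sup>+z. \<integral>\<^sup>+y. \<integral>\<^sup>+z'. ennreal (?m y) * (?k z z' * ennreal ((F (z - y) - F (z' - y))\<^sup>2)) \<partial>lborel \<partial>lborel \<partial>lborel)"
    by (intro nn_integral_cong lborel_pair.Fubini') measurable
  also have "\<dots> = (\<integral>\<^sup>+y. \<integral>\<^sup>+z. \<integral>\<^sup>+z'. ennreal (?m y) * (?k z z' * ennreal ((F (z - y) - F (z' - y))\<^sup>2)) \<partial>lborel \<partial>lborel \<partial>lborel)"
    by (intro lborel_pair.Fubini') measurable
  also have "\<dots> = (\<integral>\<^sup>+y. ennreal (?m y) * diff_energy h F \<partial>lborel)"
  proof (intro nn_integral_cong)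
    fix y
    have "(\<integral>\<^sup>+z. \<integral>\<^sup>+z'. ennreal (?m y) * (?k z z' * ennreal ((F (z - y) - F (z' - y))\<^sup>2)) \<partial>lborel \<partial>lborel)
        = ennreal (?m y) * (\<integral>\<^sup>+z. \<integral>\<^sup>+z'. ?k z z' * ennreal ((F (z - y) - F (z' - y))\<^sup>2) \<partial>lborel \<partial>lborel)"
      by (simp add: nn_integral_cmult)
    also have "(\<integral>\<^sup>+z. \<integral>\<^sup>+z'. ?k z z' * ennreal ((F (z - y) - F (z' - y))\<^sup>2) \<partial>lborel \<partial>lborel)
        = (\<integral>\<^sup>+z. \<integral>\<^sup>+z'. ?k (y + z) (y + z') * ennreal ((F z - F z')\<^sup>2) \<partial>lborel \<partial>lborel)"
    proof -
      have "(\<integral>\<^sup>+z'. ?k z z' * ennreal ((F (z - y) - F (z' - y))\<^sup>2) \<partial>lborel)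
          = (\<integral>\<^sup>+z'. ?k z (y + z') * ennreal ((F (z - y) - F z')\<^sup>2) \<partial>lborel)" for z
        using nn_integral_lborel_plus[of "\<lambda>z'. ?k z z' * ennreal ((F (z - y) - F (z' - y))\<^sup>2)" y] by simp
      moreover have "(\<integral>\<^sup>+z. (\<integral>\<^sup>+z'. ?k z (y + z') * ennreal ((F (z - y) - F z')\<^sup>2) \<partial>lborel) \<partial>lborel)
          = (\<integral>\<^sup>+z. \<integral>\<^sup>+z'. ?k (y + z) (y + z') * ennreal ((F z - F z')\<^sup>2) \<partial>lborel \<partial>lborel)"
        using nn_integral_lborel_plus[of "\<lambda>z. \<integral>\<^sup>+z'. ?k z (y + z') * ennreal ((F (z - y) - F z')\<^sup>2) \<partial>lborel" y] by simp
      ultimately show ?thesis by simp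
    qed
    finally show "(\<integral>\<^sup>+z. \<integral>\<^sup>+z'. ennreal (?m y) * (?k z z' * ennreal ((F (z - y) - F (z' - y))\<^sup>2)) \<partial>lborel \<partial>lborel)
        = ennreal (?m y) * diff_energy h F"
      by (simp add: diff_energy_def)
  qed
  also have "\<dots> = (\<integral>\<^sup>+y. ennreal (?m y) \<partial>lborel) * diff_energy h F"
    by (simp add: nn_integral_multc)
  also have "(\<integral>\<^sup>+y. ennreal (?m y) \<partial>lborel) = 1"
    using integrable_mollifier[OF \<delta>] mollifier_nonneg[OF \<delta>] integral_mollifier[OF \<delta>, where 'a='a]
    by (subst nn_integral_eq_integral) auto
  finally show ?thesis by simp
qed

section \<open>Difference quotients and the Dirichlet integral\<close>

text \<open>The choice of the basis vector is immaterial by rotation invariance.\<close>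

definition second_moment :: "'a::euclidean_space itself \<Rightarrow> real \<Rightarrow> ennreal" where
  "second_moment _ h = (\<integral>\<^sup>+y. indicator {..<h} (norm y) * ennreal ((y \<bullet> (SOME b::'a. b \<in> Basis))\<^sup>2) \<partial>lborel)"

text \<open>A rotation takes \<open>a\<close> to a multiple of the basis vector chosen in
  \<open>second_moment\<close>, and the ball is invariant.\<close>

lemma nn_integral_ball_inner_square:
  fixes a :: "'a::euclidean_space"
  shows "(\<integral>\<^sup>+y. indicator {..<h} (norm y) * ennreal ((a \<bullet> y)\<^sup>2) \<partial>lborel) = ennreal ((norm a)\<^sup>2) * second_moment TYPE('a) h"
proof -
  define b where "b = (SOME b::'a. b \<in> Basis)"
  have b: "norm b = 1"
    unfolding b_def using someI_ex[of "\<lambda>b::'a. b \<in> Basis"] nonempty_Basis by auto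
  obtain T where T: "orthogonal_transformation T" "T a = norm a *\<^sub>R b"
    using ex_orthogonal_norm_eq[of a "norm a *\<^sub>R b"] b by auto
  have n: "norm (T y) = norm y" and i: "T x \<bullet> T y = x \<bullet> y" for x y
    using T(1) orthogonal_transformation_norm by (auto simp: orthogonal_transformation_def norm_eq_sqrt_inner)
  have "a \<bullet> y = norm a * (T y \<bullet> b)" for y
    using i[of a y] T(2) by (simp add: inner_commute)
  then have "(\<integral>\<^sup>+y. indicator {..<h} (norm y) * ennreal ((a \<bullet> y)\<^sup>2) \<partial>lborel)
     = (\<integral>\<^sup>+y. ennreal ((norm a)\<^sup>2) * (indicator {..<h} (norm (T y)) * ennreal ((T y \<bullet> b)\<^sup>2)) \<partial>lborel)"
    by (intro nn_integral_cong) (simp add: n power_mult_distrib ennreal_mult indicator_def)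
  also have "\<dots> = (\<integral>\<^sup>+y. ennreal ((norm a)\<^sup>2) * (indicator {..<h} (norm y) * ennreal ((y \<bullet> b)\<^sup>2)) \<partial>lborel)"
    by (rule nn_integral_lborel_orthogonal[OF T(1)]) measurable
  also have "\<dots> = ennreal ((norm a)\<^sup>2) * second_moment TYPE('a) h"
    unfolding second_moment_def b_def[symmetric] by (rule nn_integral_cmult) measurable
  finally show ?thesis .
qed

lemma nn_integral_ball_norm_square:
  "(\<integral>\<^sup>+y. indicator {..<h} (norm (y::'a::euclidean_space)) * ennreal ((norm y)\<^sup>2) \<partial>lborel) = of_nat DIM('a) * second_moment TYPE('a) h"
proof -
  have e: "ennreal ((norm y)\<^sup>2) = (\<Sum>b\<in>Basis. ennreal ((b \<bullet> y)\<^sup>2))" for y :: 'a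
  proof -
    have "(norm y)\<^sup>2 = (\<Sum>b\<in>Basis. (b \<bullet> y)\<^sup>2)"
      unfolding power2_norm_eq_inner
      by (subst euclidean_inner, rule sum.cong) (simp_all only: power2_eq_square inner_commute)
    then show ?thesis by (simp add: sum_ennreal)
  qed
  have "(\<integral>\<^sup>+y. indicator {..<h} (norm (y::'a::euclidean_space)) * ennreal ((norm y)\<^sup>2) \<partial>lborel)
      = (\<integral>\<^sup>+y. (\<Sum>b\<in>Basis. indicator {..<h} (norm (y::'a)) * ennreal ((b \<bullet> y)\<^sup>2)) \<partial>lborel)"
    unfolding e sum_distrib_left ..
  also have "\<dots> = (\<Sum>b\<in>Basis. \<integral>\<^sup>+y. indicator {..<h} (norm (y::'a)) * ennreal ((b \<bullet> y)\<^sup>2) \<partial>lborel)"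
    by (rule nn_integral_sum) measurable
  also have "\<dots> = (\<Sum>b\<in>(Basis::'a set). second_moment TYPE('a) h)"
    by (intro sum.cong) (simp_all add: nn_integral_ball_inner_square)
  finally show ?thesis by simp
qed

lemma second_moment_finite: "second_moment TYPE('a::euclidean_space) h < \<infinity>"
proof -
  let ?b = "SOME b::'a. b \<in> Basis"
  have b: "norm ?b = 1"
    using someI_ex[of "\<lambda>b::'a. b \<in> Basis"] nonempty_Basis by auto
  have "second_moment TYPE('a) h \<le> (\<integral>\<^sup>+y. ennreal (h\<^sup>2 * indicator (cball (0::'a) h) y) \<partial>lborel)"
    unfolding second_moment_def
  proof (intro nn_integral_mono)
    fix y :: 'a
    show "indicator {..<h} (norm y) * ennreal ((y \<bullet> ?b)\<^sup>2) \<le> ennreal (h\<^sup>2 * indicator (cball 0 h) y)"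
    proof (cases "norm y < h")
      case True
      have "\<bar>y \<bullet> ?b\<bar> \<le> \<bar>h\<bar>" using Cauchy_Schwarz_ineq2[of y ?b] b True by simp
      then have "(y \<bullet> ?b)\<^sup>2 \<le> h\<^sup>2" by (rule abs_le_square_iff[THEN iffD1])
      then show ?thesis using True by (simp add: ennreal_leI)
    qed simp
  qed
  also have "\<dots> < \<infinity>" by (rule nn_integral_const_cball)
  finally show ?thesis .
qed

lemma second_moment_pos:
  assumes "0 < h"
  shows "second_moment TYPE('a::euclidean_space) h \<noteq> 0"
proof
  define b where "b = (SOME b::'a. b \<in> Basis)"
  let ?b = b
  have b: "norm b = 1"
    unfolding b_def using someI_ex[of "\<lambda>b::'a. b \<in> Basis"] nonempty_Basis by auto
  have m: "(\<lambda>y. indicator {..<h} (norm y) * ennreal ((y \<bullet> b)\<^sup>2)) \<in> borel_measurable lborel"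
    by measurable
  define U where "U = {y::'a. norm y < h \<and> y \<bullet> ?b \<noteq> 0}"
  have "open U" unfolding U_def
    by (intro open_Collect_conj open_Collect_less open_Collect_neq continuous_intros)
  assume "second_moment TYPE('a) h = 0"
  then have "AE y in lborel. indicator {..<h} (norm y) * ennreal ((y \<bullet> ?b)\<^sup>2) = 0"
    unfolding second_moment_def b_def[symmetric] using nn_integral_0_iff_AE[OF m] by simp
  then have "AE y in lborel. y \<notin> U"
    by eventually_elim (auto simp: U_def indicator_def)
  then have "U \<in> null_sets lborel" using \<open>open U\<close> by (subst (asm) AE_iff_null) auto
  then have "U = {}" using open_null_empty[OF \<open>open U\<close>] by simp
  moreover have "(h / 2) *\<^sub>R ?b \<in> U"
    using assms b by (simp add: U_def flip: power2_norm_eq_inner)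
  ultimately show False by simp
qed

lemma diff_energy_eq:
  fixes f :: "'a::euclidean_space \<Rightarrow> real"
  assumes [measurable]: "f \<in> borel_measurable borel"
  shows "diff_energy h f = (\<integral>\<^sup>+y. indicator {..<h} (norm y) * (\<integral>\<^sup>+z. ennreal ((f (z + y) - f z)\<^sup>2) \<partial>lborel) \<partial>lborel)"
proof -
  have "diff_energy h f = (\<integral>\<^sup>+z. \<integral>\<^sup>+y. indicator {..<h} (dist z (z + y)) * ennreal ((f z - f (z + y))\<^sup>2) \<partial>lborel \<partial>lborel)"
    unfolding diff_energy_def
    by (intro nn_integral_cong nn_integral_lborel_plus[symmetric]) measurable
  also have "\<dots> = (\<integral>\<^sup>+z. \<integral>\<^sup>+y. indicator {..<h} (norm y) * ennreal ((f (z + y) - f z)\<^sup>2) \<partial>lborel \<partial>lborel)"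
    by (intro nn_integral_cong) (simp add: dist_norm indicator_def power2_commute)
  also have "\<dots> = (\<integral>\<^sup>+y. \<integral>\<^sup>+z. indicator {..<h} (norm y) * ennreal ((f (z + y) - f z)\<^sup>2) \<partial>lborel \<partial>lborel)"
    by (intro lborel_pair.Fubini') measurable
  also have "\<dots> = (\<integral>\<^sup>+y. indicator {..<h} (norm y) * (\<integral>\<^sup>+z. ennreal ((f (z + y) - f z)\<^sup>2) \<partial>lborel) \<partial>lborel)"
    by (intro nn_integral_cong nn_integral_cmult) measurable
  finally show ?thesis .
qed

text \<open>Cauchy-Schwarz on the unit interval, obtained by integrating the square of
  \<open>g' t - d\<close>, where \<open>d\<close> is the mean of \<open>g'\<close>.\<close>

lemma square_increment_le:
  fixes g :: "real \<Rightarrow> real"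
  assumes g: "\<And>t. (g has_real_derivative g' t) (at t)" and c: "continuous_on UNIV g'"
  shows "ennreal ((g 1 - g 0)\<^sup>2) \<le> (\<integral>\<^sup>+t. indicator {0..1} t * ennreal ((g' t)\<^sup>2) \<partial>lborel)"
proof -
  define d where "d = g 1 - g 0"
  have "(g' has_integral (g 1 - g 0)) {0..1}"
    by (rule fundamental_theorem_of_calculus)
      (use g in \<open>auto simp: has_real_derivative_iff_has_vector_derivative[symmetric] intro: has_field_derivative_at_within\<close>)
  then have i: "(g' has_integral d) {0..1}" by (simp add: d_def)
  have sq: "(\<lambda>t. (g' t)\<^sup>2) integrable_on {0..1}"
    by (intro integrable_continuous_interval continuous_intros continuous_on_subset[OF c]) auto
  then obtain I where I: "((\<lambda>t. (g' t)\<^sup>2) has_integral I) {0..1}" by auto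
  have "((\<lambda>t. (g' t)\<^sup>2 - (2 * d) * g' t + d\<^sup>2) has_integral (I - (2 * d) * d + d\<^sup>2 * (1 - 0))) {0..1}"
    using has_integral_const_real[of "d\<^sup>2" 0 1]
    by (intro has_integral_add has_integral_diff has_integral_mult_right I i) (simp add: mult.commute)
  moreover have "0 \<le> (g' t)\<^sup>2 - (2 * d) * g' t + d\<^sup>2" for t
    using zero_le_power2[of "g' t - d"] by (simp add: power2_eq_square algebra_simps)
  ultimately have "0 \<le> I - (2 * d) * d + d\<^sup>2 * (1 - 0)"
    using has_integral_nonneg by blast
  then have "d\<^sup>2 \<le> I" by (simp add: power2_eq_square)
  moreover have "(\<integral>\<^sup>+t. ennreal ((g' t)\<^sup>2) * indicator {0..1} t \<partial>lborel) = ennreal I"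
    by (rule nn_integral_has_integral_lebesgue'[OF _ I]) auto
  ultimately show ?thesis by (simp add: d_def mult.commute ennreal_leI)
qed

text \<open>The increment is integrated along the segment from \<open>p\<close> to
  \<open>p + y\<close>. The weight is constant in the direction \<open>y\<close>, so translation
  invariance makes the contribution of every \<open>t\<close> the same.\<close>

lemma nn_integral_increment_le:
  fixes u \<omega> :: "'a::euclidean_space \<Rightarrow> real"
  assumes u: "\<And>p. (u has_derivative D p) (at p)" and c: "continuous_on UNIV (\<lambda>p. D p y)"
    and [measurable]: "\<omega> \<in> borel_measurable borel" and \<omega>: "\<And>p. 0 \<le> \<omega> p" "\<And>p t. \<omega> (p + t *\<^sub>R y) = \<omega> p"
  shows "(\<integral>\<^sup>+p. ennreal (\<omega> p * (u (p + y) - u p)\<^sup>2) \<partial>lborel) \<le> (\<integral>\<^sup>+p. ennreal (\<omega> p * (D p y)\<^sup>2) \<partial>lborel)"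
proof -
  have [measurable]: "(\<lambda>p. D p y) \<in> borel_measurable borel"
    using c by (rule borel_measurable_continuous_onI)
  have "continuous_on UNIV u"
    using u by (meson continuous_at_imp_continuous_on has_derivative_continuous)
  then have [measurable]: "u \<in> borel_measurable borel" by (rule borel_measurable_continuous_onI)
  have pt: "ennreal ((u (p + y) - u p)\<^sup>2) \<le> (\<integral>\<^sup>+t. indicator {0..1} t * ennreal ((D (p + t *\<^sub>R y) y)\<^sup>2) \<partial>lborel)" for p
  proof -
    have "((\<lambda>t. u (p + t *\<^sub>R y)) has_real_derivative D (p + t *\<^sub>R y) y) (at t)" for t
    proof -
      have "((\<lambda>t. u (p + t *\<^sub>R y)) has_derivative (\<lambda>s. D (p + t *\<^sub>R y) (s *\<^sub>R y))) (at t)"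
        by (rule has_derivative_compose[OF _ u]) (auto intro!: derivative_eq_intros)
      moreover have "D (p + t *\<^sub>R y) (s *\<^sub>R y) = D (p + t *\<^sub>R y) y * s" for s
        using linear_scale[OF has_derivative_linear[OF u]] by simp
      ultimately show ?thesis by (simp add: has_field_derivative_def)
    qed
    moreover have "continuous_on UNIV (\<lambda>t. D (p + t *\<^sub>R y) y)"
      by (intro continuous_on_compose2[OF c] continuous_intros) auto
    ultimately show ?thesis
      using square_increment_le[of "\<lambda>t. u (p + t *\<^sub>R y)" "\<lambda>t. D (p + t *\<^sub>R y) y"] by simp
  qed
  have "(\<integral>\<^sup>+p. ennreal (\<omega> p * (u (p + y) - u p)\<^sup>2) \<partial>lborel)
     \<le> (\<integral>\<^sup>+p. ennreal (\<omega> p) * (\<integral>\<^sup>+t. indicator {0..1} t * ennreal ((D (p + t *\<^sub>R y) y)\<^sup>2) \<partial>lborel) \<partial>lborel)"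
    using pt by (intro nn_integral_mono) (simp add: ennreal_mult \<omega> mult_left_mono)
  also have "\<dots> = (\<integral>\<^sup>+p. \<integral>\<^sup>+t. ennreal (\<omega> p) * (indicator {0..1} t * ennreal ((D (p + t *\<^sub>R y) y)\<^sup>2)) \<partial>lborel \<partial>lborel)"
    by (intro nn_integral_cong nn_integral_cmult[symmetric]) measurable
  also have "\<dots> = (\<integral>\<^sup>+t. \<integral>\<^sup>+p. ennreal (\<omega> p) * (indicator {0..1} t * ennreal ((D (p + t *\<^sub>R y) y)\<^sup>2)) \<partial>lborel \<partial>lborel)"
    by (intro lborel_pair.Fubini') measurable
  also have "\<dots> = (\<integral>\<^sup>+t. indicator {0..1::real} t * (\<integral>\<^sup>+p. ennreal (\<omega> p * (D p y)\<^sup>2) \<partial>lborel) \<partial>lborel)"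
  proof (intro nn_integral_cong)
    fix t :: real
    have "(\<integral>\<^sup>+p. ennreal (\<omega> p) * (indicator {0..1} t * ennreal ((D (p + t *\<^sub>R y) y)\<^sup>2)) \<partial>lborel)
       = (\<integral>\<^sup>+p. indicator {0..1} t * ennreal (\<omega> (p + t *\<^sub>R y) * (D (p + t *\<^sub>R y) y)\<^sup>2) \<partial>lborel)"
      by (intro nn_integral_cong) (simp add: \<omega> ennreal_mult mult_ac)
    also have "\<dots> = indicator {0..1} t * (\<integral>\<^sup>+p. ennreal (\<omega> (t *\<^sub>R y + p) * (D (t *\<^sub>R y + p) y)\<^sup>2) \<partial>lborel)"
      by (subst nn_integral_cmult) (auto simp: add.commute)
    also have "(\<integral>\<^sup>+p. ennreal (\<omega> (t *\<^sub>R y + p) * (D (t *\<^sub>R y + p) y)\<^sup>2) \<partial>lborel) = (\<integral>\<^sup>+p. ennreal (\<omega> p * (D p y)\<^sup>2) \<partial>lborel)"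
      by (rule nn_integral_lborel_plus) measurable
    finally show "(\<integral>\<^sup>+p. ennreal (\<omega> p) * (indicator {0..1} t * ennreal ((D (p + t *\<^sub>R y) y)\<^sup>2)) \<partial>lborel)
       = indicator {0..1} t * (\<integral>\<^sup>+p. ennreal (\<omega> p * (D p y)\<^sup>2) \<partial>lborel)" .
  qed
  also have "\<dots> = (\<integral>\<^sup>+p. ennreal (\<omega> p * (D p y)\<^sup>2) \<partial>lborel)"
    by (subst nn_integral_multc) auto
  finally show ?thesis .
qed

text \<open>A gradient on an arbitrary Euclidean space, in particular on the product, where the two
  partial gradients of a function appear as its components.\<close>

definition grad :: "('a::euclidean_space \<Rightarrow> real) \<Rightarrow> 'a \<Rightarrow> 'a" where
  "grad f z = (\<Sum>b\<in>Basis. frechet_derivative f (at z) b *\<^sub>R b)"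

lemma C_k_grad:
  assumes "C_k (Suc 0) f"
  shows "(f has_derivative (\<lambda>y. grad f z \<bullet> y)) (at z)" "continuous_on UNIV (grad f)"
proof -
  have "frechet_derivative f (at z) = (\<lambda>y. grad f z \<bullet> y)"
  proof
    fix y
    show "frechet_derivative f (at z) y = grad f z \<bullet> y"
      using has_derivative_basis_sum[OF C_k_Suc_has_derivative[OF assms, of z], of y]
      by (simp add: grad_def inner_sum_left inner_commute[of y] mult.commute)
  qed
  then show "(f has_derivative (\<lambda>y. grad f z \<bullet> y)) (at z)"
    using C_k_Suc_has_derivative[OF assms, of z] by simp
  show "continuous_on UNIV (grad f)"
    unfolding grad_def[abs_def] using assms by (intro continuous_intros) auto
qed

lemma grad_eq_0_outside:
  assumes "C_k (Suc 0) f" "\<And>z. norm z > R \<Longrightarrow> f z = 0" "norm z > R"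
  shows "grad f z = 0"
proof -
  have "((\<lambda>_. 0) has_derivative (\<lambda>y. grad f z \<bullet> y)) (at z)"
  proof (rule has_derivative_transform_eventually[OF C_k_grad(1)[OF assms(1)]])
    have "\<forall>\<^sub>F w in nhds z. w \<in> {w. R < norm w}"
      using assms(3) by (intro eventually_nhds_in_open open_Collect_less continuous_intros) simp
    then show "\<forall>\<^sub>F w in at z. f w = 0"
      using assms(2) by (auto elim!: eventually_mono simp: eventually_at_filter)
    show "f z = 0" using assms by simp
  qed simp
  then have "(\<lambda>y. grad f z \<bullet> y) = (\<lambda>_. 0)"
    using has_derivative_unique[OF _ has_derivative_const] by blast
  then have "grad f z \<bullet> grad f z = 0" by meson
  then show ?thesis by simp
qed

text \<open>Mean value inequality for \<open>G\<close> minus its linear part at \<open>z\<close>,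
  with the uniform continuity of the gradient on a ball. The indicator makes the error integrable in
  \<open>z\<close>.\<close>

lemma grad_increment_uniform:
  fixes G :: "'a::euclidean_space \<Rightarrow> real"
  assumes G: "C_k (Suc 0) G" and supp: "\<And>z. norm z > R \<Longrightarrow> G z = 0" and \<epsilon>: "0 < \<epsilon>"
  shows "\<exists>h0>0. \<forall>y z. norm y < h0 \<longrightarrow> \<bar>G (z + y) - G z - grad G z \<bullet> y\<bar> \<le> \<epsilon> * norm y * indicator (cball 0 (R + 1)) z"
proof -
  have "uniformly_continuous_on (cball 0 (R + 2)) (grad G)"
    by (intro compact_uniformly_continuous continuous_on_subset[OF C_k_grad(2)[OF G]]) auto
  then obtain d where d: "d > 0"
    "\<And>z w. z \<in> cball 0 (R + 2) \<Longrightarrow> w \<in> cball 0 (R + 2) \<Longrightarrow> dist w z < d \<Longrightarrow> dist (grad G w) (grad G z) < \<epsilon>"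
    using \<epsilon> unfolding uniformly_continuous_on_def by metis
  show ?thesis
  \<comment> \<open>Since \<open>y\<close> has norm less than 1, \<open>z + y\<close> stays outside
    the support when \<open>z\<close> has norm above \<open>R + 1\<close>; otherwise the points
    involved lie in the ball of radius \<open>R + 2\<close>.\<close>
  proof (intro exI[of _ "min d 1"] conjI allI impI)
    show "0 < min d 1" using d by simp
    fix y z :: 'a assume y: "norm y < min d 1"
    show "\<bar>G (z + y) - G z - grad G z \<bullet> y\<bar> \<le> \<epsilon> * norm y * indicator (cball 0 (R + 1)) z"
    proof (cases "norm z \<le> R + 1")
      case False
      have "norm (z + y) > R" using False y norm_triangle_ineq2[of z "- y"] by simp
      then show ?thesis using False supp grad_eq_0_outside[OF G supp, where z=z] by simp
    next
      case True
      define \<phi> where "\<phi> w = G w - grad G z \<bullet> w" for w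
      have "norm (\<phi> (z + y) - \<phi> z) \<le> \<epsilon> * norm (z + y - z)"
      proof (rule differentiable_bound[of "ball z (min d 1)" \<phi> "\<lambda>w y. grad G w \<bullet> y - grad G z \<bullet> y"])
        fix w assume w: "w \<in> ball z (min d 1)"
        show "(\<phi> has_derivative (\<lambda>y. grad G w \<bullet> y - grad G z \<bullet> y)) (at w within ball z (min d 1))"
          unfolding \<phi>_def
          by (intro has_derivative_diff has_derivative_at_withinI[OF C_k_grad(1)[OF G]] has_derivative_inner_right has_derivative_ident)
        have "norm w \<le> R + 2" using w True norm_triangle_ineq2[of w z] by (simp add: dist_norm norm_minus_commute)
        then have "dist (grad G w) (grad G z) < \<epsilon>" using w True by (intro d(2)) (auto simp: dist_commute)
        then have "norm (grad G w - grad G z) \<le> \<epsilon>" by (simp add: dist_norm)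
        moreover have "onorm (\<lambda>y. grad G w \<bullet> y - grad G z \<bullet> y) \<le> norm (grad G w - grad G z)"
          by (rule onorm_le) (simp add: Cauchy_Schwarz_ineq2 flip: inner_diff_left)
        ultimately show "onorm (\<lambda>y. grad G w \<bullet> y - grad G z \<bullet> y) \<le> \<epsilon>" by simp
      qed (use y d in \<open>auto simp: dist_norm\<close>)
      then show ?thesis using True by (simp add: \<phi>_def inner_add_right algebra_simps)
    qed
  qed
qed

text \<open>For small \<open>h\<close> the increment of \<open>G k\<close> is its linear part up to
  a relative error \<open>s\<close>, and the average of the squared linear part over the ball of
  radius \<open>h\<close> is the squared gradient times \<open>second_moment\<close>. Dividing by
  this positive finite factor and letting \<open>s\<close> tend to 0 leaves the constant
  \<open>A\<close> unchanged.\<close>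

lemma nn_integral_grad_square_le:
  fixes G :: "'k \<Rightarrow> 'a::euclidean_space \<Rightarrow> real"
  assumes K: "finite K" and G: "\<And>k. k \<in> K \<Longrightarrow> C_k (Suc 0) (G k)"
    and supp: "\<And>k z. k \<in> K \<Longrightarrow> norm z > R \<Longrightarrow> G k z = 0" and A: "0 \<le> A"
    and le: "\<And>h. 0 < h \<Longrightarrow> (\<Sum>k\<in>K. diff_energy h (G k)) \<le> ennreal A * second_moment TYPE('a) h"
  shows "(\<Sum>k\<in>K. \<integral>\<^sup>+z. ennreal ((norm (grad (G k) z))\<^sup>2) \<partial>lborel) \<le> ennreal A"
proof -
  let ?I = "\<Sum>k\<in>K. \<integral>\<^sup>+z. ennreal ((norm (grad (G k) z))\<^sup>2) \<partial>lborel"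
  let ?V = "emeasure lborel (cball (0::'a) (R + 1))"
  define C where "C = real (card K) * measure lborel (cball (0::'a) (R + 1)) * real DIM('a)"
  have C0: "0 \<le> C" by (simp add: C_def)
  have V: "?V = ennreal (measure lborel (cball (0::'a) (R + 1)))"
    using emeasure_bounded_finite[of "cball (0::'a) (R + 1)"] by (intro emeasure_eq_ennreal_measure) auto
  have gm: "grad (G k) \<in> borel_measurable borel" if "k \<in> K" for k
    using C_k_grad(2)[OF G[OF that]] by (rule borel_measurable_continuous_onI)
  have Gm: "G k \<in> borel_measurable borel" if "k \<in> K" for k
    using C_k_continuous[OF G[OF that]] by (rule borel_measurable_continuous_onI)
  \<comment> \<open>The bound is \<open>(1 + s) * A\<close> plus the error
    \<open>(1 + 1 / s) * s\<^sup>2 * C\<close>, and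
    \<open>(1 + 1 / s) * s\<^sup>2 = s * (s + 1)\<close>.\<close>
  have bound: "?I \<le> ennreal (A + s * (A + (s + 1) * C))" if s: "0 < s" for s
  proof -
    have "\<exists>h0>0. \<forall>y z. norm y < h0 \<longrightarrow> \<bar>G k (z + y) - G k z - grad (G k) z \<bullet> y\<bar> \<le> s * norm y * indicator (cball 0 (R + 1)) z" if "k \<in> K" for k
      by (rule grad_increment_uniform[OF G[OF that] supp[OF that] s])
    then obtain h0 where h0: "\<And>k. k \<in> K \<Longrightarrow> 0 < h0 k"
      "\<And>k y z. k \<in> K \<Longrightarrow> norm y < h0 k \<Longrightarrow> \<bar>G k (z + y) - G k z - grad (G k) z \<bullet> y\<bar> \<le> s * norm y * indicator (cball 0 (R + 1)) z"
      by metis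
    \<comment> \<open>One scale for all members; the inserted 1 keeps the minimum meaningful when
      \<open>K\<close> is empty.\<close>
    define h where "h = Min (insert 1 (h0 ` K))"
    have h: "0 < h" "\<And>k. k \<in> K \<Longrightarrow> h \<le> h0 k" using K h0(1) by (auto simp: h_def)
    let ?M = "second_moment TYPE('a) h"
    have one: "?M * (\<integral>\<^sup>+z. ennreal ((norm (grad (G k) z))\<^sup>2) \<partial>lborel)
        \<le> ennreal (1 + s) * diff_energy h (G k) + ennreal ((1 + 1 / s) * s\<^sup>2) * (of_nat DIM('a) * ?M * ?V)" if k: "k \<in> K" for k
    proof -
      note [measurable] = gm[OF k] Gm[OF k]
      have cb [measurable]: "cball (0::'a) (R + 1) \<in> sets borel" by simp
      have ci: "(\<integral>\<^sup>+z. a * (b * indicator (cball (0::'a) (R + 1)) z) \<partial>lborel) = a * (b * ?V)" for a b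
        by (simp add: nn_integral_cmult_indicator flip: mult.assoc)
      have "?M * (\<integral>\<^sup>+z. ennreal ((norm (grad (G k) z))\<^sup>2) \<partial>lborel) = (\<integral>\<^sup>+z. ennreal ((norm (grad (G k) z))\<^sup>2) * ?M \<partial>lborel)"
        by (subst nn_integral_multc) (auto simp: mult.commute)
      also have "\<dots> = (\<integral>\<^sup>+z. \<integral>\<^sup>+y. indicator {..<h} (norm y) * ennreal ((grad (G k) z \<bullet> y)\<^sup>2) \<partial>lborel \<partial>lborel)"
        by (intro nn_integral_cong) (simp add: nn_integral_ball_inner_square)
      also have "\<dots> = (\<integral>\<^sup>+y. \<integral>\<^sup>+z. indicator {..<h} (norm y) * ennreal ((grad (G k) z \<bullet> y)\<^sup>2) \<partial>lborel \<partial>lborel)"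
        by (intro lborel_pair.Fubini') measurable
      also have "\<dots> \<le> (\<integral>\<^sup>+y. indicator {..<h} (norm y) * (ennreal (1 + s) * (\<integral>\<^sup>+z. ennreal ((G k (z + y) - G k z)\<^sup>2) \<partial>lborel)
          + ennreal ((1 + 1 / s) * s\<^sup>2) * (ennreal ((norm y)\<^sup>2) * ?V)) \<partial>lborel)"
      proof (intro nn_integral_mono)
        fix y :: 'a
        show "(\<integral>\<^sup>+z. indicator {..<h} (norm y) * ennreal ((grad (G k) z \<bullet> y)\<^sup>2) \<partial>lborel)
          \<le> indicator {..<h} (norm y) * (ennreal (1 + s) * (\<integral>\<^sup>+z. ennreal ((G k (z + y) - G k z)\<^sup>2) \<partial>lborel)
          + ennreal ((1 + 1 / s) * s\<^sup>2) * (ennreal ((norm y)\<^sup>2) * ?V))"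
        proof (cases "norm y < h")
          case True
          have pt: "ennreal ((grad (G k) z \<bullet> y)\<^sup>2) \<le> ennreal (1 + s) * ennreal ((G k (z + y) - G k z)\<^sup>2)
              + ennreal ((1 + 1 / s) * s\<^sup>2) * (ennreal ((norm y)\<^sup>2) * indicator (cball 0 (R + 1)) z)" for z
          proof -
            let ?a = "grad (G k) z \<bullet> y" and ?b = "G k (z + y) - G k z" and ?i = "indicator (cball 0 (R + 1)) z :: real"
            have "\<bar>?b - ?a\<bar> \<le> s * norm y * ?i" using h0(2)[OF k, of y z] True h(2)[OF k] by simp
            then have "(?b - ?a)\<^sup>2 \<le> (s * norm y * ?i)\<^sup>2" by (intro abs_le_square_iff[THEN iffD1]) auto
            also have "\<dots> = s\<^sup>2 * ((norm y)\<^sup>2 * ?i)" by (auto simp: indicator_def power_mult_distrib)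
            finally have "(1 + 1 / s) * (?b - ?a)\<^sup>2 \<le> (1 + 1 / s) * (s\<^sup>2 * ((norm y)\<^sup>2 * ?i))"
              using s by (intro mult_left_mono) auto
            \<comment> \<open>Young's inequality with parameter \<open>s\<close>, written as the
              nonnegativity of a perfect square.\<close>
            moreover have "?a\<^sup>2 \<le> (1 + s) * ?b\<^sup>2 + (1 + 1 / s) * (?b - ?a)\<^sup>2"
            proof -
              have "0 \<le> (s * ?b + (?b - ?a))\<^sup>2 / s" using s by simp
              also have "\<dots> = (1 + s) * ?b\<^sup>2 + (1 + 1 / s) * (?b - ?a)\<^sup>2 - ?a\<^sup>2"
                using s by (simp add: field_simps power2_eq_square)
              finally show ?thesis by simp
            qed
            ultimately have "?a\<^sup>2 \<le> (1 + s) * ?b\<^sup>2 + ((1 + 1 / s) * s\<^sup>2) * ((norm y)\<^sup>2 * ?i)" by simp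
            then have "ennreal (?a\<^sup>2) \<le> ennreal ((1 + s) * ?b\<^sup>2 + ((1 + 1 / s) * s\<^sup>2) * ((norm y)\<^sup>2 * ?i))"
              by (rule ennreal_leI)
            also have "\<dots> = ennreal (1 + s) * ennreal (?b\<^sup>2) + ennreal ((1 + 1 / s) * s\<^sup>2) * (ennreal ((norm y)\<^sup>2) * indicator (cball 0 (R + 1)) z)"
              using s by (subst ennreal_plus) (auto simp: ennreal_mult'' ennreal_indicator)
            finally show ?thesis .
          qed
          have "(\<integral>\<^sup>+z. indicator {..<h} (norm y) * ennreal ((grad (G k) z \<bullet> y)\<^sup>2) \<partial>lborel)
             \<le> (\<integral>\<^sup>+z. ennreal (1 + s) * ennreal ((G k (z + y) - G k z)\<^sup>2)
              + ennreal ((1 + 1 / s) * s\<^sup>2) * (ennreal ((norm y)\<^sup>2) * indicator (cball 0 (R + 1)) z) \<partial>lborel)"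
            using True pt by (intro nn_integral_mono) simp
          also have "\<dots> = ennreal (1 + s) * (\<integral>\<^sup>+z. ennreal ((G k (z + y) - G k z)\<^sup>2) \<partial>lborel)
              + ennreal ((1 + 1 / s) * s\<^sup>2) * (ennreal ((norm y)\<^sup>2) * ?V)"
            unfolding ci[symmetric] by (subst nn_integral_add) (measurable, simp add: nn_integral_cmult)
          finally show ?thesis using True by simp
        qed simp
      qed
      also have "\<dots> = (\<integral>\<^sup>+y. ennreal (1 + s) * (indicator {..<h} (norm y) * (\<integral>\<^sup>+z. ennreal ((G k (z + y) - G k z)\<^sup>2) \<partial>lborel))
          + ennreal ((1 + 1 / s) * s\<^sup>2) * ?V * (indicator {..<h} (norm y) * ennreal ((norm y)\<^sup>2)) \<partial>lborel)"
        by (intro nn_integral_cong) (simp add: distrib_left mult_ac)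
      also have "\<dots> = ennreal (1 + s) * diff_energy h (G k) + ennreal ((1 + 1 / s) * s\<^sup>2) * ?V * (of_nat DIM('a) * ?M)"
        unfolding diff_energy_eq[OF Gm[OF k]] nn_integral_ball_norm_square[symmetric]
        by (subst nn_integral_add) (auto simp: nn_integral_cmult)
      finally show ?thesis by (simp add: mult_ac)
    qed
    have "?M * ?I \<le> (\<Sum>k\<in>K. ennreal (1 + s) * diff_energy h (G k) + ennreal ((1 + 1 / s) * s\<^sup>2) * (of_nat DIM('a) * ?M * ?V))"
      unfolding sum_distrib_left by (intro sum_mono one)
    also have "\<dots> = ennreal (1 + s) * (\<Sum>k\<in>K. diff_energy h (G k)) + of_nat (card K) * (ennreal ((1 + 1 / s) * s\<^sup>2) * (of_nat DIM('a) * ?M * ?V))"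
      by (simp add: sum.distrib sum_distrib_left)
    also have "\<dots> \<le> ennreal (1 + s) * (ennreal A * ?M) + of_nat (card K) * (ennreal ((1 + 1 / s) * s\<^sup>2) * (of_nat DIM('a) * ?M * ?V))"
      by (intro add_right_mono mult_left_mono le h) auto
    also have "\<dots> = ?M * ennreal (A + s * (A + (s + 1) * C))"
    proof -
      have "ennreal (A + s * (A + (s + 1) * C)) = ennreal ((1 + s) * A + real (card K) * ((1 + 1 / s) * s\<^sup>2 * (real DIM('a) * measure lborel (cball (0::'a) (R + 1)))))"
        using s by (intro arg_cong[where f = ennreal]) (simp add: C_def field_simps power2_eq_square)
      also have "\<dots> = ennreal (1 + s) * ennreal A + of_nat (card K) * (ennreal ((1 + 1 / s) * s\<^sup>2) * (of_nat DIM('a) * ?V))"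
        unfolding V using s A by (subst ennreal_plus) (auto simp: ennreal_mult ennreal_of_nat_eq_real_of_nat)
      finally show ?thesis by (simp add: distrib_left mult_ac)
    qed
    finally show ?thesis
      using second_moment_pos[OF h(1), where 'a='a] second_moment_finite[of h, where 'a='a]
      by (subst (asm) ennreal_mult_le_mult_iff) auto
  qed
  have "((\<lambda>s. ennreal (A + s * (A + (s + 1) * C))) \<longlongrightarrow> ennreal (A + 0 * (A + (0 + 1) * C))) (at_right 0)"
    by (intro tendsto_intros)
  moreover have "\<forall>\<^sub>F s in at_right 0. ?I \<le> ennreal (A + s * (A + (s + 1) * C))"
    using eventually_at_right_less[of 0] by eventually_elim (rule bound)
  ultimately have "?I \<le> ennreal (A + 0 * (A + (0 + 1) * C))"
    by (intro tendsto_lowerbound) auto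
  then show ?thesis by simp
qed

section \<open>Fourier coefficients on a period cell\<close>

definition wave :: "real \<Rightarrow> int^'n \<Rightarrow> real^'n \<Rightarrow> complex" where
  "wave L k x = cis (2 * pi / L * (\<Sum>a\<in>UNIV. real_of_int (k $ a) * x $ a))"

definition cell :: "real \<Rightarrow> (real^'n) set" where
  "cell L = {x. \<forall>a. \<bar>x $ a\<bar> \<le> L / 2}"

lemma wave_add_index: "wave L (k + j) x = wave L k x * wave L j x"
  by (simp add: wave_def cis_mult sum.distrib algebra_simps)

lemma wave_add_arg: "wave L k (x + y) = wave L k x * wave L k y"
  by (simp add: wave_def cis_mult sum.distrib algebra_simps)

lemma wave_uminus_index: "wave L (- k) x = cnj (wave L k x)"
  by (simp add: wave_def cis_cnj sum_negf)

lemma wave_uminus_arg: "wave L k (- x) = cnj (wave L k x)"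
  by (simp add: wave_def cis_cnj sum_negf)

lemma wave_0 [simp]: "wave L 0 x = 1" "wave L k 0 = 1"
  by (simp_all add: wave_def)

lemma norm_wave [simp]: "norm (wave L k x) = 1"
  by (simp add: wave_def)

lemma wave_sum_index: "wave L (\<Sum>i\<in>I. \<phi> i) x = (\<Prod>i\<in>I. wave L (\<phi> i) x)"
  by (induction I rule: infinite_finite_induct) (auto simp: wave_add_index)

lemma continuous_on_wave [continuous_intros]:
  "continuous_on S f \<Longrightarrow> continuous_on S (\<lambda>x. wave L k (f x))"
  unfolding wave_def by (intro continuous_intros)

lemma wave_measurable [measurable]: "wave L k \<in> borel_measurable borel"
  by (intro borel_measurable_continuous_onI continuous_intros)

lemma mem_cell_iff: "x \<in> cell L \<longleftrightarrow> (\<forall>a. x $ a \<in> {- (L / 2)..L / 2})"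
proof -
  have "\<bar>t\<bar> \<le> L / 2 \<longleftrightarrow> t \<in> {- (L / 2)..L / 2}" for t by auto
  then show ?thesis by (simp add: cell_def)
qed

lemma cell_eq_cbox: "cell L = cbox (\<chi> a. - (L / 2)) (\<chi> a. L / 2)"
  by (auto simp: mem_cell_iff mem_box_cart)

lemma cell_measurable [measurable]: "cell L \<in> sets borel"
  by (simp add: cell_eq_cbox)

lemma compact_cell: "compact (cell L)"
  by (simp add: cell_eq_cbox)

lemma set_integrable_cell:
  fixes f :: "real^'n \<Rightarrow> 'b::{banach, second_countable_topology}"
  assumes "continuous_on UNIV f"
  shows "set_integrable lborel (cell L) f"
  unfolding set_integrable_def
  by (rule borel_integrable_compact[OF compact_cell]) (auto intro: continuous_on_subset[OF assms])

lemma integral_interval_cis: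
  assumes "0 < L"
  shows "(LINT t:{- (L/2)..L/2}|lborel. cis (2 * pi / L * (real_of_int j * t))) = (if j = 0 then of_real L else 0)"
proof (cases "j = 0")
  case True
  then show ?thesis using assms by (simp add: set_lebesgue_integral_def scaleR_conv_of_real)
next
  case False
  define \<alpha> where "\<alpha> = 2 * pi / L * real_of_int j"
  have \<alpha>: "\<alpha> \<noteq> 0" using False assms by (simp add: \<alpha>_def)
  let ?F = "\<lambda>t. cis (\<alpha> * t) / (\<i> * of_real \<alpha>)"
  have "(LINT t:{- (L/2)..L/2}|lborel. cis (\<alpha> * t)) = ?F (L/2) - ?F (- (L/2))"
    unfolding set_lebesgue_integral_def
  proof (rule integral_FTC_Icc)
    fix t
    have "((\<lambda>t. cis (\<alpha> * t)) has_vector_derivative \<i> * of_real \<alpha> * cis (\<alpha> * t)) (at t within {- (L/2)..L/2})"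
      unfolding has_vector_derivative_def
      by (auto intro!: derivative_eq_intros simp: scaleR_conv_of_real)
    from has_vector_derivative_divide[OF this, of "\<i> * of_real \<alpha>"]
    show "(?F has_vector_derivative cis (\<alpha> * t)) (at t within {- (L/2)..L/2})"
      using \<alpha> by simp
  qed (use assms in \<open>auto intro!: continuous_intros\<close>)
  also have "cis (\<alpha> * (L/2)) = cis (\<alpha> * (- (L/2)))"
  proof -
    have "\<alpha> * (L/2) = 2 * pi * real_of_int j + \<alpha> * (- (L/2))"
      using assms by (simp add: \<alpha>_def field_simps)
    then have "cis (\<alpha> * (L/2)) = cis (2 * pi * real_of_int j) * cis (\<alpha> * (- (L/2)))"
      by (simp only: cis_mult)
    then show ?thesis by (simp only: cis_multiple_2pi Ints_of_int mult_1_left)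
  qed
  finally show ?thesis using False by (simp add: \<alpha>_def mult.assoc)
qed

text \<open>Both the indicator of the cell and the exponential factor over the coordinates, so the
  integral is a product of one-dimensional ones, each of which vanishes unless its frequency is
  0.\<close>

lemma integral_cell_wave:
  fixes k :: "int^'n"
  assumes L: "0 < L"
  shows "(LINT x:cell L|lborel. wave L k x) = (if k = 0 then of_real (L ^ CARD('n)) else 0)"
proof -
  let ?B = "Basis :: (real^'n) set"
  define g where "g b t = indicator {- (L/2)..L/2} t *\<^sub>R cis (2 * pi / L * (((\<chi> a. real_of_int (k $ a)) \<bullet> b) * t))" for b :: "real^'n" and t
  have B: "?B = (\<lambda>a. axis a 1) ` UNIV" by (auto simp: Basis_vec_def)
  have inj: "inj (\<lambda>a::'n. axis a (1::real))" by (auto simp: inj_on_def axis_eq_axis)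
  have prodB: "(\<Prod>b\<in>?B. F b) = (\<Prod>a\<in>UNIV. F (axis a 1))" for F :: "real^'n \<Rightarrow> complex"
    unfolding B by (subst prod.reindex[OF inj]) simp
  have pt: "indicator (cell L) x *\<^sub>R wave L k x = (\<Prod>b\<in>?B. g b (x \<bullet> b))" for x
  proof -
    have "(\<Prod>b\<in>?B. g b (x \<bullet> b)) = (\<Prod>a\<in>UNIV. indicator {- (L/2)..L/2} (x $ a) *\<^sub>R cis (2 * pi / L * (real_of_int (k $ a) * x $ a)))"
      unfolding prodB by (simp add: g_def inner_axis)
    also have "\<dots> = (\<Prod>a\<in>UNIV. of_real (indicator {- (L/2)..L/2} (x $ a))) * (\<Prod>a\<in>UNIV. cis (2 * pi / L * (real_of_int (k $ a) * x $ a)))"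
      by (simp add: scaleR_conv_of_real prod.distrib)
    also have "(\<Prod>a\<in>UNIV. cis (2 * pi / L * (real_of_int (k $ a) * x $ a))) = wave L k x"
      by (simp add: wave_def sum_distrib_left cis_conv_exp exp_sum)
    also have "(\<Prod>a\<in>UNIV. of_real (indicator {- (L/2)..L/2} (x $ a))) = (of_real (indicator (cell L) x) :: complex)"
    proof (cases "x \<in> cell L")
      case True
      then have "x $ a \<in> {- (L/2)..L/2}" for a by (simp only: mem_cell_iff)
      then show ?thesis using True by (simp only: indicator_simps) simp
    next
      case False
      then obtain a where "x $ a \<notin> {- (L/2)..L/2}" by (auto simp only: mem_cell_iff)
      then have "(\<Prod>a\<in>UNIV. of_real (indicator {- (L/2)..L/2} (x $ a))) = (0::complex)"
        by (intro prod_zero finite bexI[of _ a] UNIV_I) (simp only: indicator_simps of_real_0 not_False_eq_True)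
      then show ?thesis using False by simp
    qed
    finally show ?thesis by (simp add: scaleR_conv_of_real)
  qed
  interpret P: product_sigma_finite "\<lambda>b::real^'n. lborel :: real measure" by standard
  have gi: "integrable lborel (g b)" for b
    unfolding g_def[abs_def] by (intro borel_integrable_compact continuous_intros) auto
  have "(LINT x:cell L|lborel. wave L k x) = (LINT x|lborel. (\<Prod>b\<in>?B. g b (x \<bullet> b)))"
    by (simp add: set_lebesgue_integral_def pt)
  also have "\<dots> = (LINT f|Pi\<^sub>M ?B (\<lambda>_. lborel). (\<Prod>b\<in>?B. g b ((\<Sum>b\<in>?B. f b *\<^sub>R b) \<bullet> b)))"
  proof (subst lborel_eq, rule integral_distr)
    have "g b \<in> borel_measurable borel" for b using borel_measurable_integrable[OF gi[of b]] by simp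
    then show "(\<lambda>x. \<Prod>b\<in>?B. g b (x \<bullet> b)) \<in> borel_measurable borel" by measurable
  qed measurable
  also have "\<dots> = (LINT f|Pi\<^sub>M ?B (\<lambda>_. lborel). (\<Prod>b\<in>?B. g b (f b)))"
  proof (intro Bochner_Integration.integral_cong refl prod.cong arg_cong[where f = "g _"])
    fix f :: "real^'n \<Rightarrow> real" and b :: "real^'n" assume "b \<in> ?B"
    then show "(\<Sum>b\<in>?B. f b *\<^sub>R b) \<bullet> b = f b" by simp
  qed
  also have "\<dots> = (\<Prod>b\<in>?B. LINT t|lborel. g b t)"
    by (rule P.product_integral_prod) (auto intro: gi)
  also have "\<dots> = (\<Prod>a\<in>UNIV. if k $ a = 0 then of_real L else 0)"
  proof -
    have "g (axis a 1) = (\<lambda>t. indicator {- (L/2)..L/2} t *\<^sub>R cis (2 * pi / L * (real_of_int (k $ a) * t)))" for a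
      by (rule ext) (simp add: g_def inner_axis)
    then show ?thesis
      unfolding prodB integral_interval_cis[OF L, unfolded set_lebesgue_integral_def, symmetric] by simp
  qed
  also have "\<dots> = (if k = 0 then of_real (L ^ CARD('n)) else 0)"
  proof (cases "k = 0")
    case False
    then obtain a where "k $ a \<noteq> 0" by (auto simp: vec_eq_iff)
    then show ?thesis using False by (auto intro!: prod_zero)
  qed simp
  finally show ?thesis .
qed

lemma measure_cell:
  assumes "0 < L"
  shows "measure lborel (cell L :: (real^'n) set) = L ^ CARD('n)"
proof -
  have "of_real (measure lborel (cell L :: (real^'n) set)) = (LINT x:cell L|lborel. wave L (0::int^'n) x)"
    using emeasure_compact_finite[of "cell L :: (real^'n) set"] compact_cell
    by (simp add: set_lebesgue_integral_def scaleR_conv_of_real less_top[symmetric])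
  also have "\<dots> = of_real (L ^ CARD('n))" using integral_cell_wave[OF assms, of 0] by simp
  finally show ?thesis using of_real_eq_iff by blast
qed

text \<open>The sum runs over an arbitrary index set mapped to frequencies, so that repeated
  frequencies, as they occur in expanded squares and powers, are allowed.\<close>

lemma integral_cell_trig:
  fixes \<kappa> :: "'i \<Rightarrow> int^'n"
  assumes L: "0 < L" and J: "finite J"
  shows "(LINT x:cell L|lborel. (\<Sum>i\<in>J. A i * wave L (\<kappa> i) x)) = of_real (L ^ CARD('n)) * (\<Sum>i\<in>{i\<in>J. \<kappa> i = 0}. A i)"
proof -
  have i: "set_integrable lborel (cell L) (\<lambda>x. A i * wave L (\<kappa> i) x)" for i
    by (intro set_integrable_cell continuous_intros)
  have "(LINT x:cell L|lborel. (\<Sum>i\<in>J. A i * wave L (\<kappa> i) x)) = (\<Sum>i\<in>J. LINT x:cell L|lborel. A i * wave L (\<kappa> i) x)"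
    using i unfolding set_lebesgue_integral_def set_integrable_def scaleR_sum_right
    by (intro Bochner_Integration.integral_sum) auto
  also have "\<dots> = (\<Sum>i\<in>J. if \<kappa> i = 0 then of_real (L ^ CARD('n)) * A i else 0)"
    by (intro sum.cong) (simp_all add: integral_cell_wave[OF L])
  also have "\<dots> = of_real (L ^ CARD('n)) * (\<Sum>i\<in>{i\<in>J. \<kappa> i = 0}. A i)"
    using J by (simp add: sum.If_cases sum_distrib_left Collect_conj_eq)
  finally show ?thesis .
qed

lemma parseval_cell:
  fixes A :: "int^'n \<Rightarrow> complex"
  assumes L: "0 < L" and K: "finite K"
  shows "(LINT x:cell L|lborel. (norm (\<Sum>k\<in>K. A k * wave L k x))\<^sup>2) = L ^ CARD('n) * (\<Sum>k\<in>K. (norm (A k))\<^sup>2)"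
proof -
  have sq: "of_real ((norm (\<Sum>k\<in>K. A k * wave L k x))\<^sup>2)
      = (\<Sum>p\<in>K \<times> K. (A (fst p) * cnj (A (snd p))) * wave L (fst p - snd p) x)" for x
  proof -
    have w: "wave L (k - j) x = wave L k x * cnj (wave L j x)" for k j
      using wave_add_index[of L k "- j" x] by (simp add: wave_uminus_index)
    have "of_real ((norm (\<Sum>k\<in>K. A k * wave L k x))\<^sup>2) = (\<Sum>k\<in>K. A k * wave L k x) * (\<Sum>k\<in>K. cnj (A k) * cnj (wave L k x))"
      by (simp only: of_real_power complex_norm_square[symmetric] cnj_sum[symmetric] complex_cnj_mult[symmetric])
    also have "\<dots> = (\<Sum>p\<in>K \<times> K. (A (fst p) * wave L (fst p) x) * (cnj (A (snd p)) * cnj (wave L (snd p) x)))"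
      by (simp add: sum_product sum.cartesian_product split_beta)
    finally show ?thesis by (simp add: w mult_ac)
  qed
  have "of_real (LINT x:cell L|lborel. (norm (\<Sum>k\<in>K. A k * wave L k x))\<^sup>2)
      = (LINT x:cell L|lborel. of_real ((norm (\<Sum>k\<in>K. A k * wave L k x))\<^sup>2) :: complex)"
    by (simp add: set_lebesgue_integral_def scaleR_conv_of_real flip: integral_complex_of_real)
  also have "\<dots> = of_real (L ^ CARD('n)) * (\<Sum>p\<in>{p\<in>K \<times> K. fst p - snd p = 0}. A (fst p) * cnj (A (snd p)))"
    unfolding sq by (rule integral_cell_trig[OF L]) (use K in auto)
  also have "(\<Sum>p\<in>{p\<in>K \<times> K. fst p - snd p = 0}. A (fst p) * cnj (A (snd p))) = (\<Sum>k\<in>K. A k * cnj (A k))"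
    by (rule sum.reindex_bij_witness[of _ "\<lambda>k. (k, k)" fst]) auto
  also have "\<dots> = of_real (\<Sum>k\<in>K. (norm (A k))\<^sup>2)"
    by (simp only: complex_norm_square of_real_sum)
  finally show ?thesis by (simp only: of_real_mult[symmetric] of_real_eq_iff)
qed

text \<open>This is where an integer exponent is used: the power expands into tuples of frequencies,
  and only those with zero sum survive the integration.\<close>

lemma power_cell:
  fixes A :: "int^'n \<Rightarrow> complex"
  assumes L: "0 < L" and K: "finite K"
  shows "(LINT x:cell L|lborel. (\<Sum>k\<in>K. A k * wave L k x) ^ p)
    = of_real (L ^ CARD('n)) * (\<Sum>\<phi>\<in>{\<phi> \<in> PiE {..<p} (\<lambda>_. K). (\<Sum>i<p. \<phi> i) = 0}. \<Prod>i<p. A (\<phi> i))"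
proof -
  have "(\<Sum>k\<in>K. A k * wave L k x) ^ p = (\<Sum>\<phi>\<in>PiE {..<p} (\<lambda>_. K). (\<Prod>i<p. A (\<phi> i)) * wave L (\<Sum>i<p. \<phi> i) x)" for x
  proof -
    have "(\<Sum>k\<in>K. A k * wave L k x) ^ p = (\<Prod>i<p. \<Sum>k\<in>K. A k * wave L k x)" by simp
    also have "\<dots> = (\<Sum>\<phi>\<in>PiE {..<p} (\<lambda>_. K). \<Prod>i<p. A (\<phi> i) * wave L (\<phi> i) x)"
      by (rule prod_sum_PiE) (use K in auto)
    finally show ?thesis by (simp add: prod.distrib wave_sum_index)
  qed
  then show ?thesis
    using integral_cell_trig[OF L, of "PiE {..<p} (\<lambda>_. K)" "\<lambda>\<phi>. \<Prod>i<p. A (\<phi> i)" "\<lambda>\<phi>. \<Sum>i<p. \<phi> i"] K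
    by (simp add: finite_PiE)
qed

text \<open>The integral extends over the whole space. For functions supported in the cell this is
  the usual coefficient of the periodic extension, and translations can be treated without cutting
  at the boundary of the cell.\<close>

definition fcoef :: "real \<Rightarrow> (real^'n \<Rightarrow> real) \<Rightarrow> int^'n \<Rightarrow> complex" where
  "fcoef L g k = (LINT x|lborel. of_real (g x) * cnj (wave L k x)) / of_real (L ^ CARD('n))"

lemma integrable_bounded_mult_wave:
  assumes "integrable lborel (g :: real^'n \<Rightarrow> real)"
  shows "integrable lborel (\<lambda>x. of_real (g x) * cnj (wave L k x))"
proof (rule Bochner_Integration.integrable_bound[OF assms])
  show "(\<lambda>x. of_real (g x) * cnj (wave L k x)) \<in> borel_measurable lborel"
    using borel_measurable_integrable[OF assms] unfolding wave_uminus_index[symmetric] by measurable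
qed (simp add: norm_mult)

lemma fcoef_translate: "fcoef L (\<lambda>x. g (x + s)) k = wave L k s * fcoef L g k"
  if [measurable]: "g \<in> borel_measurable borel" for g :: "real^'n \<Rightarrow> real"
proof -
  have "(LINT x|lborel. of_real (g x) * cnj (wave L k (x - s))) = (LINT x|distr lborel borel ((+) s). of_real (g x) * cnj (wave L k (x - s)))"
    by (simp add: lborel_distr_plus)
  also have "\<dots> = (LINT x|lborel. of_real (g (s + x)) * cnj (wave L k (s + x - s)))"
    unfolding wave_uminus_index[symmetric] by (rule integral_distr) measurable
  finally have "(LINT x|lborel. of_real (g (x + s)) * cnj (wave L k x)) = (LINT x|lborel. of_real (g x) * cnj (wave L k (x - s)))"
    by (simp add: add.commute)
  also have "\<dots> = (LINT x|lborel. wave L k s * (of_real (g x) * cnj (wave L k x)))"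
    using wave_add_arg[of L k _ "- s"] by (simp add: wave_uminus_arg mult_ac)
  finally show ?thesis by (simp add: fcoef_def)
qed

text \<open>The mean square distance from \<open>g\<close> to its trigonometric sum is nonnegative;
  the cross term equals the sum of the squared coefficients times the cell volume, and Parseval
  evaluates the last term.\<close>

lemma bessel_cell:
  fixes g :: "real^'n \<Rightarrow> real"
  assumes L: "0 < L" and K: "finite K" and g: "continuous_on UNIV g" and supp: "\<And>x. x \<notin> cell L \<Longrightarrow> g x = 0"
  shows "L ^ CARD('n) * (\<Sum>k\<in>K. (norm (fcoef L g k))\<^sup>2) \<le> (LINT x|lborel. (g x)\<^sup>2)"
proof -
  let ?c = "fcoef L g" and ?V = "L ^ CARD('n)"
  let ?S = "\<lambda>x. \<Sum>k\<in>K. ?c k * wave L k x"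
  have onc: "(LINT x|lborel. f x) = (LINT x:cell L|lborel. f x)" if "\<And>x. x \<notin> cell L \<Longrightarrow> f x = 0" for f :: "real^'n \<Rightarrow> 'b::{banach,second_countable_topology}"
    unfolding set_lebesgue_integral_def using that by (intro Bochner_Integration.integral_cong) (auto simp: indicator_def)
  have c: "(LINT x:cell L|lborel. of_real (g x) * cnj (wave L k x)) = of_real ?V * ?c k" for k
    using L by (subst onc[symmetric]) (auto simp: supp fcoef_def)
  have cross: "(LINT x:cell L|lborel. Re (of_real (g x) * cnj (?S x))) = ?V * (\<Sum>k\<in>K. (norm (?c k))\<^sup>2)"
  proof -
    have "(LINT x:cell L|lborel. Re (of_real (g x) * cnj (?S x))) = Re (LINT x:cell L|lborel. of_real (g x) * cnj (?S x))"
    proof -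
      have "set_integrable lborel (cell L) (\<lambda>x. of_real (g x) * cnj (?S x))"
        by (intro set_integrable_cell continuous_intros g)
      then show ?thesis
        unfolding set_lebesgue_integral_def set_integrable_def
        by (subst integral_Re[symmetric]) auto
    qed
    also have "(LINT x:cell L|lborel. of_real (g x) * cnj (?S x)) = (\<Sum>k\<in>K. LINT x:cell L|lborel. cnj (?c k) * (of_real (g x) * cnj (wave L k x)))"
    proof -
      have "set_integrable lborel (cell L) (\<lambda>x. cnj (?c k) * (of_real (g x) * cnj (wave L k x)))" for k
        by (intro set_integrable_cell continuous_intros g)
      then show ?thesis
        unfolding set_lebesgue_integral_def set_integrable_def
        by (subst Bochner_Integration.integral_sum[symmetric]) (auto simp: sum_distrib_left scaleR_sum_right mult_ac)
    qed
    also have "\<dots> = of_real (?V * (\<Sum>k\<in>K. (norm (?c k))\<^sup>2))"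
      unfolding set_integral_mult_right c of_real_mult of_real_sum complex_norm_square sum_distrib_left
      by (simp add: mult_ac)
    finally show ?thesis by simp
  qed
  have "0 \<le> (LINT x:cell L|lborel. (norm (of_real (g x) - ?S x))\<^sup>2)"
    unfolding set_lebesgue_integral_def by (intro Bochner_Integration.integral_nonneg) auto
  also have "\<dots> = (LINT x:cell L|lborel. (g x)\<^sup>2 - 2 * Re (of_real (g x) * cnj (?S x)) + (norm (?S x))\<^sup>2)"
  proof -
    have "(norm (of_real a - S))\<^sup>2 = a\<^sup>2 - 2 * Re (of_real a * cnj S) + (norm S)\<^sup>2" for a :: real and S :: complex
      unfolding cmod_power2 by (simp add: power2_eq_square algebra_simps)
    then show ?thesis by (simp only:)
  qed
  also have "\<dots> = (LINT x:cell L|lborel. (g x)\<^sup>2) - 2 * (LINT x:cell L|lborel. Re (of_real (g x) * cnj (?S x))) + (LINT x:cell L|lborel. (norm (?S x))\<^sup>2)"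
  proof -
    have 1: "set_integrable lborel (cell L) (\<lambda>x. (g x)\<^sup>2)" "set_integrable lborel (cell L) (\<lambda>x. 2 * Re (of_real (g x) * cnj (?S x)))"
      "set_integrable lborel (cell L) (\<lambda>x. (norm (?S x))\<^sup>2)"
      by (intro set_integrable_cell continuous_intros g)+
    show ?thesis
      using 1 by (subst set_integral_add, simp, simp, subst set_integral_diff) auto
  qed
  also have "\<dots> = (LINT x|lborel. (g x)\<^sup>2) - ?V * (\<Sum>k\<in>K. (norm (?c k))\<^sup>2)"
    unfolding cross parseval_cell[OF L K] using onc[of "\<lambda>x. (g x)\<^sup>2"] supp by simp
  finally show ?thesis by simp
qed

section \<open>Fejer means\<close>

definition trig_poly :: "real \<Rightarrow> (real^'n \<Rightarrow> real) \<Rightarrow> bool" where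
  "trig_poly L f \<longleftrightarrow> (\<exists>K b. finite K \<and> (\<forall>x. of_real (f x) = (\<Sum>k\<in>K. b k * wave L k x)))"

lemma trig_polyI:
  assumes J: "finite J" and f: "\<And>x. of_real (f x) = (\<Sum>i\<in>J. A i * wave L (\<kappa> i) x)"
  shows "trig_poly L f"
  unfolding trig_poly_def
proof (intro exI conjI allI)
  show "finite (\<kappa> ` J)" using J by simp
  fix x
  have "of_real (f x) = (\<Sum>k\<in>\<kappa> ` J. \<Sum>i\<in>{i\<in>J. \<kappa> i = k}. A i * wave L (\<kappa> i) x)"
    unfolding f by (rule sum.image_gen[OF J])
  also have "\<dots> = (\<Sum>k\<in>\<kappa> ` J. (\<Sum>i\<in>{i\<in>J. \<kappa> i = k}. A i) * wave L k x)"
    by (intro sum.cong refl) (simp add: sum_distrib_right)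
  finally show "of_real (f x) = (\<Sum>k\<in>\<kappa> ` J. (\<Sum>i\<in>{i\<in>J. \<kappa> i = k}. A i) * wave L k x)" .
qed

lemma trig_poly_mult:
  assumes "trig_poly L f" "trig_poly L g"
  shows "trig_poly L (\<lambda>x. f x * g x)"
proof -
  obtain K b where f: "finite K" "\<And>x. of_real (f x) = (\<Sum>k\<in>K. b k * wave L k x)"
    using assms(1) unfolding trig_poly_def by blast
  obtain K' b' where g: "finite K'" "\<And>x. of_real (g x) = (\<Sum>k\<in>K'. b' k * wave L k x)"
    using assms(2) unfolding trig_poly_def by blast
  show ?thesis
  proof (rule trig_polyI[where J = "K \<times> K'" and A = "\<lambda>p. b (fst p) * b' (snd p)" and \<kappa> = "\<lambda>p. fst p + snd p"])
    show "finite (K \<times> K')" using f g by simp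
    show "of_real (f x * g x) = (\<Sum>p\<in>K \<times> K'. b (fst p) * b' (snd p) * wave L (fst p + snd p) x)" for x
      unfolding of_real_mult f(2) g(2) sum_product sum.cartesian_product
      by (intro sum.cong) (auto simp: wave_add_index mult_ac)
  qed
qed

lemma trig_poly_1: "trig_poly L (\<lambda>_. 1)"
  by (rule trig_polyI[where J = "{()}" and A = "\<lambda>_. 1" and \<kappa> = "\<lambda>_. 0"]) auto

lemma trig_poly_prod: "(\<And>i. i \<in> I \<Longrightarrow> trig_poly L (f i)) \<Longrightarrow> trig_poly L (\<lambda>x. \<Prod>i\<in>I. f i x)"
  by (induction I rule: infinite_finite_induct) (auto intro: trig_poly_mult trig_poly_1)

lemma trig_poly_power: "trig_poly L f \<Longrightarrow> trig_poly L (\<lambda>x. f x ^ M)"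
  by (induction M) (auto intro: trig_poly_mult trig_poly_1)

text \<open>A substitute for the classical Fejer kernel: a nonnegative trigonometric polynomial
  whose base has its maximum 1 in the cell only at the origin, so that its powers concentrate there
  as \<open>M\<close> grows. Normalization is left to the mean.\<close>

definition fejer :: "real \<Rightarrow> nat \<Rightarrow> real^'n \<Rightarrow> real" where
  "fejer L M x = (\<Prod>a\<in>UNIV. (1 + cos (2 * pi / L * x $ a)) / 2) ^ M"

lemma trig_poly_fejer: "trig_poly L (fejer L M)"
proof -
  have "trig_poly L (\<lambda>x::real^'n. (1 + cos (2 * pi / L * x $ a)) / 2)" for a
  proof (rule trig_polyI[where J = "{0,1,2::nat}" and A = "\<lambda>i. if i = 0 then 1/2 else 1/4"
        and \<kappa> = "\<lambda>i. if i = 0 then 0 else if i = 1 then axis a 1 else - axis a 1"])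
    fix x :: "real^'n"
    have "(\<Sum>b\<in>UNIV. real_of_int (axis a 1 $ b) * x $ b) = x $ a"
      by (simp add: axis_def if_distrib[of real_of_int] if_distrib[of "\<lambda>t. t * _"] cong: if_cong)
    then have "wave L (axis a 1) x = cis (2 * pi / L * x $ a)" by (simp add: wave_def)
    then show "of_real ((1 + cos (2 * pi / L * x $ a)) / 2) = (\<Sum>i\<in>{0,1,2::nat}. (if i = 0 then 1/2 else 1/4) *
        wave L (if i = 0 then 0 else if i = 1 then axis a 1 else - axis a 1) x)"
      by (simp add: wave_uminus_index complex_eq_iff)
  qed simp
  then show ?thesis unfolding fejer_def[abs_def] by (intro trig_poly_power trig_poly_prod)
qed

lemma fejer_nonneg: "0 \<le> fejer L M x"
proof -
  have *: "0 \<le> 1 + cos t" for t :: real using cos_ge_minus_one[of t] by linarith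
  show ?thesis unfolding fejer_def by (intro zero_le_power prod_nonneg divide_nonneg_nonneg * zero_le_numeral)
qed

lemma continuous_on_fejer: "continuous_on S (fejer L M)"
  unfolding fejer_def[abs_def] by (intro continuous_intros) auto

lemma fejer_power: "fejer L M x = fejer L 1 x ^ M"
  by (simp add: fejer_def)

lemma fejer_less_1:
  fixes x :: "real^'n"
  assumes L: "0 < L" and x: "x \<in> cell L" "x \<noteq> 0"
  shows "fejer L 1 x < 1"
proof -
  obtain a where a: "x $ a \<noteq> 0" using x(2) by (auto simp: vec_eq_iff)
  let ?c = "\<lambda>a. (1 + cos (2 * pi / L * x $ a)) / 2"
  have c: "0 \<le> ?c a" "?c a \<le> 1" for a
  proof -
    have "0 \<le> (1 + cos t) / 2 \<and> (1 + cos t) / 2 \<le> 1" for t :: real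
    proof -
      have "0 \<le> 1 + cos t" using cos_ge_minus_one[of t] by linarith
      moreover have "1 + cos t \<le> 2" using cos_le_one[of t] by linarith
      ultimately show ?thesis by (simp only: zero_le_divide_iff divide_le_eq_1) simp
    qed
    then show "0 \<le> ?c a" "?c a \<le> 1" by blast+
  qed
  have "\<bar>2 * pi / L * x $ a\<bar> = (2 * pi / L) * \<bar>x $ a\<bar>" using L by (simp add: abs_mult)
  also have "\<dots> \<le> (2 * pi / L) * (L / 2)"
    using x(1) L by (intro mult_left_mono) (auto simp: cell_def)
  also have "\<dots> = pi" using L by simp
  finally have "cos \<bar>2 * pi / L * x $ a\<bar> < cos 0"
    using a L by (intro cos_monotone_0_pi) auto
  then have "cos (2 * pi / L * x $ a) < 1" by (simp only: cos_abs_real cos_zero)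
  then have "?c a < 1" by simp
  moreover have "(\<Prod>a\<in>UNIV. ?c a) = ?c a * (\<Prod>a\<in>UNIV - {a}. ?c a)" by (rule prod.remove) auto
  moreover have "?c a * (\<Prod>a\<in>UNIV - {a}. ?c a) \<le> ?c a * 1"
    using c by (intro mult_left_mono prod_le_1) auto
  ultimately show ?thesis by (simp add: fejer_def)
qed

text \<open>Away from the origin the base is at most some \<rho> below 1, by compactness; near the
  origin it exceeds a number \<rho>' between \<rho> and 1. The quotient of the integrals is
  therefore at most a constant times (\<rho> / \<rho>')^M.\<close>

lemma fejer_tail:
  fixes \<delta> :: real
  assumes L: "0 < L" and \<delta>: "0 < \<delta>"
  shows "(\<lambda>M. (LINT y:{y\<in>cell L. \<delta> \<le> norm y}|lborel. fejer L M (y::real^'n)) / (LINT y:cell L|lborel. fejer L M (y::real^'n))) \<longlonglongrightarrow> 0"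
    and fejer_integral_pos: "0 < (LINT y:cell L|lborel. fejer L M (y::real^'n))"
proof -
  let ?q = "fejer L 1 :: real^'n \<Rightarrow> real" and ?I = "\<lambda>M. LINT y:cell L|lborel. fejer L M (y::real^'n)"
  define S where "S = {y\<in>cell L. \<delta> \<le> norm (y::real^'n)}"
  have "closed {y::real^'n. \<delta> \<le> norm y}" by (intro closed_Collect_le continuous_intros)
  then have S: "compact S" using compact_Int_closed[OF compact_cell] by (simp add: S_def Collect_conj_eq)
  have [measurable]: "S \<in> sets borel" using S by (intro borel_closed compact_imp_closed)
  obtain \<rho> where \<rho>: "0 \<le> \<rho>" "\<rho> < 1" "\<And>y. y \<in> S \<Longrightarrow> ?q y \<le> \<rho>"
  proof (cases "S = {}")
    case False
    obtain y where y: "y \<in> S" "\<And>z. z \<in> S \<Longrightarrow> ?q z \<le> ?q y"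
      using continuous_attains_sup[OF S False continuous_on_fejer] by blast
    have "?q y < 1" using y(1) \<delta> by (intro fejer_less_1[OF L]) (auto simp: S_def)
    then show ?thesis using that[of "?q y"] y fejer_nonneg by blast
  qed (use that[of 0] in auto)
  define \<rho>' where "\<rho>' = (1 + \<rho>) / 2"
  have \<rho>': "0 < \<rho>'" "\<rho>' < 1" "\<rho> < \<rho>'" using \<rho> by (auto simp: \<rho>'_def)
  have "?q 0 = 1" by (simp add: fejer_def)
  moreover have "open {y. \<rho>' < ?q y}" by (intro open_Collect_less continuous_on_fejer continuous_intros)
  ultimately obtain \<eta>0 where \<eta>0: "0 < \<eta>0" "ball 0 \<eta>0 \<subseteq> {y. \<rho>' < ?q y}"
    using \<rho>'(2) by (auto elim!: openE[where x = 0])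
  define \<eta> where "\<eta> = min \<eta>0 (L / 2)"
  have \<eta>: "0 < \<eta>" "\<And>y. y \<in> ball 0 \<eta> \<Longrightarrow> \<rho>' < ?q y"
    using \<eta>0 L by (auto simp: \<eta>_def)
  have bc: "ball 0 \<eta> \<subseteq> (cell L :: (real^'n) set)"
  proof
    fix y :: "real^'n" assume "y \<in> ball 0 \<eta>"
    then have "norm y \<le> L / 2" by (simp add: \<eta>_def)
    then have "\<bar>y $ a\<bar> \<le> L / 2" for a using component_le_norm_cart[of y a] by linarith
    then show "y \<in> cell L" by (simp only: cell_def mem_Collect_eq) blast
  qed
  let ?v = "measure lborel (ball (0::real^'n) \<eta>)" and ?V = "measure lborel (cell L :: (real^'n) set)"
  have v: "0 < ?v" using \<eta>(1) content_ball_pos by blast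
  have fc: "emeasure lborel (cell L :: (real^'n) set) < \<infinity>" by (intro emeasure_compact_finite compact_cell)
  have fb: "emeasure lborel (ball (0::real^'n) \<eta>) < \<infinity>" by (intro emeasure_bounded_finite bounded_ball)
  have fS: "emeasure lborel S < \<infinity>" by (intro emeasure_compact_finite S)
  have ic: "set_integrable lborel (cell L) (fejer L M :: real^'n \<Rightarrow> real)" for M
    by (intro set_integrable_cell continuous_on_fejer)
  have iS: "set_integrable lborel S (fejer L M)" for M
    unfolding set_integrable_def by (intro borel_integrable_compact S continuous_on_fejer)
  have low: "\<rho>' ^ M * ?v \<le> ?I M" for M
  proof -
    have "\<rho>' ^ M * ?v = (LINT y:ball (0::real^'n) \<eta>|lborel. \<rho>' ^ M)"
      using fb by (simp add: set_lebesgue_integral_def)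
    also have "\<dots> \<le> (LINT y:cell L|lborel. fejer L M (y::real^'n))"
      unfolding set_lebesgue_integral_def
    proof (rule integral_mono)
      show "integrable lborel (\<lambda>x. indicator (ball (0::real^'n) \<eta>) x *\<^sub>R \<rho>' ^ M)"
        using fb by simp
      show "integrable lborel (\<lambda>x. indicator (cell L) x *\<^sub>R fejer L M (x::real^'n))"
        using ic by (simp add: set_integrable_def)
      fix y :: "real^'n"
      show "indicator (ball 0 \<eta>) y *\<^sub>R \<rho>' ^ M \<le> indicator (cell L) y *\<^sub>R fejer L M y"
      proof (cases "y \<in> ball 0 \<eta>")
        case True
        then have "\<rho>' ^ M \<le> fejer L M y"
          unfolding fejer_power[of L M] using \<eta>(2)[OF True] \<rho>' by (intro power_mono) auto
        then show ?thesis using True bc by auto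
      qed (simp add: fejer_nonneg)
    qed
    finally show ?thesis .
  qed
  show pos: "0 < ?I M" for M
    using low[of M] v \<rho>' by (meson less_le_trans mult_pos_pos zero_less_power)
  have high: "(LINT y:S|lborel. fejer L M y) \<le> \<rho> ^ M * measure lborel S" for M
  proof -
    have "(LINT y:S|lborel. fejer L M y) \<le> (LINT y:S|lborel. \<rho> ^ M)"
    proof (rule set_integral_mono[OF iS])
      show "set_integrable lborel S (\<lambda>y. \<rho> ^ M)" using fS by (simp add: set_integrable_def)
      show "fejer L M y \<le> \<rho> ^ M" if "y \<in> S" for y
        unfolding fejer_power[of L M] using \<rho>(3)[OF that] fejer_nonneg by (intro power_mono) auto
    qed
    also have "\<dots> = \<rho> ^ M * measure lborel S" using fS by (simp add: set_lebesgue_integral_def)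
    finally show ?thesis .
  qed
  show "(\<lambda>M. (LINT y:{y\<in>cell L. \<delta> \<le> norm y}|lborel. fejer L M (y::real^'n)) / ?I M) \<longlonglongrightarrow> 0"
    unfolding S_def[symmetric]
  proof (rule tendsto_sandwich)
    show "\<forall>\<^sub>F M in sequentially. 0 \<le> (LINT y:S|lborel. fejer L M y) / ?I M"
      using pos fejer_nonneg
      by (intro always_eventually allI divide_nonneg_pos)
        (auto simp: set_lebesgue_integral_def intro!: Bochner_Integration.integral_nonneg mult_nonneg_nonneg)
    show "\<forall>\<^sub>F M in sequentially. (LINT y:S|lborel. fejer L M y) / ?I M \<le> (\<rho> / \<rho>') ^ M * (measure lborel S / ?v)"
    proof (intro always_eventually allI)
      fix M
      have "(LINT y:S|lborel. fejer L M y) / ?I M \<le> (\<rho> ^ M * measure lborel S) / (\<rho>' ^ M * ?v)"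
        using high[of M] low[of M] \<rho> \<rho>' v by (intro frac_le) auto
      then show "(LINT y:S|lborel. fejer L M y) / ?I M \<le> (\<rho> / \<rho>') ^ M * (measure lborel S / ?v)"
        by (simp add: power_divide)
    qed
    have "(\<lambda>M. (\<rho> / \<rho>') ^ M) \<longlonglongrightarrow> 0" using \<rho> \<rho>' by (intro LIMSEQ_realpow_zero) auto
    from tendsto_mult_left_zero[OF this, of "measure lborel S / ?v"]
    show "(\<lambda>M. (\<rho> / \<rho>') ^ M * (measure lborel S / ?v)) \<longlonglongrightarrow> 0" .
  qed simp
qed

text \<open>For \<open>g\<close> supported in the cell, integrating the periodic kernel over the
  whole space is the same as convolving it with the periodic extension of \<open>g\<close>.\<close>

definition fmean :: "real \<Rightarrow> nat \<Rightarrow> (real^'n \<Rightarrow> real) \<Rightarrow> real^'n \<Rightarrow> real" where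
  "fmean L M g x = (LINT y|lborel. fejer L M (x - y) * g y) / (LINT y:cell L|lborel. fejer L M (y::real^'n))"

text \<open>The multipliers are the Fourier coefficients of the normalized kernel: nonnegativity and
  total mass 1 bound them by 1, and reality makes them conjugate symmetric. The set \<open>K\<close>
  and the multipliers do not depend on \<open>g\<close>, so the same frequencies serve for all
  slices.\<close>

lemma fejer_multipliers:
  assumes L: "0 < L"
  shows "\<exists>K c. finite K \<and> uminus ` K = K \<and> (\<forall>k. norm (c k) \<le> 1) \<and> (\<forall>k. c (- k) = cnj (c k)) \<and>
     (\<forall>(g::real^'n \<Rightarrow> real) x. integrable lborel g \<longrightarrow> of_real (fmean L M g x) = (\<Sum>k\<in>K. c k * fcoef L g k * wave L k x))"
proof -
  let ?N = "LINT y:cell L|lborel. fejer L M (y::real^'n)" and ?V = "L ^ CARD('n)"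
  have N: "0 < ?N" by (rule fejer_integral_pos[OF L zero_less_one])
  obtain K0 :: "(int^'n) set" and b0 where K0: "finite K0" "\<And>x. of_real (fejer L M x) = (\<Sum>k\<in>K0. b0 k * wave L k x)"
    using trig_poly_fejer unfolding trig_poly_def by blast
  \<comment> \<open>Adding the negatives makes the frequency set symmetric; the coefficients are
    extended by 0.\<close>
  define K where "K = K0 \<union> uminus ` K0"
  define b where "b k = (if k \<in> K0 then b0 k else 0)" for k
  have K: "finite K" "uminus ` K = K" using K0(1) by (auto simp: K_def image_Un image_image)
  have f: "of_real (fejer L M x) = (\<Sum>k\<in>K. b k * wave L k x)" for x
    unfolding K0(2) using K(1) by (intro sum.mono_neutral_cong_left) (auto simp: K_def b_def)
  have V: "(0::real) < ?V" using L by simp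
  have bint: "(LINT x:cell L|lborel. of_real (fejer L M x) * cnj (wave L j x)) = of_real ?V * b j" for j
  proof -
    have "(LINT x:cell L|lborel. of_real (fejer L M x) * cnj (wave L j x)) = (LINT x:cell L|lborel. (\<Sum>k\<in>K. b k * wave L (k - j) x))"
    proof -
      have "of_real (fejer L M x) * cnj (wave L j x) = (\<Sum>k\<in>K. b k * wave L (k - j) x)" for x
        unfolding f sum_distrib_right
        using wave_add_index[of L _ "- j" x] by (simp add: wave_uminus_index mult_ac)
      then show ?thesis by simp
    qed
    also have "\<dots> = of_real ?V * (\<Sum>k\<in>{k\<in>K. k - j = 0}. b k)"
      by (rule integral_cell_trig[OF L K(1)])
    also have "{k\<in>K. k - j = 0} = (if j \<in> K then {j} else {})" by auto
    also have "(\<Sum>k\<in>(if j \<in> K then {j} else {}). b k) = b j"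
      by (auto simp: b_def K_def)
    finally show ?thesis .
  qed
  define c where "c k = of_real ?V * b k / of_real ?N" for k
  have "norm (c k) \<le> 1" for k
  proof -
    have "norm (of_real ?V * b k) \<le> (LINT x:cell L|lborel. norm (of_real (fejer L M x) * cnj (wave L k x)))"
      unfolding bint[symmetric] set_lebesgue_integral_def
      by (rule order.trans[OF integral_norm_bound]) (simp add: norm_mult)
    also have "\<dots> = ?N" by (simp add: norm_mult fejer_nonneg)
    finally show ?thesis using N by (simp add: c_def norm_divide norm_mult)
  qed
  moreover have "c (- k) = cnj (c k)" for k
  proof -
    have "of_real ?V * b (- k) = cnj (of_real ?V * b k)"
      unfolding bint[symmetric] set_lebesgue_integral_def
      by (subst Bochner_Integration.integral_cnj[symmetric]) (simp add: wave_uminus_index)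
    then show ?thesis by (simp add: c_def)
  qed
  moreover have "of_real (fmean L M g x) = (\<Sum>k\<in>K. c k * fcoef L g k * wave L k x)" if g: "integrable lborel g" for g :: "real^'n \<Rightarrow> real" and x
  proof -
    have "of_real (LINT y|lborel. fejer L M (x - y) * g y) = (LINT y|lborel. of_real (fejer L M (x - y) * g y) :: complex)"
      by (rule integral_complex_of_real[symmetric])
    also have "\<dots> = (LINT y|lborel. (\<Sum>k\<in>K. b k * wave L k x * (of_real (g y) * cnj (wave L k y))))"
    proof (intro Bochner_Integration.integral_cong refl)
      fix y
      have "wave L k (x - y) = wave L k x * cnj (wave L k y)" for k
        using wave_add_arg[of L k x "- y"] by (simp add: wave_uminus_arg)
      then show "of_real (fejer L M (x - y) * g y) = (\<Sum>k\<in>K. b k * wave L k x * (of_real (g y) * cnj (wave L k y)))"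
        by (simp add: f sum_distrib_left sum_distrib_right mult_ac)
    qed
    also have "\<dots> = (\<Sum>k\<in>K. b k * wave L k x * (LINT y|lborel. of_real (g y) * cnj (wave L k y)))"
      by (subst Bochner_Integration.integral_sum) (auto intro: integrable_bounded_mult_wave[OF g])
    also have "\<dots> = (\<Sum>k\<in>K. of_real ?N * (c k * fcoef L g k * wave L k x))"
      using N V L by (intro sum.cong) (auto simp: c_def fcoef_def)
    finally show ?thesis using N by (simp add: fmean_def sum_distrib_left[symmetric])
  qed
  ultimately show ?thesis using K by (intro exI[of _ K] exI[of _ c]) auto
qed

lemma fmean_nonneg:
  assumes "0 < L" "\<And>y. 0 \<le> g y"
  shows "0 \<le> fmean L M g x"
  unfolding fmean_def using fejer_integral_pos[OF assms(1) zero_less_one] assms(2) fejer_nonneg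
  by (intro divide_nonneg_pos Bochner_Integration.integral_nonneg mult_nonneg_nonneg) auto

text \<open>The usual approximate identity argument: continuity at \<open>x\<close> near the origin
  of the kernel, boundedness against the tail.\<close>

lemma fmean_tendsto:
  fixes g :: "real^'n \<Rightarrow> real"
  assumes L: "0 < L" and g: "continuous_on UNIV g" and B: "\<And>y. \<bar>g y\<bar> \<le> B"
    and supp: "\<And>y. y \<notin> cell (L / 2) \<Longrightarrow> g y = 0" and x: "x \<in> cell (L / 2)"
  shows "(\<lambda>M. fmean L M g x) \<longlonglongrightarrow> g x"
proof -
  let ?N = "\<lambda>M. LINT y:cell L|lborel. fejer L M (y::real^'n)"
  have N: "0 < ?N M" for M by (rule fejer_integral_pos[OF L zero_less_one])
  \<comment> \<open>Here the half cell matters: with \<open>x\<close> in it and \<open>y\<close>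
    outside the full cell, \<open>x - y\<close> has left the support, so the whole-space integral
    reduces to the cell.\<close>
  have gz: "g (x - y) = 0" if y: "y \<notin> cell L" for y
  proof -
    obtain a where "\<bar>y $ a\<bar> > L / 2" using y unfolding cell_def mem_Collect_eq not_all not_le by blast
    moreover have "\<bar>x $ a\<bar> \<le> L / 4" using x by (simp add: cell_def)
    moreover have "\<bar>y $ a\<bar> \<le> \<bar>x $ a\<bar> + \<bar>(x - y) $ a\<bar>"
      using abs_triangle_ineq4[of "x $ a" "(x - y) $ a"] by simp
    ultimately have "\<not> \<bar>(x - y) $ a\<bar> \<le> L / 4" by linarith
    then have "x - y \<notin> cell (L / 2)" by (auto simp: cell_def)
    then show ?thesis by (rule supp)
  qed
  have cg: "continuous_on UNIV (\<lambda>y. g (x - y))"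
    by (intro continuous_on_compose2[OF g] continuous_intros) auto
  have i1: "set_integrable lborel (cell L) (\<lambda>y. fejer L M y * (g (x - y) - g x))" for M
    by (intro set_integrable_cell continuous_intros continuous_on_fejer cg)
  have eq: "fmean L M g x - g x = (LINT y:cell L|lborel. fejer L M y * (g (x - y) - g x)) / ?N M" for M
  proof -
    have "(LINT y|lborel. fejer L M (x - y) * g y) = (LINT y|lborel. fejer L M y * g (x - y))"
      using integral_lborel_minus[of "\<lambda>y. fejer L M (x - y) * g y" x] by simp
    also have "\<dots> = (LINT y:cell L|lborel. fejer L M y * g (x - y))"
      unfolding set_lebesgue_integral_def
      by (intro Bochner_Integration.integral_cong) (auto simp: indicator_def gz)
    also have "\<dots> = (LINT y:cell L|lborel. fejer L M y * (g (x - y) - g x) + g x * fejer L M y)"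
      by (simp add: algebra_simps)
    also have "\<dots> = (LINT y:cell L|lborel. fejer L M y * (g (x - y) - g x)) + g x * ?N M"
      by (subst set_integral_add) (auto intro!: i1 set_integrable_cell continuous_intros continuous_on_fejer)
    finally show ?thesis using N[of M] by (simp add: fmean_def add_divide_distrib)
  qed
  have B0: "0 \<le> B" using B[of 0] by linarith
  show ?thesis
  proof (rule LIMSEQ_I)
    fix e :: real assume e: "0 < e"
    have "isCont (\<lambda>y. g (x - y)) 0" using cg by (simp add: continuous_on_eq_continuous_at)
    then have "\<forall>\<epsilon>>0. \<exists>\<delta>>0. \<forall>y. norm y < \<delta> \<longrightarrow> \<bar>g (x - y) - g x\<bar> < \<epsilon>"
      unfolding continuous_at_eps_delta by (simp add: dist_norm)
    then obtain \<delta> where \<delta>: "0 < \<delta>" "\<And>y. norm y < \<delta> \<Longrightarrow> \<bar>g (x - y) - g x\<bar> < e / 2"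
      using e half_gt_zero by blast
    define S where "S = {y\<in>cell L. \<delta> \<le> norm (y::real^'n)}"
    have "closed {y::real^'n. \<delta> \<le> norm y}" by (intro closed_Collect_le continuous_intros)
    then have S: "compact S" using compact_Int_closed[OF compact_cell] by (simp add: S_def Collect_conj_eq)
    have iS: "integrable lborel (\<lambda>y. indicator S y *\<^sub>R fejer L M y)" for M
      by (intro borel_integrable_compact S continuous_on_fejer)
    have ic: "integrable lborel (\<lambda>y::real^'n. indicator (cell L) y *\<^sub>R fejer L M y)" for M
      using set_integrable_cell[OF continuous_on_fejer, of L L M] by (simp add: set_integrable_def)
    have bound: "\<bar>fmean L M g x - g x\<bar> \<le> e / 2 + 2 * B * ((LINT y:S|lborel. fejer L M y) / ?N M)" for M
    proof -
      have "\<bar>LINT y:cell L|lborel. fejer L M y * (g (x - y) - g x)\<bar>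
        \<le> (LINT y|lborel. e / 2 * (indicator (cell L) y *\<^sub>R fejer L M y) + 2 * B * (indicator S y *\<^sub>R fejer L M y))"
        unfolding set_lebesgue_integral_def
      proof (rule integral_abs_bound_integral)
        show "integrable lborel (\<lambda>y. indicator (cell L) y *\<^sub>R (fejer L M y * (g (x - y) - g x)))"
          using i1 by (simp add: set_integrable_def)
        show "integrable lborel (\<lambda>y. e / 2 * (indicator (cell L) y *\<^sub>R fejer L M y) + 2 * B * (indicator S y *\<^sub>R fejer L M y))"
          using iS[of M] ic[of M] by (intro Bochner_Integration.integrable_add integrable_mult_right)
        fix y :: "real^'n"
        show "\<bar>indicator (cell L) y *\<^sub>R (fejer L M y * (g (x - y) - g x))\<bar>
          \<le> e / 2 * (indicator (cell L) y *\<^sub>R fejer L M y) + 2 * B * (indicator S y *\<^sub>R fejer L M y)"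
        proof (cases "y \<in> cell L")
          case True
          have "\<bar>g (x - y) - g x\<bar> \<le> e / 2 + 2 * B * indicator S y"
          proof (cases "norm y < \<delta>")
            case False
            have "\<bar>g (x - y) - g x\<bar> \<le> 2 * B" using B[of "x - y"] B[of x] by linarith
            then show ?thesis using True False e by (simp add: S_def)
          qed (use \<delta>(2)[of y] B0 in \<open>auto simp: indicator_def\<close>)
          then have "fejer L M y * \<bar>g (x - y) - g x\<bar> \<le> fejer L M y * (e / 2 + 2 * B * indicator S y)"
            by (rule mult_left_mono) (rule fejer_nonneg)
          moreover have "\<bar>indicator (cell L) y *\<^sub>R (fejer L M y * (g (x - y) - g x))\<bar> = fejer L M y * \<bar>g (x - y) - g x\<bar>"
            using True by (simp add: abs_mult fejer_nonneg)
          ultimately show ?thesis using True by (simp add: algebra_simps)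
        qed (simp add: S_def)
      qed
      also have "\<dots> = e / 2 * ?N M + 2 * B * (LINT y:S|lborel. fejer L M y)"
        using iS[of M] ic[of M] by (simp add: set_lebesgue_integral_def)
      finally have "\<bar>LINT y:cell L|lborel. fejer L M y * (g (x - y) - g x)\<bar> / ?N M \<le> (e / 2 * ?N M + 2 * B * (LINT y:S|lborel. fejer L M y)) / ?N M"
        using N[of M] by (intro divide_right_mono) auto
      then show ?thesis using N[of M] by (simp add: eq add_divide_distrib)
    qed
    have "(\<lambda>M. 2 * B * ((LINT y:S|lborel. fejer L M y) / ?N M)) \<longlonglongrightarrow> 2 * B * 0"
      unfolding S_def by (intro tendsto_intros fejer_tail L \<delta>)
    then have "\<forall>\<^sub>F M in sequentially. 2 * B * ((LINT y:S|lborel. fejer L M y) / ?N M) < e / 2"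
      using e by (intro order_tendstoD(2)) auto
    then obtain M0 where "\<And>M. M \<ge> M0 \<Longrightarrow> 2 * B * ((LINT y:S|lborel. fejer L M y) / ?N M) < e / 2"
      unfolding eventually_sequentially by blast
    then show "\<exists>no. \<forall>n\<ge>no. norm (fmean L n g x - g x) < e"
      using bound by (intro exI[of _ M0]) (fastforce intro: le_less_trans)
  qed
qed

section \<open>Radial test functions from radial Fourier coefficients\<close>

lemma grad_eqI:
  assumes "(f has_derivative (\<lambda>y. D \<bullet> y)) (at z)"
  shows "grad f z = D"
proof -
  have e: "frechet_derivative f (at z) = (\<lambda>y. D \<bullet> y)" using frechet_derivative_at[OF assms] by simp
  show ?thesis unfolding grad_def e by (rule euclidean_representation)
qed

lemma test_functionsI:
  assumes "\<And>k. C_k k u" "\<And>p. u p \<noteq> 0 \<Longrightarrow> p \<in> S" "bounded S"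
  shows "u \<in> test_functions"
proof -
  have "bounded {p. u p \<noteq> 0}" using assms(2,3) by (auto intro: bounded_subset)
  then show ?thesis using assms(1) by (simp add: test_functions_def compact_closure)
qed

lemma test_functionsD:
  assumes "u \<in> test_functions"
  shows "C_k k u" "\<exists>R\<ge>0. \<forall>p. norm p > R \<longrightarrow> u p = 0"
proof -
  show "C_k k u" using assms by (simp add: test_functions_def)
  have "bounded {p. u p \<noteq> 0}"
    using assms bounded_subset[OF compact_imp_bounded closure_subset] by (auto simp: test_functions_def)
  then obtain R where R: "\<And>p. u p \<noteq> 0 \<Longrightarrow> norm p \<le> R" by (auto simp: bounded_iff)
  have "u p = 0" if "norm p > max R 0" for p
    using R[of p] that by (cases "u p = 0") auto
  then show "\<exists>R\<ge>0. \<forall>p. norm p > R \<longrightarrow> u p = 0"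
    by (intro exI[of _ "max R 0"]) auto
qed

lemma C_k_slice_z: "C_k k u \<Longrightarrow> C_k k (\<lambda>z. u (x, z))"
  using C_k_compose_affine[of "\<lambda>z. (0, z)" k u "(x, 0)"] by (simp add: bounded_linear_Pair bounded_linear_zero bounded_linear_ident)

lemma C_k_slice_x: "C_k k u \<Longrightarrow> C_k k (\<lambda>x. u (x, z))"
  using C_k_compose_affine[of "\<lambda>x. (x, 0)" k u "(0, z)"] by (simp add: bounded_linear_Pair bounded_linear_zero bounded_linear_ident)

text \<open>The derivative determines its gradient, so the definite description in
  \<open>grad_z\<close> and \<open>grad_x\<close> has a unique witness for continuously
  differentiable slices.\<close>

lemma gderiv_grad:
  assumes "C_k (Suc 0) f"
  shows "(THE D. GDERIV f z :> D) = grad f z"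
proof (rule the_equality)
  have *: "(f has_derivative (\<lambda>y. y \<bullet> grad f z)) (at z)"
    using C_k_grad(1)[OF assms, of z] by (simp add: inner_commute)
  then show "GDERIV f z :> grad f z" by (simp add: gderiv_def inner_commute)
  fix D assume "GDERIV f z :> D"
  then have "(f has_derivative (\<lambda>y. D \<bullet> y)) (at z)" by (simp add: gderiv_def inner_commute)
  then show "D = grad f z" by (rule grad_eqI[symmetric])
qed

lemma grad_z_eq: "C_k (Suc 0) u \<Longrightarrow> grad_z u (x, z) = grad (\<lambda>z. u (x, z)) z"
  and grad_x_eq: "C_k (Suc 0) u \<Longrightarrow> grad_x u (x, z) = grad (\<lambda>x. u (x, z)) x"
  by (simp_all add: grad_z_def grad_x_def gderiv_grad C_k_slice_z C_k_slice_x del: C_k.simps)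

text \<open>Seeing the partial gradients as components of the full one gives their joint continuity
  in \<open>x\<close> and \<open>z\<close>, hence measurability.\<close>

lemma grad_slices:
  assumes u: "C_k (Suc 0) u"
  shows "grad (\<lambda>z. u (x, z)) z = snd (grad u (x, z))" "grad (\<lambda>x. u (x, z)) x = fst (grad u (x, z))"
proof -
  have "((\<lambda>z. u (x, z)) has_derivative (\<lambda>y. grad u (x, z) \<bullet> (0, y))) (at z)"
    by (rule has_derivative_compose[of "\<lambda>z. (x, z)" _ _ _ u, OF _ C_k_grad(1)[OF u]]) (auto intro!: derivative_eq_intros)
  then have "((\<lambda>z. u (x, z)) has_derivative (\<lambda>y. snd (grad u (x, z)) \<bullet> y)) (at z)"
    by (simp add: inner_prod_def)
  then show "grad (\<lambda>z. u (x, z)) z = snd (grad u (x, z))" by (rule grad_eqI)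
  have "((\<lambda>x. u (x, z)) has_derivative (\<lambda>y. grad u (x, z) \<bullet> (y, 0))) (at x)"
    by (rule has_derivative_compose[of "\<lambda>x. (x, z)" _ _ _ u, OF _ C_k_grad(1)[OF u]]) (auto intro!: derivative_eq_intros)
  then have "((\<lambda>x. u (x, z)) has_derivative (\<lambda>y. fst (grad u (x, z)) \<bullet> y)) (at x)"
    by (simp add: inner_prod_def)
  then show "grad (\<lambda>x. u (x, z)) x = fst (grad u (x, z))" by (rule grad_eqI)
qed

text \<open>Parseval after discarding the imaginary part; the trigonometric sum may be
  complex-valued.\<close>

lemma nn_integral_cell_Re_le:
  fixes B :: "int^'n \<Rightarrow> complex"
  assumes L: "0 < L" and K: "finite K"
  shows "(\<integral>\<^sup>+x. indicator (cell L) x * ennreal ((Re (\<Sum>k\<in>K. B k * wave L k x))\<^sup>2) \<partial>lborel) \<le> ennreal (L ^ CARD('n) * (\<Sum>k\<in>K. (norm (B k))\<^sup>2))"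
proof -
  let ?S = "\<lambda>x. \<Sum>k\<in>K. B k * wave L k x"
  have "(\<integral>\<^sup>+x. indicator (cell L) x * ennreal ((Re (?S x))\<^sup>2) \<partial>lborel) \<le> (\<integral>\<^sup>+x. ennreal (indicator (cell L) x *\<^sub>R (norm (?S x))\<^sup>2) \<partial>lborel)"
  proof (intro nn_integral_mono)
    fix x
    have "(Re (?S x))\<^sup>2 \<le> (norm (?S x))\<^sup>2" by (simp add: cmod_power2)
    then show "indicator (cell L) x * ennreal ((Re (?S x))\<^sup>2) \<le> ennreal (indicator (cell L) x *\<^sub>R (norm (?S x))\<^sup>2)"
      by (auto simp: indicator_def ennreal_leI)
  qed
  also have "\<dots> = ennreal (LINT x:cell L|lborel. (norm (?S x))\<^sup>2)"
    unfolding set_lebesgue_integral_def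
  proof (rule nn_integral_eq_integral)
    show "integrable lborel (\<lambda>x. indicator (cell L) x *\<^sub>R (norm (?S x))\<^sup>2)"
      using set_integrable_cell[of "\<lambda>x. (norm (?S x))\<^sup>2" L] by (simp add: set_integrable_def continuous_intros)
  qed auto
  finally show ?thesis by (simp add: parseval_cell[OF L K])
qed

text \<open>Young's inequality, from the square of \<open>s *\<^sub>R a - b\<close>. With small
  \<open>s\<close> almost nothing is lost on \<open>a\<close>, and the error \<open>b\<close>
  absorbs the large factor.\<close>

lemma square_norm_sum_le:
  fixes a b :: "'a::real_inner"
  assumes s: "0 < s"
  shows "(norm (a + b))\<^sup>2 \<le> (1 + s) * (norm a)\<^sup>2 + (1 + 1 / s) * (norm b)\<^sup>2"
proof -
  have "0 \<le> (norm (s *\<^sub>R a - b))\<^sup>2 / s" using s by simp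
  also have "\<dots> = s * (norm a)\<^sup>2 - 2 * (a \<bullet> b) + (norm b)\<^sup>2 / s"
    using s unfolding power2_norm_eq_inner
    by (simp add: inner_diff_left inner_diff_right inner_commute field_simps)
  finally show ?thesis
    by (simp add: power2_norm_eq_inner inner_add_left inner_add_right inner_commute field_simps)
qed

section \<open>Trigonometric sums with a cutoff in x\<close>

definition freq :: "int^'n \<Rightarrow> real^'n" where
  "freq k = (\<chi> a. real_of_int (k $ a))"

lemma wave_freq: "wave L k x = cis (2 * pi / L * (freq k \<bullet> x))"
  by (simp add: wave_def freq_def inner_vec_def)

text \<open>For a symmetric frequency set and even coefficients the sum is already real, and taking
  the real part changes nothing.\<close>

definition trig_lift :: "real \<Rightarrow> (int^'n) set \<Rightarrow> (int^'n \<Rightarrow> 'b \<Rightarrow> real) \<Rightarrow> real^'n \<Rightarrow> 'b \<Rightarrow> real" where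
  "trig_lift L K G x z = Re (\<Sum>k\<in>K. of_real (G k z) * wave L k x)"

lemma trig_lift_eq: "trig_lift L K G x z = (\<Sum>k\<in>K. G k z * cos (2 * pi / L * (freq k \<bullet> x)))"
  by (simp add: trig_lift_def wave_freq)

locale cutoff_lift =
  fixes L :: real and K :: "(int^'n) set" and G :: "int^'n \<Rightarrow> real^'m \<Rightarrow> real" and \<zeta> :: "real^'n \<Rightarrow> real"
    and R D :: real
  assumes L: "0 < L" and K: "finite K"
    and G: "\<And>j k. k \<in> K \<Longrightarrow> C_k j (G k)" and Gs: "\<And>k z. k \<in> K \<Longrightarrow> norm z > R \<Longrightarrow> G k z = 0"
    and Gr: "\<And>k z z'. k \<in> K \<Longrightarrow> norm z = norm z' \<Longrightarrow> G k z = G k z'"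
    and \<zeta>: "\<And>j. C_k j \<zeta>" and \<zeta>01: "\<And>x. 0 \<le> \<zeta> x" "\<And>x. \<zeta> x \<le> 1" and \<zeta>s: "\<And>x. x \<notin> cell L \<Longrightarrow> \<zeta> x = 0"
    and D: "\<And>x. norm (grad \<zeta> x) \<le> D"
begin

text \<open>Averaging over the translations \<open>t\<close> extracts the mean of the \<open>k\<close>-th power of the trigonometric sum
  in spite of the cutoff.\<close>

definition lift :: "real^'n \<Rightarrow> (real^'n) \<times> (real^'m) \<Rightarrow> real" where
  "lift t p = \<zeta> (fst p) * trig_lift L K G (fst p + t) (snd p)"

lemma C_k_lift: "C_k j (lift t)"
proof -
  have 1: "C_k j (\<lambda>p::(real^'n) \<times> (real^'m). f (fst p))" if "C_k j f" for f
    using C_k_compose_affine[OF bounded_linear_fst that, of 0] by simp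
  have 2: "C_k j (\<lambda>p::(real^'n) \<times> (real^'m). f (snd p))" if "C_k j f" for f
    using C_k_compose_affine[OF bounded_linear_snd that, of 0] by simp
  have "C_k j (\<lambda>x. cos (2 * pi / L * (freq k \<bullet> (x + t))))" for k
  proof (rule C_k_compose_real[of cos _ "\<lambda>x. 2 * pi / L * (freq k \<bullet> (x + t))"])
    show "C_k i (cos :: real \<Rightarrow> real)" for i using C_k_sin_cos by blast
    show "C_k j (\<lambda>x. 2 * pi / L * (freq k \<bullet> (x + t)))"
      unfolding inner_commute[of "freq k"] inner_add_left
      by (intro C_k_mult C_k_const C_k_add C_k_inner_left)
  qed
  then show ?thesis
    unfolding lift_def[abs_def] trig_lift_eq
    by (intro C_k_mult C_k_sum 1 2 G \<zeta>) auto
qed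

lemma lift_support: "lift t p \<noteq> 0 \<Longrightarrow> p \<in> cell L \<times> cball 0 R"
proof (rule ccontr)
  assume nz: "lift t p \<noteq> 0" and "p \<notin> cell L \<times> cball 0 R"
  then consider "fst p \<notin> cell L" | "norm (snd p) > R" by (cases p) auto
  then have "lift t p = 0"
  proof cases
    case 2
    then have "G k (snd p) = 0" if "k \<in> K" for k using Gs that by blast
    then show ?thesis by (simp add: lift_def trig_lift_eq)
  qed (simp add: lift_def \<zeta>s)
  then show False using nz by simp
qed

lemma lift_test: "lift t \<in> test_functions"
proof (rule test_functionsI[OF C_k_lift])
  show "lift t p \<noteq> 0 \<Longrightarrow> p \<in> cell L \<times> cball 0 R" for p by (rule lift_support)
  show "bounded (cell L \<times> cball (0::real^'m) R)"
    by (intro bounded_Times bounded_cball compact_imp_bounded compact_cell)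
qed

lemma lift_radial: "radial_z (lift t)"
  unfolding radial_z_def
proof (intro allI impI)
  fix x and z z' :: "real^'m" assume eq: "norm z = norm z'"
  have "G k z = G k z'" if "k \<in> K" for k using Gr[OF that eq] .
  then show "lift t (x, z) = lift t (x, z')"
    unfolding lift_def trig_lift_eq fst_conv snd_conv by (intro arg_cong[where f = "\<lambda>u. _ * u"] sum.cong refl) simp
qed

lemma grad_\<zeta>_outside: "x \<notin> cell L \<Longrightarrow> grad \<zeta> x = 0"
proof (rule grad_eqI)
  assume x: "x \<notin> cell L"
  have "open (- cell L)" using compact_imp_closed[OF compact_cell] by (simp add: open_closed)
  then have "\<forall>\<^sub>F y in nhds x. y \<in> - cell L" using x by (intro eventually_nhds_in_open) auto
  then have "\<forall>\<^sub>F y in at x. 0 = \<zeta> y"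
    using \<zeta>s by (auto simp: eventually_at_filter elim!: eventually_mono)
  then have "(\<zeta> has_derivative (\<lambda>_. 0)) (at x)"
    by (rule has_derivative_transform_eventually[OF has_derivative_const]) (use \<zeta>s x in auto)
  then show "(\<zeta> has_derivative (\<lambda>y. 0 \<bullet> y)) (at x)" by simp
qed

text \<open>The gradient in \<open>x\<close> of \<open>trig_lift L K G x z\<close>.\<close>

definition Y :: "real^'n \<Rightarrow> real^'m \<Rightarrow> real^'n" where
  "Y x z = (\<Sum>k\<in>K. (- (G k z * sin (2 * pi / L * (freq k \<bullet> x)) * (2 * pi / L))) *\<^sub>R freq k)"

lemma grad_z_lift: "grad_z (lift t) (x, z) = \<zeta> x *\<^sub>R (\<Sum>k\<in>K. cos (2 * pi / L * (freq k \<bullet> (x + t))) *\<^sub>R grad (G k) z)"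
proof -
  have "((\<lambda>z. lift t (x, z)) has_derivative (\<lambda>y. \<zeta> x * (\<Sum>k\<in>K. (grad (G k) z \<bullet> y) * cos (2 * pi / L * (freq k \<bullet> (x + t)))))) (at z)"
    unfolding lift_def trig_lift_eq fst_conv snd_conv
    by (intro has_derivative_mult_right has_derivative_sum has_derivative_mult_left C_k_grad(1) G)
  then have "((\<lambda>z. lift t (x, z)) has_derivative (\<lambda>y. (\<zeta> x *\<^sub>R (\<Sum>k\<in>K. cos (2 * pi / L * (freq k \<bullet> (x + t))) *\<^sub>R grad (G k) z)) \<bullet> y)) (at z)"
    by (simp add: inner_sum_left mult.commute)
  then show ?thesis unfolding grad_z_eq[OF C_k_lift] by (rule grad_eqI)
qed

lemma grad_x_lift: "grad_x (lift t) (x, z) = trig_lift L K G (x + t) z *\<^sub>R grad \<zeta> x + \<zeta> x *\<^sub>R Y (x + t) z"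
proof -
  have "((\<lambda>x. trig_lift L K G (x + t) z) has_derivative (\<lambda>y. \<Sum>k\<in>K. G k z * (- sin (2 * pi / L * (freq k \<bullet> (x + t))) * (2 * pi / L * (freq k \<bullet> y))))) (at x)"
    unfolding trig_lift_eq using L
    by (auto intro!: derivative_eq_intros sum.cong simp: algebra_simps)
  then have "((\<lambda>x. trig_lift L K G (x + t) z) has_derivative (\<lambda>y. Y (x + t) z \<bullet> y)) (at x)"
    by (simp add: Y_def inner_sum_left mult_ac sum_negf)
  from has_derivative_mult[OF C_k_grad(1)[OF \<zeta>] this]
  have "((\<lambda>x. lift t (x, z)) has_derivative (\<lambda>y. (trig_lift L K G (x + t) z *\<^sub>R grad \<zeta> x + \<zeta> x *\<^sub>R Y (x + t) z) \<bullet> y)) (at x)"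
    by (simp add: lift_def inner_add_left algebra_simps)
  then show ?thesis unfolding grad_x_eq[OF C_k_lift] by (rule grad_eqI)
qed

text \<open>A translation multiplies the coefficients by numbers of modulus 1, so every bound by
  Parseval is the same for all \<open>t\<close>.\<close>

lemma shift_wave: "(\<Sum>k\<in>K. B k * wave L k (x + t)) = (\<Sum>k\<in>K. (B k * wave L k t) * wave L k x)"
  by (simp add: wave_add_arg mult_ac)

text \<open>The cutoff does not depend on \<open>z\<close> and is at most 1, so Parseval applies to
  each component of the gradient.\<close>

lemma grad_z_lift_integral:
  "(\<integral>\<^sup>+x. ennreal ((norm (grad_z (lift t) (x, z)))\<^sup>2) \<partial>lborel) \<le> ennreal (L ^ CARD('n) * (\<Sum>k\<in>K. (norm (grad (G k) z))\<^sup>2))"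
proof -
  let ?B = "\<lambda>b k. of_real (grad (G k) z \<bullet> b) * wave L k t"
  have pt: "ennreal ((norm (grad_z (lift t) (x, z)))\<^sup>2) \<le> (\<Sum>b\<in>Basis. indicator (cell L) x * ennreal ((Re (\<Sum>k\<in>K. ?B b k * wave L k x))\<^sup>2))" for x
  proof (cases "x \<in> cell L")
    case True
    let ?v = "\<Sum>k\<in>K. cos (2 * pi / L * (freq k \<bullet> (x + t))) *\<^sub>R grad (G k) z"
    have v: "?v \<bullet> b = Re (\<Sum>k\<in>K. ?B b k * wave L k x)" for b
      unfolding shift_wave[symmetric] by (simp add: inner_sum_left wave_freq mult.commute)
    have "norm (\<zeta> x *\<^sub>R ?v) \<le> norm ?v"
      using \<zeta>01[of x] mult_right_mono[of "\<zeta> x" 1 "norm ?v"] by simp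
    then have "(norm (grad_z (lift t) (x, z)))\<^sup>2 \<le> (norm ?v)\<^sup>2"
      unfolding grad_z_lift by (intro power_mono) auto
    also have "\<dots> = (\<Sum>b\<in>Basis. (Re (\<Sum>k\<in>K. ?B b k * wave L k x))\<^sup>2)"
      unfolding power2_norm_eq_inner by (subst euclidean_inner) (simp only: v power2_eq_square)
    finally show ?thesis using True by (simp add: ennreal_leI sum_ennreal)
  qed (simp add: grad_z_lift \<zeta>s)
  have "(\<integral>\<^sup>+x. ennreal ((norm (grad_z (lift t) (x, z)))\<^sup>2) \<partial>lborel)
      \<le> (\<integral>\<^sup>+x. (\<Sum>b\<in>Basis. indicator (cell L) x * ennreal ((Re (\<Sum>k\<in>K. ?B b k * wave L k x))\<^sup>2)) \<partial>lborel)"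
    by (intro nn_integral_mono pt)
  also have "\<dots> = (\<Sum>b\<in>Basis. \<integral>\<^sup>+x. indicator (cell L) x * ennreal ((Re (\<Sum>k\<in>K. ?B b k * wave L k x))\<^sup>2) \<partial>lborel)"
    by (rule nn_integral_sum) measurable
  also have "\<dots> \<le> (\<Sum>b\<in>(Basis::(real^'m) set). ennreal (L ^ CARD('n) * (\<Sum>k\<in>K. (norm (?B b k))\<^sup>2)))"
    by (intro sum_mono nn_integral_cell_Re_le L K)
  also have "\<dots> = ennreal (\<Sum>b\<in>(Basis::(real^'m) set). L ^ CARD('n) * (\<Sum>k\<in>K. (norm (?B b k))\<^sup>2))"
    using L by (intro sum_ennreal mult_nonneg_nonneg sum_nonneg) auto
  also have "(\<Sum>b\<in>(Basis::(real^'m) set). L ^ CARD('n) * (\<Sum>k\<in>K. (norm (?B b k))\<^sup>2)) = L ^ CARD('n) * (\<Sum>k\<in>K. (norm (grad (G k) z))\<^sup>2)"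
  proof -
    have "(norm (grad (G k) z))\<^sup>2 = (\<Sum>b\<in>Basis. (norm (?B b k))\<^sup>2)" for k
      unfolding power2_norm_eq_inner[of "grad (G k) z"] by (subst euclidean_inner) (simp add: norm_mult power2_eq_square)
    then show ?thesis by (simp add: sum_distrib_left[symmetric]) (subst sum.swap, simp)
  qed
  finally show ?thesis .
qed

text \<open>The product rule gives a term from the trigonometric sum and a term from the cutoff.
  Young's inequality separates them: the former is evaluated by Parseval with the frequencies as
  factors, the latter by \<open>D\<close> and Parseval without them.\<close>

lemma grad_x_lift_integral:
  assumes s: "0 < s"
  shows "(\<integral>\<^sup>+x. ennreal ((norm (grad_x (lift t) (x, z)))\<^sup>2) \<partial>lborel)
    \<le> ennreal (L ^ CARD('n) * ((1 + s) * (\<Sum>k\<in>K. (2 * pi / L)\<^sup>2 * (norm (freq k))\<^sup>2 * (G k z)\<^sup>2) + (1 + 1 / s) * D\<^sup>2 * (\<Sum>k\<in>K. (G k z)\<^sup>2)))"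
proof -
  let ?B = "\<lambda>b k. \<i> * of_real (G k z * (2 * pi / L) * (freq k \<bullet> b)) * wave L k t" and ?A = "\<lambda>k. of_real (G k z) * wave L k t"
  let ?I = "indicator (cell L) :: real^'n \<Rightarrow> ennreal"
  have D0: "0 \<le> D" using D[of 0] norm_ge_zero[of "grad \<zeta> 0"] by linarith
  have pt: "ennreal ((norm (grad_x (lift t) (x, z)))\<^sup>2) \<le> ennreal (1 + s) * (\<Sum>b\<in>Basis. ?I x * ennreal ((Re (\<Sum>k\<in>K. ?B b k * wave L k x))\<^sup>2))
      + ennreal ((1 + 1 / s) * D\<^sup>2) * (?I x * ennreal ((Re (\<Sum>k\<in>K. ?A k * wave L k x))\<^sup>2))" for x
  proof (cases "x \<in> cell L")
    case True
    have Yb: "Y (x + t) z \<bullet> b = Re (\<Sum>k\<in>K. ?B b k * wave L k x)" for b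
      unfolding shift_wave[symmetric] Y_def by (simp add: inner_sum_left wave_freq mult_ac sum_negf)
    have tl: "trig_lift L K G (x + t) z = Re (\<Sum>k\<in>K. ?A k * wave L k x)"
      unfolding trig_lift_def shift_wave ..
    have "norm (\<zeta> x *\<^sub>R Y (x + t) z) \<le> norm (Y (x + t) z)"
      using \<zeta>01[of x] mult_right_mono[of "\<zeta> x" 1 "norm (Y (x + t) z)"] by simp
    then have 1: "(norm (\<zeta> x *\<^sub>R Y (x + t) z))\<^sup>2 \<le> (norm (Y (x + t) z))\<^sup>2" by (intro power_mono) auto
    have "norm (trig_lift L K G (x + t) z *\<^sub>R grad \<zeta> x) \<le> D * \<bar>trig_lift L K G (x + t) z\<bar>"
      using mult_right_mono[OF D[of x], of "\<bar>trig_lift L K G (x + t) z\<bar>"] by (simp add: mult.commute)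
    then have "(norm (trig_lift L K G (x + t) z *\<^sub>R grad \<zeta> x))\<^sup>2 \<le> (D * \<bar>trig_lift L K G (x + t) z\<bar>)\<^sup>2"
      by (intro power_mono) auto
    then have 2: "(norm (trig_lift L K G (x + t) z *\<^sub>R grad \<zeta> x))\<^sup>2 \<le> D\<^sup>2 * (trig_lift L K G (x + t) z)\<^sup>2"
      by (simp add: power_mult_distrib)
    have "(norm (grad_x (lift t) (x, z)))\<^sup>2 \<le> (1 + s) * (norm (\<zeta> x *\<^sub>R Y (x + t) z))\<^sup>2 + (1 + 1 / s) * (norm (trig_lift L K G (x + t) z *\<^sub>R grad \<zeta> x))\<^sup>2"
      unfolding grad_x_lift add.commute[of "trig_lift L K G (x + t) z *\<^sub>R grad \<zeta> x"] by (rule square_norm_sum_le[OF s])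
    also have "\<dots> \<le> (1 + s) * (norm (Y (x + t) z))\<^sup>2 + (1 + 1 / s) * (D\<^sup>2 * (trig_lift L K G (x + t) z)\<^sup>2)"
      using s 1 2 by (intro add_mono mult_left_mono) auto
    also have "(norm (Y (x + t) z))\<^sup>2 = (\<Sum>b\<in>Basis. (Re (\<Sum>k\<in>K. ?B b k * wave L k x))\<^sup>2)"
      unfolding power2_norm_eq_inner by (subst euclidean_inner) (simp only: Yb power2_eq_square)
    finally have "ennreal ((norm (grad_x (lift t) (x, z)))\<^sup>2) \<le> ennreal ((1 + s) * (\<Sum>b\<in>Basis. (Re (\<Sum>k\<in>K. ?B b k * wave L k x))\<^sup>2)
        + (1 + 1 / s) * D\<^sup>2 * (Re (\<Sum>k\<in>K. ?A k * wave L k x))\<^sup>2)"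
      unfolding tl by (simp add: ennreal_leI mult.assoc)
    also have "\<dots> = ennreal (1 + s) * ennreal (\<Sum>b\<in>Basis. (Re (\<Sum>k\<in>K. ?B b k * wave L k x))\<^sup>2)
        + ennreal ((1 + 1 / s) * D\<^sup>2) * ennreal ((Re (\<Sum>k\<in>K. ?A k * wave L k x))\<^sup>2)"
    proof -
      have p: "0 \<le> 1 + s" "0 \<le> (1 + 1 / s) * D\<^sup>2" using s by auto
      show ?thesis
        unfolding ennreal_mult'[OF p(1), symmetric] ennreal_mult'[OF p(2), symmetric]
        by (intro ennreal_plus mult_nonneg_nonneg sum_nonneg zero_le_power2 p)
    qed
    finally show ?thesis using True by (simp only: indicator_simps mult_1_left sum_ennreal zero_le_power2)
  qed (simp add: grad_x_lift \<zeta>s grad_\<zeta>_outside)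
  have "(\<integral>\<^sup>+x. ennreal ((norm (grad_x (lift t) (x, z)))\<^sup>2) \<partial>lborel)
      \<le> (\<integral>\<^sup>+x. ennreal (1 + s) * (\<Sum>b\<in>Basis. ?I x * ennreal ((Re (\<Sum>k\<in>K. ?B b k * wave L k x))\<^sup>2))
      + ennreal ((1 + 1 / s) * D\<^sup>2) * (?I x * ennreal ((Re (\<Sum>k\<in>K. ?A k * wave L k x))\<^sup>2)) \<partial>lborel)"
    by (intro nn_integral_mono pt)
  also have "\<dots> = ennreal (1 + s) * (\<Sum>b\<in>Basis. \<integral>\<^sup>+x. ?I x * ennreal ((Re (\<Sum>k\<in>K. ?B b k * wave L k x))\<^sup>2) \<partial>lborel)
      + ennreal ((1 + 1 / s) * D\<^sup>2) * (\<integral>\<^sup>+x. ?I x * ennreal ((Re (\<Sum>k\<in>K. ?A k * wave L k x))\<^sup>2) \<partial>lborel)"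
    by (subst nn_integral_add, measurable, subst nn_integral_cmult, measurable, subst nn_integral_cmult, measurable, subst nn_integral_sum, measurable)
  also have "\<dots> \<le> ennreal (1 + s) * (\<Sum>b\<in>(Basis::(real^'n) set). ennreal (L ^ CARD('n) * (\<Sum>k\<in>K. (norm (?B b k))\<^sup>2)))
      + ennreal ((1 + 1 / s) * D\<^sup>2) * ennreal (L ^ CARD('n) * (\<Sum>k\<in>K. (norm (?A k))\<^sup>2))"
    by (intro add_mono mult_left_mono sum_mono nn_integral_cell_Re_le L K) auto
  also have "(\<Sum>b\<in>(Basis::(real^'n) set). ennreal (L ^ CARD('n) * (\<Sum>k\<in>K. (norm (?B b k))\<^sup>2))) = ennreal (\<Sum>b\<in>(Basis::(real^'n) set). L ^ CARD('n) * (\<Sum>k\<in>K. (norm (?B b k))\<^sup>2))"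
    using L by (intro sum_ennreal mult_nonneg_nonneg sum_nonneg) auto
  also have "(\<Sum>b\<in>(Basis::(real^'n) set). L ^ CARD('n) * (\<Sum>k\<in>K. (norm (?B b k))\<^sup>2)) = L ^ CARD('n) * (\<Sum>k\<in>K. (2 * pi / L)\<^sup>2 * (norm (freq k))\<^sup>2 * (G k z)\<^sup>2)"
  proof -
    have "(2 * pi / L)\<^sup>2 * (norm (freq k))\<^sup>2 * (G k z)\<^sup>2 = (\<Sum>b\<in>Basis. (norm (?B b k))\<^sup>2)" for k
      unfolding power2_norm_eq_inner[of "freq k"] euclidean_inner[of "freq k" "freq k"]
    proof -
      have "(norm (?B b k))\<^sup>2 = (G k z * (2 * pi / L) * (freq k \<bullet> b))\<^sup>2" for b
        by (simp only: norm_mult[of "\<i> * _"] norm_mult[of "\<i>"] norm_ii norm_of_real norm_wave mult_1_left mult_1_right power2_abs)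
      then show "(2 * pi / L)\<^sup>2 * (\<Sum>b\<in>Basis. (freq k \<bullet> b) * (freq k \<bullet> b)) * (G k z)\<^sup>2 = (\<Sum>b\<in>Basis. (norm (?B b k))\<^sup>2)"
        by (simp only:) (simp add: sum_distrib_left sum_distrib_right sum_divide_distrib power2_eq_square mult_ac)
    qed
    then show ?thesis by (simp only: sum_distrib_left[symmetric]) (subst sum.swap, simp)
  qed
  also have "ennreal (1 + s) * ennreal (L ^ CARD('n) * (\<Sum>k\<in>K. (2 * pi / L)\<^sup>2 * (norm (freq k))\<^sup>2 * (G k z)\<^sup>2))
      + ennreal ((1 + 1 / s) * D\<^sup>2) * ennreal (L ^ CARD('n) * (\<Sum>k\<in>K. (norm (?A k))\<^sup>2))
    = ennreal (L ^ CARD('n) * ((1 + s) * (\<Sum>k\<in>K. (2 * pi / L)\<^sup>2 * (norm (freq k))\<^sup>2 * (G k z)\<^sup>2) + (1 + 1 / s) * D\<^sup>2 * (\<Sum>k\<in>K. (G k z)\<^sup>2)))"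
  proof -
    let ?X = "\<Sum>k\<in>K. (2 * pi / L)\<^sup>2 * (norm (freq k))\<^sup>2 * (G k z)\<^sup>2" and ?Z = "\<Sum>k\<in>K. (G k z)\<^sup>2"
    have nA: "(\<Sum>k\<in>K. (norm (?A k))\<^sup>2) = ?Z" by (simp add: norm_mult)
    have "0 \<le> ?X" "0 \<le> ?Z" by (auto intro!: sum_nonneg)
    then have "0 \<le> (1 + s) * (L ^ CARD('n) * ?X)" "0 \<le> (1 + 1 / s) * D\<^sup>2 * (L ^ CARD('n) * ?Z)"
      using s L by auto
    then have "ennreal ((1 + s) * (L ^ CARD('n) * ?X)) + ennreal ((1 + 1 / s) * D\<^sup>2 * (L ^ CARD('n) * ?Z))
       = ennreal (L ^ CARD('n) * ((1 + s) * ?X + (1 + 1 / s) * D\<^sup>2 * ?Z))"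
      by (subst ennreal_plus[symmetric]) (auto simp: algebra_simps)
    moreover have "0 \<le> 1 + s" "0 \<le> (1 + 1 / s) * D\<^sup>2" using s by auto
    ultimately show ?thesis unfolding nA by (simp only: ennreal_mult'[symmetric])
  qed
  finally show ?thesis .
qed

end

text \<open>The Sobolev inequality for one function, raised to the power p/2 and stated with
  nonnegative integrals. Quantifying over upper bounds \<open>E\<close> of the energy lets it be
  applied to estimates of the energy.\<close>

definition sob :: "real \<Rightarrow> real \<Rightarrow> nat \<Rightarrow> (('n::finite, 'm::finite) point \<Rightarrow> real) \<Rightarrow> bool" where
  "sob \<tau> S p \<psi> \<longleftrightarrow> (\<forall>E\<ge>0. (\<integral>\<^sup>+q. ennreal (energy_density \<tau> (grad_z \<psi>) (grad_x \<psi>) q) \<partial>lborel) \<le> ennreal E \<longrightarrow>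
     (\<integral>\<^sup>+q. ennreal (\<bar>\<psi> q\<bar> ^ p) \<partial>lborel) \<le> ennreal ((E / S) powr (real p / 2)))"

lemma nn_integral_lborel_pair:
  fixes f :: "'a::euclidean_space \<times> 'b::euclidean_space \<Rightarrow> ennreal"
  assumes "f \<in> borel_measurable borel"
  shows "(\<integral>\<^sup>+p. f p \<partial>lborel) = (\<integral>\<^sup>+z. \<integral>\<^sup>+x. f (x, z) \<partial>lborel \<partial>lborel)"
    and "(\<integral>\<^sup>+p. f p \<partial>lborel) = (\<integral>\<^sup>+x. \<integral>\<^sup>+z. f (x, z) \<partial>lborel \<partial>lborel)"
proof -
  have m: "f \<in> borel_measurable (lborel \<Otimes>\<^sub>M lborel)"
    using assms by (simp add: lborel_prod)
  show "(\<integral>\<^sup>+p. f p \<partial>lborel) = (\<integral>\<^sup>+z. \<integral>\<^sup>+x. f (x, z) \<partial>lborel \<partial>lborel)"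
    using lborel_pair.nn_integral_snd[OF m] by (simp add: lborel_prod)
  show "(\<integral>\<^sup>+p. f p \<partial>lborel) = (\<integral>\<^sup>+x. \<integral>\<^sup>+z. f (x, z) \<partial>lborel \<partial>lborel)"
    using lborel.nn_integral_fst[OF m] by (simp add: lborel_prod)
qed

lemma continuous_on_grads:
  assumes u: "C_k (Suc 0) u"
  shows "continuous_on UNIV (grad_z u)" "continuous_on UNIV (grad_x u)"
proof -
  have "grad_z u = (\<lambda>p. snd (grad u p))" "grad_x u = (\<lambda>p. fst (grad u p))"
    using grad_z_eq[OF u] grad_x_eq[OF u] grad_slices[OF u] by (auto simp: fun_eq_iff)
  then show "continuous_on UNIV (grad_z u)" "continuous_on UNIV (grad_x u)"
    using C_k_grad(2)[OF u] by (auto intro!: continuous_intros)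
qed

lemma grads_measurable:
  assumes u: "C_k (Suc 0) u"
  shows "grad_z u \<in> borel_measurable borel" "grad_x u \<in> borel_measurable borel"
  using continuous_on_grads[OF u] by (auto intro: borel_measurable_continuous_onI)

lemma energy_density_measurable:
  fixes g :: "('a::finite, 'b::finite) point \<Rightarrow> real^'b" and h :: "('a, 'b) point \<Rightarrow> real^'a"
  assumes [measurable]: "g \<in> borel_measurable borel" "h \<in> borel_measurable borel"
  shows "energy_density \<tau> g h \<in> borel_measurable borel"
proof -
  have [measurable]: "(\<lambda>p::('a, 'b) point. norm (snd p)) \<in> borel_measurable borel"
    by (intro borel_measurable_continuous_onI continuous_intros)
  show ?thesis unfolding energy_density_def[abs_def] by measurable
qed

lemma energy_density_nonneg: "0 \<le> energy_density \<tau> g h p"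
  by (simp add: energy_density_def)

section \<open>Energy and Sobolev inequality of the lift\<close>

context cutoff_lift
begin

text \<open>The numbers \<alpha>, \<beta> and \<gamma> bound the z-energy, the x-energy and the
  weighted square of the coefficients, each per unit volume of the cell. Only the gradient of the
  cutoff brings in \<gamma>, which therefore carries the factor \<open>D\<^sup>2\<close>.\<close>

lemma energy_lift:
  assumes s: "0 < s" and nn: "0 \<le> \<alpha>" "0 \<le> \<beta>" "0 \<le> \<gamma>"
    and \<alpha>: "(\<Sum>k\<in>K. \<integral>\<^sup>+z. ennreal ((norm (grad (G k) z))\<^sup>2) \<partial>lborel) \<le> ennreal \<alpha>"
    and \<beta>: "(\<integral>\<^sup>+z. ennreal (norm z powr (2 * \<tau>) * (\<Sum>k\<in>K. (2 * pi / L)\<^sup>2 * (norm (freq k))\<^sup>2 * (G k z)\<^sup>2)) \<partial>lborel) \<le> ennreal \<beta>"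
    and \<gamma>: "(\<integral>\<^sup>+z. ennreal (norm z powr (2 * \<tau>) * (\<Sum>k\<in>K. (G k z)\<^sup>2)) \<partial>lborel) \<le> ennreal \<gamma>"
  shows "(\<integral>\<^sup>+q. ennreal (energy_density \<tau> (grad_z (lift t)) (grad_x (lift t)) q) \<partial>lborel)
    \<le> ennreal (L ^ CARD('n) * (\<alpha> + (\<tau> + 1)\<^sup>2 * ((1 + s) * \<beta> + (1 + 1 / s) * D\<^sup>2 * \<gamma>)))"
proof -
  let ?w = "\<lambda>z::real^'m. norm z powr (2 * \<tau>)" and ?V = "L ^ CARD('n)"
  let ?X = "\<lambda>z. \<Sum>k\<in>K. (2 * pi / L)\<^sup>2 * (norm (freq k))\<^sup>2 * (G k z)\<^sup>2" and ?Z = "\<lambda>z. \<Sum>k\<in>K. (G k z)\<^sup>2"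
  note [measurable] = grads_measurable[OF C_k_lift[of "Suc 0" t]]
  have V: "0 \<le> ?V" using L by simp
  have X0: "0 \<le> ?X z" and Z0: "0 \<le> ?Z z" for z by (auto intro!: sum_nonneg)
  have [measurable]: "energy_density \<tau> (grad_z (lift t)) (grad_x (lift t)) \<in> borel_measurable borel"
    by (intro energy_density_measurable) measurable
  have Gm: "G k \<in> borel_measurable borel" and gm: "grad (G k) \<in> borel_measurable borel" if "k \<in> K" for k
    using C_k_continuous[OF G[OF that, of 0]] C_k_grad(2)[OF G[OF that]]
    by (auto intro: borel_measurable_continuous_onI)
  note [measurable] = Gm gm
  have c0: "0 \<le> (\<tau> + 1)\<^sup>2" by simp
  have pt: "(\<integral>\<^sup>+x. ennreal (energy_density \<tau> (grad_z (lift t)) (grad_x (lift t)) (x, z)) \<partial>lborel)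
    \<le> ennreal ?V * (\<Sum>k\<in>K. ennreal ((norm (grad (G k) z))\<^sup>2)) + (ennreal (?V * (\<tau> + 1)\<^sup>2 * (1 + s)) * ennreal (?w z * ?X z) + ennreal (?V * (\<tau> + 1)\<^sup>2 * ((1 + 1 / s) * D\<^sup>2)) * ennreal (?w z * ?Z z))" for z
  proof -
    have "(\<integral>\<^sup>+x. ennreal (energy_density \<tau> (grad_z (lift t)) (grad_x (lift t)) (x, z)) \<partial>lborel)
      = (\<integral>\<^sup>+x. ennreal ((norm (grad_z (lift t) (x, z)))\<^sup>2) + ennreal ((\<tau> + 1)\<^sup>2 * ?w z) * ennreal ((norm (grad_x (lift t) (x, z)))\<^sup>2) \<partial>lborel)"
      by (intro nn_integral_cong) (simp add: energy_density_def ennreal_mult'[symmetric])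
    also have "\<dots> = (\<integral>\<^sup>+x. ennreal ((norm (grad_z (lift t) (x, z)))\<^sup>2) \<partial>lborel) + ennreal ((\<tau> + 1)\<^sup>2 * ?w z) * (\<integral>\<^sup>+x. ennreal ((norm (grad_x (lift t) (x, z)))\<^sup>2) \<partial>lborel)"
      by (subst nn_integral_add, measurable, subst nn_integral_cmult, measurable)
    also have "\<dots> \<le> ennreal (?V * (\<Sum>k\<in>K. (norm (grad (G k) z))\<^sup>2)) + ennreal ((\<tau> + 1)\<^sup>2 * ?w z) * ennreal (?V * ((1 + s) * ?X z + (1 + 1 / s) * D\<^sup>2 * ?Z z))"
      by (intro add_mono mult_left_mono grad_z_lift_integral grad_x_lift_integral s) auto
    also have "ennreal (?V * (\<Sum>k\<in>K. (norm (grad (G k) z))\<^sup>2)) = ennreal ?V * (\<Sum>k\<in>K. ennreal ((norm (grad (G k) z))\<^sup>2))"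
      using V by (simp add: ennreal_mult' sum_ennreal)
    also have "ennreal ((\<tau> + 1)\<^sup>2 * ?w z) * ennreal (?V * ((1 + s) * ?X z + (1 + 1 / s) * D\<^sup>2 * ?Z z))
      = ennreal (?V * (\<tau> + 1)\<^sup>2 * (1 + s)) * ennreal (?w z * ?X z) + ennreal (?V * (\<tau> + 1)\<^sup>2 * ((1 + 1 / s) * D\<^sup>2)) * ennreal (?w z * ?Z z)"
    proof -
      have "ennreal ((\<tau> + 1)\<^sup>2 * ?w z) * ennreal (?V * ((1 + s) * ?X z + (1 + 1 / s) * D\<^sup>2 * ?Z z))
        = ennreal ((\<tau> + 1)\<^sup>2 * ?w z * (?V * ((1 + s) * ?X z + (1 + 1 / s) * D\<^sup>2 * ?Z z)))"
        by (rule ennreal_mult'[symmetric]) simp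
      also have "(\<tau> + 1)\<^sup>2 * ?w z * (?V * ((1 + s) * ?X z + (1 + 1 / s) * D\<^sup>2 * ?Z z))
         = ?V * (\<tau> + 1)\<^sup>2 * (1 + s) * (?w z * ?X z) + ?V * (\<tau> + 1)\<^sup>2 * ((1 + 1 / s) * D\<^sup>2) * (?w z * ?Z z)"
        by algebra
      also have "ennreal \<dots> = ennreal (?V * (\<tau> + 1)\<^sup>2 * (1 + s)) * ennreal (?w z * ?X z) + ennreal (?V * (\<tau> + 1)\<^sup>2 * ((1 + 1 / s) * D\<^sup>2)) * ennreal (?w z * ?Z z)"
      proof -
        have n: "0 \<le> ?V * (\<tau> + 1)\<^sup>2 * (1 + s)" "0 \<le> ?V * (\<tau> + 1)\<^sup>2 * ((1 + 1 / s) * D\<^sup>2)"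
          using s V by auto
        show ?thesis
          unfolding ennreal_mult'[OF n(1), symmetric] ennreal_mult'[OF n(2), symmetric]
          by (intro ennreal_plus mult_nonneg_nonneg n X0 Z0 powr_ge_zero)
      qed
      finally show ?thesis .
    qed
    finally show ?thesis .
  qed
  have "(\<integral>\<^sup>+q. ennreal (energy_density \<tau> (grad_z (lift t)) (grad_x (lift t)) q) \<partial>lborel)
    = (\<integral>\<^sup>+z. \<integral>\<^sup>+x. ennreal (energy_density \<tau> (grad_z (lift t)) (grad_x (lift t)) (x, z)) \<partial>lborel \<partial>lborel)"
    by (rule nn_integral_lborel_pair) measurable
  also have "\<dots> \<le> (\<integral>\<^sup>+z. ennreal ?V * (\<Sum>k\<in>K. ennreal ((norm (grad (G k) z))\<^sup>2)) + (ennreal (?V * (\<tau> + 1)\<^sup>2 * (1 + s)) * ennreal (?w z * ?X z) + ennreal (?V * (\<tau> + 1)\<^sup>2 * ((1 + 1 / s) * D\<^sup>2)) * ennreal (?w z * ?Z z)) \<partial>lborel)"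
    by (intro nn_integral_mono pt)
  also have "\<dots> = ennreal ?V * (\<Sum>k\<in>K. \<integral>\<^sup>+z. ennreal ((norm (grad (G k) z))\<^sup>2) \<partial>lborel) + (ennreal (?V * (\<tau> + 1)\<^sup>2 * (1 + s)) * (\<integral>\<^sup>+z. ennreal (?w z * ?X z) \<partial>lborel) + ennreal (?V * (\<tau> + 1)\<^sup>2 * ((1 + 1 / s) * D\<^sup>2)) * (\<integral>\<^sup>+z. ennreal (?w z * ?Z z) \<partial>lborel))"
    by (subst nn_integral_add, measurable, subst nn_integral_add, measurable, subst nn_integral_cmult, measurable,
        subst nn_integral_cmult, measurable, subst nn_integral_cmult, measurable, subst nn_integral_sum, measurable)
  also have "\<dots> \<le> ennreal ?V * ennreal \<alpha> + (ennreal (?V * (\<tau> + 1)\<^sup>2 * (1 + s)) * ennreal \<beta> + ennreal (?V * (\<tau> + 1)\<^sup>2 * ((1 + 1 / s) * D\<^sup>2)) * ennreal \<gamma>)"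
    by (intro add_mono mult_left_mono \<alpha> \<beta> \<gamma>) auto
  also have "\<dots> = ennreal (?V * (\<alpha> + (\<tau> + 1)\<^sup>2 * ((1 + s) * \<beta> + (1 + 1 / s) * D\<^sup>2 * \<gamma>)))"
  proof -
    have n: "0 \<le> ?V * (\<tau> + 1)\<^sup>2 * (1 + s)" "0 \<le> ?V * (\<tau> + 1)\<^sup>2 * ((1 + 1 / s) * D\<^sup>2)"
      using s V by auto
    have "ennreal ?V * ennreal \<alpha> + (ennreal (?V * (\<tau> + 1)\<^sup>2 * (1 + s)) * ennreal \<beta> + ennreal (?V * (\<tau> + 1)\<^sup>2 * ((1 + 1 / s) * D\<^sup>2)) * ennreal \<gamma>)
      = ennreal (?V * \<alpha> + (?V * (\<tau> + 1)\<^sup>2 * (1 + s) * \<beta> + ?V * (\<tau> + 1)\<^sup>2 * ((1 + 1 / s) * D\<^sup>2) * \<gamma>))"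
      unfolding ennreal_mult'[OF n(1), symmetric] ennreal_mult'[OF n(2), symmetric] ennreal_mult'[OF V, symmetric]
      using n nn V by (simp add: ennreal_plus[symmetric] del: ennreal_plus)
    then show ?thesis by (simp add: algebra_simps)
  qed
  finally show ?thesis .
qed

text \<open>Integration over a period selects the tuples with zero sum, for which the phases caused
  by the base point \<open>x\<close> multiply to 1; so the result does not depend on
  \<open>x\<close>. Absolute values can only increase the left-hand integral.\<close>

lemma lift_power_lower:
  assumes Ksym: "uminus ` K = K" and Gsym: "\<And>k z. k \<in> K \<Longrightarrow> G (- k) z = G k z" and G0: "\<And>k z. k \<in> K \<Longrightarrow> 0 \<le> G k z"
  shows "ennreal (L ^ CARD('n) * (\<Sum>\<phi>\<in>{\<phi> \<in> PiE {..<p} (\<lambda>_. K). (\<Sum>i<p. \<phi> i) = 0}. \<Prod>i<p. G (\<phi> i) z))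
    \<le> (\<integral>\<^sup>+t. indicator (cell L) t * ennreal (\<bar>trig_lift L K G (x + t) z\<bar> ^ p) \<partial>lborel)"
proof -
  let ?J = "\<Sum>\<phi>\<in>{\<phi> \<in> PiE {..<p} (\<lambda>_. K). (\<Sum>i<p. \<phi> i) = 0}. \<Prod>i<p. G (\<phi> i) z"
  let ?T = "\<lambda>t. trig_lift L K G (x + t) z"
  \<comment> \<open>The substitution of \<open>- k\<close> for \<open>k\<close> preserves
    \<open>K\<close> and the coefficients, so the sum equals its complex conjugate.\<close>
  have real: "of_real (?T t) = (\<Sum>k\<in>K. (of_real (G k z) * wave L k x) * wave L k t)" for t
  proof -
    let ?s = "\<Sum>k\<in>K. of_real (G k z) * wave L k (x + t)"
    have "cnj ?s = (\<Sum>k\<in>K. of_real (G (- k) z) * wave L (- k) (x + t))"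
      by (simp add: wave_uminus_index Gsym)
    also have "\<dots> = (\<Sum>k\<in>uminus ` K. of_real (G k z) * wave L k (x + t))"
      by (subst sum.reindex) auto
    finally have "cnj ?s = ?s" by (simp only: Ksym)
    then have "of_real (Re ?s) = ?s" by (simp only: Reals_cnj_iff[symmetric] of_real_Re)
    then show ?thesis by (simp add: trig_lift_def wave_add_arg mult_ac)
  qed
  have Tc: "continuous_on UNIV ?T"
    unfolding trig_lift_eq by (intro continuous_intros)
  have "of_real (LINT t:cell L|lborel. (?T t) ^ p) = (LINT t:cell L|lborel. of_real ((?T t) ^ p) :: complex)"
    by (simp add: set_lebesgue_integral_def scaleR_conv_of_real flip: integral_complex_of_real)
  also have "\<dots> = (LINT t:cell L|lborel. (\<Sum>k\<in>K. (of_real (G k z) * wave L k x) * wave L k t) ^ p)"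
    by (simp add: real)
  also have "\<dots> = of_real (L ^ CARD('n)) * (\<Sum>\<phi>\<in>{\<phi> \<in> PiE {..<p} (\<lambda>_. K). (\<Sum>i<p. \<phi> i) = 0}. \<Prod>i<p. of_real (G (\<phi> i) z) * wave L (\<phi> i) x)"
    by (rule power_cell[OF L K])
  also have "(\<Sum>\<phi>\<in>{\<phi> \<in> PiE {..<p} (\<lambda>_. K). (\<Sum>i<p. \<phi> i) = 0}. \<Prod>i<p. of_real (G (\<phi> i) z) * wave L (\<phi> i) x) = of_real ?J"
    unfolding of_real_sum
    by (intro sum.cong refl) (simp add: prod.distrib wave_sum_index[symmetric])
  finally have "(LINT t:cell L|lborel. (?T t) ^ p) = L ^ CARD('n) * ?J"
    by (simp only: of_real_mult[symmetric] of_real_eq_iff)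
  moreover have "(LINT t:cell L|lborel. (?T t) ^ p) \<le> (LINT t:cell L|lborel. \<bar>?T t\<bar> ^ p)"
    by (intro set_integral_mono set_integrable_cell continuous_intros Tc) (simp add: power_abs[symmetric])
  ultimately have "ennreal (L ^ CARD('n) * ?J) \<le> ennreal (LINT t:cell L|lborel. \<bar>?T t\<bar> ^ p)"
    by (simp add: ennreal_leI)
  also have "\<dots> = (\<integral>\<^sup>+t. ennreal (indicator (cell L) t *\<^sub>R \<bar>?T t\<bar> ^ p) \<partial>lborel)"
    unfolding set_lebesgue_integral_def
  proof (rule nn_integral_eq_integral[symmetric])
    show "integrable lborel (\<lambda>t. indicator (cell L) t *\<^sub>R \<bar>?T t\<bar> ^ p)"
      using set_integrable_cell[of "\<lambda>t. \<bar>?T t\<bar> ^ p" L] Tc by (simp add: set_integrable_def continuous_intros)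
  qed auto
  also have "\<dots> = (\<integral>\<^sup>+t. indicator (cell L) t * ennreal (\<bar>?T t\<bar> ^ p) \<partial>lborel)"
    by (intro nn_integral_cong) (auto simp: indicator_def)
  finally show ?thesis .
qed

text \<open>The inequalities for all translates are integrated over \<open>t\<close> in the cell.
  The right-hand side gains the cell volume; by Fubini the left-hand side contains the period
  integral for each fixed \<open>x\<close>, which is at least the cell volume times the sum over
  zero-sum tuples. The volume cancels.\<close>

lemma lift_sobolev:
  assumes sob: "\<And>t. sob \<tau> S p (lift t)" and s: "0 < s" and nn: "0 \<le> \<alpha>" "0 \<le> \<beta>" "0 \<le> \<gamma>"
    and \<alpha>: "(\<Sum>k\<in>K. \<integral>\<^sup>+z. ennreal ((norm (grad (G k) z))\<^sup>2) \<partial>lborel) \<le> ennreal \<alpha>"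
    and \<beta>: "(\<integral>\<^sup>+z. ennreal (norm z powr (2 * \<tau>) * (\<Sum>k\<in>K. (2 * pi / L)\<^sup>2 * (norm (freq k))\<^sup>2 * (G k z)\<^sup>2)) \<partial>lborel) \<le> ennreal \<beta>"
    and \<gamma>: "(\<integral>\<^sup>+z. ennreal (norm z powr (2 * \<tau>) * (\<Sum>k\<in>K. (G k z)\<^sup>2)) \<partial>lborel) \<le> ennreal \<gamma>"
    and Ksym: "uminus ` K = K" and Gsym: "\<And>k z. k \<in> K \<Longrightarrow> G (- k) z = G k z" and G0: "\<And>k z. k \<in> K \<Longrightarrow> 0 \<le> G k z"
  shows "(\<integral>\<^sup>+x. ennreal (\<zeta> x ^ p) \<partial>lborel) * (\<integral>\<^sup>+z. ennreal (\<Sum>\<phi>\<in>{\<phi> \<in> PiE {..<p} (\<lambda>_. K). (\<Sum>i<p. \<phi> i) = 0}. \<Prod>i<p. G (\<phi> i) z) \<partial>lborel)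
    \<le> ennreal ((L ^ CARD('n) * (\<alpha> + (\<tau> + 1)\<^sup>2 * ((1 + s) * \<beta> + (1 + 1 / s) * D\<^sup>2 * \<gamma>)) / S) powr (real p / 2))"
proof -
  let ?V = "L ^ CARD('n)"
  let ?E = "?V * (\<alpha> + (\<tau> + 1)\<^sup>2 * ((1 + s) * \<beta> + (1 + 1 / s) * D\<^sup>2 * \<gamma>))"
  let ?C = "ennreal ((?E / S) powr (real p / 2))"
  let ?J = "\<lambda>z. \<Sum>\<phi>\<in>{\<phi> \<in> PiE {..<p} (\<lambda>_. K). (\<Sum>i<p. \<phi> i) = 0}. \<Prod>i<p. G (\<phi> i) z"
  let ?I = "indicator (cell L) :: real^'n \<Rightarrow> ennreal"
  have V: "0 < ?V" using L by simp
  have E0: "0 \<le> ?E" using nn s V by (intro mult_nonneg_nonneg add_nonneg_nonneg) auto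
  have Gm: "G k \<in> borel_measurable borel" if "k \<in> K" for k
    using C_k_continuous[OF G[OF that, of 0]] by (auto intro: borel_measurable_continuous_onI)
  note [measurable] = Gm
  have \<zeta>m [measurable]: "\<zeta> \<in> borel_measurable borel"
    using C_k_continuous[OF \<zeta>] by (rule borel_measurable_continuous_onI)
  have Jm: "?J \<in> borel_measurable borel"
    by (intro borel_measurable_sum borel_measurable_prod Gm) auto
  have Tm [measurable]: "(\<lambda>(x, z). trig_lift L K G x z) \<in> borel_measurable (borel \<Otimes>\<^sub>M borel)"
    unfolding trig_lift_eq by measurable
  have b: "(\<integral>\<^sup>+q. ennreal (\<bar>lift t q\<bar> ^ p) \<partial>lborel) \<le> ?C" for t
    using sob[of t, unfolded sob_def] E0 energy_lift[OF s nn \<alpha> \<beta> \<gamma>, of t] by blast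
  have l: "(\<integral>\<^sup>+q. ennreal (\<bar>lift t q\<bar> ^ p) \<partial>lborel) = (\<integral>\<^sup>+x. ennreal (\<zeta> x ^ p) * (\<integral>\<^sup>+z. ennreal (\<bar>trig_lift L K G (x + t) z\<bar> ^ p) \<partial>lborel) \<partial>lborel)" for t
  proof -
    have "lift t \<in> borel_measurable borel"
      using C_k_continuous[OF C_k_lift] by (rule borel_measurable_continuous_onI)
    then have "(\<integral>\<^sup>+q. ennreal (\<bar>lift t q\<bar> ^ p) \<partial>lborel) = (\<integral>\<^sup>+x. \<integral>\<^sup>+z. ennreal (\<bar>lift t (x, z)\<bar> ^ p) \<partial>lborel \<partial>lborel)"
      by (intro nn_integral_lborel_pair) measurable
    also have "\<dots> = (\<integral>\<^sup>+x. \<integral>\<^sup>+z. ennreal (\<zeta> x ^ p) * ennreal (\<bar>trig_lift L K G (x + t) z\<bar> ^ p) \<partial>lborel \<partial>lborel)"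
      by (intro nn_integral_cong) (simp add: lift_def abs_mult power_mult_distrib \<zeta>01 ennreal_mult')
    also have "\<dots> = (\<integral>\<^sup>+x. ennreal (\<zeta> x ^ p) * (\<integral>\<^sup>+z. ennreal (\<bar>trig_lift L K G (x + t) z\<bar> ^ p) \<partial>lborel) \<partial>lborel)"
      by (intro nn_integral_cong nn_integral_cmult) measurable
    finally show ?thesis .
  qed
  have "(\<integral>\<^sup>+x. ennreal (\<zeta> x ^ p) \<partial>lborel) * (ennreal ?V * (\<integral>\<^sup>+z. ennreal (?J z) \<partial>lborel))
      = (\<integral>\<^sup>+x. ennreal (\<zeta> x ^ p) * (\<integral>\<^sup>+z. ennreal (?V * ?J z) \<partial>lborel) \<partial>lborel)"
    using V Jm by (subst nn_integral_multc) (auto simp: ennreal_mult' nn_integral_cmult)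
  also have "\<dots> \<le> (\<integral>\<^sup>+x. ennreal (\<zeta> x ^ p) * (\<integral>\<^sup>+z. \<integral>\<^sup>+t. ?I t * ennreal (\<bar>trig_lift L K G (x + t) z\<bar> ^ p) \<partial>lborel \<partial>lborel) \<partial>lborel)"
    by (intro nn_integral_mono mult_left_mono lift_power_lower Ksym Gsym G0) auto
  also have "\<dots> = (\<integral>\<^sup>+x. ennreal (\<zeta> x ^ p) * (\<integral>\<^sup>+t. \<integral>\<^sup>+z. ?I t * ennreal (\<bar>trig_lift L K G (x + t) z\<bar> ^ p) \<partial>lborel \<partial>lborel) \<partial>lborel)"
    by (intro nn_integral_cong arg_cong[where f = "\<lambda>u. _ * u"] lborel_pair.Fubini') measurable
  also have "\<dots> = (\<integral>\<^sup>+x. \<integral>\<^sup>+t. ?I t * (ennreal (\<zeta> x ^ p) * (\<integral>\<^sup>+z. ennreal (\<bar>trig_lift L K G (x + t) z\<bar> ^ p) \<partial>lborel)) \<partial>lborel \<partial>lborel)"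
  proof (intro nn_integral_cong)
    fix x
    have "(\<integral>\<^sup>+t. \<integral>\<^sup>+z. ?I t * ennreal (\<bar>trig_lift L K G (x + t) z\<bar> ^ p) \<partial>lborel \<partial>lborel)
      = (\<integral>\<^sup>+t. ?I t * (\<integral>\<^sup>+z. ennreal (\<bar>trig_lift L K G (x + t) z\<bar> ^ p) \<partial>lborel) \<partial>lborel)"
      by (intro nn_integral_cong nn_integral_cmult) measurable
    then show "ennreal (\<zeta> x ^ p) * (\<integral>\<^sup>+t. \<integral>\<^sup>+z. ?I t * ennreal (\<bar>trig_lift L K G (x + t) z\<bar> ^ p) \<partial>lborel \<partial>lborel)
      = (\<integral>\<^sup>+t. ?I t * (ennreal (\<zeta> x ^ p) * (\<integral>\<^sup>+z. ennreal (\<bar>trig_lift L K G (x + t) z\<bar> ^ p) \<partial>lborel)) \<partial>lborel)"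
      by (simp add: nn_integral_cmult[symmetric] mult_ac)
  qed
  also have "\<dots> = (\<integral>\<^sup>+t. \<integral>\<^sup>+x. ?I t * (ennreal (\<zeta> x ^ p) * (\<integral>\<^sup>+z. ennreal (\<bar>trig_lift L K G (x + t) z\<bar> ^ p) \<partial>lborel)) \<partial>lborel \<partial>lborel)"
    by (intro lborel_pair.Fubini') measurable
  also have "\<dots> = (\<integral>\<^sup>+t. ?I t * (\<integral>\<^sup>+q. ennreal (\<bar>lift t q\<bar> ^ p) \<partial>lborel) \<partial>lborel)"
    unfolding l by (intro nn_integral_cong nn_integral_cmult) measurable
  also have "\<dots> \<le> (\<integral>\<^sup>+t. ?I t * ?C \<partial>lborel)"
    by (intro nn_integral_mono mult_left_mono b) auto
  also have "\<dots> = emeasure lborel (cell L :: (real^'n) set) * ?C"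
    by (subst nn_integral_multc) auto
  also have "emeasure lborel (cell L :: (real^'n) set) = ennreal ?V"
    using emeasure_compact_finite[of "cell L :: (real^'n) set"] compact_cell
    by (subst emeasure_eq_ennreal_measure) (auto simp: measure_cell[OF L] less_top[symmetric])
  finally have "ennreal ?V * ((\<integral>\<^sup>+x. ennreal (\<zeta> x ^ p) \<partial>lborel) * (\<integral>\<^sup>+z. ennreal (?J z) \<partial>lborel)) \<le> ennreal ?V * ?C"
    by (simp add: mult_ac)
  then show ?thesis using V L by (subst (asm) ennreal_mult_le_mult_iff) auto
qed

end

section \<open>The inequality for a rearranged family\<close>

text \<open>Young's inequality with the mollification scale \<delta> itself as parameter: the error
  is \<open>(1 + 1 / \<delta>) * (A * \<delta>)\<^sup>2 = (1 + \<delta>) * \<delta> *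
  A\<^sup>2\<close>, which still tends to 0.\<close>

lemma sum_weighted_square_perturb:
  fixes F G :: "'k \<Rightarrow> 'a::euclidean_space \<Rightarrow> real"
  assumes K: "finite K" and c: "\<And>k. k \<in> K \<Longrightarrow> 0 \<le> c k" and \<delta>: "0 < \<delta>" and A: "0 \<le> A"
    and Fm: "\<And>k. k \<in> K \<Longrightarrow> F k \<in> borel_measurable borel"
    and close: "\<And>k z. k \<in> K \<Longrightarrow> \<bar>G k z - F k z\<bar> \<le> A * \<delta>"
    and supp: "\<And>k z. k \<in> K \<Longrightarrow> norm z > R \<Longrightarrow> F k z = 0 \<and> G k z = 0"
    and \<tau>: "0 < \<tau>" and R: "0 \<le> R" and \<beta>: "0 \<le> \<beta>"
    and le: "(\<integral>\<^sup>+z. ennreal (norm z powr (2 * \<tau>) * (\<Sum>k\<in>K. c k * (F k z)\<^sup>2)) \<partial>lborel) \<le> ennreal \<beta>"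
  shows "(\<integral>\<^sup>+z. ennreal (norm z powr (2 * \<tau>) * (\<Sum>k\<in>K. c k * (G k z)\<^sup>2)) \<partial>lborel)
    \<le> ennreal ((1 + \<delta>) * \<beta> + (1 + \<delta>) * \<delta> * (A\<^sup>2 * (\<Sum>k\<in>K. c k) * (R powr (2 * \<tau>) * measure lborel (cball (0::'a) R))))"
proof -
  let ?w = "\<lambda>z::'a. norm z powr (2 * \<tau>)" and ?W = "R powr (2 * \<tau>)" and ?m = "measure lborel (cball (0::'a) R)"
  let ?c = "(1 + \<delta>) * \<delta> * (A\<^sup>2 * (\<Sum>k\<in>K. c k) * ?W)"
  note [measurable] = Fm
  have sc: "0 \<le> (\<Sum>k\<in>K. c k)" using c by (rule sum_nonneg)
  have c0: "0 \<le> ?c" using sc \<delta> by (intro mult_nonneg_nonneg) auto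
  have pt: "ennreal (?w z * (\<Sum>k\<in>K. c k * (G k z)\<^sup>2)) \<le> ennreal (1 + \<delta>) * ennreal (?w z * (\<Sum>k\<in>K. c k * (F k z)\<^sup>2)) + ennreal ?c * indicator (cball 0 R) z" for z
  proof (cases "norm z \<le> R")
    case True
    have 1: "(G k z)\<^sup>2 \<le> (1 + \<delta>) * (F k z)\<^sup>2 + (1 + \<delta>) * \<delta> * A\<^sup>2" if k: "k \<in> K" for k
    proof -
      have "(G k z)\<^sup>2 = (norm (F k z + (G k z - F k z)))\<^sup>2" by simp
      also have "\<dots> \<le> (1 + \<delta>) * (norm (F k z))\<^sup>2 + (1 + 1 / \<delta>) * (norm (G k z - F k z))\<^sup>2"
        by (rule square_norm_sum_le[OF \<delta>])
      also have "(norm (G k z - F k z))\<^sup>2 \<le> (A * \<delta>)\<^sup>2"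
        using close[OF k, of z] by (intro power_mono) auto
      then have "(1 + 1 / \<delta>) * (norm (G k z - F k z))\<^sup>2 \<le> (1 + 1 / \<delta>) * (A * \<delta>)\<^sup>2"
        using \<delta> by (intro mult_left_mono) auto
      also have "(1 + 1 / \<delta>) * (A * \<delta>)\<^sup>2 = (1 + \<delta>) * \<delta> * A\<^sup>2"
        using \<delta> by (simp add: field_simps power2_eq_square)
      finally show ?thesis by simp
    qed
    have "(\<Sum>k\<in>K. c k * (G k z)\<^sup>2) \<le> (\<Sum>k\<in>K. c k * ((1 + \<delta>) * (F k z)\<^sup>2 + (1 + \<delta>) * \<delta> * A\<^sup>2))"
      by (intro sum_mono mult_left_mono 1 c)
    also have "\<dots> = (1 + \<delta>) * (\<Sum>k\<in>K. c k * (F k z)\<^sup>2) + (1 + \<delta>) * \<delta> * (A\<^sup>2 * (\<Sum>k\<in>K. c k))"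
      by (simp add: distrib_left sum.distrib sum_distrib_left sum_distrib_right mult_ac)
    finally have "?w z * (\<Sum>k\<in>K. c k * (G k z)\<^sup>2) \<le> ?w z * ((1 + \<delta>) * (\<Sum>k\<in>K. c k * (F k z)\<^sup>2) + (1 + \<delta>) * \<delta> * (A\<^sup>2 * (\<Sum>k\<in>K. c k)))"
      by (rule mult_left_mono) simp
    also have "\<dots> = (1 + \<delta>) * (?w z * (\<Sum>k\<in>K. c k * (F k z)\<^sup>2)) + ?w z * ((1 + \<delta>) * \<delta> * (A\<^sup>2 * (\<Sum>k\<in>K. c k)))"
      by (simp add: algebra_simps)
    also have "?w z * ((1 + \<delta>) * \<delta> * (A\<^sup>2 * (\<Sum>k\<in>K. c k))) \<le> ?W * ((1 + \<delta>) * \<delta> * (A\<^sup>2 * (\<Sum>k\<in>K. c k)))"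
      using True \<tau> \<delta> sc by (intro mult_right_mono powr_mono2 mult_nonneg_nonneg) auto
    finally have "?w z * (\<Sum>k\<in>K. c k * (G k z)\<^sup>2) \<le> (1 + \<delta>) * (?w z * (\<Sum>k\<in>K. c k * (F k z)\<^sup>2)) + ?c"
      by (simp add: mult_ac)
    then have "ennreal (?w z * (\<Sum>k\<in>K. c k * (G k z)\<^sup>2)) \<le> ennreal ((1 + \<delta>) * (?w z * (\<Sum>k\<in>K. c k * (F k z)\<^sup>2)) + ?c)"
      by (rule ennreal_leI)
    also have "\<dots> = ennreal ((1 + \<delta>) * (?w z * (\<Sum>k\<in>K. c k * (F k z)\<^sup>2))) + ennreal ?c"
      using \<delta> c c0 by (intro ennreal_plus mult_nonneg_nonneg sum_nonneg) auto
    also have "ennreal ((1 + \<delta>) * (?w z * (\<Sum>k\<in>K. c k * (F k z)\<^sup>2))) = ennreal (1 + \<delta>) * ennreal (?w z * (\<Sum>k\<in>K. c k * (F k z)\<^sup>2))"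
      using \<delta> by (intro ennreal_mult') auto
    finally show ?thesis using True by simp
  next
    case False
    then have "G k z = 0" if "k \<in> K" for k using supp[OF that, of z] by simp
    then show ?thesis by simp
  qed
  have cb: "cball (0::'a) R \<in> sets lborel" by simp
  have "(\<integral>\<^sup>+z. ennreal (?w z * (\<Sum>k\<in>K. c k * (G k z)\<^sup>2)) \<partial>lborel)
     \<le> (\<integral>\<^sup>+z. ennreal (1 + \<delta>) * ennreal (?w z * (\<Sum>k\<in>K. c k * (F k z)\<^sup>2)) + ennreal ?c * indicator (cball 0 R) z \<partial>lborel)"
    by (intro nn_integral_mono pt)
  also have "\<dots> = ennreal (1 + \<delta>) * (\<integral>\<^sup>+z. ennreal (?w z * (\<Sum>k\<in>K. c k * (F k z)\<^sup>2)) \<partial>lborel) + ennreal ?c * emeasure lborel (cball (0::'a) R)"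
    using cb by (subst nn_integral_add, measurable, simp add: nn_integral_cmult nn_integral_cmult_indicator)
  also have "\<dots> \<le> ennreal (1 + \<delta>) * ennreal \<beta> + ennreal ?c * emeasure lborel (cball (0::'a) R)"
    by (intro add_right_mono mult_left_mono le) auto
  also have "emeasure lborel (cball (0::'a) R) = ennreal ?m"
    using emeasure_bounded_finite[of "cball (0::'a) R"] by (intro emeasure_eq_ennreal_measure) auto
  also have "ennreal (1 + \<delta>) * ennreal \<beta> + ennreal ?c * ennreal ?m = ennreal ((1 + \<delta>) * \<beta> + ?c * ?m)"
    using \<delta> \<beta> c0 by (simp add: ennreal_mult'[symmetric] ennreal_plus[symmetric] del: ennreal_plus)
  finally show ?thesis by (simp add: mult_ac)
qed

lemma nn_integral_sum_prod:
  assumes "finite P" "\<And>\<phi>. \<phi> \<in> P \<Longrightarrow> g \<phi> \<in> borel_measurable borel" "\<And>\<phi> z. \<phi> \<in> P \<Longrightarrow> 0 \<le> g \<phi> z"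
  shows "(\<integral>\<^sup>+z. ennreal (\<Sum>\<phi>\<in>P. g \<phi> z) \<partial>lborel) = (\<Sum>\<phi>\<in>P. \<integral>\<^sup>+z. ennreal (g \<phi> z) \<partial>(lborel :: 'a::euclidean_space measure))"
proof -
  have "(\<integral>\<^sup>+z. ennreal (\<Sum>\<phi>\<in>P. g \<phi> z) \<partial>lborel) = (\<integral>\<^sup>+z. (\<Sum>\<phi>\<in>P. ennreal (g \<phi> z)) \<partial>(lborel :: 'a measure))"
    using assms(3) by (intro nn_integral_cong sum_ennreal[symmetric]) auto
  also have "\<dots> = (\<Sum>\<phi>\<in>P. \<integral>\<^sup>+z. ennreal (g \<phi> z) \<partial>(lborel :: 'a measure))"
    using assms(2) by (intro nn_integral_sum) auto
  finally show ?thesis .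
qed

text \<open>The rearranged family is only Lipschitz, so it is mollified before it is lifted to a
  radial test function. Bounds on difference energies survive both rearrangement and mollification,
  which is why the hypothesis on the z-energy is stated for all \<open>h\<close> and not through
  gradients.\<close>

lemma rearranged_sobolev:
  fixes f :: "int^'n \<Rightarrow> real^'m \<Rightarrow> real" and \<zeta> :: "real^'n \<Rightarrow> real"
  assumes rad: "\<And>\<psi>::('n, 'm) point \<Rightarrow> real. \<psi> \<in> test_functions \<Longrightarrow> radial_z \<psi> \<Longrightarrow> sob \<tau> S p \<psi>"
    and \<tau>: "0 < \<tau>" and S: "0 < S" and p: "0 < p" and L: "0 < L"
    and \<zeta>: "\<And>j. C_k j \<zeta>" "\<And>x. 0 \<le> \<zeta> x" "\<And>x. \<zeta> x \<le> 1" "\<And>x. x \<notin> cell L \<Longrightarrow> \<zeta> x = 0" "\<And>x. norm (grad \<zeta> x) \<le> D"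
    and Z: "(\<integral>\<^sup>+x. ennreal (\<zeta> x ^ p) \<partial>lborel) = ennreal Z" "0 \<le> Z"
    and K: "finite K" "uminus ` K = K"
    and fn: "\<And>k z. k \<in> K \<Longrightarrow> 0 \<le> f k z" and fl: "\<And>k z z'. k \<in> K \<Longrightarrow> \<bar>f k z - f k z'\<bar> \<le> A * dist z z'"
    and fs: "\<And>k z. k \<in> K \<Longrightarrow> norm z > R \<Longrightarrow> f k z = 0" and fsym: "\<And>k. k \<in> K \<Longrightarrow> f (- k) = f k"
    and A: "0 \<le> A" and R: "0 \<le> R" and s: "0 < s" and nn: "0 \<le> \<alpha>" "0 \<le> \<beta>" "0 \<le> \<gamma>"
    and \<alpha>: "\<And>h. 0 < h \<Longrightarrow> (\<Sum>k\<in>K. diff_energy h (f k)) \<le> ennreal \<alpha> * second_moment TYPE(real^'m) h"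
    and \<beta>: "(\<integral>\<^sup>+z. ennreal (norm z powr (2 * \<tau>) * (\<Sum>k\<in>K. (2 * pi / L)\<^sup>2 * (norm (freq k))\<^sup>2 * (f k z)\<^sup>2)) \<partial>lborel) \<le> ennreal \<beta>"
    and \<gamma>: "(\<integral>\<^sup>+z. ennreal (norm z powr (2 * \<tau>) * (\<Sum>k\<in>K. (f k z)\<^sup>2)) \<partial>lborel) \<le> ennreal \<gamma>"
  shows "ennreal Z * (\<integral>\<^sup>+z. ennreal (\<Sum>\<phi>\<in>{\<phi> \<in> PiE {..<p} (\<lambda>_. K). (\<Sum>i<p. \<phi> i) = 0}. \<Prod>i<p. f (\<phi> i) z) \<partial>lborel)
    \<le> ennreal ((L ^ CARD('n) * (\<alpha> + (\<tau> + 1)\<^sup>2 * ((1 + s) * \<beta> + (1 + 1 / s) * D\<^sup>2 * \<gamma>)) / S) powr (real p / 2))"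
proof -
  let ?w = "\<lambda>z::real^'m. norm z powr (2 * \<tau>)"
  let ?P = "{\<phi> \<in> PiE {..<p} (\<lambda>_. K). (\<Sum>i<p. \<phi> i) = 0}"
  let ?J = "\<lambda>g z. \<Sum>\<phi>\<in>?P. \<Prod>i<p. g (\<phi> i) z"
  have P: "finite ?P" using K(1) by (simp add: finite_PiE)
  have PK: "\<phi> i \<in> K" if "\<phi> \<in> ?P" "i < p" for \<phi> i using that by auto
  interpret R: rearrangement_class K f ?w A R
  proof
    show "\<And>z z'::real^'m. norm z \<le> norm z' \<Longrightarrow> ?w z \<le> ?w z'" using \<tau> by (intro powr_mono2) auto
  qed (use K A R in \<open>auto intro: fn fl fs\<close>)
  obtain F where F: "R.adm F" and Frad: "\<And>k z z'. k \<in> K \<Longrightarrow> norm z = norm z' \<Longrightarrow> F k z = F k z'"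
    using R.ex_radial_adm by blast
  note Fd = R.admD[OF F]
  have Fm: "F k \<in> borel_measurable borel" and Fc: "continuous_on UNIV (F k)" if "k \<in> K" for k
    using R.adm_measurable[OF F that] R.adm_continuous[OF F that] by auto
  have fm: "f k \<in> borel_measurable borel" if "k \<in> K" for k
    using R.adm_measurable[OF R.adm_self that] .
  \<comment> \<open>The clause on equal members of the admissible class carries the evenness of the
    coefficients over to the rearranged family.\<close>
  have Fsym: "F (- k) = F k" if k: "k \<in> K" for k
  proof -
    have "- k \<in> K" using k K(2) by blast
    then show ?thesis using Fd(6)[of "- k" k] k fsym[OF k] by simp
  qed
  have wF: "(\<integral>\<^sup>+z. ennreal (?w z * (\<Sum>k\<in>K. c k * (F k z)\<^sup>2)) \<partial>lborel) \<le> (\<integral>\<^sup>+z. ennreal (?w z * (\<Sum>k\<in>K. c k * (f k z)\<^sup>2)) \<partial>lborel)"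
    if c: "\<And>k. 0 \<le> c k" for c
  proof -
    have e: "(\<integral>\<^sup>+z. ennreal (?w z * (\<Sum>k\<in>K. c k * (g k z)\<^sup>2)) \<partial>lborel) = (\<Sum>k\<in>K. ennreal (c k) * (\<integral>\<^sup>+z. ennreal (?w z * (g k z)\<^sup>2) \<partial>lborel))"
      if gm: "\<And>k. k \<in> K \<Longrightarrow> g k \<in> borel_measurable borel" for g
    proof -
      note [measurable] = gm
      have "(\<integral>\<^sup>+z. ennreal (?w z * (\<Sum>k\<in>K. c k * (g k z)\<^sup>2)) \<partial>lborel) = (\<integral>\<^sup>+z. ennreal (\<Sum>k\<in>K. c k * (?w z * (g k z)\<^sup>2)) \<partial>lborel)"
        by (simp add: sum_distrib_left mult_ac)
      also have "\<dots> = (\<Sum>k\<in>K. \<integral>\<^sup>+z. ennreal (c k * (?w z * (g k z)\<^sup>2)) \<partial>lborel)"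
      proof (rule nn_integral_sum_prod[OF K(1)])
        fix k assume k: "k \<in> K"
        note [measurable] = gm[OF k]
        show "(\<lambda>z. c k * (?w z * (g k z)\<^sup>2)) \<in> borel_measurable borel" by measurable
      qed (use c in auto)
      also have "\<dots> = (\<Sum>k\<in>K. ennreal (c k) * (\<integral>\<^sup>+z. ennreal (?w z * (g k z)\<^sup>2) \<partial>lborel))"
        using c by (intro sum.cong refl) (simp add: ennreal_mult' nn_integral_cmult gm)
      finally show ?thesis .
    qed
    have "(\<Sum>k\<in>K. ennreal (c k) * (\<integral>\<^sup>+z. ennreal (?w z * (F k z)\<^sup>2) \<partial>lborel)) \<le> (\<Sum>k\<in>K. ennreal (c k) * (\<integral>\<^sup>+z. ennreal (?w z * (f k z)\<^sup>2) \<partial>lborel))"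
      by (intro sum_mono mult_left_mono Fd(4)) auto
    then show ?thesis using e[of F, OF Fm] e[of f, OF fm] by simp
  qed
  \<comment> \<open>Scales of at most 1 keep all mollified supports in the ball of radius
    \<open>R + 1\<close>.\<close>
  define \<delta> where "\<delta> j = 1 / (real j + 1)" for j :: nat
  have \<delta>: "0 < \<delta> j" "\<delta> j \<le> 1" for j by (auto simp: \<delta>_def)
  have \<delta>0: "\<delta> \<longlonglongrightarrow> 0" unfolding \<delta>_def[abs_def] using LIMSEQ_inverse_real_of_nat by (simp add: inverse_eq_divide add.commute)
  define G where "G j k = conv (mollifier (\<delta> j)) (F k)" for j k
  have close: "\<bar>G j k z - F k z\<bar> \<le> A * \<delta> j" if "k \<in> K" for j k z
    unfolding G_def by (rule conv_mollifier_close[OF \<delta>(1) Fd(2)[OF that] A])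
  have Gs: "G j k z = 0" if "k \<in> K" "norm z > R + 1" for j k z
    unfolding G_def
  proof (rule conv_mollifier_support[OF \<delta>(1), where R = R])
    show "norm z > R \<Longrightarrow> F k z = 0" for z by (rule Fd(3)[OF that(1)])
    show "R + \<delta> j < norm z" using that(2) \<delta>(2)[of j] by linarith
  qed
  have GC: "C_k i (G j k)" if "k \<in> K" for i j k
    unfolding G_def by (rule C_k_conv[OF C_k_mollifier[OF \<delta>(1)] Fc[OF that] Fd(3)[OF that]])
  have G0: "0 \<le> G j k z" if "k \<in> K" for j k z
    unfolding G_def conv_def using Fd(1)[OF that] mollifier_nonneg[OF \<delta>(1)]
    by (intro Bochner_Integration.integral_nonneg mult_nonneg_nonneg)
  have mm: "mollifier (\<delta> j) \<in> borel_measurable (borel :: (real^'m) measure)" for j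
    using C_k_continuous[OF C_k_mollifier[OF \<delta>(1)]] by (rule borel_measurable_continuous_onI)
  have Gr: "G j k z = G j k z'" if "k \<in> K" "norm z = norm z'" for j k z z'
    unfolding G_def by (rule conv_radial[OF mollifier_radial[OF \<delta>(1)] Frad[OF that(1)] mm Fm[OF that(1)] that(2)])
  have Gm: "G j k \<in> borel_measurable borel" if "k \<in> K" for j k
    using C_k_continuous[OF GC[OF that]] by (rule borel_measurable_continuous_onI)
  have Gde: "(\<Sum>k\<in>K. diff_energy h (G j k)) \<le> ennreal \<alpha> * second_moment TYPE(real^'m) h" if "0 < h" for h j
  proof -
    have "(\<Sum>k\<in>K. diff_energy h (G j k)) \<le> (\<Sum>k\<in>K. diff_energy h (f k))"
      unfolding G_def by (intro sum_mono order.trans[OF diff_energy_conv[OF \<delta>(1) Fc] Fd(5)])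
    also note \<alpha>[OF that]
    finally show ?thesis .
  qed
  \<comment> \<open>Here the difference energies are converted into gradients, now that the
    functions are smooth.\<close>
  have Ga: "(\<Sum>k\<in>K. \<integral>\<^sup>+z. ennreal ((norm (grad (G j k) z))\<^sup>2) \<partial>lborel) \<le> ennreal \<alpha>" for j
    by (rule nn_integral_grad_square_le[OF K(1) GC Gs nn(1) Gde])
  define C where "C c = A\<^sup>2 * (\<Sum>k\<in>K. c k) * ((R + 1) powr (2 * \<tau>) * measure lborel (cball (0::real^'m) (R + 1)))" for c :: "int^'n \<Rightarrow> real"
  have C0: "0 \<le> C c" if "\<And>k. 0 \<le> c k" for c
    unfolding C_def using that by (intro mult_nonneg_nonneg sum_nonneg) auto
  let ?c1 = "\<lambda>k. (2 * pi / L)\<^sup>2 * (norm (freq k))\<^sup>2" and ?c2 = "\<lambda>k::int^'n. 1::real"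
  have pert: "(\<integral>\<^sup>+z. ennreal (?w z * (\<Sum>k\<in>K. c k * (G j k z)\<^sup>2)) \<partial>lborel) \<le> ennreal ((1 + \<delta> j) * b + (1 + \<delta> j) * \<delta> j * C c)"
    if c: "\<And>k. 0 \<le> c k" and b: "0 \<le> b" and le: "(\<integral>\<^sup>+z. ennreal (?w z * (\<Sum>k\<in>K. c k * (f k z)\<^sup>2)) \<partial>lborel) \<le> ennreal b" for c b j
    unfolding C_def
  proof (rule sum_weighted_square_perturb[OF K(1) c \<delta>(1) A Fm close _ \<tau> _ b order.trans[OF wF[OF c] le]])
    show "F k z = 0 \<and> G j k z = 0" if "k \<in> K" "norm z > R + 1" for k z
      using Fd(3)[OF that(1), of z] Gs[OF that] that(2) by simp
  qed (use R in auto)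
  define E where "E j = L ^ CARD('n) * (\<alpha> + (\<tau> + 1)\<^sup>2 * ((1 + s) * ((1 + \<delta> j) * \<beta> + (1 + \<delta> j) * \<delta> j * C ?c1)
      + (1 + 1 / s) * D\<^sup>2 * ((1 + \<delta> j) * \<gamma> + (1 + \<delta> j) * \<delta> j * C ?c2)))" for j
  let ?E = "L ^ CARD('n) * (\<alpha> + (\<tau> + 1)\<^sup>2 * ((1 + s) * \<beta> + (1 + 1 / s) * D\<^sup>2 * \<gamma>))"
  have step: "ennreal Z * (\<integral>\<^sup>+z. ennreal (?J (G j) z) \<partial>lborel) \<le> ennreal ((E j / S) powr (real p / 2))" for j
  proof -
    interpret C: cutoff_lift L K "G j" \<zeta> "R + 1" D
      by unfold_locales ((rule L K(1) GC Gs Gr \<zeta>; assumption)+)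
    have b: "0 \<le> (1 + \<delta> j) * \<beta> + (1 + \<delta> j) * \<delta> j * C ?c1" "0 \<le> (1 + \<delta> j) * \<gamma> + (1 + \<delta> j) * \<delta> j * C ?c2"
      using C0[of ?c1] C0[of ?c2] nn \<delta>[of j] by (auto intro!: add_nonneg_nonneg mult_nonneg_nonneg)
    have sob: "sob \<tau> S p (C.lift t)" for t by (rule rad[OF C.lift_test C.lift_radial])
    have sym: "G j (- k) z = G j k z" if "k \<in> K" for k z by (simp add: G_def Fsym[OF that])
    have p1: "(\<integral>\<^sup>+z. ennreal (?w z * (\<Sum>k\<in>K. (G j k z)\<^sup>2)) \<partial>lborel) \<le> ennreal ((1 + \<delta> j) * \<gamma> + (1 + \<delta> j) * \<delta> j * C ?c2)"
      using pert[of ?c2 \<gamma> j] nn \<gamma> by simp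
    have p2: "(\<integral>\<^sup>+z. ennreal (?w z * (\<Sum>k\<in>K. ?c1 k * (G j k z)\<^sup>2)) \<partial>lborel) \<le> ennreal ((1 + \<delta> j) * \<beta> + (1 + \<delta> j) * \<delta> j * C ?c1)"
      by (rule pert[OF _ nn(2) \<beta>]) simp
    show ?thesis
      unfolding E_def Z(1)[symmetric]
      by (rule C.lift_sobolev[OF sob s nn(1) b Ga p2 p1 K(2) sym G0])
  qed
  have Elim: "(\<lambda>j. ennreal ((E j / S) powr (real p / 2))) \<longlonglongrightarrow> ennreal ((?E / S) powr (real p / 2))"
  proof (intro tendsto_ennrealI tendsto_powr' tendsto_const disjI2 conjI)
    have "E \<longlonglongrightarrow> L ^ CARD('n) * (\<alpha> + (\<tau> + 1)\<^sup>2 * ((1 + s) * ((1 + 0) * \<beta> + (1 + 0) * 0 * C ?c1)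
      + (1 + 1 / s) * D\<^sup>2 * ((1 + 0) * \<gamma> + (1 + 0) * 0 * C ?c2)))"
      unfolding E_def[abs_def] by (intro tendsto_intros \<delta>0)
    then have "E \<longlonglongrightarrow> ?E" by simp
    then show "(\<lambda>j. E j / S) \<longlonglongrightarrow> ?E / S" using S by (intro tendsto_intros) auto
    show "0 < real p / 2" using p by simp
    have "0 \<le> E j" for j
      unfolding E_def using C0[of ?c1] C0[of ?c2] nn \<delta>[of j] s L by (auto intro!: add_nonneg_nonneg mult_nonneg_nonneg)
    then show "\<forall>\<^sub>F j in sequentially. 0 \<le> E j / S" using S by simp
  qed
  have Glim: "(\<lambda>j. G j k z) \<longlonglongrightarrow> F k z" if "k \<in> K" for k z
  proof (rule LIM_zero_cancel, rule tendsto_rabs_zero_cancel, rule tendsto_sandwich[where f = "\<lambda>_. 0" and h = "\<lambda>j. A * \<delta> j"])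
    show "\<forall>\<^sub>F j in sequentially. \<bar>G j k z - F k z\<bar> \<le> A * \<delta> j" using close[OF that] by simp
    show "(\<lambda>j. A * \<delta> j) \<longlonglongrightarrow> 0" using tendsto_mult_right_zero[OF \<delta>0, of A] .
  qed auto
  have Pm: "(\<lambda>z. \<Prod>i<p. g (\<phi> i) z) \<in> borel_measurable borel" if "\<And>k. k \<in> K \<Longrightarrow> g k \<in> borel_measurable borel" "\<phi> \<in> ?P" for g :: "int^'n \<Rightarrow> real^'m \<Rightarrow> real" and \<phi>
    using that PK by (intro borel_measurable_prod) auto
  have "ennreal Z * (\<integral>\<^sup>+z. ennreal (?J f z) \<partial>lborel) \<le> ennreal Z * (\<integral>\<^sup>+z. ennreal (?J F z) \<partial>lborel)"
  proof (rule mult_left_mono)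
    have "(\<integral>\<^sup>+z. ennreal (?J f z) \<partial>lborel) = (\<Sum>\<phi>\<in>?P. \<integral>\<^sup>+z. ennreal (\<Prod>i<p. f (\<phi> i) z) \<partial>lborel)"
      by (rule nn_integral_sum_prod[OF P Pm[OF fm]]) (auto intro!: prod_nonneg fn)
    also have "\<dots> \<le> (\<Sum>\<phi>\<in>?P. \<integral>\<^sup>+z. ennreal (\<Prod>i<p. F (\<phi> i) z) \<partial>lborel)"
      by (intro sum_mono R.adm_prod[OF F]) auto
    also have "\<dots> = (\<integral>\<^sup>+z. ennreal (?J F z) \<partial>lborel)"
      by (rule nn_integral_sum_prod[OF P Pm[OF Fm], symmetric]) (auto intro!: prod_nonneg Fd(1))
    finally show "(\<integral>\<^sup>+z. ennreal (?J f z) \<partial>lborel) \<le> (\<integral>\<^sup>+z. ennreal (?J F z) \<partial>lborel)" .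
  qed simp
  also have "\<dots> = (\<integral>\<^sup>+z. ennreal (Z * ?J F z) \<partial>lborel)"
    using Z(2) Pm[OF Fm] by (subst nn_integral_cmult[symmetric]) (auto simp: ennreal_mult' intro!: borel_measurable_sum)
  \<comment> \<open>The mollified members converge pointwise and stand on the smaller side, so
    Fatou's lemma suffices.\<close>
  also have "\<dots> = (\<integral>\<^sup>+z. liminf (\<lambda>j. ennreal (Z * ?J (G j) z)) \<partial>lborel)"
    using PK by (intro nn_integral_cong lim_imp_Liminf[symmetric] tendsto_intros Glim) auto
  also have "\<dots> \<le> liminf (\<lambda>j. \<integral>\<^sup>+z. ennreal (Z * ?J (G j) z) \<partial>lborel)"
    using Pm[OF Gm] by (intro nn_integral_liminf) (auto intro!: borel_measurable_sum borel_measurable_times)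
  also have "\<dots> \<le> liminf (\<lambda>j. ennreal ((E j / S) powr (real p / 2)))"
  proof (intro Liminf_mono always_eventually allI)
    fix j
    have "(\<integral>\<^sup>+z. ennreal (Z * ?J (G j) z) \<partial>lborel) = ennreal Z * (\<integral>\<^sup>+z. ennreal (?J (G j) z) \<partial>lborel)"
      using Z(2) Pm[OF Gm] by (subst nn_integral_cmult[symmetric]) (auto simp: ennreal_mult' intro!: borel_measurable_sum)
    then show "(\<integral>\<^sup>+z. ennreal (Z * ?J (G j) z) \<partial>lborel) \<le> ennreal ((E j / S) powr (real p / 2))"
      using step[of j] by simp
  qed
  also have "\<dots> = ennreal ((?E / S) powr (real p / 2))"
    using Elim by (rule lim_imp_Liminf[rotated]) simp
  finally show ?thesis .
qed

section \<open>Fourier coefficients of a test function\<close>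

text \<open>The constant is the same \<open>second_moment\<close> as in the converse passage from
  difference energies to gradients, so the detour through difference energies costs nothing.\<close>

lemma diff_energy_le:
  fixes g :: "'a::euclidean_space \<Rightarrow> real"
  assumes g: "C_k (Suc 0) g"
  shows "diff_energy h g \<le> second_moment TYPE('a) h * (\<integral>\<^sup>+z. ennreal ((norm (grad g z))\<^sup>2) \<partial>lborel)"
proof -
  have [measurable]: "g \<in> borel_measurable borel" "grad g \<in> borel_measurable borel"
    using C_k_continuous[OF g] C_k_grad(2)[OF g] by (auto intro: borel_measurable_continuous_onI)
  have inc: "(\<integral>\<^sup>+z. ennreal ((g (z + y) - g z)\<^sup>2) \<partial>lborel) \<le> (\<integral>\<^sup>+z. ennreal ((grad g z \<bullet> y)\<^sup>2) \<partial>lborel)" for y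
    using nn_integral_increment_le[of g "\<lambda>z y. grad g z \<bullet> y" y "\<lambda>_. 1"] C_k_grad[OF g]
    by (simp add: continuous_intros)
  have "diff_energy h g \<le> (\<integral>\<^sup>+y. indicator {..<h} (norm y) * (\<integral>\<^sup>+z. ennreal ((grad g z \<bullet> y)\<^sup>2) \<partial>lborel) \<partial>lborel)"
    unfolding diff_energy_eq[OF \<open>g \<in> borel_measurable borel\<close>]
    by (rule nn_integral_mono, rule mult_left_mono[OF inc]) simp
  also have "\<dots> = (\<integral>\<^sup>+y. \<integral>\<^sup>+z. indicator {..<h} (norm y) * ennreal ((grad g z \<bullet> y)\<^sup>2) \<partial>lborel \<partial>lborel)"
    by (intro nn_integral_cong nn_integral_cmult[symmetric]) measurable
  also have "\<dots> = (\<integral>\<^sup>+z. \<integral>\<^sup>+y. indicator {..<h} (norm y) * ennreal ((grad g z \<bullet> y)\<^sup>2) \<partial>lborel \<partial>lborel)"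
    by (intro lborel_pair.Fubini') measurable
  also have "\<dots> = (\<integral>\<^sup>+z. second_moment TYPE('a) h * ennreal ((norm (grad g z))\<^sup>2) \<partial>lborel)"
    by (simp only: nn_integral_ball_inner_square mult.commute)
  also have "\<dots> = second_moment TYPE('a) h * (\<integral>\<^sup>+z. ennreal ((norm (grad g z))\<^sup>2) \<partial>lborel)"
    by (rule nn_integral_cmult) measurable
  finally show ?thesis .
qed

lemma fcoef_diff:
  fixes g g' :: "real^'n \<Rightarrow> real"
  assumes "integrable lborel g" "integrable lborel g'"
  shows "fcoef L (\<lambda>x. g x - g' x) k = fcoef L g k - fcoef L g' k"
proof -
  have "(LINT x|lborel. of_real (g x - g' x) * cnj (wave L k x)) = (LINT x|lborel. of_real (g x) * cnj (wave L k x) - of_real (g' x) * cnj (wave L k x))"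
    by (simp add: left_diff_distrib)
  also have "\<dots> = (LINT x|lborel. of_real (g x) * cnj (wave L k x)) - (LINT x|lborel. of_real (g' x) * cnj (wave L k x))"
    by (intro Bochner_Integration.integral_diff integrable_bounded_mult_wave assms)
  finally show ?thesis by (simp add: fcoef_def diff_divide_distrib)
qed

lemma fcoef_uminus: "fcoef L g (- k) = cnj (fcoef L g k)"
proof -
  have "(LINT x|lborel. of_real (g x) * cnj (wave L (- k) x)) = (LINT x|lborel. cnj (of_real (g x) * cnj (wave L k x)))"
    by (simp add: wave_uminus_index)
  also have "\<dots> = cnj (LINT x|lborel. of_real (g x) * cnj (wave L k x))"
    by (rule Bochner_Integration.integral_cnj)
  finally show ?thesis by (simp add: fcoef_def)
qed

text \<open>The real and imaginary parts are the difference quotients of cosine and sine at 0, with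
  limits 0 and the frequency in the direction \<open>b\<close>.\<close>

lemma wave_difference_quotient:
  fixes k :: "int^'n"
  assumes L: "0 < L"
  shows "((\<lambda>s. (norm (wave L k (s *\<^sub>R b) - 1))\<^sup>2 / s\<^sup>2) \<longlongrightarrow> (2 * pi / L)\<^sup>2 * (freq k \<bullet> b)\<^sup>2) (at_right 0)"
proof -
  define c where "c = 2 * pi / L * (freq k \<bullet> b)"
  have w: "wave L k (s *\<^sub>R b) = cis (c * s)" for s
    by (simp add: wave_freq c_def mult_ac)
  have n: "(norm (cis t - 1))\<^sup>2 = (cos t - 1)\<^sup>2 + (sin t)\<^sup>2" for t
    by (simp add: cmod_power2)
  have "((\<lambda>s. sin (c * s)) has_real_derivative c) (at 0)" "((\<lambda>s. cos (c * s)) has_real_derivative 0) (at 0)"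
    by (auto intro!: derivative_eq_intros)
  then have "((\<lambda>s. sin (c * s) / s) \<longlongrightarrow> c) (at 0)" "((\<lambda>s. (cos (c * s) - 1) / s) \<longlongrightarrow> 0) (at 0)"
    by (auto simp: has_field_derivative_iff)
  then have "((\<lambda>s. ((cos (c * s) - 1) / s)\<^sup>2 + (sin (c * s) / s)\<^sup>2) \<longlongrightarrow> 0\<^sup>2 + c\<^sup>2) (at 0)"
    by (intro tendsto_intros)
  then have "((\<lambda>s. (norm (wave L k (s *\<^sub>R b) - 1))\<^sup>2 / s\<^sup>2) \<longlongrightarrow> c\<^sup>2) (at 0)"
    by (simp add: w n power_divide add_divide_distrib)
  then have "((\<lambda>s. (norm (wave L k (s *\<^sub>R b) - 1))\<^sup>2 / s\<^sup>2) \<longlongrightarrow> c\<^sup>2) (at_right 0)"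
    by (rule tendsto_mono[OF at_le[OF subset_UNIV]])
  then show ?thesis by (simp only: c_def power_mult_distrib)
qed

section \<open>Bessel bounds for the slices of a test function\<close>

text \<open>The condition \<open>4 * R0 \<le> L\<close> puts the support in x inside the half cell,
  so that nothing wraps around the torus; with \<open>4 \<le> L\<close> translations in x by at most
  1 keep it inside the cell.\<close>

locale test_function_fourier =
  fixes u :: "('n::finite, 'm::finite) point \<Rightarrow> real" and R0 \<Lambda> L :: real
  assumes u: "\<And>k. C_k k u" and R0: "0 \<le> R0" and us: "\<And>p. norm p > R0 \<Longrightarrow> u p = 0"
    and lip: "\<And>p q. \<bar>u p - u q\<bar> \<le> \<Lambda> * dist p q" and \<Lambda>: "0 \<le> \<Lambda>"
    and L: "0 < L" and LR: "4 * R0 \<le> L" "4 \<le> L"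
begin

text \<open>The absolute value makes the plain power, which the Fourier expansion can handle, equal
  to the power of |u| also for odd exponents. Since |u| is not differentiable, all estimates go
  through increments, which are bounded by those of \<open>u\<close>.\<close>

definition U :: "real^'m \<Rightarrow> real^'n \<Rightarrow> real" where "U z x = \<bar>u (x, z)\<bar>"

lemma u_continuous: "continuous_on UNIV u" using C_k_continuous[OF u] .

lemma U_continuous: "continuous_on UNIV (U z)"
  unfolding U_def[abs_def] by (intro continuous_intros continuous_on_compose2[OF u_continuous]) auto

lemma u_outside_x: "norm x > R0 \<Longrightarrow> u (x, z) = 0" and u_outside_z: "norm z > R0 \<Longrightarrow> u (x, z) = 0"
  using us[of "(x, z)"] norm_fst_le[of x z] norm_snd_le[of z x] by auto

lemma U_outside: "norm x > R0 \<Longrightarrow> U z x = 0" by (simp add: U_def u_outside_x)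

lemma Vpos: "0 < L ^ CARD('n)" using L by simp

lemma U_int: "integrable lborel (U z)"
  by (rule integrable_continuous_compact_support[OF U_continuous, of R0]) (simp add: U_def u_outside_x)

lemma norm_large:
  fixes x :: "real^'n"
  assumes "x \<notin> cell (L / 2)"
  shows "norm x > R0"
proof -
  obtain a where "\<bar>x $ a\<bar> > L / 2 / 2" using assms unfolding cell_def mem_Collect_eq not_all not_le by blast
  then show ?thesis using component_le_norm_cart[of x a] LR by linarith
qed

lemma half_cell: "cell (L / 2) \<subseteq> (cell L :: (real^'n) set)"
proof
  fix x :: "real^'n" assume x: "x \<in> cell (L / 2)"
  have "\<bar>x $ a\<bar> \<le> L / 2" for a
  proof -
    have "\<bar>x $ a\<bar> \<le> L / 2 / 2" using x unfolding cell_def by blast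
    then show ?thesis using L by linarith
  qed
  then show "x \<in> cell L" unfolding cell_def by blast
qed

lemma U_half: "x \<notin> cell (L / 2) \<Longrightarrow> U z x = 0"
  using norm_large u_outside_x by (simp add: U_def)

lemma U_cell: "x \<notin> cell L \<Longrightarrow> U z x = 0"
  using U_half half_cell by blast

text \<open>Bessel's inequality with a single frequency: the uniform bound on the increment,
  integrated over the cell, produces the cell volume, which cancels. The Lipschitz constant is thus
  independent of the period and the frequency.\<close>

lemma fcoef_lipschitz: "norm (fcoef L (U z) k - fcoef L (U z') k) \<le> \<Lambda> * dist z z'"
proof -
  let ?g = "\<lambda>x. U z x - U z' x"
  have gb: "\<bar>?g x\<bar> \<le> \<Lambda> * dist z z'" for x
  proof -
    have "\<bar>?g x\<bar> \<le> \<bar>u (x, z) - u (x, z')\<bar>" unfolding U_def by (rule abs_triangle_ineq3)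
    also have "\<dots> \<le> \<Lambda> * dist z z'" using lip[of "(x, z)" "(x, z')"] by (simp add: dist_Pair_Pair)
    finally show ?thesis .
  qed
  have "L ^ CARD('n) * (\<Sum>k\<in>{k}. (norm (fcoef L ?g k))\<^sup>2) \<le> (LINT x|lborel. (?g x)\<^sup>2)"
    by (rule bessel_cell[OF L]) (auto intro!: continuous_intros U_continuous simp: U_cell)
  also have "\<dots> \<le> (LINT x|lborel. indicator (cell L) (x::real^'n) *\<^sub>R (\<Lambda> * dist z z')\<^sup>2)"
  proof (rule Bochner_Integration.integral_mono)
    show "integrable lborel (\<lambda>x. (?g x)\<^sup>2)"
      by (rule integrable_continuous_compact_support[of _ R0]) (auto intro!: continuous_intros U_continuous simp: U_outside)
    show "integrable lborel (\<lambda>x::real^'n. indicator (cell L) x *\<^sub>R (\<Lambda> * dist z z')\<^sup>2)"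
      using set_integrable_cell[of "\<lambda>_::real^'n. (\<Lambda> * dist z z')\<^sup>2" L] by (simp add: set_integrable_def)
    fix x :: "real^'n"
    show "(?g x)\<^sup>2 \<le> indicator (cell L) x *\<^sub>R (\<Lambda> * dist z z')\<^sup>2"
    proof (cases "x \<in> cell L")
      case True
      then show ?thesis using power_mono[OF gb[of x], of 2] by simp
    qed (simp add: U_cell)
  qed
  also have "\<dots> = L ^ CARD('n) * (\<Lambda> * dist z z')\<^sup>2"
    using emeasure_compact_finite[of "cell L :: (real^'n) set"] compact_cell by (simp add: measure_cell[OF L] less_top[symmetric])
  finally have "(norm (fcoef L ?g k))\<^sup>2 \<le> (\<Lambda> * dist z z')\<^sup>2" using Vpos by simp
  then have "norm (fcoef L ?g k) \<le> \<Lambda> * dist z z'"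
    by (rule power2_le_imp_le) (simp add: \<Lambda>)
  then show ?thesis by (simp only: fcoef_diff[OF U_int U_int])
qed

lemma fcoef_difference_bound:
  assumes K: "finite K"
  shows "ennreal (\<Sum>k\<in>K. (norm (fcoef L (U z) k - fcoef L (U z') k))\<^sup>2) \<le> ennreal (1 / L ^ CARD('n)) * (\<integral>\<^sup>+x. ennreal ((u (x, z) - u (x, z'))\<^sup>2) \<partial>lborel)"
proof -
  let ?g = "\<lambda>x. U z x - U z' x"
  have i: "integrable lborel (\<lambda>x. (?g x)\<^sup>2)"
    by (rule integrable_continuous_compact_support[of _ R0]) (auto intro!: continuous_intros U_continuous simp: U_outside)
  have "L ^ CARD('n) * (\<Sum>k\<in>K. (norm (fcoef L ?g k))\<^sup>2) \<le> (LINT x|lborel. (?g x)\<^sup>2)"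
    by (rule bessel_cell[OF L K]) (auto intro!: continuous_intros U_continuous simp: U_cell)
  then have "(\<Sum>k\<in>K. (norm (fcoef L ?g k))\<^sup>2) \<le> 1 / L ^ CARD('n) * (LINT x|lborel. (?g x)\<^sup>2)"
    using Vpos by (simp add: field_simps)
  then have "ennreal (\<Sum>k\<in>K. (norm (fcoef L ?g k))\<^sup>2) \<le> ennreal (1 / L ^ CARD('n)) * ennreal (LINT x|lborel. (?g x)\<^sup>2)"
    using Vpos by (subst ennreal_mult'[symmetric]) (auto intro: ennreal_leI)
  also have "ennreal (LINT x|lborel. (?g x)\<^sup>2) = (\<integral>\<^sup>+x. ennreal ((?g x)\<^sup>2) \<partial>lborel)"
    by (rule nn_integral_eq_integral[OF i, symmetric]) simp
  also have "\<dots> \<le> (\<integral>\<^sup>+x. ennreal ((u (x, z) - u (x, z'))\<^sup>2) \<partial>lborel)"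
    unfolding U_def by (intro nn_integral_mono ennreal_leI abs_le_square_iff[THEN iffD1] abs_triangle_ineq3)
  finally show ?thesis by (simp only: fcoef_diff[OF U_int U_int] mult_left_mono zero_le)
qed

lemma fcoef_square_bound:
  assumes K: "finite K"
  shows "ennreal (\<Sum>k\<in>K. (norm (fcoef L (U z) k))\<^sup>2) \<le> ennreal (1 / L ^ CARD('n)) * (\<integral>\<^sup>+x. ennreal ((u (x, z))\<^sup>2) \<partial>lborel)"
proof -
  have i: "integrable lborel (\<lambda>x. (U z x)\<^sup>2)"
    by (rule integrable_continuous_compact_support[of _ R0]) (auto intro!: continuous_intros U_continuous simp: U_outside)
  have "L ^ CARD('n) * (\<Sum>k\<in>K. (norm (fcoef L (U z) k))\<^sup>2) \<le> (LINT x|lborel. (U z x)\<^sup>2)"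
    by (rule bessel_cell[OF L K U_continuous]) (simp add: U_cell)
  then have "(\<Sum>k\<in>K. (norm (fcoef L (U z) k))\<^sup>2) \<le> 1 / L ^ CARD('n) * (LINT x|lborel. (U z x)\<^sup>2)"
    using Vpos by (simp add: field_simps)
  then have "ennreal (\<Sum>k\<in>K. (norm (fcoef L (U z) k))\<^sup>2) \<le> ennreal (1 / L ^ CARD('n)) * ennreal (LINT x|lborel. (U z x)\<^sup>2)"
    using Vpos by (subst ennreal_mult'[symmetric]) (auto intro: ennreal_leI)
  also have "ennreal (LINT x|lborel. (U z x)\<^sup>2) = (\<integral>\<^sup>+x. ennreal ((U z x)\<^sup>2) \<partial>lborel)"
    by (rule nn_integral_eq_integral[OF i, symmetric]) simp
  also have "\<dots> = (\<integral>\<^sup>+x. ennreal ((u (x, z))\<^sup>2) \<partial>lborel)"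
    by (simp add: U_def)
  finally show ?thesis .
qed

text \<open>Bessel's inequality for the translates \<open>|u|(x + s b, z) - |u|(x, z)\<close>, divided by \<open>s\<^sup>2\<close>, in the
  limit \<open>s \<rightarrow> 0\<close>; this way \<open>|u|\<close> need not be differentiated.\<close>

lemma fcoef_gradient_bound:
  fixes K :: "(int^'n) set"
  assumes K: "finite K"
  shows "ennreal (\<Sum>k\<in>K. (2 * pi / L)\<^sup>2 * (norm (freq k))\<^sup>2 * (norm (fcoef L (U z) k))\<^sup>2)
    \<le> ennreal (1 / L ^ CARD('n)) * (\<integral>\<^sup>+x. ennreal ((norm (grad (\<lambda>x. u (x, z)) x))\<^sup>2) \<partial>lborel)"
proof -
  let ?a = "\<lambda>k. fcoef L (U z) k" and ?v = "\<lambda>x. u (x, z)"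
  have v1: "C_k (Suc 0) ?v" by (rule C_k_slice_x[OF u])
  have gm [measurable]: "grad ?v \<in> borel_measurable borel"
    using C_k_grad(2)[OF v1] by (rule borel_measurable_continuous_onI)
  have dir: "ennreal (\<Sum>k\<in>K. (2 * pi / L)\<^sup>2 * (freq k \<bullet> b)\<^sup>2 * (norm (?a k))\<^sup>2)
      \<le> ennreal (1 / L ^ CARD('n)) * (\<integral>\<^sup>+x. ennreal ((grad ?v x \<bullet> b)\<^sup>2) \<partial>lborel)" if b: "b \<in> Basis" for b
  proof -
    have bound: "ennreal (\<Sum>k\<in>K. (norm (wave L k (s *\<^sub>R b) - 1))\<^sup>2 / s\<^sup>2 * (norm (?a k))\<^sup>2)
       \<le> ennreal (1 / L ^ CARD('n)) * (\<integral>\<^sup>+x. ennreal ((grad ?v x \<bullet> b)\<^sup>2) \<partial>lborel)" if s: "0 < s" "s < 1" for s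
    proof -
      let ?U' = "\<lambda>x. U z (x + s *\<^sub>R b)"
      let ?g = "\<lambda>x. ?U' x - U z x"
      have [measurable]: "U z \<in> borel_measurable borel" using U_continuous by (rule borel_measurable_continuous_onI)
      have U'c: "continuous_on UNIV ?U'" by (intro continuous_on_compose2[OF U_continuous] continuous_intros) auto
      have shift: "U z (x + s *\<^sub>R b) = 0" if x: "x \<notin> cell L" for x
      proof -
        obtain a where "\<bar>x $ a\<bar> > L / 2" using x unfolding cell_def mem_Collect_eq not_all not_le by blast
        moreover have "\<bar>x $ a\<bar> \<le> norm x" by (rule component_le_norm_cart)
        moreover have "norm x \<le> norm (x + s *\<^sub>R b) + norm (s *\<^sub>R b)"
          using norm_triangle_ineq4[of "x + s *\<^sub>R b" "s *\<^sub>R b"] by simp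
        moreover have "norm (s *\<^sub>R b) \<le> 1" using s b by simp
        ultimately have "norm (x + s *\<^sub>R b) > R0" using LR by linarith
        then show ?thesis by (simp add: U_def u_outside_x)
      qed
      have i: "integrable lborel (\<lambda>x. (?g x)\<^sup>2)"
      proof -
        have "set_integrable lborel (cell L) (\<lambda>x. (?g x)\<^sup>2)" by (intro set_integrable_cell continuous_intros U'c U_continuous)
        moreover have "indicator (cell L) x *\<^sub>R (?g x)\<^sup>2 = (?g x)\<^sup>2" for x
          using shift[of x] U_cell[of x z] by (auto simp: indicator_def)
        ultimately show ?thesis by (simp only: set_integrable_def)
      qed
      have i': "integrable lborel ?U'"
      proof -
        have "set_integrable lborel (cell L) ?U'" by (intro set_integrable_cell U'c)
        moreover have "indicator (cell L) x *\<^sub>R ?U' x = ?U' x" for x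
          using shift[of x] by (auto simp: indicator_def)
        ultimately show ?thesis by (simp only: set_integrable_def)
      qed
      have fg: "fcoef L ?g k = (wave L k (s *\<^sub>R b) - 1) * ?a k" for k
        using fcoef_translate[of "U z" L "s *\<^sub>R b" k] by (simp add: fcoef_diff[OF i' U_int] left_diff_distrib)
      have "L ^ CARD('n) * (\<Sum>k\<in>K. (norm (fcoef L ?g k))\<^sup>2) \<le> (LINT x|lborel. (?g x)\<^sup>2)"
        by (rule bessel_cell[OF L K]) (auto intro!: continuous_intros U'c U_continuous simp: U_cell shift)
      then have "(\<Sum>k\<in>K. (norm (fcoef L ?g k))\<^sup>2) \<le> 1 / L ^ CARD('n) * (LINT x|lborel. (?g x)\<^sup>2)"
        using Vpos by (simp add: field_simps)
      then have "ennreal (\<Sum>k\<in>K. (norm (fcoef L ?g k))\<^sup>2) \<le> ennreal (1 / L ^ CARD('n)) * ennreal (LINT x|lborel. (?g x)\<^sup>2)"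
        using Vpos by (subst ennreal_mult'[symmetric]) (auto intro: ennreal_leI)
      also have "ennreal (LINT x|lborel. (?g x)\<^sup>2) = (\<integral>\<^sup>+x. ennreal ((?g x)\<^sup>2) \<partial>lborel)"
        by (rule nn_integral_eq_integral[OF i, symmetric]) simp
      also have "\<dots> \<le> (\<integral>\<^sup>+x. ennreal (1 * (?v (x + s *\<^sub>R b) - ?v x)\<^sup>2) \<partial>lborel)"
        unfolding U_def mult_1_left by (intro nn_integral_mono ennreal_leI abs_le_square_iff[THEN iffD1] abs_triangle_ineq3)
      also have "\<dots> \<le> (\<integral>\<^sup>+x. ennreal (1 * (grad ?v x \<bullet> (s *\<^sub>R b))\<^sup>2) \<partial>lborel)"
        by (rule nn_integral_increment_le[OF C_k_grad(1)[OF v1]]) (auto intro!: continuous_intros C_k_grad(2)[OF v1])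
      also have "\<dots> = (\<integral>\<^sup>+x. ennreal (s\<^sup>2) * ennreal ((grad ?v x \<bullet> b)\<^sup>2) \<partial>lborel)"
        by (simp add: power_mult_distrib ennreal_mult')
      also have "\<dots> = ennreal (s\<^sup>2) * (\<integral>\<^sup>+x. ennreal ((grad ?v x \<bullet> b)\<^sup>2) \<partial>lborel)"
        by (rule nn_integral_cmult) measurable
      finally have *: "ennreal (\<Sum>k\<in>K. (norm (fcoef L ?g k))\<^sup>2) \<le> ennreal (1 / L ^ CARD('n)) * (ennreal (s\<^sup>2) * (\<integral>\<^sup>+x. ennreal ((grad ?v x \<bullet> b)\<^sup>2) \<partial>lborel))"
        by (simp add: mult_left_mono)
      have "(\<Sum>k\<in>K. (norm (wave L k (s *\<^sub>R b) - 1))\<^sup>2 / s\<^sup>2 * (norm (?a k))\<^sup>2) = (1 / s\<^sup>2) * (\<Sum>k\<in>K. (norm (fcoef L ?g k))\<^sup>2)"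
        by (simp add: fg norm_mult power_mult_distrib sum_distrib_left)
      then have "ennreal (\<Sum>k\<in>K. (norm (wave L k (s *\<^sub>R b) - 1))\<^sup>2 / s\<^sup>2 * (norm (?a k))\<^sup>2) = ennreal (1 / s\<^sup>2) * ennreal (\<Sum>k\<in>K. (norm (fcoef L ?g k))\<^sup>2)"
        by (simp only:) (rule ennreal_mult', simp)
      also have "\<dots> \<le> ennreal (1 / s\<^sup>2) * (ennreal (1 / L ^ CARD('n)) * (ennreal (s\<^sup>2) * (\<integral>\<^sup>+x. ennreal ((grad ?v x \<bullet> b)\<^sup>2) \<partial>lborel)))"
        using * by (rule mult_left_mono) simp
      also have "\<dots> = (ennreal (1 / s\<^sup>2) * ennreal (s\<^sup>2)) * (ennreal (1 / L ^ CARD('n)) * (\<integral>\<^sup>+x. ennreal ((grad ?v x \<bullet> b)\<^sup>2) \<partial>lborel))"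
        by (simp only: mult_ac)
      also have "ennreal (1 / s\<^sup>2) * ennreal (s\<^sup>2) = 1"
        using s by (simp add: ennreal_mult'[symmetric])
      finally show ?thesis by simp
    qed
    have "((\<lambda>s. ennreal (\<Sum>k\<in>K. (norm (wave L k (s *\<^sub>R b) - 1))\<^sup>2 / s\<^sup>2 * (norm (?a k))\<^sup>2))
        \<longlongrightarrow> ennreal (\<Sum>k\<in>K. (2 * pi / L)\<^sup>2 * (freq k \<bullet> b)\<^sup>2 * (norm (?a k))\<^sup>2)) (at_right 0)"
      by (intro tendsto_ennrealI tendsto_sum tendsto_mult wave_difference_quotient L tendsto_const)
    moreover have "\<forall>\<^sub>F s in at_right 0. ennreal (\<Sum>k\<in>K. (norm (wave L k (s *\<^sub>R b) - 1))\<^sup>2 / s\<^sup>2 * (norm (?a k))\<^sup>2)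
        \<le> ennreal (1 / L ^ CARD('n)) * (\<integral>\<^sup>+x. ennreal ((grad ?v x \<bullet> b)\<^sup>2) \<partial>lborel)"
      by (rule eventually_at_rightI[of 0 1]) (use bound in auto)
    ultimately show ?thesis by (intro tendsto_upperbound) auto
  qed
  have sq: "(norm y)\<^sup>2 = (\<Sum>b\<in>Basis. (y \<bullet> b)\<^sup>2)" for y :: "real^'n"
    unfolding power2_norm_eq_inner by (subst euclidean_inner) (simp only: power2_eq_square)
  have "ennreal (\<Sum>k\<in>K. (2 * pi / L)\<^sup>2 * (norm (freq k))\<^sup>2 * (norm (?a k))\<^sup>2)
     = ennreal (\<Sum>b\<in>Basis. \<Sum>k\<in>K. (2 * pi / L)\<^sup>2 * (freq k \<bullet> b)\<^sup>2 * (norm (?a k))\<^sup>2)"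
    unfolding sq[of "freq _"] by (subst sum.swap) (simp add: sum_distrib_left sum_distrib_right)
  also have "\<dots> = (\<Sum>b\<in>Basis. ennreal (\<Sum>k\<in>K. (2 * pi / L)\<^sup>2 * (freq k \<bullet> b)\<^sup>2 * (norm (?a k))\<^sup>2))"
    by (intro sum_ennreal[symmetric] sum_nonneg) auto
  also have "\<dots> \<le> (\<Sum>b\<in>Basis. ennreal (1 / L ^ CARD('n)) * (\<integral>\<^sup>+x. ennreal ((grad ?v x \<bullet> b)\<^sup>2) \<partial>lborel))"
    by (intro sum_mono dir)
  also have "\<dots> = ennreal (1 / L ^ CARD('n)) * (\<integral>\<^sup>+x. (\<Sum>b\<in>Basis. ennreal ((grad ?v x \<bullet> b)\<^sup>2)) \<partial>lborel)"
    by (subst nn_integral_sum) (auto simp: sum_distrib_left)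
  also have "(\<integral>\<^sup>+x. (\<Sum>b\<in>Basis. ennreal ((grad ?v x \<bullet> b)\<^sup>2)) \<partial>lborel) = (\<integral>\<^sup>+x. ennreal ((norm (grad ?v x))\<^sup>2) \<partial>lborel)"
    unfolding sq by (simp add: sum_ennreal)
  finally show ?thesis .
qed

end

section \<open>Moduli of the coefficients of the Fejer means\<close>

context test_function_fourier
begin

lemma u_measurable [measurable]: "u \<in> borel_measurable borel"
  using u_continuous by (rule borel_measurable_continuous_onI)

lemma fcoef_support: "norm z > R0 \<Longrightarrow> fcoef L (U z) k = 0"
proof -
  assume "norm z > R0"
  then have "U z = (\<lambda>x. 0)" by (simp add: U_def u_outside_z fun_eq_iff)
  then show ?thesis by (simp add: fcoef_def)
qed

text \<open>When \<open>c\<close> is the family of multipliers of a Fejer mean, this is the modulus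
  of the coefficient of the mean of \<open>U z\<close> at frequency \<open>k\<close>.\<close>

definition mcoef :: "(int^'n \<Rightarrow> complex) \<Rightarrow> int^'n \<Rightarrow> real^'m \<Rightarrow> real" where
  "mcoef c k z = norm (c k * fcoef L (U z) k)"

lemma mcoef_lipschitz:
  assumes c: "norm (c k) \<le> 1"
  shows "\<bar>mcoef c k z - mcoef c k z'\<bar> \<le> norm (fcoef L (U z) k - fcoef L (U z') k)"
proof -
  have "\<bar>mcoef c k z - mcoef c k z'\<bar> \<le> norm (c k * fcoef L (U z) k - c k * fcoef L (U z') k)"
    unfolding mcoef_def by (rule norm_triangle_ineq3)
  also have "\<dots> = norm (c k) * norm (fcoef L (U z) k - fcoef L (U z') k)"
    by (simp add: norm_mult[symmetric] right_diff_distrib)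
  also have "\<dots> \<le> 1 * norm (fcoef L (U z) k - fcoef L (U z') k)"
    using c by (rule mult_right_mono) simp
  finally show ?thesis by simp
qed

lemma mcoef_le: "norm (c k) \<le> 1 \<Longrightarrow> mcoef c k z \<le> norm (fcoef L (U z) k)"
  unfolding mcoef_def norm_mult by (rule mult_left_le_one_le) auto

lemma mcoef_continuous:
  assumes c: "norm (c k) \<le> 1"
  shows "continuous_on UNIV (mcoef c k)"
proof (rule lipschitz_on_continuous_on, rule lipschitz_onI[OF _ \<Lambda>])
  fix z z' :: "real^'m"
  show "dist (mcoef c k z) (mcoef c k z') \<le> \<Lambda> * dist z z'"
    using mcoef_lipschitz[of c k z z', OF assms] fcoef_lipschitz[of z k z'] by (simp add: dist_real_def)
qed

lemma mcoef_measurable: "norm (c k) \<le> 1 \<Longrightarrow> mcoef c k \<in> borel_measurable borel"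
  by (intro borel_measurable_continuous_onI mcoef_continuous)

text \<open>For each pair \<open>z\<close>, \<open>z'\<close> Bessel's inequality bounds the sum
  over the frequencies by an integral over x; Fubini then exposes the difference energies of the
  slices of \<open>u\<close>, which their Dirichlet integrals control.\<close>

lemma mcoef_diff_energy:
  assumes K: "finite K" and c: "\<And>k. norm (c k) \<le> 1" and A: "0 \<le> A"
    and le: "(\<integral>\<^sup>+p. ennreal ((norm (grad_z u p))\<^sup>2) \<partial>lborel) \<le> ennreal A"
  shows "(\<Sum>k\<in>K. diff_energy h (mcoef c k)) \<le> ennreal (A / L ^ CARD('n)) * second_moment TYPE(real^'m) h"
proof -
  let ?i = "\<lambda>z z'::real^'m. indicator {..<h} (dist z z') :: ennreal" and ?c = "ennreal (1 / L ^ CARD('n))"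
  let ?sm = "second_moment TYPE(real^'m) h"
  note [measurable] = mcoef_measurable[OF c]
  have gz: "grad_z u \<in> borel_measurable borel" by (rule grads_measurable[OF u])
  have "(\<Sum>k\<in>K. diff_energy h (mcoef c k)) = (\<integral>\<^sup>+z. \<integral>\<^sup>+z'. (\<Sum>k\<in>K. ?i z z' * ennreal ((mcoef c k z - mcoef c k z')\<^sup>2)) \<partial>lborel \<partial>lborel)"
    unfolding diff_energy_def
    by (subst nn_integral_sum[symmetric], measurable, subst nn_integral_sum[symmetric], measurable)
  also have "\<dots> \<le> (\<integral>\<^sup>+z. \<integral>\<^sup>+z'. ?i z z' * (?c * (\<integral>\<^sup>+x. ennreal ((u (x, z) - u (x, z'))\<^sup>2) \<partial>lborel)) \<partial>lborel \<partial>lborel)"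
  proof (rule nn_integral_mono, rule nn_integral_mono)
    fix z z' :: "real^'m"
    have "(\<Sum>k\<in>K. ?i z z' * ennreal ((mcoef c k z - mcoef c k z')\<^sup>2)) = ?i z z' * ennreal (\<Sum>k\<in>K. (mcoef c k z - mcoef c k z')\<^sup>2)"
      by (simp add: sum_distrib_left[symmetric] sum_ennreal)
    also have "(\<Sum>k\<in>K. (mcoef c k z - mcoef c k z')\<^sup>2) \<le> (\<Sum>k\<in>K. (norm (fcoef L (U z) k - fcoef L (U z') k))\<^sup>2)"
      using mcoef_lipschitz[OF c] by (intro sum_mono abs_le_square_iff[THEN iffD1]) simp
    then have "?i z z' * ennreal (\<Sum>k\<in>K. (mcoef c k z - mcoef c k z')\<^sup>2) \<le> ?i z z' * ennreal (\<Sum>k\<in>K. (norm (fcoef L (U z) k - fcoef L (U z') k))\<^sup>2)"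
      by (intro mult_left_mono ennreal_leI) auto
    also have "\<dots> \<le> ?i z z' * (?c * (\<integral>\<^sup>+x. ennreal ((u (x, z) - u (x, z'))\<^sup>2) \<partial>lborel))"
      by (rule mult_left_mono[OF fcoef_difference_bound[OF K]]) simp
    finally show "(\<Sum>k\<in>K. ?i z z' * ennreal ((mcoef c k z - mcoef c k z')\<^sup>2)) \<le> ?i z z' * (?c * (\<integral>\<^sup>+x. ennreal ((u (x, z) - u (x, z'))\<^sup>2) \<partial>lborel))" .
  qed
  also have "\<dots> = (\<integral>\<^sup>+z. \<integral>\<^sup>+z'. ?c * (\<integral>\<^sup>+x. ?i z z' * ennreal ((u (x, z) - u (x, z'))\<^sup>2) \<partial>lborel) \<partial>lborel \<partial>lborel)"
    by (intro nn_integral_cong) (simp add: nn_integral_cmult mult_ac)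
  also have "\<dots> = ?c * (\<integral>\<^sup>+z. \<integral>\<^sup>+z'. \<integral>\<^sup>+x. ?i z z' * ennreal ((u (x, z) - u (x, z'))\<^sup>2) \<partial>lborel \<partial>lborel \<partial>lborel)"
    by (simp add: nn_integral_cmult)
  also have "(\<integral>\<^sup>+z. \<integral>\<^sup>+z'. \<integral>\<^sup>+x. ?i z z' * ennreal ((u (x, z) - u (x, z'))\<^sup>2) \<partial>lborel \<partial>lborel \<partial>lborel)
      = (\<integral>\<^sup>+z. \<integral>\<^sup>+x. \<integral>\<^sup>+z'. ?i z z' * ennreal ((u (x, z) - u (x, z'))\<^sup>2) \<partial>lborel \<partial>lborel \<partial>lborel)"
    by (intro nn_integral_cong lborel_pair.Fubini') measurable
  also have "\<dots> = (\<integral>\<^sup>+x. diff_energy h (\<lambda>z. u (x, z)) \<partial>lborel)"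
    unfolding diff_energy_def by (intro lborel_pair.Fubini') measurable
  also have "\<dots> \<le> (\<integral>\<^sup>+x. ?sm * (\<integral>\<^sup>+z. ennreal ((norm (grad (\<lambda>z. u (x, z)) z))\<^sup>2) \<partial>lborel) \<partial>lborel)"
    by (intro nn_integral_mono diff_energy_le C_k_slice_z u)
  also have "\<dots> = (\<integral>\<^sup>+x. ?sm * (\<integral>\<^sup>+z. ennreal ((norm (grad_z u (x, z)))\<^sup>2) \<partial>lborel) \<partial>lborel)"
    by (simp only: grad_z_eq[OF u])
  also have "\<dots> = ?sm * (\<integral>\<^sup>+x. (\<integral>\<^sup>+z. ennreal ((norm (grad_z u (x, z)))\<^sup>2) \<partial>lborel) \<partial>lborel)"
    using gz by (intro nn_integral_cmult) (measurable, simp add: borel_prod)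
  also have "(\<integral>\<^sup>+x. (\<integral>\<^sup>+z. ennreal ((norm (grad_z u (x, z)))\<^sup>2) \<partial>lborel) \<partial>lborel) = (\<integral>\<^sup>+p. ennreal ((norm (grad_z u p))\<^sup>2) \<partial>lborel)"
    using gz by (intro nn_integral_lborel_pair(2)[symmetric]) measurable
  finally have "(\<Sum>k\<in>K. diff_energy h (mcoef c k)) \<le> ?c * (?sm * (\<integral>\<^sup>+p. ennreal ((norm (grad_z u p))\<^sup>2) \<partial>lborel))"
    by (simp add: mult_left_mono)
  also have "\<dots> \<le> ?c * (?sm * ennreal A)"
    by (intro mult_left_mono le) auto
  also have "\<dots> = (?c * ennreal A) * ?sm" by (simp only: mult_ac)
  also have "?c * ennreal A = ennreal (A / L ^ CARD('n))"
    using Vpos A by (subst ennreal_mult'[symmetric]) auto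
  finally show ?thesis .
qed

text \<open>Common form of two bounds: \<open>g\<close> the squared frequencies with
  \<open>q\<close> the squared x-gradient of \<open>u\<close>, and \<open>g\<close> constant 1 with
  \<open>q\<close> the square of \<open>u\<close>.\<close>

lemma mcoef_weighted:
  fixes K :: "(int^'n) set" and q :: "('n, 'm) point \<Rightarrow> real" and \<omega> :: "real^'m \<Rightarrow> real"
  assumes K: "finite K" and c: "\<And>k. norm (c k) \<le> 1" and B: "0 \<le> B"
    and \<omega>: "\<And>z. 0 \<le> \<omega> z" and \<omega>m [measurable]: "\<omega> \<in> borel_measurable borel" and g: "\<And>k. 0 \<le> g k"
    and q [measurable]: "q \<in> borel_measurable borel" and q0: "\<And>p. 0 \<le> q p"
    and bound: "\<And>z. ennreal (\<Sum>k\<in>K. g k * (norm (fcoef L (U z) k))\<^sup>2) \<le> ennreal (1 / L ^ CARD('n)) * (\<integral>\<^sup>+x. ennreal (q (x, z)) \<partial>lborel)"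
    and le: "(\<integral>\<^sup>+p. ennreal (\<omega> (snd p) * q p) \<partial>lborel) \<le> ennreal B"
  shows "(\<integral>\<^sup>+z. ennreal (\<omega> z * (\<Sum>k\<in>K. g k * (mcoef c k z)\<^sup>2)) \<partial>lborel) \<le> ennreal (B / L ^ CARD('n))"
proof -
  let ?c = "ennreal (1 / L ^ CARD('n))"
  have \<omega>s: "(\<lambda>p. \<omega> (snd p)) \<in> borel_measurable (borel :: ((real^'n) \<times> (real^'m)) measure)"
    by (intro measurable_compose[OF _ \<omega>m] borel_measurable_continuous_onI continuous_intros)
  have "(\<integral>\<^sup>+z. ennreal (\<omega> z * (\<Sum>k\<in>K. g k * (mcoef c k z)\<^sup>2)) \<partial>lborel) \<le> (\<integral>\<^sup>+z. ?c * (\<integral>\<^sup>+x. ennreal (\<omega> z * q (x, z)) \<partial>lborel) \<partial>lborel)"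
  proof (rule nn_integral_mono)
    fix z
    have "(\<Sum>k\<in>K. g k * (mcoef c k z)\<^sup>2) \<le> (\<Sum>k\<in>K. g k * (norm (fcoef L (U z) k))\<^sup>2)"
      using mcoef_le[OF c] g by (intro sum_mono mult_left_mono power_mono) (auto simp: mcoef_def)
    then have "ennreal (\<omega> z * (\<Sum>k\<in>K. g k * (mcoef c k z)\<^sup>2)) \<le> ennreal (\<omega> z * (\<Sum>k\<in>K. g k * (norm (fcoef L (U z) k))\<^sup>2))"
      by (intro ennreal_leI mult_left_mono \<omega>)
    also have "\<dots> = ennreal (\<omega> z) * ennreal (\<Sum>k\<in>K. g k * (norm (fcoef L (U z) k))\<^sup>2)"
      by (rule ennreal_mult'[OF \<omega>])
    also have "\<dots> \<le> ennreal (\<omega> z) * (?c * (\<integral>\<^sup>+x. ennreal (q (x, z)) \<partial>lborel))"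
      by (rule mult_left_mono[OF bound]) simp
    also have "\<dots> = ?c * (\<integral>\<^sup>+x. ennreal (\<omega> z * q (x, z)) \<partial>lborel)"
      by (simp add: ennreal_mult'[OF \<omega>] nn_integral_cmult mult_ac)
    finally show "ennreal (\<omega> z * (\<Sum>k\<in>K. g k * (mcoef c k z)\<^sup>2)) \<le> ?c * (\<integral>\<^sup>+x. ennreal (\<omega> z * q (x, z)) \<partial>lborel)" .
  qed
  also have "\<dots> = ?c * (\<integral>\<^sup>+z. \<integral>\<^sup>+x. ennreal (\<omega> z * q (x, z)) \<partial>lborel \<partial>lborel)"
    by (rule nn_integral_cmult) measurable
  also have "(\<integral>\<^sup>+z. \<integral>\<^sup>+x. ennreal (\<omega> z * q (x, z)) \<partial>lborel \<partial>lborel) = (\<integral>\<^sup>+p. ennreal (\<omega> (snd p) * q p) \<partial>lborel)"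
    by (subst nn_integral_lborel_pair(1)) (use \<omega>s q in \<open>auto intro!: measurable_compose[OF _ measurable_ennreal] borel_measurable_times\<close>)
  finally have "(\<integral>\<^sup>+z. ennreal (\<omega> z * (\<Sum>k\<in>K. g k * (mcoef c k z)\<^sup>2)) \<partial>lborel) \<le> ?c * (\<integral>\<^sup>+p. ennreal (\<omega> (snd p) * q p) \<partial>lborel)" .
  also have "\<dots> \<le> ?c * ennreal B" by (intro mult_left_mono le) simp
  also have "\<dots> = ennreal (B / L ^ CARD('n))"
    using Vpos B by (subst ennreal_mult'[symmetric]) auto
  finally show ?thesis .
qed

text \<open>The mean is nonnegative, so enlarging the half cell to the cell only increases the
  integral. There the power is a sum over zero-sum tuples, and the triangle inequality replaces the
  coefficients by their moduli.\<close>

lemma fmean_power_le: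
  assumes K: "finite K" and fm: "\<And>x. of_real (fmean L M (U z) x) = (\<Sum>k\<in>K. c k * fcoef L (U z) k * wave L k x)"
  shows "(\<integral>\<^sup>+x. indicator (cell (L / 2)) x * ennreal (fmean L M (U z) x ^ p) \<partial>lborel)
    \<le> ennreal (L ^ CARD('n) * (\<Sum>\<phi>\<in>{\<phi> \<in> PiE {..<p} (\<lambda>_. K). (\<Sum>i<p. \<phi> i) = 0}. \<Prod>i<p. mcoef c (\<phi> i) z))"
proof -
  let ?m = "fmean L M (U z)" and ?P = "{\<phi> \<in> PiE {..<p} (\<lambda>_. K). (\<Sum>i<p. \<phi> i) = 0}"
  have m0: "0 \<le> ?m x" for x by (rule fmean_nonneg[OF L]) (simp add: U_def)
  have "?m = (\<lambda>x. Re (\<Sum>k\<in>K. c k * fcoef L (U z) k * wave L k x))"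
    using fm by (metis Re_complex_of_real)
  then have mc: "continuous_on UNIV ?m"
    by (simp only:) (intro continuous_intros)
  have ii: "set_integrable lborel (cell L) (\<lambda>x. ?m x ^ p)" by (intro set_integrable_cell continuous_intros mc)
  have "of_real (LINT x:cell L|lborel. ?m x ^ p) = (LINT x:cell L|lborel. of_real (?m x ^ p) :: complex)"
    by (simp add: set_lebesgue_integral_def scaleR_conv_of_real flip: integral_complex_of_real)
  also have "\<dots> = (LINT x:cell L|lborel. (\<Sum>k\<in>K. c k * fcoef L (U z) k * wave L k x) ^ p)"
    by (simp only: of_real_power fm)
  also have "\<dots> = of_real (L ^ CARD('n)) * (\<Sum>\<phi>\<in>?P. \<Prod>i<p. c (\<phi> i) * fcoef L (U z) (\<phi> i))"
    by (rule power_cell[OF L K])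
  finally have eq: "of_real (LINT x:cell L|lborel. ?m x ^ p) = of_real (L ^ CARD('n)) * (\<Sum>\<phi>\<in>?P. \<Prod>i<p. c (\<phi> i) * fcoef L (U z) (\<phi> i))" .
  have "(LINT x:cell L|lborel. ?m x ^ p) \<le> norm (of_real (LINT x:cell L|lborel. ?m x ^ p) :: complex)"
    by simp
  also have "\<dots> \<le> L ^ CARD('n) * (\<Sum>\<phi>\<in>?P. \<Prod>i<p. mcoef c (\<phi> i) z)"
  proof -
    have "norm (\<Sum>\<phi>\<in>?P. \<Prod>i<p. c (\<phi> i) * fcoef L (U z) (\<phi> i)) \<le> (\<Sum>\<phi>\<in>?P. \<Prod>i<p. mcoef c (\<phi> i) z)"
      unfolding mcoef_def prod_norm by (rule norm_sum)
    then have "L ^ CARD('n) * norm (\<Sum>\<phi>\<in>?P. \<Prod>i<p. c (\<phi> i) * fcoef L (U z) (\<phi> i)) \<le> L ^ CARD('n) * (\<Sum>\<phi>\<in>?P. \<Prod>i<p. mcoef c (\<phi> i) z)"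
      using Vpos by (intro mult_left_mono) auto
    moreover have "norm (complex_of_real (L ^ CARD('n))) = L ^ CARD('n)"
      using Vpos by (simp only: norm_of_real)
    ultimately show ?thesis by (simp only: eq norm_mult)
  qed
  finally have le: "(LINT x:cell L|lborel. ?m x ^ p) \<le> L ^ CARD('n) * (\<Sum>\<phi>\<in>?P. \<Prod>i<p. mcoef c (\<phi> i) z)" .
  have "(\<integral>\<^sup>+x. indicator (cell (L / 2)) x * ennreal (?m x ^ p) \<partial>lborel) \<le> (\<integral>\<^sup>+x. ennreal (indicator (cell L) x *\<^sub>R ?m x ^ p) \<partial>lborel)"
    using half_cell by (intro nn_integral_mono) (auto simp: indicator_def)
  also have "\<dots> = ennreal (LINT x:cell L|lborel. ?m x ^ p)"
    unfolding set_lebesgue_integral_def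
    using ii m0 by (intro nn_integral_eq_integral) (auto simp: set_integrable_def)
  also have "\<dots> \<le> ennreal (L ^ CARD('n) * (\<Sum>\<phi>\<in>?P. \<Prod>i<p. mcoef c (\<phi> i) z))"
    by (rule ennreal_leI[OF le])
  finally show ?thesis .
qed

text \<open>Bessel gives each energy term the factor one over the cell volume, and the lift returns
  the volume, so the energy is free of \<open>L\<close>. One cell volume remains on the right, to be
  matched by \<open>Z\<close> for a cutoff spread over the cell.\<close>

lemma fourier_sobolev:
  fixes \<zeta> :: "real^'n \<Rightarrow> real"
  assumes rad: "\<And>\<psi>::('n, 'm) point \<Rightarrow> real. \<psi> \<in> test_functions \<Longrightarrow> radial_z \<psi> \<Longrightarrow> sob \<tau> S p \<psi>"
    and \<tau>: "0 < \<tau>" and S: "0 < S" and p: "0 < p"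
    and \<zeta>: "\<And>j. C_k j \<zeta>" "\<And>x. 0 \<le> \<zeta> x" "\<And>x. \<zeta> x \<le> 1" "\<And>x. x \<notin> cell L \<Longrightarrow> \<zeta> x = 0" "\<And>x. norm (grad \<zeta> x) \<le> D"
    and Z: "(\<integral>\<^sup>+x. ennreal (\<zeta> x ^ p) \<partial>lborel) = ennreal Z" "0 < Z"
    and s: "0 < s" and nn: "0 \<le> A" "0 \<le> B" "0 \<le> \<Gamma>"
    and A: "(\<integral>\<^sup>+p. ennreal ((norm (grad_z u p))\<^sup>2) \<partial>lborel) \<le> ennreal A"
    and B: "(\<integral>\<^sup>+p. ennreal (norm (snd p) powr (2 * \<tau>) * (norm (grad_x u p))\<^sup>2) \<partial>lborel) \<le> ennreal B"
    and \<Gamma>: "(\<integral>\<^sup>+p. ennreal (norm (snd p) powr (2 * \<tau>) * (u p)\<^sup>2) \<partial>lborel) \<le> ennreal \<Gamma>"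
  shows "ennreal Z * (\<integral>\<^sup>+q. ennreal (\<bar>u q\<bar> ^ p) \<partial>lborel)
    \<le> ennreal (L ^ CARD('n) * ((A + (\<tau> + 1)\<^sup>2 * ((1 + s) * B + (1 + 1 / s) * D\<^sup>2 * \<Gamma>)) / S) powr (real p / 2))"
proof -
  let ?V = "L ^ CARD('n)" and ?w = "\<lambda>z::real^'m. norm z powr (2 * \<tau>)"
  define C where "C = ((A + (\<tau> + 1)\<^sup>2 * ((1 + s) * B + (1 + 1 / s) * D\<^sup>2 * \<Gamma>)) / S) powr (real p / 2)"
  have C0: "0 \<le> C" by (simp add: C_def)
  define multipliers where "multipliers M K c \<longleftrightarrow> finite K \<and> uminus ` K = K \<and> (\<forall>k. norm (c k) \<le> 1) \<and> (\<forall>k. c (- k) = cnj (c k)) \<and>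
     (\<forall>(g::real^'n \<Rightarrow> real) x. integrable lborel g \<longrightarrow> of_real (fmean L M g x) = (\<Sum>k\<in>K. c k * fcoef L g k * wave L k x))"
    for M K c
  have "\<forall>M. \<exists>K c. multipliers M K c"
    unfolding multipliers_def using fejer_multipliers[OF L] by blast
  then obtain K where "\<forall>M. \<exists>c. multipliers M (K M) c"
    by (rule choice[THEN exE])
  then obtain c where "\<forall>M. multipliers M (K M) (c M)"
    by (rule choice[THEN exE])
  then have Kc: "\<And>M. finite (K M)" "\<And>M. uminus ` K M = K M" "\<And>M k. norm (c M k) \<le> 1" "\<And>M k. c M (- k) = cnj (c M k)"
     "\<And>M (g::real^'n \<Rightarrow> real) x. integrable lborel g \<Longrightarrow> of_real (fmean L M g x) = (\<Sum>k\<in>K M. c M k * fcoef L g k * wave L k x)"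
    by (simp_all add: multipliers_def)
  define J where "J M z = (\<Sum>\<phi>\<in>{\<phi> \<in> PiE {..<p} (\<lambda>_. K M). (\<Sum>i<p. \<phi> i) = 0}. \<Prod>i<p. mcoef (c M) (\<phi> i) z)" for M z
  have Jm: "J M \<in> borel_measurable borel" for M
    unfolding J_def[abs_def] by (intro borel_measurable_sum borel_measurable_prod mcoef_measurable Kc(3))
  have J0: "0 \<le> J M z" for M z
    unfolding J_def mcoef_def by (intro sum_nonneg prod_nonneg) auto
  have u_measurable': "u \<in> borel_measurable borel" by (rule u_measurable)
  have gx: "grad_x u \<in> borel_measurable borel" by (rule grads_measurable[OF u])
  \<comment> \<open>The bound does not depend on \<open>M\<close>; this allows passing from the
    Fejer means to \<open>U z\<close> by Fatou's lemma, in both variables.\<close>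
  have JM: "ennreal Z * (\<integral>\<^sup>+z. ennreal (J M z) \<partial>lborel) \<le> ennreal C" for M
  proof -
    let ?f = "mcoef (c M)"
    have \<alpha>: "(\<Sum>k\<in>K M. diff_energy h (?f k)) \<le> ennreal (A / ?V) * second_moment TYPE(real^'m) h" for h
      by (rule mcoef_diff_energy[OF Kc(1) Kc(3) nn(1) A])
    have \<beta>: "(\<integral>\<^sup>+z. ennreal (?w z * (\<Sum>k\<in>K M. (2 * pi / L)\<^sup>2 * (norm (freq k))\<^sup>2 * (?f k z)\<^sup>2)) \<partial>lborel) \<le> ennreal (B / ?V)"
    proof (rule mcoef_weighted[OF Kc(1) Kc(3) nn(2)])
      show "(\<lambda>p. (norm (grad_x u p))\<^sup>2) \<in> borel_measurable borel" using gx by measurable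
      fix z
      show "ennreal (\<Sum>k\<in>K M. (2 * pi / L)\<^sup>2 * (norm (freq k))\<^sup>2 * (norm (fcoef L (U z) k))\<^sup>2)
         \<le> ennreal (1 / ?V) * (\<integral>\<^sup>+x. ennreal ((norm (grad_x u (x, z)))\<^sup>2) \<partial>lborel)"
        unfolding grad_x_eq[OF u] by (rule fcoef_gradient_bound[OF Kc(1)])
    qed (use B in auto)
    have \<gamma>: "(\<integral>\<^sup>+z. ennreal (?w z * (\<Sum>k\<in>K M. 1 * (?f k z)\<^sup>2)) \<partial>lborel) \<le> ennreal (\<Gamma> / ?V)"
    proof (rule mcoef_weighted[OF Kc(1) Kc(3) nn(3)])
      show "(\<lambda>p. (u p)\<^sup>2) \<in> borel_measurable borel" by measurable
      fix z
      show "ennreal (\<Sum>k\<in>K M. 1 * (norm (fcoef L (U z) k))\<^sup>2) \<le> ennreal (1 / ?V) * (\<integral>\<^sup>+x. ennreal ((u (x, z))\<^sup>2) \<partial>lborel)"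
        unfolding mult_1_left by (rule fcoef_square_bound[OF Kc(1)])
    qed (use \<Gamma> in auto)
    have lip: "\<bar>?f k z - ?f k z'\<bar> \<le> \<Lambda> * dist z z'" for k z z'
      using mcoef_lipschitz[OF Kc(3)] fcoef_lipschitz by (rule order.trans)
    have sym: "?f (- k) = ?f k" for k
      by (rule ext) (simp add: mcoef_def Kc(4) fcoef_uminus norm_mult)
    have s0: "?f k z = 0" if "norm z > R0" for k z by (simp add: mcoef_def fcoef_support[OF that])
    have "ennreal Z * (\<integral>\<^sup>+z. ennreal (J M z) \<partial>lborel)
      \<le> ennreal ((?V * (A / ?V + (\<tau> + 1)\<^sup>2 * ((1 + s) * (B / ?V) + (1 + 1 / s) * D\<^sup>2 * (\<Gamma> / ?V))) / S) powr (real p / 2))"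
      unfolding J_def
    proof (rule rearranged_sobolev[where f = ?f and K = "K M" and A = \<Lambda> and R = R0 and s = s and \<zeta> = \<zeta> and D = D])
      show "0 \<le> Z" using Z(2) by simp
      show "0 \<le> ?f k z" for k z by (simp add: mcoef_def)
      show "0 \<le> A / ?V" "0 \<le> B / ?V" "0 \<le> \<Gamma> / ?V" using nn Vpos by simp_all
      show "(\<integral>\<^sup>+z. ennreal (?w z * (\<Sum>k\<in>K M. (?f k z)\<^sup>2)) \<partial>lborel) \<le> ennreal (\<Gamma> / ?V)"
        using \<gamma> by (simp only: mult_1_left)
    qed (fact rad \<tau> S p L \<zeta> Z(1) Kc(1,2) | rule lip s0 sym \<Lambda> R0 s \<alpha> \<beta>; assumption?)+
    also have "?V * (A / ?V + (\<tau> + 1)\<^sup>2 * ((1 + s) * (B / ?V) + (1 + 1 / s) * D\<^sup>2 * (\<Gamma> / ?V))) = A + (\<tau> + 1)\<^sup>2 * ((1 + s) * B + (1 + 1 / s) * D\<^sup>2 * \<Gamma>)"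
    proof -
      have "?V * (A / ?V + q * (t * (B / ?V) + r * (\<Gamma> / ?V))) = A + q * (t * B + r * \<Gamma>)" for q t r
        using L by (simp add: field_simps)
      then show ?thesis by blast
    qed
    finally show ?thesis unfolding C_def .
  qed
  have bM: "(\<integral>\<^sup>+z. ennreal (?V * J M z) \<partial>lborel) \<le> ennreal (?V * C / Z)" for M
  proof -
    have "(\<integral>\<^sup>+z. ennreal (?V * J M z) \<partial>lborel) = ennreal ?V * (\<integral>\<^sup>+z. ennreal (J M z) \<partial>lborel)"
      using Vpos Jm by (subst nn_integral_cmult[symmetric]) (auto simp: ennreal_mult')
    then have "ennreal Z * (\<integral>\<^sup>+z. ennreal (?V * J M z) \<partial>lborel) = ennreal ?V * (ennreal Z * (\<integral>\<^sup>+z. ennreal (J M z) \<partial>lborel))"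
      by (simp only: mult_ac)
    also have "\<dots> \<le> ennreal ?V * ennreal C" by (rule mult_left_mono[OF JM]) simp
    also have "\<dots> = ennreal Z * ennreal (?V * C / Z)"
      using Vpos Z(2) C0 by (simp add: ennreal_mult'[symmetric])
    finally show ?thesis using Z(2) by (subst (asm) ennreal_mult_le_mult_iff) auto
  qed
  have Ub: "\<exists>b. \<forall>x. \<bar>U z x\<bar> \<le> b" for z
  proof -
    have "compact (U z ` cball 0 R0)" by (intro compact_continuous_image continuous_on_subset[OF U_continuous]) auto
    then obtain b where b: "\<And>x. x \<in> cball 0 R0 \<Longrightarrow> \<bar>U z x\<bar> \<le> b"
      using compact_imp_bounded bounded_iff by (metis image_eqI real_norm_def)
    have "\<bar>U z x\<bar> \<le> max b 0" for x
      using b[of x] U_outside[of x z] by (cases "norm x \<le> R0") auto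
    then show ?thesis by blast
  qed
  have pt: "(\<integral>\<^sup>+x. ennreal (U z x ^ p) \<partial>lborel) \<le> liminf (\<lambda>M. ennreal (?V * J M z))" for z
  proof -
    obtain b where b: "\<And>x. \<bar>U z x\<bar> \<le> b" using Ub[of z] by blast
    let ?h = "\<lambda>M x. indicator (cell (L / 2)) x * ennreal (fmean L M (U z) x ^ p)"
    have hl: "ennreal (U z x ^ p) = liminf (\<lambda>M. ?h M x)" for x
    proof (cases "x \<in> cell (L / 2)")
      case True
      have "(\<lambda>M. fmean L M (U z) x) \<longlonglongrightarrow> U z x"
        by (rule fmean_tendsto[OF L U_continuous b U_half True])
      then have "(\<lambda>M. ennreal (fmean L M (U z) x ^ p)) \<longlonglongrightarrow> ennreal (U z x ^ p)"
        by (intro tendsto_intros)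
      then show ?thesis using True by (simp add: lim_imp_Liminf)
    next
      case False
      then show ?thesis using p by (simp add: U_half Liminf_const power_0_left)
    qed
    have fmm: "(\<lambda>x. fmean L M (U z) x) \<in> borel_measurable borel" for M
    proof -
      have "fmean L M (U z) x = Re (\<Sum>k\<in>K M. c M k * fcoef L (U z) k * wave L k x)" for x
        using Kc(5)[OF U_int, of M z x] by (metis Re_complex_of_real)
      then show ?thesis by (simp only:) measurable
    qed
    have "(\<integral>\<^sup>+x. ennreal (U z x ^ p) \<partial>lborel) = (\<integral>\<^sup>+x. liminf (\<lambda>M. ?h M x) \<partial>lborel)"
      by (simp only: hl)
    also have "\<dots> \<le> liminf (\<lambda>M. \<integral>\<^sup>+x. ?h M x \<partial>lborel)"
      using fmm by (intro nn_integral_liminf) measurable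
    also have "\<dots> \<le> liminf (\<lambda>M. ennreal (?V * J M z))"
      unfolding J_def by (intro Liminf_mono always_eventually allI fmean_power_le Kc(1) Kc(5) U_int)
    finally show ?thesis .
  qed
  have "(\<integral>\<^sup>+q. ennreal (\<bar>u q\<bar> ^ p) \<partial>lborel) = (\<integral>\<^sup>+z. \<integral>\<^sup>+x. ennreal (U z x ^ p) \<partial>lborel \<partial>lborel)"
    unfolding U_def by (intro nn_integral_lborel_pair(1)) measurable
  also have "\<dots> \<le> (\<integral>\<^sup>+z. liminf (\<lambda>M. ennreal (?V * J M z)) \<partial>lborel)"
    by (intro nn_integral_mono pt)
  also have "\<dots> \<le> liminf (\<lambda>M. \<integral>\<^sup>+z. ennreal (?V * J M z) \<partial>lborel)"
    using Jm by (intro nn_integral_liminf) measurable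
  also have "\<dots> \<le> ennreal (?V * C / Z)"
    by (intro Liminf_le always_eventually allI bM) auto
  finally have "ennreal Z * (\<integral>\<^sup>+q. ennreal (\<bar>u q\<bar> ^ p) \<partial>lborel) \<le> ennreal Z * ennreal (?V * C / Z)"
    by (rule mult_left_mono) simp
  also have "\<dots> = ennreal (?V * C)"
    using Z(2) by (simp add: ennreal_mult'[symmetric])
  finally show ?thesis unfolding C_def .
qed

end

section \<open>Plateau functions and the limit of infinite period\<close>

lemma bounded_grad:
  assumes f: "C_k (Suc 0) f" and supp: "\<And>x. norm x > R \<Longrightarrow> f x = 0"
  shows "\<exists>D\<ge>0. \<forall>x. norm (grad f x) \<le> D"
proof -
  have "compact (grad f ` cball 0 R)"
    by (intro compact_continuous_image continuous_on_subset[OF C_k_grad(2)[OF f]]) auto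
  then obtain D where D: "\<forall>y\<in>grad f ` cball 0 R. norm y \<le> D"
    using compact_imp_bounded bounded_iff by blast
  have "norm (grad f x) \<le> max D 0" for x
  proof (cases "norm x \<le> R")
    case True
    then have "norm (grad f x) \<le> D" using D by auto
    then show ?thesis by simp
  next
    case False
    then show ?thesis using grad_eq_0_outside[OF f supp, where z=x] by simp
  qed
  then show ?thesis by (intro exI[of _ "max D 0"]) simp
qed

lemma lipschitz_of_bounded_grad:
  assumes f: "C_k (Suc 0) f" and D: "\<And>x. norm (grad f x) \<le> D"
  shows "\<bar>f x - f y\<bar> \<le> D * dist x y"
proof -
  have "norm (f x - f y) \<le> D * norm (x - y)"
  proof (rule differentiable_bound[of UNIV f "\<lambda>w y. grad f w \<bullet> y"])
    fix w
    show "(f has_derivative (\<lambda>y. grad f w \<bullet> y)) (at w within UNIV)" using C_k_grad(1)[OF f] .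
    have "norm (grad f w \<bullet> y) \<le> D * norm y" for y
      using Cauchy_Schwarz_ineq2[of "grad f w" y] mult_right_mono[OF D[of w], of "norm y"] by simp
    then show "onorm (\<lambda>y. grad f w \<bullet> y) \<le> D" by (rule onorm_le)
  qed auto
  then show ?thesis by (simp add: dist_norm)
qed

text \<open>With q a smooth function that is positive exactly on the open unit cube and at most 1,
  the expression 1 - (1 - q)^N is smooth, lives on the same cube and increases to its indicator. The
  gradient bound depends on \<open>N\<close>.\<close>

definition plateau :: "nat \<Rightarrow> real^'n \<Rightarrow> real" where
  "plateau N x = 1 - (1 - (\<Prod>a\<in>UNIV. flat 1 (1 / 4 - (x $ a)\<^sup>2))) ^ N"

lemma flat_1: "0 \<le> flat 1 t" "flat 1 t \<le> 1" "0 < flat 1 t \<longleftrightarrow> 0 < t"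
  by (auto simp: flat_def)

lemma square_less_quarter: "0 < 1 / 4 - t\<^sup>2 \<longleftrightarrow> \<bar>t\<bar> < 1 / 2" for t :: real
  using abs_square_less_1[of "2 * t"] by (simp add: power_mult_distrib abs_mult mult.commute)

lemma plateau_base:
  fixes x :: "real^'n"
  shows "0 \<le> (\<Prod>a\<in>UNIV. flat 1 (1 / 4 - (x $ a)\<^sup>2))" "(\<Prod>a\<in>UNIV. flat 1 (1 / 4 - (x $ a)\<^sup>2)) \<le> 1"
  by (auto intro!: prod_nonneg prod_le_1 simp: flat_1)

lemma plateau_nonneg: "0 \<le> plateau N x" and plateau_le_1: "plateau N x \<le> 1"
  using plateau_base[of x] by (auto simp: plateau_def intro!: power_le_one)

lemma plateau_outside:
  fixes x :: "real^'n"
  assumes "\<not> (\<forall>a. \<bar>x $ a\<bar> < 1 / 2)"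
  shows "plateau N x = 0"
proof -
  obtain a where "\<not> \<bar>x $ a\<bar> < 1 / 2" using assms by blast
  then have "\<not> 0 < 1 / 4 - (x $ a)\<^sup>2" by (simp only: square_less_quarter not_False_eq_True)
  then have "flat 1 (1 / 4 - (x $ a)\<^sup>2) = 0" by (simp only: flat_def if_False)
  then have "(\<Prod>a\<in>UNIV. flat 1 (1 / 4 - (x $ a)\<^sup>2)) = 0" by (intro prod_zero) auto
  then show ?thesis by (simp only: plateau_def) simp
qed

lemma plateau_tendsto:
  fixes x :: "real^'n"
  assumes "\<forall>a. \<bar>x $ a\<bar> < 1 / 2"
  shows "(\<lambda>N. plateau N x) \<longlonglongrightarrow> 1"
proof -
  have "0 < flat 1 (1 / 4 - (x $ a)\<^sup>2)" for a
    using assms unfolding flat_1(3) square_less_quarter by blast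
  then have "0 < (\<Prod>a\<in>UNIV. flat 1 (1 / 4 - (x $ a)\<^sup>2))" by (intro prod_pos) auto
  then have "norm (1 - (\<Prod>a\<in>UNIV. flat 1 (1 / 4 - (x $ a)\<^sup>2))) < 1"
    using plateau_base(2)[of x] unfolding real_norm_def by linarith
  then have "(\<lambda>N. (1 - (\<Prod>a\<in>UNIV. flat 1 (1 / 4 - (x $ a)\<^sup>2))) ^ N) \<longlonglongrightarrow> 0"
    by (rule LIMSEQ_power_zero)
  then have "(\<lambda>N. 1 - (1 - (\<Prod>a\<in>UNIV. flat 1 (1 / 4 - (x $ a)\<^sup>2))) ^ N) \<longlonglongrightarrow> 1 - 0"
    by (intro tendsto_diff tendsto_const)
  then show ?thesis by (simp add: plateau_def)
qed

lemma C_k_plateau: "C_k k (plateau N :: real^'n \<Rightarrow> real)"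
proof -
  have 1: "C_k k (\<lambda>x::real^'n. x $ a)" for a
    using C_k_inner_left[of k "axis a (1::real)"] by (simp add: inner_axis)
  show ?thesis
    unfolding plateau_def[abs_def]
    by (intro C_k_diff C_k_const C_k_power C_k_prod C_k_compose_real[OF C_k_flat] 1)
qed

lemma plateau_outside_cell: "x \<notin> cell 1 \<Longrightarrow> plateau N x = 0"
  by (rule plateau_outside) (auto simp: cell_def intro: less_imp_le)

lemma norm_cell_bound: "x \<in> cell 1 \<Longrightarrow> norm (x::real^'n) \<le> CARD('n)"
proof -
  assume "x \<in> cell 1"
  then have "\<And>a. \<bar>x $ a\<bar> \<le> 1 / 2" by (simp add: cell_def)
  then have "\<And>a. \<bar>x $ a\<bar> \<le> 1" by (meson order.trans half_bounded_equal one_le_numeral divide_le_eq_1 zero_less_numeral order_less_imp_le)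
  then have "(\<Sum>a\<in>UNIV. \<bar>x $ a\<bar>) \<le> (\<Sum>a\<in>(UNIV::'n set). 1)" by (intro sum_mono) auto
  then show ?thesis using norm_le_l1_cart[of x] by simp
qed

lemma plateau_grad_bound: "\<exists>D\<ge>0. \<forall>x. norm (grad (plateau N :: real^'n \<Rightarrow> real) x) \<le> D"
proof (rule bounded_grad[OF C_k_plateau])
  fix x :: "real^'n" assume "norm x > CARD('n)"
  then show "plateau N x = 0" using norm_cell_bound[of x] by (intro plateau_outside_cell) force
qed

definition plateau_mass :: "'n::finite itself \<Rightarrow> nat \<Rightarrow> nat \<Rightarrow> real" where
  "plateau_mass _ p N = (LINT x|lborel. plateau N (x::real^'n) ^ p)"

lemma plateau_continuous: "continuous_on UNIV (plateau N)"
  using C_k_continuous[OF C_k_plateau] .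

lemma plateau_power_measurable: "(\<lambda>x. plateau N x ^ p) \<in> borel_measurable borel"
  by (intro borel_measurable_continuous_onI continuous_intros plateau_continuous)

lemma plateau_power_integrable:
  assumes p: "0 < p"
  shows "integrable lborel (\<lambda>x::real^'n. plateau N x ^ p)"
proof (rule integrable_continuous_compact_support)
  show "continuous_on UNIV (\<lambda>x::real^'n. plateau N x ^ p)"
    by (intro continuous_intros plateau_continuous)
  fix x :: "real^'n" assume "norm x > CARD('n)"
  then have "x \<notin> cell 1" using norm_cell_bound[of x] by force
  then show "plateau N x ^ p = 0" using p by (simp add: plateau_outside_cell power_0_left)
qed

text \<open>Dominated convergence to the indicator of the open cube, whose measure is that of the
  closed cell of side 1.\<close>

lemma plateau_mass_tendsto:
  assumes p: "0 < p"
  shows "plateau_mass TYPE('n::finite) p \<longlonglongrightarrow> 1"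
proof -
  let ?a = "(\<chi> a. - (1 / 2)) :: real^'n" and ?b = "(\<chi> a. 1 / 2) :: real^'n"
  have box: "x \<in> box ?a ?b \<longleftrightarrow> (\<forall>a. \<bar>x $ a\<bar> < 1 / 2)" for x
  proof -
    have "- (1 / 2) < t \<and> t < 1 / 2 \<longleftrightarrow> \<bar>t\<bar> < 1 / 2" for t :: real by auto
    then show ?thesis by (simp only: mem_box_cart vec_lambda_beta)
  qed
  have "(\<lambda>N. LINT x|lborel. plateau N (x::real^'n) ^ p) \<longlonglongrightarrow> (LINT x|lborel. indicator (box ?a ?b) x)"
  proof (rule integral_dominated_convergence[where w = "indicator (cell 1)"])
    show "integrable lborel (indicator (cell 1) :: real^'n \<Rightarrow> real)"
      using emeasure_compact_finite[OF compact_cell] by (intro integrable_real_indicator) (auto simp: top.not_eq_extremum)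
    show "AE x in lborel. (\<lambda>N. plateau N (x::real^'n) ^ p) \<longlonglongrightarrow> indicator (box ?a ?b) x"
    proof (rule AE_I2)
      fix x :: "real^'n"
      show "(\<lambda>N. plateau N x ^ p) \<longlonglongrightarrow> indicator (box ?a ?b) x"
      proof (cases "\<forall>a. \<bar>x $ a\<bar> < 1 / 2")
        case True
        have "(\<lambda>N. plateau N x ^ p) \<longlonglongrightarrow> 1 ^ p" by (intro tendsto_power plateau_tendsto[OF True])
        moreover have "x \<in> box ?a ?b" using box True by blast
        ultimately show ?thesis by simp
      next
        case False
        then have "x \<notin> box ?a ?b" using box by blast
        then show ?thesis using p by (simp add: plateau_outside[OF False] power_0_left)
      qed
    qed
    show "AE x in lborel. norm (plateau N (x::real^'n) ^ p) \<le> indicator (cell 1) x" for N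
    proof (rule AE_I2)
      fix x :: "real^'n"
      show "norm (plateau N x ^ p) \<le> indicator (cell 1) x"
        using p plateau_nonneg[of N x] plateau_le_1[of N x]
        by (cases "x \<in> cell 1") (auto simp: plateau_outside_cell power_0_left norm_power intro: power_le_one)
    qed
    show "(\<lambda>x. plateau N x ^ p) \<in> borel_measurable lborel" for N
      using plateau_power_measurable by simp
  qed simp
  moreover have "(LINT x|lborel. indicator (box ?a ?b) x) = (1::real)"
  proof -
    have "emeasure lborel (box ?a ?b) = emeasure lborel (cbox ?a ?b)"
      by (simp add: emeasure_lborel_box_eq emeasure_lborel_cbox_eq)
    then have "measure lborel (box ?a ?b) = measure lborel (cell 1 :: (real^'n) set)"
      by (simp add: measure_def cell_eq_cbox)
    then show ?thesis by (simp add: measure_cell)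
  qed
  ultimately show ?thesis by (simp add: plateau_mass_def[abs_def])
qed

lemma nn_integral_scale:
  fixes f :: "'a::euclidean_space \<Rightarrow> ennreal"
  assumes [measurable]: "f \<in> borel_measurable borel" and L: "0 < L"
  shows "(\<integral>\<^sup>+x. f (x /\<^sub>R L) \<partial>lborel) = ennreal (L ^ DIM('a)) * (\<integral>\<^sup>+x. f x \<partial>lborel)"
proof -
  have "(\<integral>\<^sup>+x. f (x /\<^sub>R L) \<partial>lborel)
    = (\<integral>\<^sup>+x. f (x /\<^sub>R L) \<partial>density (distr lborel borel (\<lambda>x. 0 + L *\<^sub>R x)) (\<lambda>_. ennreal (\<bar>L\<bar> ^ DIM('a))))"
    using L by (subst lborel_affine[of L 0]) auto
  also have "\<dots> = ennreal (L ^ DIM('a)) * (\<integral>\<^sup>+x. f x \<partial>lborel)"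
    using L by (simp add: nn_integral_density nn_integral_distr nn_integral_cmult)
  finally show ?thesis .
qed

lemma nn_integral_compact_support_finite:
  fixes f :: "'a::euclidean_space \<Rightarrow> real"
  assumes f: "continuous_on UNIV f" and supp: "\<And>z. norm z > R \<Longrightarrow> f z = 0" and nn: "\<And>z. 0 \<le> f z"
  shows "\<exists>A\<ge>0. (\<integral>\<^sup>+z. ennreal (f z) \<partial>lborel) = ennreal A"
proof -
  have "integrable lborel f" using integrable_continuous_compact_support[OF f supp] .
  then have "(\<integral>\<^sup>+z. ennreal (f z) \<partial>lborel) = ennreal (integral\<^sup>L lborel f)"
    using nn by (intro nn_integral_eq_integral) auto
  moreover have "0 \<le> integral\<^sup>L lborel f" using nn by (intro Bochner_Integration.integral_nonneg)
  ultimately show ?thesis by blast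
qed

text \<open>The two scalings that matter: the gradient is of order 1/L, which makes the cutoff error
  vanish, and the mass is proportional to the cell volume, which balances the volume left over in
  the Fourier estimate.\<close>

lemma scaled_plateau:
  assumes L: "0 < L" and D: "\<And>x. norm (grad (plateau N :: real^'n \<Rightarrow> real) x) \<le> D" and p: "0 < p"
  defines "\<zeta> \<equiv> \<lambda>x::real^'n. plateau N (x /\<^sub>R L)"
  shows "C_k j \<zeta>" "0 \<le> \<zeta> x" "\<zeta> x \<le> 1" "x \<notin> cell L \<Longrightarrow> \<zeta> x = 0" "norm (grad \<zeta> x) \<le> D / L"
    "(\<integral>\<^sup>+x. ennreal (\<zeta> x ^ p) \<partial>lborel) = ennreal (L ^ CARD('n) * plateau_mass TYPE('n) p N)"
proof -
  have bl: "bounded_linear (\<lambda>x::real^'n. x /\<^sub>R L)" by (rule bounded_linear_scaleR_right)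
  show "C_k j \<zeta>"
    using C_k_compose_affine[OF bl C_k_plateau, of j N 0] by (simp add: \<zeta>_def)
  show "0 \<le> \<zeta> x" "\<zeta> x \<le> 1" by (simp_all add: \<zeta>_def plateau_nonneg plateau_le_1)
  show "\<zeta> x = 0" if "x \<notin> cell L"
    using that L unfolding \<zeta>_def by (intro plateau_outside_cell) (auto simp: cell_def abs_mult field_simps)
  have "(\<zeta> has_derivative (\<lambda>y. grad (plateau N) (x /\<^sub>R L) \<bullet> (y /\<^sub>R L))) (at x)"
    unfolding \<zeta>_def
    by (rule has_derivative_compose[of "\<lambda>x. x /\<^sub>R L", OF bounded_linear_imp_has_derivative[OF bl] C_k_grad(1)[OF C_k_plateau]])
  then have "(\<zeta> has_derivative (\<lambda>y. (grad (plateau N) (x /\<^sub>R L) /\<^sub>R L) \<bullet> y)) (at x)" by simp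
  from grad_eqI[OF this] show "norm (grad \<zeta> x) \<le> D / L"
    using D[of "x /\<^sub>R L"] L by (simp add: field_simps)
  have "(\<integral>\<^sup>+x. ennreal (\<zeta> x ^ p) \<partial>lborel) = ennreal (L ^ CARD('n)) * (\<integral>\<^sup>+x. ennreal (plateau N (x::real^'n) ^ p) \<partial>lborel)"
    unfolding \<zeta>_def
    by (subst nn_integral_scale[where f = "\<lambda>x. ennreal (plateau N x ^ p)", OF _ L])
      (intro measurable_compose[OF _ measurable_ennreal] plateau_power_measurable, simp)
  also have "(\<integral>\<^sup>+x. ennreal (plateau N (x::real^'n) ^ p) \<partial>lborel) = ennreal (plateau_mass TYPE('n) p N)"
    unfolding plateau_mass_def using plateau_power_integrable[OF p]
    by (intro nn_integral_eq_integral) (auto simp: plateau_nonneg)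
  finally show "(\<integral>\<^sup>+x. ennreal (\<zeta> x ^ p) \<partial>lborel) = ennreal (L ^ CARD('n) * plateau_mass TYPE('n) p N)"
    using L by (simp add: ennreal_mult')
qed

text \<open>For a fixed plateau function the period tends to infinity, which removes the cutoff
  error. The limit of sharper plateau functions comes only afterwards, because their gradient bound
  depends on \<open>N\<close>.\<close>

theorem sob_of_radial:
  assumes rad: "\<And>\<psi>::('n::finite, 'm::finite) point \<Rightarrow> real. \<psi> \<in> test_functions \<Longrightarrow> radial_z \<psi> \<Longrightarrow> sob \<tau> S p \<psi>"
    and \<tau>: "0 < \<tau>" and S: "0 < S" and p: "0 < p" and ut: "u \<in> test_functions"
  shows "sob \<tau> S p (u :: ('n, 'm) point \<Rightarrow> real)"
  unfolding sob_def
proof (intro allI impI)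
  fix E :: real assume E0: "0 \<le> E"
    and le: "(\<integral>\<^sup>+q. ennreal (energy_density \<tau> (grad_z u) (grad_x u) q) \<partial>lborel) \<le> ennreal E"
  note u = test_functionsD(1)[OF ut]
  obtain R0 where R0: "0 \<le> R0" "\<And>p. norm p > R0 \<Longrightarrow> u p = 0" using test_functionsD(2)[OF ut] by blast
  obtain \<Lambda> where \<Lambda>: "0 \<le> \<Lambda>" "\<And>p. norm (grad u p) \<le> \<Lambda>" using bounded_grad[OF u R0(2)] by blast
  have lip: "\<bar>u p - u q\<bar> \<le> \<Lambda> * dist p q" for p q by (rule lipschitz_of_bounded_grad[OF u \<Lambda>(2)])
  have gs: "grad_z u p = snd (grad u p)" "grad_x u p = fst (grad u p)" for p
    using grad_z_eq[OF u, of "fst p" "snd p"] grad_x_eq[OF u, of "fst p" "snd p"] grad_slices[OF u, where x = "fst p" and z = "snd p"] by simp_all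
  have g0: "grad_z u p = 0" "grad_x u p = 0" if "norm p > R0" for p
    using grad_eq_0_outside[OF u R0(2) that] by (simp_all add: gs)
  have uc: "continuous_on UNIV u" using C_k_continuous[OF u] .
  note gc = continuous_on_grads[OF u]
  have wc: "continuous_on UNIV (\<lambda>p::('n, 'm) point. norm (snd p) powr (2 * \<tau>))"
    using \<tau> by (intro continuous_on_powr' continuous_intros) auto
  have fin: "\<exists>A\<ge>0. (\<integral>\<^sup>+q. ennreal (f q) \<partial>lborel) = ennreal A"
    if "continuous_on UNIV f" "\<And>q. R0 < norm q \<Longrightarrow> f q = 0" "\<And>q. 0 \<le> f q" for f :: "('n, 'm) point \<Rightarrow> real"
    by (rule nn_integral_compact_support_finite[OF that])
  obtain A where A: "0 \<le> A" "(\<integral>\<^sup>+p. ennreal ((norm (grad_z u p))\<^sup>2) \<partial>lborel) = ennreal A"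
  proof -
    have "\<exists>A\<ge>0. (\<integral>\<^sup>+p. ennreal ((norm (grad_z u p))\<^sup>2) \<partial>lborel) = ennreal A"
      by (rule fin) (simp_all add: g0 continuous_intros gc)
    then show ?thesis using that by blast
  qed
  obtain B where B: "0 \<le> B" "(\<integral>\<^sup>+p. ennreal (norm (snd p) powr (2 * \<tau>) * (norm (grad_x u p))\<^sup>2) \<partial>lborel) = ennreal B"
  proof -
    have "\<exists>B\<ge>0. (\<integral>\<^sup>+p. ennreal (norm (snd p) powr (2 * \<tau>) * (norm (grad_x u p))\<^sup>2) \<partial>lborel) = ennreal B"
      by (rule fin) (simp_all add: g0 continuous_intros gc wc)
    then show ?thesis using that by blast
  qed
  obtain \<Gamma> where \<Gamma>: "0 \<le> \<Gamma>" "(\<integral>\<^sup>+p. ennreal (norm (snd p) powr (2 * \<tau>) * (u p)\<^sup>2) \<partial>lborel) = ennreal \<Gamma>"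
  proof -
    have "\<exists>\<Gamma>\<ge>0. (\<integral>\<^sup>+p. ennreal (norm (snd p) powr (2 * \<tau>) * (u p)\<^sup>2) \<partial>lborel) = ennreal \<Gamma>"
      by (rule fin) (simp_all add: R0(2) continuous_intros uc wc)
    then show ?thesis using that by blast
  qed
  obtain I where I: "0 \<le> I" "(\<integral>\<^sup>+q. ennreal (\<bar>u q\<bar> ^ p) \<partial>lborel) = ennreal I"
  proof -
    have "\<exists>I\<ge>0. (\<integral>\<^sup>+q. ennreal (\<bar>u q\<bar> ^ p) \<partial>lborel) = ennreal I"
      by (rule fin) (use p in \<open>simp_all add: R0(2) continuous_intros uc power_0_left\<close>)
    then show ?thesis using that by blast
  qed
  \<comment> \<open>Here \<open>t\<close> is both the reciprocal of the period and the parameter in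
    Young's inequality; then
    \<open>(1 + 1 / t) * (D * t)\<^sup>2 = (t\<^sup>2 + t) * D\<^sup>2\<close> tends to 0 with
    \<open>t\<close>.\<close>
  let ?F = "\<lambda>t D. ((A + (\<tau> + 1)\<^sup>2 * ((1 + t) * B + (1 + 1 / t) * (D * t)\<^sup>2 * \<Gamma>)) / S) powr (real p / 2)"
  let ?C = "((A + (\<tau> + 1)\<^sup>2 * B) / S) powr (real p / 2)"
  have step: "plateau_mass TYPE('n) p N * I \<le> ?F t D"
    if t: "0 < t" and tR: "t * (4 * R0) \<le> 1" "t * 4 \<le> 1" and D: "0 \<le> D" "\<And>x. norm (grad (plateau N :: real^'n \<Rightarrow> real) x) \<le> D"
      and m: "0 < plateau_mass TYPE('n) p N" for N t D
  proof -
    have L: "0 < 1 / t" using t by simp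
    interpret test_function_fourier u R0 \<Lambda> "1 / t"
      by unfold_locales (use u R0 lip \<Lambda>(1) t tR in \<open>auto simp: field_simps\<close>)
    let ?m = "plateau_mass TYPE('n) p N" and ?V = "(1 / t) ^ CARD('n)"
    have "ennreal (?V * ?m) * (\<integral>\<^sup>+q. ennreal (\<bar>u q\<bar> ^ p) \<partial>lborel)
      \<le> ennreal (?V * ((A + (\<tau> + 1)\<^sup>2 * ((1 + t) * B + (1 + 1 / t) * (D / (1 / t))\<^sup>2 * \<Gamma>)) / S) powr (real p / 2))"
      by (rule fourier_sobolev[OF rad \<tau> S p scaled_plateau[OF L D(2) p] _ t A(1) B(1) \<Gamma>(1)])
        (use A B \<Gamma> m Vpos in auto)
    then have "ennreal (?V * ?m * I) \<le> ennreal (?V * ?F t D)"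
      using Vpos m I by (simp add: ennreal_mult'[symmetric] del: power_one_over)
    then have "?V * (?m * I) \<le> ?V * ?F t D"
      using Vpos by (subst (asm) ennreal_le_iff) (simp_all add: mult.assoc)
    then show ?thesis using Vpos by (simp only: mult_le_cancel_left_pos)
  qed
  have mN: "plateau_mass TYPE('n) p N * I \<le> ?C" if m: "0 < plateau_mass TYPE('n) p N" for N
  proof -
    obtain D where D: "0 \<le> D" "\<And>x. norm (grad (plateau N :: real^'n \<Rightarrow> real) x) \<le> D" using plateau_grad_bound by blast
    have t0: "(\<lambda>j. inverse (real (Suc j))) \<longlonglongrightarrow> 0" by (rule LIMSEQ_inverse_real_of_nat)
    have sm: "\<forall>\<^sub>F j in sequentially. inverse (real (Suc j)) * c \<le> 1" for c
    proof -
      have "(\<lambda>j. inverse (real (Suc j)) * c) \<longlonglongrightarrow> 0 * c" by (intro tendsto_intros t0)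
      then have "\<forall>\<^sub>F j in sequentially. inverse (real (Suc j)) * c < 1" by (rule order_tendstoD) simp
      then show ?thesis by (rule eventually_mono) simp
    qed
    have "(\<lambda>j. ?F (inverse (real (Suc j))) D) \<longlonglongrightarrow> ?C"
    proof -
      let ?b = "\<lambda>t. (A + (\<tau> + 1)\<^sup>2 * ((1 + t) * B + (t\<^sup>2 + t) * D\<^sup>2 * \<Gamma>)) / S"
      have "(\<lambda>j. ?b (inverse (real (Suc j)))) \<longlonglongrightarrow> ?b 0"
        using S by (intro tendsto_intros t0) auto
      then have lim: "(\<lambda>j. ?b (inverse (real (Suc j))) powr (real p / 2)) \<longlonglongrightarrow> ?b 0 powr (real p / 2)"
        using p A(1) B(1) \<Gamma>(1) S by (intro tendsto_powr' tendsto_const) (auto intro!: always_eventually divide_nonneg_pos add_nonneg_nonneg mult_nonneg_nonneg)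
      have eq: "(1 + 1 / t) * (D * t)\<^sup>2 * \<Gamma> = (t\<^sup>2 + t) * D\<^sup>2 * \<Gamma>" if "t \<noteq> 0" for t
        using that by (simp add: field_simps power2_eq_square)
      have "(1 + 1 / inverse (real (Suc j))) * (D * inverse (real (Suc j)))\<^sup>2 * \<Gamma>
         = ((inverse (real (Suc j)))\<^sup>2 + inverse (real (Suc j))) * D\<^sup>2 * \<Gamma>" for j
        by (rule eq) simp
      moreover have "?b 0 = (A + (\<tau> + 1)\<^sup>2 * B) / S" by simp
      ultimately show ?thesis using lim by (simp only:)
    qed
    moreover have "\<forall>\<^sub>F j in sequentially. plateau_mass TYPE('n) p N * I \<le> ?F (inverse (real (Suc j))) D"
      using sm[of "4 * R0"] sm[of 4]
      by eventually_elim (rule step[OF _ _ _ D m], auto)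
    ultimately show ?thesis by (rule tendsto_lowerbound) simp
  qed
  have "(\<lambda>N. plateau_mass TYPE('n) p N * I) \<longlonglongrightarrow> 1 * I"
    by (intro tendsto_mult_right plateau_mass_tendsto[OF p])
  moreover have "\<forall>\<^sub>F N in sequentially. 0 < plateau_mass TYPE('n) p N"
    by (rule order_tendstoD(1)[OF plateau_mass_tendsto[OF p]]) simp
  then have "\<forall>\<^sub>F N in sequentially. plateau_mass TYPE('n) p N * I \<le> ?C"
    by (rule eventually_mono) (rule mN)
  ultimately have IC: "I \<le> ?C" using tendsto_upperbound by fastforce
  have m: "(\<lambda>q. ennreal ((norm (grad_z u q))\<^sup>2)) \<in> borel_measurable borel"
    "(\<lambda>q. ennreal (norm (snd q) powr (2 * \<tau>) * (norm (grad_x u q))\<^sup>2)) \<in> borel_measurable borel"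
    by (intro measurable_compose[OF _ measurable_ennreal] borel_measurable_continuous_onI continuous_intros gc wc)+
  \<comment> \<open>The two parts of the energy, kept apart so far, recombine to the energy of
    \<open>u\<close>, which \<open>E\<close> bounds.\<close>
  have "ennreal (A + (\<tau> + 1)\<^sup>2 * B) = (\<integral>\<^sup>+q. ennreal ((norm (grad_z u q))\<^sup>2) \<partial>lborel) + ennreal ((\<tau> + 1)\<^sup>2) * (\<integral>\<^sup>+q. ennreal (norm (snd q) powr (2 * \<tau>) * (norm (grad_x u q))\<^sup>2) \<partial>lborel)"
    using A B by (simp add: ennreal_mult' ennreal_plus)
  also have "\<dots> = (\<integral>\<^sup>+q. ennreal ((norm (grad_z u q))\<^sup>2) + ennreal ((\<tau> + 1)\<^sup>2) * ennreal (norm (snd q) powr (2 * \<tau>) * (norm (grad_x u q))\<^sup>2) \<partial>lborel)"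
    using m by (simp add: nn_integral_add nn_integral_cmult)
  also have "\<dots> = (\<integral>\<^sup>+q. ennreal (energy_density \<tau> (grad_z u) (grad_x u) q) \<partial>lborel)"
    by (intro nn_integral_cong) (simp add: energy_density_def ennreal_mult'[symmetric] mult.assoc)
  also note le
  finally have "A + (\<tau> + 1)\<^sup>2 * B \<le> E" using E0 by simp
  then have "?C \<le> (E / S) powr (real p / 2)"
    using S A(1) B(1) by (intro powr_mono2 divide_right_mono) auto
  then show "(\<integral>\<^sup>+q. ennreal (\<bar>u q\<bar> ^ p) \<partial>lborel) \<le> ennreal ((E / S) powr (real p / 2))"
    unfolding I(2) using IC by (intro ennreal_leI) simp
qed

section \<open>Passage to the completion\<close>

lemma abs_powr_nat: "0 < k \<Longrightarrow> \<bar>x\<bar> powr real k = \<bar>x\<bar> ^ k" for x :: real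
  by (cases "x = 0") (auto simp: powr_realpow power_0_left)

lemma energy_density_add:
  assumes s: "0 < s"
  shows "energy_density \<tau> (\<lambda>q. a q + b q) (\<lambda>q. c q + d q) p
    \<le> (1 + s) * energy_density \<tau> a c p + (1 + 1 / s) * energy_density \<tau> b d p"
proof -
  let ?w = "(\<tau> + 1)\<^sup>2 * norm (snd p) powr (2 * \<tau>)"
  have "?w * (norm (c p + d p))\<^sup>2 \<le> ?w * ((1 + s) * (norm (c p))\<^sup>2 + (1 + 1 / s) * (norm (d p))\<^sup>2)"
    by (intro mult_left_mono square_norm_sum_le s) simp
  with square_norm_sum_le[OF s, of "a p" "b p"] show ?thesis
    unfolding energy_density_def by (simp only: distrib_left mult_ac)
qed

lemma nn_integral_energy_add:
  assumes s: "0 < s" and [measurable]: "a \<in> borel_measurable borel" "b \<in> borel_measurable borel" "c \<in> borel_measurable borel" "d \<in> borel_measurable borel"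
  shows "(\<integral>\<^sup>+p. ennreal (energy_density \<tau> (\<lambda>q. a q + b q) (\<lambda>q. c q + d q) p) \<partial>lborel)
    \<le> ennreal (1 + s) * (\<integral>\<^sup>+p. ennreal (energy_density \<tau> a c p) \<partial>lborel) + ennreal (1 + 1 / s) * (\<integral>\<^sup>+p. ennreal (energy_density \<tau> b d p) \<partial>lborel)"
proof -
  have m: "(\<lambda>p. ennreal (energy_density \<tau> a c p)) \<in> borel_measurable borel" "(\<lambda>p. ennreal (energy_density \<tau> b d p)) \<in> borel_measurable borel"
    by (intro measurable_compose[OF _ measurable_ennreal] energy_density_measurable assms)+
  have "(\<integral>\<^sup>+p. ennreal (energy_density \<tau> (\<lambda>q. a q + b q) (\<lambda>q. c q + d q) p) \<partial>lborel)
    \<le> (\<integral>\<^sup>+p. ennreal (1 + s) * ennreal (energy_density \<tau> a c p) + ennreal (1 + 1 / s) * ennreal (energy_density \<tau> b d p) \<partial>lborel)"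
    using s by (intro nn_integral_mono)
      (auto intro!: ennreal_leI energy_density_add simp: ennreal_mult'[symmetric] ennreal_plus[symmetric] energy_density_nonneg simp del: ennreal_plus)
  also have "\<dots> = ennreal (1 + s) * (\<integral>\<^sup>+p. ennreal (energy_density \<tau> a c p) \<partial>lborel) + ennreal (1 + 1 / s) * (\<integral>\<^sup>+p. ennreal (energy_density \<tau> b d p) \<partial>lborel)"
    using m by (simp add: nn_integral_add nn_integral_cmult)
  finally show ?thesis .
qed

lemma L1_loc_tendsto_AE_subseq:
  fixes u :: "'a::euclidean_space \<Rightarrow> real"
  assumes lim: "L1_loc_tendsto \<phi> u" and [measurable]: "\<And>j. \<phi> j \<in> borel_measurable borel" "u \<in> borel_measurable borel"
  shows "\<exists>r. strict_mono r \<and> (AE x in lborel. x \<in> cball 0 R \<longrightarrow> (\<lambda>j. \<phi> (r j) x) \<longlonglongrightarrow> u x)"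
proof -
  define f where "f j x = indicator (cball 0 R) x * (\<phi> j x - u x)" for j x
  have fm [measurable]: "f j \<in> borel_measurable borel" for j
    unfolding f_def by (intro borel_measurable_times borel_measurable_indicator borel_measurable_diff assms(2,3)) auto
  have nn: "(\<lambda>j. \<integral>\<^sup>+x. ennreal (norm (f j x)) \<partial>lborel) \<longlonglongrightarrow> 0"
  proof -
    have "(\<integral>\<^sup>+x. ennreal (norm (f j x)) \<partial>lborel) = (\<integral>\<^sup>+x\<in>cball 0 R. ennreal \<bar>\<phi> j x - u x\<bar> \<partial>lborel)" for j
      by (intro nn_integral_cong) (simp add: f_def indicator_def)
    then show ?thesis using lim by (simp add: L1_loc_tendsto_def)
  qed
  \<comment> \<open>Finitely many of these integrals may be infinite, so integrability is claimed
    from some index on.\<close>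
  then have "\<forall>\<^sub>F j in sequentially. (\<integral>\<^sup>+x. ennreal (norm (f j x)) \<partial>lborel) < 1"
    by (rule order_tendstoD) simp
  then obtain j0 where j0: "\<And>j. j0 \<le> j \<Longrightarrow> (\<integral>\<^sup>+x. ennreal (norm (f j x)) \<partial>lborel) < 1"
    unfolding eventually_sequentially by blast
  have int: "integrable lborel (f (j + j0))" for j
  proof (rule integrableI_bounded)
    show "(\<integral>\<^sup>+x. ennreal (norm (f (j + j0) x)) \<partial>lborel) < \<infinity>"
      using j0[of "j + j0"] by (rule order.strict_trans[OF _ ennreal_one_less_top, folded infinity_ennreal_def]) simp
  qed simp
  have "(\<lambda>j. LINT x|lborel. norm (f (j + j0) x)) \<longlonglongrightarrow> 0"
  proof -
    have "(\<lambda>j. enn2real (\<integral>\<^sup>+x. ennreal (norm (f (j + j0) x)) \<partial>lborel)) \<longlonglongrightarrow> 0"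
      using LIMSEQ_ignore_initial_segment[OF nn, of j0] by (intro tendsto_enn2real) simp_all
    then show ?thesis by (simp add: integral_eq_nn_integral)
  qed
  from tendsto_L1_AE_subseq[OF int this] obtain r
    where r: "strict_mono r" "AE x in lborel. (\<lambda>j. f (r j + j0) x) \<longlonglongrightarrow> 0" by blast
  have "AE x in lborel. x \<in> cball 0 R \<longrightarrow> (\<lambda>j. \<phi> (r j + j0) x) \<longlonglongrightarrow> u x"
    using r(2)
  proof (eventually_elim, intro impI)
    fix x assume "(\<lambda>j. f (r j + j0) x) \<longlonglongrightarrow> 0" "x \<in> cball 0 R"
    then have "(\<lambda>j. \<phi> (r j + j0) x - u x) \<longlonglongrightarrow> 0" by (simp add: f_def)
    then show "(\<lambda>j. \<phi> (r j + j0) x) \<longlonglongrightarrow> u x" by (simp add: LIM_zero_iff)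
  qed
  moreover have "strict_mono (\<lambda>j. r j + j0)" using r(1) by (simp add: strict_mono_def)
  ultimately show ?thesis by blast
qed

text \<open>Fatou's lemma on each ball, along a subsequence that may depend on the ball; the bound
  does not depend on the ball, so exhausting the space by balls and using Fatou once more gives the
  claim.\<close>

lemma nn_integral_power_le_of_L1_loc_tendsto:
  fixes u :: "'a::euclidean_space \<Rightarrow> real"
  assumes lim: "L1_loc_tendsto \<phi> u" and [measurable]: "\<And>j. \<phi> j \<in> borel_measurable borel" "u \<in> borel_measurable borel"
    and le: "\<forall>\<^sub>F j in sequentially. (\<integral>\<^sup>+x. ennreal (\<bar>\<phi> j x\<bar> ^ k) \<partial>lborel) \<le> C"
  shows "(\<integral>\<^sup>+x. ennreal (\<bar>u x\<bar> ^ k) \<partial>lborel) \<le> C"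
proof -
  have ball: "(\<integral>\<^sup>+x. indicator (cball 0 R) x * ennreal (\<bar>u x\<bar> ^ k) \<partial>lborel) \<le> C" for R
  proof -
    obtain r where r: "strict_mono r" "AE x in lborel. x \<in> cball 0 R \<longrightarrow> (\<lambda>j. \<phi> (r j) x) \<longlonglongrightarrow> u x"
      using L1_loc_tendsto_AE_subseq[OF assms(1-3)] by blast
    have "(\<integral>\<^sup>+x. indicator (cball 0 R) x * ennreal (\<bar>u x\<bar> ^ k) \<partial>lborel) \<le> (\<integral>\<^sup>+x. liminf (\<lambda>j. ennreal (\<bar>\<phi> (r j) x\<bar> ^ k)) \<partial>lborel)"
    proof (rule nn_integral_mono_AE)
      show "AE x in lborel. indicator (cball 0 R) x * ennreal (\<bar>u x\<bar> ^ k) \<le> liminf (\<lambda>j. ennreal (\<bar>\<phi> (r j) x\<bar> ^ k))"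
        using r(2)
      proof eventually_elim
        fix x assume x: "x \<in> cball 0 R \<longrightarrow> (\<lambda>j. \<phi> (r j) x) \<longlonglongrightarrow> u x"
        show "indicator (cball 0 R) x * ennreal (\<bar>u x\<bar> ^ k) \<le> liminf (\<lambda>j. ennreal (\<bar>\<phi> (r j) x\<bar> ^ k))"
        proof (cases "x \<in> cball 0 R")
          case True
          then have "(\<lambda>j. ennreal (\<bar>\<phi> (r j) x\<bar> ^ k)) \<longlonglongrightarrow> ennreal (\<bar>u x\<bar> ^ k)"
            using x by (intro tendsto_intros) auto
          then have "liminf (\<lambda>j. ennreal (\<bar>\<phi> (r j) x\<bar> ^ k)) = ennreal (\<bar>u x\<bar> ^ k)"
            by (intro lim_imp_Liminf) auto
          then show ?thesis using True by simp
        qed simp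
      qed
    qed
    also have "\<dots> \<le> liminf (\<lambda>j. \<integral>\<^sup>+x. ennreal (\<bar>\<phi> (r j) x\<bar> ^ k) \<partial>lborel)"
      by (intro nn_integral_liminf) simp
    also have "\<dots> \<le> C"
      using eventually_subseq[OF r(1) le] by (intro Liminf_le) auto
    finally show ?thesis .
  qed
  have "(\<integral>\<^sup>+x. ennreal (\<bar>u x\<bar> ^ k) \<partial>lborel) = (\<integral>\<^sup>+x. liminf (\<lambda>j. indicator (cball 0 (real j)) x * ennreal (\<bar>u x\<bar> ^ k)) \<partial>lborel)"
  proof (intro nn_integral_cong)
    fix x
    have "\<forall>\<^sub>F j in sequentially. indicator (cball 0 (real j)) x * ennreal (\<bar>u x\<bar> ^ k) = ennreal (\<bar>u x\<bar> ^ k)"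
      using eventually_ge_at_top[of "nat \<lceil>norm x\<rceil>"]
    proof eventually_elim
      case (elim j)
      then have "x \<in> cball 0 (real j)" by simp
      then show ?case by simp
    qed
    then have "(\<lambda>j. indicator (cball 0 (real j)) x * ennreal (\<bar>u x\<bar> ^ k)) \<longlonglongrightarrow> ennreal (\<bar>u x\<bar> ^ k)"
      by (rule tendsto_eventually)
    then show "ennreal (\<bar>u x\<bar> ^ k) = liminf (\<lambda>j. indicator (cball 0 (real j)) x * ennreal (\<bar>u x\<bar> ^ k))"
      by (intro lim_imp_Liminf[symmetric]) auto
  qed
  also have "\<dots> \<le> liminf (\<lambda>j. \<integral>\<^sup>+x. indicator (cball 0 (real j)) x * ennreal (\<bar>u x\<bar> ^ k) \<partial>lborel)"
    by (intro nn_integral_liminf) (auto intro!: borel_measurable_times_ennreal borel_measurable_indicator)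
  also have "\<dots> \<le> C"
    by (intro Liminf_le always_eventually allI ball) auto
  finally show ?thesis .
qed

lemma energy_density_0: "energy_density \<tau> (\<lambda>q. 0) (\<lambda>q. 0) = (\<lambda>p. 0)"
  by (simp add: energy_density_def fun_eq_iff)

lemma test_function_in_completion:
  assumes u: "u \<in> test_functions" and C: "u \<in> C"
  shows "(u, grad_z u, grad_x u) \<in> energy_completion \<tau> C"
proof -
  have "u \<in> borel_measurable borel"
    using C_k_continuous[OF test_functionsD(1)[OF u]] by (rule borel_measurable_continuous_onI)
  moreover have "L1_loc_tendsto (\<lambda>_::nat. u) u" by (simp add: L1_loc_tendsto_def)
  ultimately show ?thesis
    unfolding energy_completion_def using C grads_measurable[OF test_functionsD(1)[OF u]]
    by (auto intro!: exI[of _ "\<lambda>_. u"] simp: energy_density_0)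
qed

lemma test_function_energy_finite:
  assumes u: "u \<in> test_functions" and \<tau>: "0 < \<tau>"
  shows "(\<integral>\<^sup>+p. ennreal (energy_density \<tau> (grad_z u) (grad_x u) p) \<partial>lborel) < \<infinity>"
proof -
  note C = test_functionsD(1)[OF u]
  obtain R where R: "\<And>p. norm p > R \<Longrightarrow> u p = 0" using test_functionsD(2)[OF u] by blast
  have "\<exists>A\<ge>0. (\<integral>\<^sup>+p. ennreal (energy_density \<tau> (grad_z u) (grad_x u) p) \<partial>lborel) = ennreal A"
  proof (rule nn_integral_compact_support_finite)
    have "continuous_on UNIV (\<lambda>p::('a, 'b) point. norm (snd p) powr (2 * \<tau>))"
      using \<tau> by (intro continuous_on_powr' continuous_intros) auto
    then show "continuous_on UNIV (energy_density \<tau> (grad_z u) (grad_x u))"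
      unfolding energy_density_def[abs_def]
      by (intro continuous_on_add continuous_on_mult continuous_on_power continuous_on_norm continuous_on_const continuous_on_grads[OF C])
    fix p :: "('a, 'b) point" assume p: "norm p > R"
    have "grad_z u p = 0" "grad_x u p = 0"
      using grad_z_eq[OF C, of "fst p" "snd p"] grad_x_eq[OF C, of "fst p" "snd p"] grad_slices[OF C, where x = "fst p" and z = "snd p"]
        grad_eq_0_outside[OF C R p] by simp_all
    then show "energy_density \<tau> (grad_z u) (grad_x u) p = 0" by (simp add: energy_density_def)
  qed (rule energy_density_nonneg)
  then show ?thesis by auto
qed

section \<open>The integer exponent and the optimal constants\<close>

locale integer_exponent =
  fixes \<tau> Q :: real and k :: nat and n :: "'n::finite itself" and m :: "'m::finite itself"
  assumes \<tau>: "0 < \<tau>" and Q: "Q = real CARD('m) + real CARD('n) * (\<tau> + 1)"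
    and k: "0 < k" "2 * Q / (Q - 2) = real k"
begin

lemma exponents: "(Q - 2) / Q = 2 / real k"
proof -
  have "0 < Q" unfolding Q using \<tau> by (intro add_pos_nonneg) auto
  \<comment> \<open>For \<open>Q = 2\<close> the quotient would be a division by zero, hence 0,
    contrary to \<open>0 < k\<close>.\<close>
  moreover have "Q \<noteq> 2" using k by auto
  ultimately show ?thesis using k by (simp add: field_simps)
qed

lemma sobolev_inequality_iff:
  "sobolev_inequality \<tau> (D :: ('n, 'm) energy_fields set) S \<longleftrightarrow>
    (\<forall>(u, g, h)\<in>D. integrable lborel (\<lambda>p. \<bar>u p\<bar> ^ k) \<and>
      (LINT p|lborel. \<bar>u p\<bar> ^ k) powr (2 / real k) \<le> inverse S * (LINT p|lborel. energy_density \<tau> g h p))"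
  unfolding sobolev_inequality_def Let_def hom_dim_def Q[symmetric] exponents k(2) abs_powr_nat[OF k(1)] ..

lemma powr_cancel: "0 \<le> a \<Longrightarrow> (a powr (2 / real k)) powr (real k / 2) = a" "0 \<le> a \<Longrightarrow> (a powr (real k / 2)) powr (2 / real k) = a"
  using k(1) by (simp_all add: powr_powr)

text \<open>A radial test function with its own gradients belongs to the radial completion; the rest
  converts between the two normalizations of the powers.\<close>

lemma sob_of_sobolev_inequality:
  fixes u :: "('n, 'm) point \<Rightarrow> real"
  assumes sob: "sobolev_inequality \<tau> (D1_z \<tau> :: ('n, 'm) energy_fields set) S" and S: "0 < S" and u: "u \<in> test_functions" "radial_z u"
  shows "sob \<tau> S k u"
  unfolding sob_def
proof (intro allI impI)
  fix E :: real assume E: "0 \<le> E" "(\<integral>\<^sup>+q. ennreal (energy_density \<tau> (grad_z u) (grad_x u) q) \<partial>lborel) \<le> ennreal E"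
  have "(u, grad_z u, grad_x u) \<in> D1_z \<tau>"
    unfolding D1_z_def by (rule test_function_in_completion) (use u in auto)
  then have int: "integrable lborel (\<lambda>p. \<bar>u p\<bar> ^ k)"
    and le: "(LINT p|lborel. \<bar>u p\<bar> ^ k) powr (2 / real k) \<le> inverse S * (LINT p|lborel. energy_density \<tau> (grad_z u) (grad_x u) p)"
    using sob unfolding sobolev_inequality_iff by auto
  let ?I = "LINT p|lborel. \<bar>u p\<bar> ^ k"
  have I0: "0 \<le> ?I" by (intro Bochner_Integration.integral_nonneg) simp
  have "(LINT p|lborel. energy_density \<tau> (grad_z u) (grad_x u) p) \<le> E"
    using E by (rule integral_real_bounded)
  then have "inverse S * (LINT p|lborel. energy_density \<tau> (grad_z u) (grad_x u) p) \<le> E / S"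
    using S by (simp add: field_simps)
  with le have "?I powr (2 / real k) \<le> E / S" by (rule order.trans)
  then have "(?I powr (2 / real k)) powr (real k / 2) \<le> (E / S) powr (real k / 2)"
    by (intro powr_mono2) auto
  then have "?I \<le> (E / S) powr (real k / 2)" using I0 by (simp only: powr_cancel)
  moreover have "(\<integral>\<^sup>+q. ennreal (\<bar>u q\<bar> ^ k) \<partial>lborel) = ennreal ?I"
    using int by (intro nn_integral_eq_integral) auto
  ultimately show "(\<integral>\<^sup>+q. ennreal (\<bar>u q\<bar> ^ k) \<partial>lborel) \<le> ennreal ((E / S) powr (real k / 2))"
    by (simp add: ennreal_leI)
qed

text \<open>Along an approximating sequence, Fatou's lemma handles the power of \<open>u\<close>,
  while Young's inequality with a small parameter bounds the energies of the approximants by that of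
  the limit.\<close>

lemma sobolev_inequality_of_sob:
  assumes sob: "\<And>u::('n, 'm) point \<Rightarrow> real. u \<in> test_functions \<Longrightarrow> sob \<tau> S k u" and S: "0 < S"
  shows "sobolev_inequality \<tau> (D1 \<tau> :: ('n, 'm) energy_fields set) S"
  unfolding sobolev_inequality_iff
proof (rule ballI, clarify)
  fix u :: "('n, 'm) point \<Rightarrow> real" and g h
  assume "(u, g, h) \<in> D1 \<tau>"
  then obtain \<phi> where um [measurable]: "u \<in> borel_measurable borel" and gm [measurable]: "g \<in> borel_measurable borel" and hm [measurable]: "h \<in> borel_measurable borel"
    and \<phi>: "\<And>j. \<phi> j \<in> test_functions" and lim: "L1_loc_tendsto \<phi> u"
    and d: "(\<lambda>j. \<integral>\<^sup>+p. ennreal (energy_density \<tau> (\<lambda>q. grad_z (\<phi> j) q - g q) (\<lambda>q. grad_x (\<phi> j) q - h q) p) \<partial>lborel) \<longlonglongrightarrow> 0"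
    unfolding D1_def energy_completion_def by auto
  note \<phi>C = test_functionsD(1)[OF \<phi>]
  have \<phi>m [measurable]: "\<phi> j \<in> borel_measurable borel" for j
    using C_k_continuous[OF \<phi>C] by (rule borel_measurable_continuous_onI)
  note gr [measurable] = grads_measurable[OF \<phi>C]
  let ?E = "\<lambda>a b. \<integral>\<^sup>+p. ennreal (energy_density \<tau> a b p) \<partial>lborel"
  let ?d = "\<lambda>j. ?E (\<lambda>q. grad_z (\<phi> j) q - g q) (\<lambda>q. grad_x (\<phi> j) q - h q)"
  \<comment> \<open>An approximant within energy distance less than 1 has finite energy, and so has
    the limit. With finite energy the Bochner integral of the density is the nonnegative one and not
    the default 0.\<close>
  have Efin: "?E g h < \<infinity>"
  proof -
    have "\<forall>\<^sub>F j in sequentially. ?d j < 1" using d by (rule order_tendstoD) simp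
    then obtain j where j: "?d j < 1" using eventually_happens[of _ sequentially] by auto
    have "?E g h = ?E (\<lambda>q. grad_z (\<phi> j) q + (g q - grad_z (\<phi> j) q)) (\<lambda>q. grad_x (\<phi> j) q + (h q - grad_x (\<phi> j) q))"
      by simp
    also have "\<dots> \<le> ennreal (1 + 1) * ?E (grad_z (\<phi> j)) (grad_x (\<phi> j)) + ennreal (1 + 1 / 1) * ?E (\<lambda>q. g q - grad_z (\<phi> j) q) (\<lambda>q. h q - grad_x (\<phi> j) q)"
      by (rule nn_integral_energy_add) measurable
    also have "?E (\<lambda>q. g q - grad_z (\<phi> j) q) (\<lambda>q. h q - grad_x (\<phi> j) q) = ?d j"
      by (simp add: energy_density_def norm_minus_commute)
    also have "ennreal (1 + 1) * ?E (grad_z (\<phi> j)) (grad_x (\<phi> j)) + ennreal (1 + 1 / 1) * ?d j < \<infinity>"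
      using test_function_energy_finite[OF \<phi> \<tau>, of j] order.strict_trans[OF j ennreal_one_less_top]
      by (simp add: ennreal_mult_less_top)
    finally show ?thesis .
  qed
  define e where "e = (LINT p|lborel. energy_density \<tau> g h p)"
  have em: "energy_density \<tau> g h \<in> borel_measurable lborel"
    using energy_density_measurable[OF gm hm] by simp
  have e: "?E g h = ennreal e" "0 \<le> e"
  proof -
    have "e = enn2real (?E g h)"
      unfolding e_def by (rule integral_eq_nn_integral[OF em]) (simp add: energy_density_nonneg)
    then show "?E g h = ennreal e" "0 \<le> e" using Efin by simp_all
  qed
  \<comment> \<open>The number \<open>s\<close> is both the parameter in Young's inequality and the
    tolerance for the remaining distance term, so that a single limit finishes the estimate.\<close>
  have bound: "(\<integral>\<^sup>+q. ennreal (\<bar>u q\<bar> ^ k) \<partial>lborel) \<le> ennreal ((((1 + s) * e + s) / S) powr (real k / 2))" if s: "0 < s" for s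
  proof (rule nn_integral_power_le_of_L1_loc_tendsto[OF lim])
    have "(\<lambda>j. ennreal (1 + 1 / s) * ?d j) \<longlonglongrightarrow> ennreal (1 + 1 / s) * 0"
      by (intro ennreal_tendsto_cmult d) simp
    then have "\<forall>\<^sub>F j in sequentially. ennreal (1 + 1 / s) * ?d j < ennreal s"
      using s by (intro order_tendstoD(2)[of _ 0]) auto
    then show "\<forall>\<^sub>F j in sequentially. (\<integral>\<^sup>+x. ennreal (\<bar>\<phi> j x\<bar> ^ k) \<partial>lborel) \<le> ennreal ((((1 + s) * e + s) / S) powr (real k / 2))"
    proof eventually_elim
      fix j assume j: "ennreal (1 + 1 / s) * ?d j < ennreal s"
      have "?E (grad_z (\<phi> j)) (grad_x (\<phi> j)) = ?E (\<lambda>q. g q + (grad_z (\<phi> j) q - g q)) (\<lambda>q. h q + (grad_x (\<phi> j) q - h q))"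
        by simp
      also have "\<dots> \<le> ennreal (1 + s) * ?E g h + ennreal (1 + 1 / s) * ?d j"
        using s by (rule nn_integral_energy_add) measurable
      also have "\<dots> \<le> ennreal (1 + s) * ennreal e + ennreal s"
        unfolding e(1) using j by (intro add_left_mono less_imp_le)
      also have "\<dots> = ennreal ((1 + s) * e + s)"
        using s e(2) by (simp add: ennreal_mult')
      finally show "(\<integral>\<^sup>+x. ennreal (\<bar>\<phi> j x\<bar> ^ k) \<partial>lborel) \<le> ennreal ((((1 + s) * e + s) / S) powr (real k / 2))"
        using sob[OF \<phi>, of j] s e(2) unfolding sob_def by auto
    qed
  qed measurable
  have I: "(\<integral>\<^sup>+q. ennreal (\<bar>u q\<bar> ^ k) \<partial>lborel) \<le> ennreal ((e / S) powr (real k / 2))"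
  proof -
    have t0: "(\<lambda>j. inverse (real (Suc j))) \<longlonglongrightarrow> 0" by (rule LIMSEQ_inverse_real_of_nat)
    have "(\<lambda>j. ((1 + inverse (real (Suc j))) * e + inverse (real (Suc j))) / S) \<longlonglongrightarrow> ((1 + 0) * e + 0) / S"
      using S by (intro tendsto_intros t0) auto
    then have "(\<lambda>j. (((1 + inverse (real (Suc j))) * e + inverse (real (Suc j))) / S) powr (real k / 2)) \<longlonglongrightarrow> (((1 + 0) * e + 0) / S) powr (real k / 2)"
      using k(1) S e(2) by (intro tendsto_powr' tendsto_const) (auto intro!: always_eventually divide_nonneg_pos add_nonneg_nonneg mult_nonneg_nonneg)
    then have "(\<lambda>j. ennreal ((((1 + inverse (real (Suc j))) * e + inverse (real (Suc j))) / S) powr (real k / 2))) \<longlonglongrightarrow> ennreal ((e / S) powr (real k / 2))"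
      by (intro tendsto_ennrealI) simp
    then show ?thesis
      by (rule LIMSEQ_le_const) (use bound in auto)
  qed
  have int: "integrable lborel (\<lambda>p. \<bar>u p\<bar> ^ k)"
  proof (rule integrableI_bounded)
    show "(\<integral>\<^sup>+p. ennreal (norm (\<bar>u p\<bar> ^ k)) \<partial>lborel) < \<infinity>"
      using I by (simp add: power_abs le_less_trans)
  qed simp
  moreover have "(LINT p|lborel. \<bar>u p\<bar> ^ k) \<le> (e / S) powr (real k / 2)"
    using I by (intro integral_real_bounded) simp_all
  then have "(LINT p|lborel. \<bar>u p\<bar> ^ k) powr (2 / real k) \<le> ((e / S) powr (real k / 2)) powr (2 / real k)"
    by (rule powr_mono2[rotated 2]) (auto intro: Bochner_Integration.integral_nonneg)
  then have "(LINT p|lborel. \<bar>u p\<bar> ^ k) powr (2 / real k) \<le> inverse S * e"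
    using S e(2) by (subst (asm) powr_cancel(2)) (simp_all add: divide_inverse mult.commute)
  ultimately show "integrable lborel (\<lambda>p. \<bar>u p\<bar> ^ k) \<and>
      (LINT p|lborel. \<bar>u p\<bar> ^ k) powr (2 / real k) \<le> inverse S * (LINT p|lborel. energy_density \<tau> g h p)"
    by (simp add: e_def)
qed

text \<open>The two inequalities hold for exactly the same positive constants, which is stronger
  than an equality of optimal values and makes both descriptions of a greatest constant literally
  the same.\<close>

lemma sobolev_inequality_D1_iff:
  assumes S: "0 < S"
  shows "sobolev_inequality \<tau> (D1 \<tau> :: ('n, 'm) energy_fields set) S \<longleftrightarrow> sobolev_inequality \<tau> (D1_z \<tau> :: ('n, 'm) energy_fields set) S"
proof
  have "(D1_z \<tau> :: ('n, 'm) energy_fields set) \<subseteq> D1 \<tau>"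
    unfolding D1_def D1_z_def energy_completion_def by blast
  then show "sobolev_inequality \<tau> (D1 \<tau> :: ('n, 'm) energy_fields set) S \<Longrightarrow> sobolev_inequality \<tau> (D1_z \<tau> :: ('n, 'm) energy_fields set) S"
    unfolding sobolev_inequality_iff by blast
next
  assume "sobolev_inequality \<tau> (D1_z \<tau> :: ('n, 'm) energy_fields set) S"
  then have "sob \<tau> S k \<psi>" if "\<psi> \<in> test_functions" "radial_z \<psi>" for \<psi> :: "('n, 'm) point \<Rightarrow> real"
    using sob_of_sobolev_inequality[OF _ S that] by blast
  then have "sob \<tau> S k u" if "u \<in> test_functions" for u :: "('n, 'm) point \<Rightarrow> real"
    using sob_of_radial[OF _ \<tau> S k(1) that] by blast
  then show "sobolev_inequality \<tau> (D1 \<tau> :: ('n, 'm) energy_fields set) S"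
    by (rule sobolev_inequality_of_sob[OF _ S])
qed

end

theorem proposition1p13:
  fixes \<tau> Q :: real
  assumes "0 < \<tau>"
    and "Q = real CARD('m::finite) + real CARD('n::finite) * (\<tau> + 1)"
    and "\<exists>k::nat. 0 < k \<and> 2 * Q / (Q - 2) = real k"
  shows "S_opt \<tau> TYPE('n) TYPE('m) = S_opt_z \<tau> TYPE('n) TYPE('m)"
proof -
  obtain k :: nat where k: "0 < k" "2 * Q / (Q - 2) = real k" using assms(3) by blast
  interpret integer_exponent \<tau> Q k "TYPE('n)" "TYPE('m)"
    by unfold_locales (use assms k in auto)
  show ?thesis
    \<comment> \<open>The equivalence assumes \<open>0 < S\<close>; the congruence rule makes this
      conjunct available when the second one is rewritten.\<close>
    unfolding S_opt_def S_opt_z_def using sobolev_inequality_D1_iff by (simp cong: conj_cong)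
qed

end
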